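(* Let $m\ge2$ and let $h:\mathbb{R}^m\to\mathbb{R}$ be a Lipschitz-continuous kernel such that the distribution function $H_F$ has a density $h_F$ with $h_F>0$ and $h_F$ bounded, and such that for all $2\le k\le m$ and all $i_1<i_2<\dots<i_m$ the density $h_{F;X_{i_2},\ldots,X_{i_k}}$ is bounded. Let $0<\alpha<\beta<1$ and let $J$ be a function with $J(t)=0$ for $t\notin[\alpha,\beta]$ which on $[\alpha,\beta]$ is bounded, a.e. continuous with respect to Lebesgue measure, and a.e. continuous with respect to $H_F^{-1}$. Let $d\geq 0$ be an integer, $a_1,\ldots,a_d\in\mathbb{R}$ and $p_1,\ldots,p_d\in(0,1)$. Let $X_1,X_2,\ldots$ be a stationary, strongly mixing sequence of real random variables with distribution function $F$, with $\mathbb{E}|X_1|^{\rho}<\infty$ for some $\rho\ge1$ and strong mixing coefficients $\alpha(n)=O(n^{-\delta})$ for some $\delta\ge 8$. Then the $GL$-statistic $T(H_n)$ satisfies $$\sqrt n\,\big(T(H_n)-T(H_F)\big)\xrightarrow{\ \mathcal{D}\ }N(0,\sigma^2),$$ where $$\sigma^2=m^2\Big(\operatorname{Var}\big(\mathbb{E}(A(Y_1,\ldots,Y_m)\mid Y_1=X_1)\big)+2\sum_{j=1}^\infty\operatorname{Cov}\big(\mathbb{E}(A(Y_1,\ldots,Y_m)\mid Y_1=X_1),\,\mathbb{E}(A(Y_1,\ldots,Y_m)\mid Y_1=X_{j+1})\big)\Big)$$ with independent copies $Y_1,\ldots,Y_m$ of $X_1$ and $$A(x_1,\ldots,x_m)=-\int_{-\infty}^{\infty}\big(1_{[h(x_1,\ldots,x_m)\le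 y]}-H_F(y)\big)J(H_F(y))\,dy+\sum_{i=1}^{d}a_i\frac{p_i-1_{[h(x_1,\ldots,x_m)\le H_F^{-1}(p_i)]}}{h_F(H_F^{-1}(p_i))}.$$
   Context: A kernel is a measurable function $h:\mathbb{R}^m\to\mathbb{R}$ that is symmetric in its arguments. For a stationary process $(X_n)_{n\in\mathbb{N}}$ the strong mixing coefficients are $$\alpha(k)=\sup_{n\in\mathbb{N}}\sup\{|\mathbb{P}(A\cap B)-\mathbb{P}(A)\mathbb{P}(B)|: A\in\mathcal{F}_1^n,\ B\in\mathcal{F}_{n+k}^\infty\},$$ where $\mathcal{F}_a^b$ is the $\sigma$-field generated by $X_a,\ldots,X_b$; the process is strongly mixing if $\alpha(k)\to0$ as $k\to\infty$. (The number $\alpha$ in $[\alpha,\beta]$ is unrelated to the coefficients $\alpha(\cdot)$.) The random variables $Y_1,Y_2,\ldots$ are independent copies of $X_1$ (independent of each other and of $(X_n)$). $H_F(y)=\mathbb{P}(h(Y_1,\ldots,Y_m)\le y)$ and $h_F$ is its density. For $2\le k\le m$ and $i_1<\dots<i_m$, $h_{F;X_{i_2},\ldots,X_{i_k}}$ denotes the density of $h(Y_{i_1},X_{i_2},\ldots,X_{i_k},Y_{i_{k+1}},\ldots,Y_{i_m})$. The empirical distribution function of the kernel is $$H_n(x)=\frac{1}{\binom{n}{m}}\sum_{1\le i_1<\ldots<i_m\le n}1_{[h(X_{i_1},\ldots,X_{i_m})\le x]}.$$ For a distribution function $H$, $H^{-1}(p)=\inf\{x: H(x)\ge p\}$ is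 the generalized inverse. "A.e. continuous with respect to $H_F^{-1}$" refers to the measure induced by the nondecreasing function $H_F^{-1}$. For $H=H_n$ or $H=H_F$, $$T(H)=\int_0^1H^{-1}(t)J(t)\,dt+\sum_{i=1}^d a_iH^{-1}(p_i);$$ $T(H_n)$ is called a generalized linear ($GL$-) statistic with kernel $h$. $\mathbb{E}(A(Y_1,\ldots,Y_m)\mid Y_1=X_j)$ denotes $a(X_j)$ where $a(x)=\mathbb{E}(A(x,Y_2,\ldots,Y_m))$.
   Formalization: The formal theorem additionally assumes that H_F is differentiable at each H_F^{-1}(p_i) with derivative h_F(H_F^{-1}(p_i)); without this (e.g. if the density jumps at such a point) the limit need not be normal and h_F has no determined value there. *)

theory Defs
  imports "HOL-Probability.Probability"
begin

text \<open>
  Points of m-dimensional Euclidean space are the extensional functions on \<open>{1..m}\<close>, that is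
  the elements of \<open>space (PiM {1..m} (\<lambda>_. borel))\<close>. Processes are indexed from 1;
  \<open>X 0\<close> plays no role.
\<close>

definition kernel :: "nat \<Rightarrow> ((nat \<Rightarrow> real) \<Rightarrow> real) \<Rightarrow> bool" where
  "kernel m h \<longleftrightarrow>
     h \<in> borel_measurable (PiM {1..m} (\<lambda>_. borel)) \<and>
     (\<forall>\<pi> x. \<pi> permutes {1..m} \<longrightarrow> x \<in> extensional {1..m} \<longrightarrow> h (x \<circ> \<pi>) = h x)"

definition lipschitz_kernel :: "nat \<Rightarrow> ((nat \<Rightarrow> real) \<Rightarrow> real) \<Rightarrow> bool" where
  "lipschitz_kernel m h \<longleftrightarrow>
     (\<exists>L\<ge>0. \<forall>x\<in>extensional {1..m}. \<forall>y\<in>extensional {1..m}.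
        \<bar>h x - h y\<bar> \<le> L * L2_set (\<lambda>j. x j - y j) {1..m})"

definition stationary :: "'a measure \<Rightarrow> (nat \<Rightarrow> 'a \<Rightarrow> real) \<Rightarrow> bool" where
  "stationary M X \<longleftrightarrow>
     (\<forall>n k. distr M (PiM {1..n} (\<lambda>_. borel)) (\<lambda>\<omega>. \<lambda>i\<in>{1..n}. X (i + k) \<omega>)
          = distr M (PiM {1..n} (\<lambda>_. borel)) (\<lambda>\<omega>. \<lambda>i\<in>{1..n}. X i \<omega>))"

definition generated_field :: "'a measure \<Rightarrow> (nat \<Rightarrow> 'a \<Rightarrow> real) \<Rightarrow> nat set \<Rightarrow> 'a set set" where
  "generated_field M X I =
     sigma_sets (space M) {X i -` B \<inter> space M | i B. i \<in> I \<and> B \<in> sets borel}"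

definition mixing_coeff :: "'a measure \<Rightarrow> (nat \<Rightarrow> 'a \<Rightarrow> real) \<Rightarrow> nat \<Rightarrow> real" where
  "mixing_coeff M X k =
     (SUP n\<in>{1..}.
        SUP (A, B)\<in>generated_field M X {1..n} \<times> generated_field M X {n + k..}.
          \<bar>measure M (A \<inter> B) - measure M A * measure M B\<bar>)"

definition strongly_mixing :: "'a measure \<Rightarrow> (nat \<Rightarrow> 'a \<Rightarrow> real) \<Rightarrow> bool" where
  "strongly_mixing M X \<longleftrightarrow> mixing_coeff M X \<longlonglongrightarrow> 0"

text \<open>\<open>Y 1, Y 2, \<dots>\<close> are independent, distributed like \<open>X 1\<close>, and jointly independent of the
  whole process \<open>X\<close>.\<close>

definition independent_copies ::
    "'a measure \<Rightarrow> (nat \<Rightarrow> 'a \<Rightarrow> real) \<Rightarrow> (nat \<Rightarrow> 'a \<Rightarrow> real) \<Rightarrow> bool" where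
  "independent_copies M X Y \<longleftrightarrow>
     prob_space.indep_vars M (\<lambda>_. borel) Y {1..} \<and>
     (\<forall>j\<ge>1. distr M borel (Y j) = distr M borel (X 1)) \<and>
     prob_space.indep_var M
       (PiM {1..} (\<lambda>_. borel)) (\<lambda>\<omega>. \<lambda>j\<in>{1..}. Y j \<omega>)
       (PiM {1..} (\<lambda>_. borel)) (\<lambda>\<omega>. \<lambda>j\<in>{1..}. X j \<omega>)"

definition kernel_cdf ::
    "'a measure \<Rightarrow> nat \<Rightarrow> ((nat \<Rightarrow> real) \<Rightarrow> real) \<Rightarrow> (nat \<Rightarrow> 'a \<Rightarrow> real) \<Rightarrow> real \<Rightarrow> real" where
  "kernel_cdf M m h Y y = measure M {\<omega> \<in> space M. h (\<lambda>j\<in>{1..m}. Y j \<omega>) \<le> y}"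

definition mixed_kernel_var ::
    "nat \<Rightarrow> ((nat \<Rightarrow> real) \<Rightarrow> real) \<Rightarrow> (nat \<Rightarrow> 'a \<Rightarrow> real) \<Rightarrow> (nat \<Rightarrow> 'a \<Rightarrow> real) \<Rightarrow>
     nat \<Rightarrow> (nat \<Rightarrow> nat) \<Rightarrow> 'a \<Rightarrow> real" where
  "mixed_kernel_var m h X Y k i \<omega> =
     h (\<lambda>j\<in>{1..m}. if j \<in> {2..k} then X (i j) \<omega> else Y (i j) \<omega>)"

text \<open>A density is only determined almost everywhere, so its boundedness means that some version
  is bounded.\<close>

definition has_bounded_density :: "'a measure \<Rightarrow> ('a \<Rightarrow> real) \<Rightarrow> bool" where
  "has_bounded_density M Z \<longleftrightarrow>
     (\<exists>f :: real \<Rightarrow> real. (\<forall>x. 0 \<le> f x) \<and> bounded (range f) \<and>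
        distributed M lborel Z (\<lambda>x. ennreal (f x)))"

definition empirical_cdf ::
    "nat \<Rightarrow> ((nat \<Rightarrow> real) \<Rightarrow> real) \<Rightarrow> (nat \<Rightarrow> 'a \<Rightarrow> real) \<Rightarrow> nat \<Rightarrow> 'a \<Rightarrow> real \<Rightarrow> real" where
  "empirical_cdf m h X n \<omega> x =
     (\<Sum>i\<in>{i \<in> {1..m} \<rightarrow>\<^sub>E {1..n}. strict_mono_on {1..m} i}.
        of_bool (h (\<lambda>j\<in>{1..m}. X (i j) \<omega>) \<le> x)) / real (n choose m)"

definition quantile :: "(real \<Rightarrow> real) \<Rightarrow> real \<Rightarrow> real" where
  "quantile H p = Inf {x. p \<le> H x}"

text \<open>
  The measure induced on \<open>{\<alpha>..\<beta>}\<close> by a function \<open>G\<close> that is nondecreasing there. \<open>G\<close> is frozen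
  outside of \<open>{\<alpha>..\<beta>}\<close> because a quantile function is meaningful on \<open>{0<..<1}\<close> only, whereas
  \<open>interval_measure\<close> expects a right-continuous nondecreasing function on the whole line.
  (The quantile function of a distribution with positive density is continuous on \<open>{0<..<1}\<close>.)
\<close>

definition stieltjes_measure_on :: "real \<Rightarrow> real \<Rightarrow> (real \<Rightarrow> real) \<Rightarrow> real measure" where
  "stieltjes_measure_on \<alpha> \<beta> G = interval_measure (\<lambda>t. G (max \<alpha> (min \<beta> t)))"

text \<open>
  An a.e. continuous \<open>J\<close> is Lebesgue measurable but possibly not Borel measurable; hence the
  integrals against \<open>lebesgue\<close> rather than \<open>lborel\<close>.
\<close>

definition GL_functional ::
    "(real \<Rightarrow> real) \<Rightarrow> nat \<Rightarrow> (nat \<Rightarrow> real) \<Rightarrow> (nat \<Rightarrow> real) \<Rightarrow> (real \<Rightarrow> real) \<Rightarrow> real" where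
  "GL_functional J d a p H =
     (LINT t:{0..1}|lebesgue. quantile H t * J t) + (\<Sum>i=1..d. a i * quantile H (p i))"

definition GL_influence ::
    "((nat \<Rightarrow> real) \<Rightarrow> real) \<Rightarrow> (real \<Rightarrow> real) \<Rightarrow> nat \<Rightarrow> (nat \<Rightarrow> real) \<Rightarrow> (nat \<Rightarrow> real) \<Rightarrow>
     (real \<Rightarrow> real) \<Rightarrow> (real \<Rightarrow> real) \<Rightarrow> (nat \<Rightarrow> real) \<Rightarrow> real" where
  "GL_influence h J d a p HF hF x =
     - (LINT y|lebesgue. (of_bool (h x \<le> y) - HF y) * J (HF y))
     + (\<Sum>i=1..d. a i * ((p i - of_bool (h x \<le> quantile HF (p i))) / hF (quantile HF (p i))))"

text \<open>The function \<open>x \<mapsto> E (A (x, Y 2, \<dots>, Y m))\<close>.\<close>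

definition first_projection ::
    "'a measure \<Rightarrow> nat \<Rightarrow> (nat \<Rightarrow> 'a \<Rightarrow> real) \<Rightarrow> ((nat \<Rightarrow> real) \<Rightarrow> real) \<Rightarrow> real \<Rightarrow> real" where
  "first_projection M m Y A x =
     (LINT \<omega>|M. A (\<lambda>j\<in>{1..m}. if j = 1 then x else Y j \<omega>))"

definition covariance :: "'a measure \<Rightarrow> ('a \<Rightarrow> real) \<Rightarrow> ('a \<Rightarrow> real) \<Rightarrow> real" where
  "covariance M U V =
     (LINT \<omega>|M. (U \<omega> - (LINT \<omega>'|M. U \<omega>')) * (V \<omega> - (LINT \<omega>'|M. V \<omega>')))"

definition long_run_variance ::
    "'a measure \<Rightarrow> (nat \<Rightarrow> 'a \<Rightarrow> real) \<Rightarrow> (real \<Rightarrow> real) \<Rightarrow> real" where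
  "long_run_variance M X g =
     prob_space.variance M (\<lambda>\<omega>. g (X 1 \<omega>)) +
     2 * (\<Sum>j. covariance M (\<lambda>\<omega>. g (X 1 \<omega>)) (\<lambda>\<omega>. g (X (Suc j + 1) \<omega>)))"

text \<open>The law of \<open>sqrt v * Z\<close> for a standard normal \<open>Z\<close>; for \<open>v = 0\<close> this is the point mass at 0,
  where \<open>normal_density\<close> would be degenerate.\<close>

definition normal_law :: "real \<Rightarrow> real measure" where
  "normal_law v = distr std_normal_distribution borel (\<lambda>z. sqrt v * z)"

end

theory Submission
  imports Defs "HOL-Real_Asymp.Real_Asymp"
begin

text \<open>
  Write \<open>H\<^sub>n\<close> for the empirical distribution function of the kernel and \<open>H\<^sub>F\<close> for its limit. The
  functional is differentiable enough at \<open>H\<^sub>F\<close> for its error to equal, up to \<open>o(1 / sqrt n)\<close> in probability, an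
  integral of \<open>H\<^sub>n - H\<^sub>F\<close> plus finitely many values of \<open>H\<^sub>n - H\<^sub>F\<close>. For each level \<open>y\<close>,
  \<open>H\<^sub>n y\<close> is a U-statistic, and its Hoeffding decomposition replaces \<open>H\<^sub>n y - H\<^sub>F y\<close> by \<open>m\<close> times an
  average of a bounded function of single observations. So the error is asymptotically an average of one
  bounded centred function of the \<open>X\<^sub>i\<close>, whose central limit theorem under strong mixing gives
  the limit law.

  \<^bold>\<open>The average.\<close> \<open>clt_char\<close> is Bernstein's method. Blocks of length \<open>Q\<^sup>2\<close> separated by gaps of
  length \<open>Q\<close>, with \<open>Q\<close> about \<open>root 6 n\<close>, are nearly independent by the covariance inequality
  \<open>mixing_covariance\<close>; the gaps are negligible in mean square, and a second-order Taylor expansion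
  of the characteristic function of one block gives the Gaussian limit.

  \<^bold>\<open>The U-statistic.\<close> The remainder of the Hoeffding decomposition is degenerate: averaging out all
  observations but one gives zero. In its second moment, a pair of well-spread index tuples with at most
  one close pair of indices contributes almost nothing, because all the other observations can be
  replaced one at a time by independent ones (\<open>decouple_all_but_core\<close>); the other pairs of tuples
  are rare. Replacing an observation needs a function that is Lipschitz in it: it is rounded to
  a finite grid, and the covariance inequality is applied on every cell. The indicator of
  \<open>h \<le> y\<close> is therefore first sandwiched between Lipschitz functions of \<open>h\<close> at distance
  \<open>n powr - 0.52\<close>; this costs little because \<open>H\<^sub>F\<close> has a bounded density. All estimates hold uniformly
  in \<open>y\<close> (\<open>uniform_linearization\<close>).

  \<^bold>\<open>The functional.\<close> Integration by parts (\<open>L_functional_repr\<close>) turns the integral of the quantile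
  function against \<open>J\<close> into minus the integral over \<open>y\<close> of a primitive of \<open>J\<close> evaluated at \<open>H y\<close>.
  That primitive is Lipschitz, and it has derivative \<open>J (H\<^sub>F y)\<close> at \<open>H\<^sub>F y\<close> for almost every \<open>y\<close>;
  this is what continuity of \<open>J\<close> almost everywhere with respect to the quantile function means.
  Hence the expansion error at each such \<open>y\<close> is \<open>o(1 / sqrt n)\<close> in mean, and dominated convergence
  integrates it (\<open>L_functional_vanishing\<close>). A single quantile is
  inverted into values of \<open>H\<^sub>n\<close> by Ghosh's argument (\<open>ghosh\<close>, \<open>quantile_vanishing\<close>).
\<close>

section \<open>Covariance inequality for strongly mixing processes\<close>

abbreviation path_space :: "(nat \<Rightarrow> real) measure" where
  "path_space \<equiv> PiM UNIV (\<lambda>_. borel)"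

text \<open>Statements about the \<open>\<sigma>\<close>-field of some of the observations are phrased with functionals of
  the whole path that look at these coordinates only.\<close>

definition depends_on :: "((nat \<Rightarrow> real) \<Rightarrow> 'b) \<Rightarrow> nat set \<Rightarrow> bool" where
  "depends_on F S \<longleftrightarrow> (\<forall>x y. (\<forall>s\<in>S. x s = y s) \<longrightarrow> F x = F y)"

lemma depends_onD: "depends_on F S \<Longrightarrow> (\<And>s. s \<in> S \<Longrightarrow> x s = y s) \<Longrightarrow> F x = F y"
  unfolding depends_on_def by blast

lemma depends_on_mono: "depends_on F S \<Longrightarrow> S \<subseteq> T \<Longrightarrow> depends_on F T"
  unfolding depends_on_def by blast

text \<open>The layer-cake formula writes \<open>H\<close> as the average over \<open>t\<close> in \<open>{0..1}\<close> of the indicators of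
  \<open>t < H\<close>, so a bound that holds for all these indicators passes to \<open>H\<close>.\<close>

lemma (in prob_space) expectation_layer_bound:
  fixes Z H :: "'a \<Rightarrow> real"
  assumes Z[measurable]: "random_variable borel Z" and Zb: "\<And>\<omega>. \<omega> \<in> space M \<Longrightarrow> \<bar>Z \<omega>\<bar> \<le> b"
    and H[measurable]: "random_variable borel H"
    and H01: "\<And>\<omega>. \<omega> \<in> space M \<Longrightarrow> 0 \<le> H \<omega> \<and> H \<omega> \<le> 1"
    and layers: "\<And>t. \<bar>expectation (\<lambda>\<omega>. Z \<omega> * of_bool (t < H \<omega>))\<bar> \<le> c"
  shows "\<bar>expectation (\<lambda>\<omega>. Z \<omega> * H \<omega>)\<bar> \<le> c"
proof -
  interpret U: prob_space "uniform_measure lborel {0..1::real}"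
    by (rule prob_space_uniform_measure) auto
  interpret U2: pair_sigma_finite M "uniform_measure lborel {0..1::real}" ..
  interpret U3: pair_prob_space M "uniform_measure lborel {0..1::real}" ..
  let ?U = "uniform_measure lborel {0..1::real}"
  have U_int: "(LINT t|?U. of_bool (t < u)) = u" if "0 \<le> u" "u \<le> 1" for u :: real
  proof -
    have "(LINT t|?U. of_bool (t < u)) = (LINT t|?U. indicator {..<u} t)"
      by (intro Bochner_Integration.integral_cong) (auto simp: indicator_def)
    also have "\<dots> = measure ?U {..<u}" by simp
    also have "\<dots> = measure lborel ({0..1} \<inter> {..<u}) / measure lborel {0..1::real}"
      by (subst measure_uniform_measure) (auto)
    also have "{0..1} \<inter> {..<u} = {0..<u}" using that by auto
    finally show ?thesis using that by simp
  qed
  have int: "integrable (M \<Otimes>\<^sub>M ?U) (\<lambda>(\<omega>, t). Z \<omega> * of_bool (t < H \<omega>))"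
  proof (rule U3.P.integrable_const_bound[where B = b])
    show "AE z in M \<Otimes>\<^sub>M ?U. norm (case z of (\<omega>, t) \<Rightarrow> Z \<omega> * of_bool (t < H \<omega>)) \<le> b"
    proof (rule AE_I2)
      fix z assume "z \<in> space (M \<Otimes>\<^sub>M ?U)"
      then have "fst z \<in> space M" by (auto simp: space_pair_measure)
      from Zb[OF this] show "norm (case z of (\<omega>, t) \<Rightarrow> Z \<omega> * of_bool (t < H \<omega>)) \<le> b"
        by (auto simp: split_beta)
    qed
    show "(\<lambda>(\<omega>, t). Z \<omega> * of_bool (t < H \<omega>)) \<in> borel_measurable (M \<Otimes>\<^sub>M ?U)"
      by measurable
  qed
  have "expectation (\<lambda>\<omega>. Z \<omega> * H \<omega>) = expectation (\<lambda>\<omega>. LINT t|?U. Z \<omega> * of_bool (t < H \<omega>))"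
    by (intro Bochner_Integration.integral_cong) (auto simp: U_int H01)
  also have "\<dots> = (LINT t|?U. expectation (\<lambda>\<omega>. Z \<omega> * of_bool (t < H \<omega>)))"
    using U2.Fubini_integral[OF int] by simp
  finally have eq: "expectation (\<lambda>\<omega>. Z \<omega> * H \<omega>) = \<dots>" .
  have "\<bar>LINT t|?U. expectation (\<lambda>\<omega>. Z \<omega> * of_bool (t < H \<omega>))\<bar>
      \<le> (LINT t|?U. \<bar>expectation (\<lambda>\<omega>. Z \<omega> * of_bool (t < H \<omega>))\<bar>)"
    by (rule integral_abs_bound)
  also have "\<dots> \<le> (LINT t|?U. c)"
  proof (rule integral_mono)
    have "integrable ?U (\<lambda>t. expectation (\<lambda>\<omega>. Z \<omega> * of_bool (t < H \<omega>)))"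
      using U2.integrable_snd[OF int] by simp
    then show "integrable ?U (\<lambda>t. \<bar>expectation (\<lambda>\<omega>. Z \<omega> * of_bool (t < H \<omega>))\<bar>)"
      by (rule integrable_abs)
  qed (auto simp: layers)
  also have "\<dots> = c" by (simp add: U.prob_space)
  finally show ?thesis using eq by simp
qed

locale process = prob_space M for M :: "'a measure" +
  fixes X :: "nat \<Rightarrow> 'a \<Rightarrow> real"
  assumes X_measurable: "\<And>n. n \<ge> 1 \<Longrightarrow> X n \<in> borel_measurable M"
begin

text \<open>Mixing and stationarity concern the indices from 1 on, and \<open>X 0\<close> need not be measurable; the
  path gets a constant there.\<close>

definition path :: "'a \<Rightarrow> nat \<Rightarrow> real" where
  "path \<omega> = (\<lambda>s. if s = 0 then 0 else X s \<omega>)"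

lemma path_apply: "s \<ge> 1 \<Longrightarrow> path \<omega> s = X s \<omega>"
  by (simp add: path_def)

lemma measurable_path[measurable]: "path \<in> M \<rightarrow>\<^sub>M path_space"
proof -
  have "(\<lambda>\<omega>. path \<omega> s) \<in> borel_measurable M" for s
    using X_measurable[of s] by (cases "s = 0") (auto simp: path_def)
  then show ?thesis by (intro measurable_PiM_single') (auto)
qed

lemma past_event:
  assumes [measurable]: "F \<in> borel_measurable path_space" and dep: "depends_on F I" and "I \<subseteq> {1..}"
    and B: "B \<in> sets borel"
  shows "{\<omega> \<in> space M. F (path \<omega>) \<in> B} \<in> generated_field M X I"
proof -
  define N where "N = sigma (space M) {X i -` B \<inter> space M | i B. i \<in> I \<and> B \<in> sets borel}"
  have sub: "{X i -` B \<inter> space M | i B. i \<in> I \<and> B \<in> sets borel} \<subseteq> Pow (space M)" by auto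
  have sp: "space N = space M" and se: "sets N = generated_field M X I"
    unfolding N_def generated_field_def using sub by (auto simp: space_measure_of_conv sets_measure_of)
  have Xm: "X i \<in> borel_measurable N" if "i \<in> I" for i
  proof (rule measurableI)
    fix A :: "real set" assume "A \<in> sets borel"
    then show "X i -` A \<inter> space N \<in> sets N"
      unfolding sp se generated_field_def using that by (intro sigma_sets.Basic) auto
  qed auto
  have "(\<lambda>\<omega>. if s \<in> I then path \<omega> s else 0) \<in> borel_measurable N" for s
    using Xm[of s] by (cases "s \<in> I"; cases "s = 0") (simp_all add: path_def)
  then have [measurable]: "(\<lambda>\<omega> s. if s \<in> I then path \<omega> s else 0) \<in> N \<rightarrow>\<^sub>M path_space"
    by (intro measurable_PiM_single') (auto)
  have "(\<lambda>\<omega>. F (\<lambda>s. if s \<in> I then path \<omega> s else 0)) \<in> borel_measurable N"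
    by measurable
  also have "(\<lambda>\<omega>. F (\<lambda>s. if s \<in> I then path \<omega> s else 0)) = (\<lambda>\<omega>. F (path \<omega>))"
    by (intro ext depends_onD[OF dep]) auto
  finally have "(\<lambda>\<omega>. F (path \<omega>)) -` B \<inter> space N \<in> sets N"
    using B by (rule measurable_sets)
  then show ?thesis by (simp add: sp se vimage_def Int_def conj_commute)
qed

lemma mixing_coeff_bound:
  assumes A: "A \<in> generated_field M X {1..n}" and B: "B \<in> generated_field M X {n + k..}" and "n \<ge> 1"
  shows "\<bar>prob (A \<inter> B) - prob A * prob B\<bar> \<le> mixing_coeff M X k"
proof -
  let ?f = "\<lambda>(A, B). \<bar>prob (A \<inter> B) - prob A * prob B\<bar>"
  have le1: "?f p \<le> 1" for p
  proof -
    obtain A B where [simp]: "p = (A, B)" by (cases p)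
    have "0 \<le> prob (A \<inter> B)" "prob (A \<inter> B) \<le> 1" "0 \<le> prob A * prob B" "prob A * prob B \<le> 1"
      by (auto intro: mult_le_one)
    then show ?thesis unfolding \<open>p = (A, B)\<close> prod.case abs_le_iff by linarith
  qed
  let ?G = "\<lambda>n. generated_field M X {1..n} \<times> generated_field M X {n + k..}"
  have ne: "?G n \<noteq> {}" for n
    unfolding generated_field_def by (auto intro: sigma_sets.Empty)
  have bdd: "bdd_above (?f ` ?G n)" for n
    using le1 by (intro bdd_aboveI[where M = 1]) auto
  have "?f (A, B) \<le> (SUP p\<in>?G n. ?f p)"
    using assms by (intro cSUP_upper bdd) auto
  also have "\<dots> \<le> (SUP n\<in>{1..}. SUP p\<in>?G n. ?f p)"
  proof (rule cSUP_upper)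
    show "bdd_above ((\<lambda>n. SUP p\<in>?G n. ?f p) ` {1..})"
      using le1 ne by (intro bdd_aboveI[where M = 1]) (auto intro!: cSUP_least)
  qed (use assms in auto)
  finally show ?thesis by (simp add: mixing_coeff_def)
qed

lemma mixing_coeff_nonneg: "0 \<le> mixing_coeff M X k"
  using mixing_coeff_bound[of "{}" 1 "{}" k]
  by (auto simp: generated_field_def intro: sigma_sets.Empty)

lemma integrable_bounded_path:
  fixes F :: "(nat \<Rightarrow> real) \<Rightarrow> 'b :: {banach, second_countable_topology}"
  assumes [measurable]: "F \<in> borel_measurable path_space" and "\<And>x. norm (F x) \<le> b"
  shows "integrable M (\<lambda>\<omega>. F (path \<omega>))"
  by (rule integrable_const_bound[where B = b]) (auto simp: assms)

text \<open>The mixing coefficient bounds covariances of events; two passes of the layer-cake formula, one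
  for each factor, extend the bound to functions with values in \<open>{0..1}\<close>.\<close>

lemma mixing_covariance_unit:
  assumes F[measurable]: "F \<in> borel_measurable path_space" and F01: "\<And>x. 0 \<le> F x \<and> F x \<le> (1::real)"
    and G[measurable]: "G \<in> borel_measurable path_space" and G01: "\<And>x. 0 \<le> G x \<and> G x \<le> (1::real)"
    and depF: "depends_on F {1..n}" and depG: "depends_on G {n + k..}" and "n \<ge> 1"
  shows "\<bar>expectation (\<lambda>\<omega>. F (path \<omega>) * G (path \<omega>))
           - expectation (\<lambda>\<omega>. F (path \<omega>)) * expectation (\<lambda>\<omega>. G (path \<omega>))\<bar> \<le> mixing_coeff M X k"
proof -
  let ?F = "\<lambda>\<omega>. F (path \<omega>)" and ?G = "\<lambda>\<omega>. G (path \<omega>)"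
  have iF: "integrable M ?F" and iG: "integrable M ?G"
    by (auto intro!: integrable_bounded_path[where b = 1] simp: F01 G01)
  have ev: "\<bar>prob ({\<omega>\<in>space M. t < ?F \<omega>} \<inter> {\<omega>\<in>space M. u < ?G \<omega>})
      - prob {\<omega>\<in>space M. t < ?F \<omega>} * prob {\<omega>\<in>space M. u < ?G \<omega>}\<bar> \<le> mixing_coeff M X k" for t u
    using past_event[OF F depF, of "{t<..}"] past_event[OF G depG, of "{u<..}"] \<open>n \<ge> 1\<close>
    by (intro mixing_coeff_bound[where n = n]) (auto simp: subset_eq)
  have P: "prob {\<omega>\<in>space M. Q \<omega>} = expectation (\<lambda>\<omega>. of_bool (Q \<omega>))"
    if "{\<omega>\<in>space M. Q \<omega>} \<in> events" for Q
  proof -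
    have "expectation (\<lambda>\<omega>. of_bool (Q \<omega>)) = expectation (indicat_real {\<omega>\<in>space M. Q \<omega>})"
      by (intro Bochner_Integration.integral_cong) (auto simp: indicator_def)
    then show ?thesis using that by (simp add: Int_absorb2 sets.sets_into_space)
  qed
  have one: "\<bar>expectation (\<lambda>\<omega>. (of_bool (u < ?G \<omega>) - prob {\<omega>\<in>space M. u < ?G \<omega>}) * ?F \<omega>)\<bar>
      \<le> mixing_coeff M X k" for u
  proof (rule expectation_layer_bound[where b = 2])
    fix t
    have "expectation (\<lambda>\<omega>. (of_bool (u < ?G \<omega>) - prob {\<omega>\<in>space M. u < ?G \<omega>}) * of_bool (t < ?F \<omega>))
       = expectation (\<lambda>\<omega>. of_bool (t < ?F \<omega> \<and> u < ?G \<omega>) - prob {\<omega>\<in>space M. u < ?G \<omega>} * of_bool (t < ?F \<omega>))"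
      by (intro Bochner_Integration.integral_cong) auto
    also have "\<dots> = expectation (\<lambda>\<omega>. of_bool (t < ?F \<omega> \<and> u < ?G \<omega>))
                  - prob {\<omega>\<in>space M. u < ?G \<omega>} * expectation (\<lambda>\<omega>. of_bool (t < ?F \<omega>))"
      by (subst Bochner_Integration.integral_diff)
         (auto intro!: integrable_const_bound[where B = 1])
    also have "\<dots> = prob ({\<omega>\<in>space M. t < ?F \<omega>} \<inter> {\<omega>\<in>space M. u < ?G \<omega>})
      - prob {\<omega>\<in>space M. t < ?F \<omega>} * prob {\<omega>\<in>space M. u < ?G \<omega>}"
    proof -
      have "{\<omega>\<in>space M. t < ?F \<omega>} \<inter> {\<omega>\<in>space M. u < ?G \<omega>} = {\<omega>\<in>space M. t < ?F \<omega> \<and> u < ?G \<omega>}" by auto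
      then show ?thesis by (simp add: P)
    qed
    finally show "\<bar>expectation (\<lambda>\<omega>. (of_bool (u < ?G \<omega>) - prob {\<omega>\<in>space M. u < ?G \<omega>}) * of_bool (t < ?F \<omega>))\<bar>
      \<le> mixing_coeff M X k"
      using ev[of t u] by simp
  next
    fix \<omega>
    have "\<bar>of_bool P - v\<bar> \<le> 2" if "0 \<le> v" "v \<le> 1" for P and v :: real
      using that by (cases P) auto
    then show "\<bar>of_bool (u < ?G \<omega>) - prob {\<omega>\<in>space M. u < ?G \<omega>}\<bar> \<le> 2"
      by auto
  qed (auto simp: F01)
  have "\<bar>expectation (\<lambda>\<omega>. (?F \<omega> - expectation ?F) * ?G \<omega>)\<bar> \<le> mixing_coeff M X k"
  proof (rule expectation_layer_bound[where b = "1 + \<bar>expectation ?F\<bar>"])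
    fix u
    have i1: "integrable M (\<lambda>\<omega>. of_bool (u < ?G \<omega>) * ?F \<omega>)"
      by (rule integrable_const_bound[where B = 1]) (auto simp: F01)
    have i2: "integrable M (\<lambda>\<omega>. of_bool (u < ?G \<omega>) :: real)"
      by (rule integrable_const_bound[where B = 1]) auto
    have "expectation (\<lambda>\<omega>. (?F \<omega> - expectation ?F) * of_bool (u < ?G \<omega>)) =
       expectation (\<lambda>\<omega>. of_bool (u < ?G \<omega>) * ?F \<omega>) - expectation ?F * prob {\<omega>\<in>space M. u < ?G \<omega>}"
      using i1 i2 by (subst P) (auto simp: algebra_simps)
    also have "\<dots> = expectation (\<lambda>\<omega>. (of_bool (u < ?G \<omega>) - prob {\<omega>\<in>space M. u < ?G \<omega>}) * ?F \<omega>)"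
      using i1 iF by (simp add: algebra_simps)
    finally show "\<bar>expectation (\<lambda>\<omega>. (?F \<omega> - expectation ?F) * of_bool (u < ?G \<omega>))\<bar> \<le> mixing_coeff M X k"
      using one[of u] by simp
  next
    fix \<omega> show "\<bar>?F \<omega> - expectation ?F\<bar> \<le> 1 + \<bar>expectation ?F\<bar>" using F01[of "path \<omega>"] by auto
  qed (auto simp: G01)
  moreover have "integrable M (\<lambda>\<omega>. ?F \<omega> * ?G \<omega>)"
    using F01 G01 by (intro integrable_bounded_path[where b = 1 and F = "\<lambda>x. F x * G x"]) (auto simp: abs_mult intro!: mult_le_one)
  ultimately show ?thesis using iG by (simp add: left_diff_distrib)
qed

text \<open>An affine change of scale maps \<open>{-a..a}\<close> and \<open>{-b..b}\<close> to \<open>{0..1}\<close> and multiplies the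
  covariance by \<open>4 * a * b\<close>.\<close>

lemma mixing_covariance:
  assumes F[measurable]: "F \<in> borel_measurable path_space" and Fb: "\<And>x. \<bar>F x\<bar> \<le> (a::real)"
    and G[measurable]: "G \<in> borel_measurable path_space" and Gb: "\<And>x. \<bar>G x\<bar> \<le> (b::real)"
    and depF: "depends_on F {1..n}" and depG: "depends_on G {n + k..}" and "n \<ge> 1"
  shows "\<bar>expectation (\<lambda>\<omega>. F (path \<omega>) * G (path \<omega>))
           - expectation (\<lambda>\<omega>. F (path \<omega>)) * expectation (\<lambda>\<omega>. G (path \<omega>))\<bar>
         \<le> 4 * a * b * mixing_coeff M X k"
proof -
  have a0: "a \<ge> 0" and b0: "b \<ge> 0" using Fb[of undefined] Gb[of undefined] by auto
  have trivial: ?thesis if "a = 0 \<or> b = 0"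
  proof -
    have "(\<forall>x. F x = 0) \<or> (\<forall>x. G x = 0)" using that Fb Gb by auto
    then show ?thesis using a0 b0 mixing_coeff_nonneg by auto
  qed
  show ?thesis
  proof (cases "a = 0 \<or> b = 0")
    case False
    then have a: "a > 0" and b: "b > 0" using a0 b0 by auto
    define F' G' where "F' x = (F x + a) / (2 * a)" and "G' x = (G x + b) / (2 * b)" for x
    have Fe: "F x = 2 * a * F' x - a" and Ge: "G x = 2 * b * G' x - b" for x
      using a b by (auto simp: F'_def G'_def field_simps)
    have [measurable]: "F' \<in> borel_measurable path_space" "G' \<in> borel_measurable path_space"
      unfolding F'_def G'_def by measurable
    have F01: "0 \<le> F' x \<and> F' x \<le> 1" and G01: "0 \<le> G' x \<and> G' x \<le> 1" for x
      using a b Fb[of x] Gb[of x] by (auto simp: F'_def G'_def field_simps abs_le_iff)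
    have i: "integrable M (\<lambda>\<omega>. F' (path \<omega>))" "integrable M (\<lambda>\<omega>. G' (path \<omega>))"
      "integrable M (\<lambda>\<omega>. F' (path \<omega>) * G' (path \<omega>))"
      using F01 G01 by (auto intro!: integrable_bounded_path[where b = 1] 
          integrable_bounded_path[where b = 1 and F = "\<lambda>x. F' x * G' x"] simp: abs_mult mult_le_one)
    have "\<bar>expectation (\<lambda>\<omega>. F' (path \<omega>) * G' (path \<omega>))
           - expectation (\<lambda>\<omega>. F' (path \<omega>)) * expectation (\<lambda>\<omega>. G' (path \<omega>))\<bar> \<le> mixing_coeff M X k"
      using depF depG \<open>n \<ge> 1\<close> F01 G01
      by (intro mixing_covariance_unit[where n = n]) (auto simp: depends_on_def F'_def G'_def)
    then have "4 * a * b * \<bar>expectation (\<lambda>\<omega>. F' (path \<omega>) * G' (path \<omega>))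
           - expectation (\<lambda>\<omega>. F' (path \<omega>)) * expectation (\<lambda>\<omega>. G' (path \<omega>))\<bar> \<le> 4 * a * b * mixing_coeff M X k"
      using a b by (intro mult_left_mono) auto
    also have "4 * a * b * \<bar>expectation (\<lambda>\<omega>. F' (path \<omega>) * G' (path \<omega>))
           - expectation (\<lambda>\<omega>. F' (path \<omega>)) * expectation (\<lambda>\<omega>. G' (path \<omega>))\<bar>
       = \<bar>4 * a * b * (expectation (\<lambda>\<omega>. F' (path \<omega>) * G' (path \<omega>))
           - expectation (\<lambda>\<omega>. F' (path \<omega>)) * expectation (\<lambda>\<omega>. G' (path \<omega>)))\<bar>"
      using a b by (simp add: abs_mult)
    also have "4 * a * b * (expectation (\<lambda>\<omega>. F' (path \<omega>) * G' (path \<omega>))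
           - expectation (\<lambda>\<omega>. F' (path \<omega>)) * expectation (\<lambda>\<omega>. G' (path \<omega>)))
      = expectation (\<lambda>\<omega>. F (path \<omega>) * G (path \<omega>))
           - expectation (\<lambda>\<omega>. F (path \<omega>)) * expectation (\<lambda>\<omega>. G (path \<omega>))"
    proof -
      have "expectation (\<lambda>\<omega>. F (path \<omega>) * G (path \<omega>)) = expectation (\<lambda>\<omega>. 4 * a * b * (F' (path \<omega>) * G' (path \<omega>))
          - 2 * a * b * F' (path \<omega>) - 2 * a * b * G' (path \<omega>) + a * b)"
        by (intro Bochner_Integration.integral_cong) (auto simp: Fe Ge algebra_simps)
      also have "\<dots> = 4 * a * b * expectation (\<lambda>\<omega>. F' (path \<omega>) * G' (path \<omega>))
          - 2 * a * b * expectation (\<lambda>\<omega>. F' (path \<omega>)) - 2 * a * b * expectation (\<lambda>\<omega>. G' (path \<omega>)) + a * b"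
        using i by (simp add: prob_space)
      finally have 1: "expectation (\<lambda>\<omega>. F (path \<omega>) * G (path \<omega>)) = \<dots>" .
      have 2: "expectation (\<lambda>\<omega>. F (path \<omega>)) = 2 * a * expectation (\<lambda>\<omega>. F' (path \<omega>)) - a"
        "expectation (\<lambda>\<omega>. G (path \<omega>)) = 2 * b * expectation (\<lambda>\<omega>. G' (path \<omega>)) - b"
        using i by (simp_all add: Fe Ge prob_space)
      show ?thesis unfolding 1 2 by (simp add: algebra_simps)
    qed
    finally show ?thesis .
  qed (rule trivial)
qed

text \<open>Each of the real and the imaginary part of the covariance is a combination of two real
  covariances, hence the constant \<open>16 = 4 * (2 + 2)\<close>.\<close>

lemma mixing_covariance_complex:
  assumes F[measurable]: "F \<in> borel_measurable path_space" and Fb: "\<And>x. cmod (F x) \<le> 1"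
    and G[measurable]: "G \<in> borel_measurable path_space" and Gb: "\<And>x. cmod (G x) \<le> 1"
    and depF: "depends_on F {1..n}" and depG: "depends_on G {n + k..}" and "n \<ge> 1"
  shows "cmod ((LINT \<omega>|M. F (path \<omega>) * G (path \<omega>))
           - (LINT \<omega>|M. F (path \<omega>)) * (LINT \<omega>|M. G (path \<omega>))) \<le> 16 * mixing_coeff M X k"
proof -
  have part: "\<bar>expectation (\<lambda>\<omega>. u (F (path \<omega>)) * v (G (path \<omega>)))
     - expectation (\<lambda>\<omega>. u (F (path \<omega>))) * expectation (\<lambda>\<omega>. v (G (path \<omega>)))\<bar> \<le> 4 * mixing_coeff M X k"
    if uv: "u = Re \<or> u = Im" "v = Re \<or> v = Im" for u v
  proof -
    have [measurable]: "u \<in> borel_measurable borel" "v \<in> borel_measurable borel" using uv by auto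
    have "\<bar>u z\<bar> \<le> cmod z" "\<bar>v z\<bar> \<le> cmod z" for z
      using uv by (auto simp: abs_Re_le_cmod abs_Im_le_cmod)
    then have b: "\<bar>u (F x)\<bar> \<le> 1" "\<bar>v (G x)\<bar> \<le> 1" for x using Fb Gb order_trans by blast+
    have "depends_on (\<lambda>x. u (F x)) {1..n}" "depends_on (\<lambda>x. v (G x)) {n + k..}"
      using depF depG unfolding depends_on_def by (metis)+
    with mixing_covariance[of "\<lambda>x. u (F x)" 1 "\<lambda>x. v (G x)" 1, OF _ b(1) _ b(2)] \<open>n \<ge> 1\<close>
    show ?thesis by auto
  qed
  have iF: "integrable M (\<lambda>\<omega>. F (path \<omega>))" and iG: "integrable M (\<lambda>\<omega>. G (path \<omega>))"
    using Fb Gb by (auto intro!: integrable_bounded_path[where b = 1])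
  have iFG: "integrable M (\<lambda>\<omega>. F (path \<omega>) * G (path \<omega>))"
    using Fb Gb by (intro integrable_bounded_path[where b = 1 and F = "\<lambda>x. F x * G x"])
      (auto simp: norm_mult mult_le_one)
  have ip: "integrable M (\<lambda>\<omega>. u (F (path \<omega>)) * v (G (path \<omega>)))" 
    if uv: "u = Re \<or> u = Im" "v = Re \<or> v = Im" for u v
  proof -
    have [measurable]: "u \<in> borel_measurable borel" "v \<in> borel_measurable borel" using uv by auto
    have "\<bar>u z\<bar> \<le> cmod z" "\<bar>v z\<bar> \<le> cmod z" for z
      using uv by (auto simp: abs_Re_le_cmod abs_Im_le_cmod)
    then have b: "\<bar>u (F x)\<bar> \<le> 1" "\<bar>v (G x)\<bar> \<le> 1" for x using Fb Gb order_trans by blast+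
    show ?thesis using b by (intro integrable_bounded_path[where b = 1 and F = "\<lambda>x. u (F x) * v (G x)"])
       (auto simp: abs_mult mult_le_one)
  qed
  let ?D = "(LINT \<omega>|M. F (path \<omega>) * G (path \<omega>)) - (LINT \<omega>|M. F (path \<omega>)) * (LINT \<omega>|M. G (path \<omega>))"
  have "Re ?D = (expectation (\<lambda>\<omega>. Re (F (path \<omega>)) * Re (G (path \<omega>))) - expectation (\<lambda>\<omega>. Re (F (path \<omega>))) * expectation (\<lambda>\<omega>. Re (G (path \<omega>))))
     - (expectation (\<lambda>\<omega>. Im (F (path \<omega>)) * Im (G (path \<omega>))) - expectation (\<lambda>\<omega>. Im (F (path \<omega>))) * expectation (\<lambda>\<omega>. Im (G (path \<omega>))))"
    using iF iG iFG ip by (simp add: integral_Re[symmetric] integral_Im[symmetric] del: integral_Re integral_Im)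
  also have "\<bar>\<dots>\<bar> \<le> 8 * mixing_coeff M X k" using part[OF disjI1[OF refl] disjI1[OF refl]] part[OF disjI2[OF refl] disjI2[OF refl]] by linarith
  finally have R: "\<bar>Re ?D\<bar> \<le> 8 * mixing_coeff M X k" .
  have "Im ?D = (expectation (\<lambda>\<omega>. Re (F (path \<omega>)) * Im (G (path \<omega>))) - expectation (\<lambda>\<omega>. Re (F (path \<omega>))) * expectation (\<lambda>\<omega>. Im (G (path \<omega>))))
     + (expectation (\<lambda>\<omega>. Im (F (path \<omega>)) * Re (G (path \<omega>))) - expectation (\<lambda>\<omega>. Im (F (path \<omega>))) * expectation (\<lambda>\<omega>. Re (G (path \<omega>))))"
    using iF iG iFG ip by (simp add: integral_Re[symmetric] integral_Im[symmetric] del: integral_Re integral_Im)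
  also have "\<bar>\<dots>\<bar> \<le> 8 * mixing_coeff M X k" using part[OF disjI1[OF refl] disjI2[OF refl]] part[OF disjI2[OF refl] disjI1[OF refl]] by linarith
  finally have I: "\<bar>Im ?D\<bar> \<le> 8 * mixing_coeff M X k" .
  from cmod_le[of ?D] R I show ?thesis by linarith
qed

end

section \<open>Second moments and the long-run variance\<close>

text \<open>The discrete l'Hospital rule of Stolz and Cesaro.\<close>

lemma cesaro_increment:
  fixes f :: "nat \<Rightarrow> real"
  assumes "(\<lambda>n. f (Suc n) - f n) \<longlonglongrightarrow> L"
  shows "(\<lambda>n. f n / real n) \<longlonglongrightarrow> L"
proof (rule LIMSEQ_I)
  fix e :: real assume "e > 0"
  then obtain N where N: "\<And>n. n \<ge> N \<Longrightarrow> \<bar>f (Suc n) - f n - L\<bar> < e / 2"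
    using LIMSEQ_D[OF assms, of "e / 2"] by auto
  have inc: "\<bar>f (N + j) - f N - real j * L\<bar> \<le> real j * (e / 2)" for j
  proof (induction j)
    case (Suc j)
    have "\<bar>f (Suc (N + j)) - f (N + j) - L\<bar> < e / 2" by (rule N) simp
    moreover have "f (N + Suc j) - f N - real (Suc j) * L
        = (f (N + j) - f N - real j * L) + (f (Suc (N + j)) - f (N + j) - L)"
      by (simp add: algebra_simps)
    moreover have "real (Suc j) * (e / 2) = real j * (e / 2) + e / 2" by (simp add: algebra_simps)
    ultimately show ?case using Suc by linarith
  qed simp
  define A where "A = \<bar>f N - real N * L\<bar>"
  obtain N2 :: nat where N2: "real N2 > 2 * A / e" using reals_Archimedean2 by blast
  show "\<exists>no. \<forall>n\<ge>no. norm (f n / real n - L) < e"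
  proof (intro exI[of _ "max (Suc N) (Suc N2)"] allI impI)
    fix n assume n: "max (Suc N) (Suc N2) \<le> n"
    define j where "j = n - N"
    have nj: "n = N + j" using n by (simp add: j_def)
    have n0: "real n > 0" using n by simp
    have "\<bar>f n - real n * L\<bar> \<le> A + real j * (e / 2)"
    proof -
      have "f n - real n * L = (f (N + j) - f N - real j * L) + (f N - real N * L)"
        unfolding nj by (simp add: algebra_simps)
      then show ?thesis using inc[of j] unfolding A_def by linarith
    qed
    also have "real j * (e / 2) \<le> real n * (e / 2)" using \<open>e > 0\<close> by (intro mult_right_mono) (auto simp: nj)
    also have "A < real n * (e / 2)"
    proof -
      have "2 * A / e < real n" using N2 n by linarith
      then show ?thesis using \<open>e > 0\<close> by (simp add: field_simps)
    qed
    finally have "\<bar>f n - real n * L\<bar> < e * real n" by (simp add: mult.commute)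
    moreover have "norm (f n / real n - L) = \<bar>f n - real n * L\<bar> / real n"
      using n0 by (simp add: field_simps abs_divide)
    ultimately show "norm (f n / real n - L) < e" using n0 by (simp add: pos_divide_less_eq)
  qed
qed

text \<open>Both sides are \<open>k\<close>-th powers of numbers of modulus at most 1, and \<open>1 - y\<close> differs from
  \<open>exp (- y)\<close> by at most \<open>y\<^sup>2\<close> for \<open>y = x / k\<close>.\<close>

lemma exp_one_minus_power_bound:
  fixes x :: real
  assumes "0 \<le> x" "x \<le> real k" "k \<ge> 1"
  shows "\<bar>(1 - x / real k) ^ k - exp (- x)\<bar> \<le> x\<^sup>2 / real k"
proof -
  define y where "y = x / real k"
  have y: "0 \<le> y" "y \<le> 1" using assms by (auto simp: y_def)
  have "exp (- x) = exp (- y) ^ k"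
    using assms by (simp add: y_def exp_of_nat_mult[symmetric])
  moreover have "norm ((1 - y) ^ k - exp (- y) ^ k) \<le> real k * norm ((1 - y) - exp (- y))"
    using y by (intro norm_power_diff) auto
  moreover have "norm ((1 - y) - exp (- y)) \<le> y\<^sup>2"
  proof -
    have 1: "1 - y \<le> exp (- y)" using exp_ge_add_one_self[of "- y"] by simp
    have "exp (- y) \<le> 1 / (1 + y)"
      using exp_ge_add_one_self[of y] y by (simp add: exp_minus field_simps)
    also have "\<dots> \<le> 1 - y + y\<^sup>2"
      using y by (simp add: field_simps power2_eq_square)
    finally show ?thesis using 1 by simp
  qed
  ultimately have "\<bar>(1 - y) ^ k - exp (- x)\<bar> \<le> real k * y\<^sup>2"
    by (smt (verit) mult_left_mono of_nat_0_le_iff real_norm_def)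
  also have "\<dots> = x\<^sup>2 / real k" using assms by (simp add: y_def power2_eq_square field_simps)
  finally show ?thesis by (simp add: y_def)
qed

lemma square_sum_le: "(a + b)\<^sup>2 \<le> 2 * a\<^sup>2 + 2 * (b :: real)\<^sup>2"
  using zero_le_power2[of "a - b"] by (simp add: power2_eq_square algebra_simps)

definition gap :: "nat \<Rightarrow> nat \<Rightarrow> nat" where
  "gap i j = (if i \<le> j then j - i else i - j)"

lemma sum_gap_le:
  fixes \<gamma> :: "nat \<Rightarrow> real"
  assumes "finite I" and \<gamma>: "summable \<gamma>" "\<And>k. 0 \<le> \<gamma> k"
  shows "(\<Sum>j\<in>I. \<gamma> (gap i j)) \<le> 2 * (\<Sum>k. \<gamma> k)"
proof -
  have "(\<Sum>j\<in>I. \<gamma> (gap i j)) = (\<Sum>j\<in>I \<inter> {..<i}. \<gamma> (gap i j)) + (\<Sum>j\<in>I - {..<i}. \<gamma> (gap i j))"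
    using sum.Int_Diff[OF \<open>finite I\<close>] by blast
  also have "(\<Sum>j\<in>I \<inter> {..<i}. \<gamma> (gap i j)) = (\<Sum>k\<in>(\<lambda>j. i - j) ` (I \<inter> {..<i}). \<gamma> k)"
    by (subst sum.reindex) (auto simp: inj_on_def gap_def intro!: sum.cong)
  also have "\<dots> \<le> suminf \<gamma>" using assms by (intro sum_le_suminf) auto
  also have "(\<Sum>j\<in>I - {..<i}. \<gamma> (gap i j)) = (\<Sum>k\<in>(\<lambda>j. j - i) ` (I - {..<i}). \<gamma> k)"
    by (subst sum.reindex) (auto simp: inj_on_def gap_def not_less intro!: sum.cong)
  also have "\<dots> \<le> suminf \<gamma>" using assms by (intro sum_le_suminf) auto
  finally show ?thesis by simp
qed

locale mixing_process = process M X for M :: "'a measure" and X +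
  fixes K :: real
  assumes stat: "stationary M X"
    and K_nonneg: "0 \<le> K"
    and mixing_rate: "\<And>k. k \<ge> 1 \<Longrightarrow> mixing_coeff M X k \<le> K / real k ^ 8"
begin

lemma measurable_X_Suc[measurable]: "X (Suc n) \<in> borel_measurable M"
  by (rule X_measurable) simp

text \<open>Stationarity, transferred from finite-dimensional distributions to functionals of the path.\<close>

lemma shift_invariance:
  fixes F :: "(nat \<Rightarrow> real) \<Rightarrow> 'b :: {banach, second_countable_topology}"
  assumes [measurable]: "F \<in> borel_measurable path_space" and dep: "depends_on F {1..n}"
  shows "(LINT \<omega>|M. F (\<lambda>s. path \<omega> (s + a))) = (LINT \<omega>|M. F (path \<omega>))"
proof -
  let ?ext = "\<lambda>z s. if s \<in> {1..n} then z s else (0::real)"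
  have [measurable]: "?ext \<in> PiM {1..n} (\<lambda>_. borel) \<rightarrow>\<^sub>M path_space"
  proof (rule measurable_PiM_single')
    fix s show "(\<lambda>z. ?ext z s) \<in> borel_measurable (PiM {1..n} (\<lambda>_. borel))"
      by (cases "s \<in> {1..n}") auto
  qed auto
  have Fm[measurable]: "(\<lambda>z. F (?ext z)) \<in> borel_measurable (PiM {1..n} (\<lambda>_. borel))" by measurable
  have m: "(\<lambda>\<omega>. \<lambda>i\<in>{1..n}. X (i + k) \<omega>) \<in> M \<rightarrow>\<^sub>M PiM {1..n} (\<lambda>_. borel)" for k
    by (intro measurable_restrict X_measurable) auto
  have eq: "(LINT \<omega>|M. F (\<lambda>s. path \<omega> (s + k)))
      = (LINT z|distr M (PiM {1..n} (\<lambda>_. borel)) (\<lambda>\<omega>. \<lambda>i\<in>{1..n}. X (i + k) \<omega>). F (?ext z))" for k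
    by (subst integral_distr[OF m Fm], intro Bochner_Integration.integral_cong depends_onD[OF dep])
      (auto simp: path_def)
  have "(LINT \<omega>|M. F (\<lambda>s. path \<omega> (s + a))) = (LINT \<omega>|M. F (\<lambda>s. path \<omega> (s + 0)))"
    unfolding eq using stat unfolding stationary_def by (simp del: add_0_right)
  then show ?thesis by simp
qed

lemma expectation_shift1:
  assumes [measurable]: "(u :: real \<Rightarrow> real) \<in> borel_measurable borel" and "i \<ge> 1"
  shows "expectation (\<lambda>\<omega>. u (X i \<omega>)) = expectation (\<lambda>\<omega>. u (X 1 \<omega>))"
  using shift_invariance[of "\<lambda>x. u (x 1)" 1 "i - 1"] assms(2)
  by (simp add: depends_on_def path_apply)

definition autocov :: "(real \<Rightarrow> real) \<Rightarrow> nat \<Rightarrow> real" where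
  "autocov u k = expectation (\<lambda>\<omega>. u (X 1 \<omega>) * u (X (1 + k) \<omega>))"

lemma autocov_gap:
  assumes [measurable]: "u \<in> borel_measurable borel" and "i \<ge> 1" "j \<ge> 1"
  shows "expectation (\<lambda>\<omega>. u (X i \<omega>) * u (X j \<omega>)) = autocov u (gap i j)"
proof -
  have *: "expectation (\<lambda>\<omega>. u (X i \<omega>) * u (X (i + k) \<omega>)) = autocov u k" if "i \<ge> 1" for i k
    using shift_invariance[of "\<lambda>x. u (x 1) * u (x (1 + k))" "1 + k" "i - 1"] that
    by (simp add: depends_on_def path_apply autocov_def add.commute)
  show ?thesis
    using *[of i "j - i"] *[of j "i - j"] assms(2,3) by (auto simp: gap_def mult.commute)
qed

lemma autocov_bound:
  assumes [measurable]: "u \<in> borel_measurable borel" and ub: "\<And>x. \<bar>u x\<bar> \<le> b"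
    and mean: "expectation (\<lambda>\<omega>. u (X 1 \<omega>)) = 0" and "k \<ge> 1"
  shows "\<bar>autocov u k\<bar> \<le> 4 * b\<^sup>2 * K / real k ^ 8"
proof -
  have "\<bar>expectation (\<lambda>\<omega>. u (path \<omega> 1) * u (path \<omega> (1 + k)))
     - expectation (\<lambda>\<omega>. u (path \<omega> 1)) * expectation (\<lambda>\<omega>. u (path \<omega> (1 + k)))\<bar> \<le> 4 * b * b * mixing_coeff M X k"
    by (rule mixing_covariance[where n = 1 and F = "\<lambda>x. u (x 1)" and G = "\<lambda>x. u (x (1 + k))"])
      (auto simp: depends_on_def ub)
  also have "\<dots> \<le> 4 * b * b * (K / real k ^ 8)"
    by (intro mult_left_mono mixing_rate) (use assms in auto)
  finally show ?thesis using mean by (simp add: path_apply autocov_def power2_eq_square)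
qed

lemma integrable_X_bounded:
  assumes [measurable]: "u \<in> borel_measurable borel" and ub: "\<And>x. \<bar>u x\<bar> \<le> (b::real)" and "i \<ge> 1"
  shows "integrable M (\<lambda>\<omega>. u (X i \<omega>))"
  using X_measurable[OF \<open>i \<ge> 1\<close>] by (intro integrable_const_bound[where B = b]) (auto simp: ub)

text \<open>Unlike the mixing bound, this one is small when \<open>u\<close> is small in mean; the minimum of both
  controls differences of projections in \<open>centered_sum_small\<close>.\<close>

lemma autocov_bound_L1:
  assumes [measurable]: "u \<in> borel_measurable borel" and ub: "\<And>x. \<bar>u x\<bar> \<le> b"
  shows "\<bar>autocov u k\<bar> \<le> b * expectation (\<lambda>\<omega>. \<bar>u (X 1 \<omega>)\<bar>)"
proof -
  have b0: "b \<ge> 0" using ub[of 0] by auto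
  have X[measurable]: "X 1 \<in> borel_measurable M" "X (1 + k) \<in> borel_measurable M" by (auto intro: X_measurable)
  have "\<bar>autocov u k\<bar> \<le> expectation (\<lambda>\<omega>. \<bar>u (X 1 \<omega>) * u (X (1 + k) \<omega>)\<bar>)"
    unfolding autocov_def by (rule integral_abs_bound)
  also have "\<dots> \<le> expectation (\<lambda>\<omega>. b * \<bar>u (X 1 \<omega>)\<bar>)"
  proof (rule integral_mono)
    fix \<omega>
    show "\<bar>u (X 1 \<omega>) * u (X (1 + k) \<omega>)\<bar> \<le> b * \<bar>u (X 1 \<omega>)\<bar>"
      unfolding abs_mult by (subst mult.commute) (intro mult_right_mono ub abs_ge_zero)
  next
    have "integrable M (\<lambda>\<omega>. u (X 1 \<omega>) * u (X (1 + k) \<omega>))"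
      using b0 by (intro integrable_const_bound[where B = "b * b"] AE_I2) (auto simp: abs_mult ub intro!: mult_mono)
    then show "integrable M (\<lambda>\<omega>. \<bar>u (X 1 \<omega>) * u (X (1 + k) \<omega>)\<bar>)" by (rule integrable_abs)
    show "integrable M (\<lambda>\<omega>. b * \<bar>u (X 1 \<omega>)\<bar>)"
      using integrable_X_bounded[OF assms(1) ub, of 1] by (intro integrable_mult_right integrable_abs) auto
  qed
  finally show ?thesis by simp
qed

lemma second_moment_expand:
  assumes [measurable]: "u \<in> borel_measurable borel" and ub: "\<And>x. \<bar>u x\<bar> \<le> b"
    and I: "finite I" "I \<subseteq> {1..}"
  shows "expectation (\<lambda>\<omega>. (\<Sum>i\<in>I. u (X i \<omega>))\<^sup>2) = (\<Sum>i\<in>I. \<Sum>j\<in>I. autocov u (gap i j))"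
proof -
  have i: "integrable M (\<lambda>\<omega>. u (X i \<omega>) * u (X j \<omega>))" if "i \<in> I" "j \<in> I" for i j
  proof -
    have [measurable]: "X i \<in> borel_measurable M" "X j \<in> borel_measurable M"
      using that I by (auto intro!: X_measurable)
    have "0 \<le> b" using ub[of 0] by auto
    then show ?thesis
      by (intro integrable_const_bound[where B = "b * b"] AE_I2) (auto simp: abs_mult ub intro!: mult_mono)
  qed
  have "expectation (\<lambda>\<omega>. (\<Sum>i\<in>I. u (X i \<omega>))\<^sup>2) = expectation (\<lambda>\<omega>. \<Sum>i\<in>I. \<Sum>j\<in>I. u (X i \<omega>) * u (X j \<omega>))"
    by (simp add: power2_eq_square sum_product)
  also have "\<dots> = (\<Sum>i\<in>I. \<Sum>j\<in>I. expectation (\<lambda>\<omega>. u (X i \<omega>) * u (X j \<omega>)))"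
    using i by (subst Bochner_Integration.integral_sum)
      (auto intro!: sum.cong Bochner_Integration.integral_sum integrable_sum)
  also have "\<dots> = (\<Sum>i\<in>I. \<Sum>j\<in>I. autocov u (gap i j))"
    using I by (intro sum.cong autocov_gap) auto
  finally show ?thesis .
qed

lemma second_moment_sum_le:
  assumes u: "u \<in> borel_measurable borel" "\<And>x. \<bar>u x\<bar> \<le> b"
    and I: "finite I" "I \<subseteq> {1..}"
    and \<gamma>: "\<And>k. \<bar>autocov u k\<bar> \<le> \<gamma> k" "summable \<gamma>"
  shows "expectation (\<lambda>\<omega>. (\<Sum>i\<in>I. u (X i \<omega>))\<^sup>2) \<le> 2 * real (card I) * (\<Sum>k. \<gamma> k)"
proof -
  have \<gamma>0: "0 \<le> \<gamma> k" for k using \<gamma>(1)[of k] by linarith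
  have "expectation (\<lambda>\<omega>. (\<Sum>i\<in>I. u (X i \<omega>))\<^sup>2) \<le> (\<Sum>i\<in>I. \<Sum>j\<in>I. \<gamma> (gap i j))"
    unfolding second_moment_expand[OF u I] by (intro sum_mono order.trans[OF abs_ge_self \<gamma>(1)])
  also have "\<dots> \<le> (\<Sum>i\<in>I. 2 * (\<Sum>k. \<gamma> k))"
    by (intro sum_mono sum_gap_le I \<gamma> \<gamma>0)
  finally show ?thesis by (simp add: mult_ac)
qed

lemma summable_power8: "summable (\<lambda>k. c / real (Suc k) ^ 8)" for c :: real
proof -
  have "summable (\<lambda>k. inverse (real (Suc k) ^ 8))"
    by (subst summable_Suc_iff[of "\<lambda>k. inverse (real k ^ 8)"]) (rule inverse_power_summable, simp)
  then show ?thesis by (simp add: divide_inverse summable_mult)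
qed

text \<open>A summable bound for the autocovariances of every centred function bounded by \<open>b\<close>.\<close>

definition autocov_majorant :: "real \<Rightarrow> nat \<Rightarrow> real" where
  "autocov_majorant b k = (if k = 0 then b\<^sup>2 else 4 * b\<^sup>2 * K / real k ^ 8)"

lemma summable_autocov_majorant: "summable (autocov_majorant b)"
  by (subst summable_Suc_iff[symmetric]) (simp add: autocov_majorant_def summable_power8 del: of_nat_Suc)

lemma autocov_le_majorant:
  assumes [measurable]: "u \<in> borel_measurable borel" and ub: "\<And>x. \<bar>u x\<bar> \<le> b"
    and mean: "expectation (\<lambda>\<omega>. u (X 1 \<omega>)) = 0"
  shows "\<bar>autocov u k\<bar> \<le> autocov_majorant b k"
proof (cases "k = 0")
  case True
  have b0: "b \<ge> 0" using ub[of 0] by auto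
  have [measurable]: "X 1 \<in> borel_measurable M" by (rule X_measurable) simp
  have "\<bar>autocov u 0\<bar> \<le> b * expectation (\<lambda>\<omega>. \<bar>u (X 1 \<omega>)\<bar>)" by (rule autocov_bound_L1) (auto simp: ub)
  also have "\<dots> \<le> b * b"
    using b0 integrable_X_bounded[OF assms(1) ub, of 1]
    by (intro mult_left_mono integral_le_const AE_I2 integrable_abs) (auto simp: ub)
  finally show ?thesis by (simp add: True autocov_majorant_def power2_eq_square)
next
  case False
  then show ?thesis using autocov_bound[OF assms, of k] by (simp add: autocov_majorant_def)
qed

definition longrun :: "(real \<Rightarrow> real) \<Rightarrow> real" where
  "longrun u = autocov u 0 + 2 * (\<Sum>k. autocov u (Suc k))"

text \<open>Passing from \<open>p\<close> to \<open>p + 1\<close> summands adds the diagonal term and two copies of a partial sum of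
  the autocovariance series.\<close>

lemma block_variance_limit:
  assumes u: "u \<in> borel_measurable borel" "\<And>x. \<bar>u x\<bar> \<le> b"
    and mean: "expectation (\<lambda>\<omega>. u (X 1 \<omega>)) = 0"
  shows "(\<lambda>p. expectation (\<lambda>\<omega>. (\<Sum>i\<in>{1..p}. u (X i \<omega>))\<^sup>2) / real p) \<longlonglongrightarrow> longrun u"
proof (rule cesaro_increment)
  have "norm (autocov u k) \<le> autocov_majorant b k" for k
    using autocov_le_majorant[OF u mean] by simp
  then have "summable (\<lambda>k. autocov u k)"
    by (rule summable_comparison_test'[OF summable_autocov_majorant])
  then have s: "summable (\<lambda>k. autocov u (Suc k))" by (simp add: summable_Suc_iff)
  have V: "expectation (\<lambda>\<omega>. (\<Sum>i\<in>{1..p}. u (X i \<omega>))\<^sup>2) = (\<Sum>i\<in>{1..p}. \<Sum>j\<in>{1..p}. autocov u (gap i j))" for p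
    by (rule second_moment_expand[OF u]) auto
  have inc: "expectation (\<lambda>\<omega>. (\<Sum>i\<in>{1..Suc p}. u (X i \<omega>))\<^sup>2) - expectation (\<lambda>\<omega>. (\<Sum>i\<in>{1..p}. u (X i \<omega>))\<^sup>2)
      = autocov u 0 + 2 * (\<Sum>k<p. autocov u (Suc k))" for p
  proof -
    have row: "(\<Sum>j\<in>{1..p}. autocov u (gap (Suc p) j)) = (\<Sum>k<p. autocov u (Suc k))"
      by (rule sum.reindex_bij_witness[of _ "\<lambda>k. p - k" "\<lambda>j. p - j"]) (auto simp: gap_def intro!: arg_cong[where f = "autocov u"])
    have col: "(\<Sum>i\<in>{1..p}. autocov u (gap i (Suc p))) = (\<Sum>j\<in>{1..p}. autocov u (gap (Suc p) j))"
      by (intro sum.cong) (auto simp: gap_def)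
    have diag: "gap (Suc p) (Suc p) = 0" by (simp add: gap_def)
    have I: "{1..Suc p} = insert (Suc p) {1..p}" by auto
    have "(\<Sum>i\<in>{1..Suc p}. \<Sum>j\<in>{1..Suc p}. autocov u (gap i j))
      = (\<Sum>i\<in>{1..p}. \<Sum>j\<in>{1..p}. autocov u (gap i j)) + 2 * (\<Sum>j\<in>{1..p}. autocov u (gap (Suc p) j)) + autocov u 0"
      unfolding I by (simp add: sum.distrib diag col[simplified])
    then show ?thesis unfolding V row by simp
  qed
  show "(\<lambda>p. expectation (\<lambda>\<omega>. (\<Sum>i\<in>{1..Suc p}. u (X i \<omega>))\<^sup>2) - expectation (\<lambda>\<omega>. (\<Sum>i\<in>{1..p}. u (X i \<omega>))\<^sup>2))
      \<longlonglongrightarrow> longrun u"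
    unfolding inc longrun_def by (intro tendsto_intros summable_LIMSEQ s)
qed

text \<open>A limit of variances. Without this the limit law of variance \<open>longrun u\<close> would not make sense.\<close>

lemma longrun_nonneg:
  assumes u: "u \<in> borel_measurable borel" "\<And>x. \<bar>u x\<bar> \<le> b"
    and mean: "expectation (\<lambda>\<omega>. u (X 1 \<omega>)) = 0"
  shows "0 \<le> longrun u"
  by (rule LIMSEQ_le_const[OF block_variance_limit[OF assms]]) auto

end

section \<open>Bernstein blocks and the central limit theorem\<close>

lemma (in prob_space) expectation_abs_le_sqrt:
  fixes R :: "'a \<Rightarrow> real"
  assumes "integrable M R" "integrable M (\<lambda>\<omega>. (R \<omega>)\<^sup>2)"
  shows "expectation (\<lambda>\<omega>. \<bar>R \<omega>\<bar>) \<le> sqrt (expectation (\<lambda>\<omega>. (R \<omega>)\<^sup>2))"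
proof -
  have "0 \<le> variance (\<lambda>\<omega>. \<bar>R \<omega>\<bar>)" by (rule variance_positive)
  also have "variance (\<lambda>\<omega>. \<bar>R \<omega>\<bar>) = expectation (\<lambda>\<omega>. (R \<omega>)\<^sup>2) - (expectation (\<lambda>\<omega>. \<bar>R \<omega>\<bar>))\<^sup>2"
    using assms by (subst variance_eq) auto
  finally show ?thesis by (intro real_le_rsqrt) simp
qed

lemma (in prob_space) integrable_iexp_real:
  assumes [measurable]: "f \<in> borel_measurable M"
  shows "integrable M (\<lambda>\<omega>. iexp (f \<omega>))"
  by (rule integrable_const_bound[where B = 1]) auto

lemma iexp_lipschitz: "cmod (iexp a - iexp b) \<le> \<bar>a - b\<bar>"
proof -
  have "iexp a - iexp b = iexp b * (iexp (a - b) - 1)"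
    by (simp add: algebra_simps exp_add[symmetric])
  then have "cmod (iexp a - iexp b) = cmod (iexp (a - b) - 1)" by (simp add: norm_mult)
  also have "\<dots> \<le> \<bar>a - b\<bar>" using iexp_approx1[of "a - b" 0] by simp
  finally show ?thesis .
qed

lemma iexp_taylor2:
  "cmod (iexp v - (1 + \<i> * of_real v - of_real (v\<^sup>2 / 2))) \<le> \<bar>v\<bar> ^ 3 / 6"
proof -
  have "(\<Sum>k\<le>2. z ^ k / fact k) = 1 + z + z\<^sup>2 / 2" for z :: complex
    by (simp add: numeral_2_eq_2)
  from this[of "\<i> * of_real v"]
  have "(\<Sum>k\<le>2. (\<i> * of_real v) ^ k / fact k) = 1 + \<i> * of_real v - of_real (v\<^sup>2 / 2)"
    by (simp add: power_mult_distrib)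
  then show ?thesis using iexp_approx1[of v 2] by (simp add: eval_nat_numeral)
qed

text \<open>For a block sum the third moment is bounded by the almost sure bound times the second moment,
  which is much smaller than the cube of the almost sure bound.\<close>

lemma iexp_taylor2_scaled:
  assumes "\<bar>v\<bar> \<le> c"
  shows "cmod (iexp (s * v) - (1 + \<i> * of_real (s * v) - of_real ((s * v)\<^sup>2 / 2))) \<le> \<bar>s\<bar> ^ 3 / 6 * (c * v\<^sup>2)"
proof -
  have "cmod (iexp (s * v) - (1 + \<i> * of_real (s * v) - of_real ((s * v)\<^sup>2 / 2))) \<le> \<bar>s * v\<bar> ^ 3 / 6"
    by (rule iexp_taylor2)
  also have "\<bar>s * v\<bar> ^ 3 / 6 = \<bar>s\<bar> ^ 3 / 6 * (\<bar>v\<bar> * v\<^sup>2)"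
    by (cases "v \<ge> 0") (simp_all add: abs_mult power_mult_distrib power3_eq_cube power2_eq_square)
  also have "\<dots> \<le> \<bar>s\<bar> ^ 3 / 6 * (c * v\<^sup>2)"
    using assms by (intro mult_left_mono mult_right_mono) auto
  finally show ?thesis .
qed

text \<open>Block \<open>j\<close> has length \<open>p\<close> and starts after \<open>j\<close> periods of length \<open>r\<close>; in the applications
  \<open>r = p + q\<close> with a gap of length \<open>q\<close> between blocks.\<close>

definition block_sum :: "(real \<Rightarrow> real) \<Rightarrow> nat \<Rightarrow> nat \<Rightarrow> nat \<Rightarrow> (nat \<Rightarrow> real) \<Rightarrow> real" where
  "block_sum u p r j x = (\<Sum>i\<in>{j * r + 1..j * r + p}. u (x i))"

lemma measurable_block_sum[measurable]:
  assumes [measurable]: "u \<in> borel_measurable borel"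
  shows "block_sum u p r j \<in> borel_measurable path_space"
  unfolding block_sum_def by measurable

lemma block_sum_shift: "block_sum u p r j x = block_sum u p r 0 (\<lambda>i. x (i + j * r))"
  unfolding block_sum_def
  by (rule sum.reindex_bij_witness[of _ "\<lambda>i. i + j * r" "\<lambda>i. i - j * r"]) auto

lemma depends_on_comp: "depends_on F S \<Longrightarrow> depends_on (\<lambda>x. f (F x)) S"
  unfolding depends_on_def by metis

lemma depends_on_block_sum: "{j * r + 1..j * r + p} \<subseteq> S \<Longrightarrow> depends_on (block_sum u p r j) S"
  unfolding depends_on_def block_sum_def by (auto intro!: sum.cong)

context mixing_process
begin

text \<open>Blocks are split off from the right; the last one is at distance \<open>q + 1\<close> from the others, so
  each split costs \<open>16\<close> times the mixing coefficient at \<open>q + 1\<close>.\<close>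

lemma char_blocks:
  assumes [measurable]: "u \<in> borel_measurable borel" and p: "p \<ge> 1"
  shows "cmod ((LINT \<omega>|M. (\<Prod>j<k. iexp (s * block_sum u p (p + q) j (path \<omega>))))
      - (LINT \<omega>|M. iexp (s * block_sum u p (p + q) 0 (path \<omega>))) ^ k) \<le> real k * (16 * (K / real (q + 1) ^ 8))"
proof (induction k)
  case 0
  then show ?case by (simp add: prob_space)
next
  case (Suc k)
  let ?r = "p + q"
  let ?e = "\<lambda>j x. iexp (s * block_sum u p ?r j x)"
  let ?\<phi> = "LINT \<omega>|M. ?e 0 (path \<omega>)"
  have \<phi>1: "cmod ?\<phi> \<le> 1"
  proof -
    have "cmod ?\<phi> \<le> (LINT \<omega>|M. cmod (?e 0 (path \<omega>)))" by (rule integral_norm_bound)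
    then show ?thesis by (simp add: prob_space)
  qed
  have shift: "(LINT \<omega>|M. ?e k (path \<omega>)) = ?\<phi>"
  proof -
    have d: "depends_on (?e 0) {1..p}"
      by (intro depends_on_comp[where f = "\<lambda>v. iexp (s * v)"] depends_on_block_sum) auto
    have "(LINT \<omega>|M. ?e k (path \<omega>)) = (LINT \<omega>|M. ?e 0 (\<lambda>i. path \<omega> (i + k * ?r)))"
      by (subst block_sum_shift) simp
    also have "\<dots> = ?\<phi>" by (rule shift_invariance[OF _ d]) simp
    finally show ?thesis .
  qed
  show ?case
  proof (cases "k = 0")
    case True
    then show ?thesis using K_nonneg by (simp add: shift[unfolded True] )
  next
    case False
    define n where "n = k * ?r - q"
    have kr: "?r \<le> k * ?r" using False by simp
    then have n: "n \<ge> 1" "n + (q + 1) = k * ?r + 1" using p unfolding n_def by linarith+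
    have dF: "depends_on (\<lambda>x. \<Prod>j<k. ?e j x) {1..n}"
    proof -
      have "depends_on (block_sum u p ?r j) {1..n}" if "j < k" for j
      proof (rule depends_on_block_sum)
        have "Suc j * ?r \<le> k * ?r" using that by (intro mult_le_mono1) simp
        then have "j * ?r + p \<le> n" unfolding n_def by simp
        then show "{j * ?r + 1..j * ?r + p} \<subseteq> {1..n}" by auto
      qed
      then show ?thesis unfolding depends_on_def
        by (auto intro!: prod.cong arg_cong[where f = "\<lambda>v. iexp (s * v)"] simp del: of_real_mult)
    qed
    have dG: "depends_on (?e k) {n + (q + 1)..}"
      unfolding n(2) by (intro depends_on_comp[where f = "\<lambda>v. iexp (s * v)"] depends_on_block_sum) auto
    have "cmod ((LINT \<omega>|M. (\<Prod>j<k. ?e j (path \<omega>)) * ?e k (path \<omega>))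
       - (LINT \<omega>|M. (\<Prod>j<k. ?e j (path \<omega>))) * (LINT \<omega>|M. ?e k (path \<omega>))) \<le> 16 * mixing_coeff M X (q + 1)"
      by (rule mixing_covariance_complex[where F = "\<lambda>x. \<Prod>j<k. ?e j x" and G = "?e k", OF _ _ _ _ dF dG n(1)])
        (auto simp: prod_norm[symmetric] intro!: prod_le_1)
    also have "\<dots> \<le> 16 * (K / real (q + 1) ^ 8)" by (intro mult_left_mono mixing_rate) auto
    finally have step: "cmod ((LINT \<omega>|M. (\<Prod>j<Suc k. ?e j (path \<omega>)))
       - (LINT \<omega>|M. (\<Prod>j<k. ?e j (path \<omega>))) * ?\<phi>) \<le> 16 * (K / real (q + 1) ^ 8)"
      unfolding shift prod.lessThan_Suc .
    have "cmod ((LINT \<omega>|M. (\<Prod>j<k. ?e j (path \<omega>))) * ?\<phi> - ?\<phi> ^ Suc k)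
        = cmod ((LINT \<omega>|M. (\<Prod>j<k. ?e j (path \<omega>))) - ?\<phi> ^ k) * cmod ?\<phi>"
      unfolding norm_mult[symmetric] by (simp add: algebra_simps)
    also have "\<dots> \<le> cmod ((LINT \<omega>|M. (\<Prod>j<k. ?e j (path \<omega>))) - ?\<phi> ^ k) * 1"
      using \<phi>1 by (intro mult_left_mono) auto
    also have "\<dots> \<le> real k * (16 * (K / real (q + 1) ^ 8))" using Suc by simp
    finally have "cmod ((LINT \<omega>|M. (\<Prod>j<k. ?e j (path \<omega>))) * ?\<phi> - ?\<phi> ^ Suc k) \<le> \<dots>" .
    from norm_diff_triangle_le[OF step this] show ?thesis
      unfolding of_nat_Suc by (simp only: distrib_right mult_1)
  qed
qed

text \<open>The first-order term drops out because \<open>u\<close> is centred.\<close>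

lemma block_char_taylor:
  fixes p :: nat
  assumes u[measurable]: "u \<in> borel_measurable borel" and ub: "\<And>x. \<bar>u x\<bar> \<le> b"
    and mean: "expectation (\<lambda>\<omega>. u (X 1 \<omega>)) = 0"
  defines "V \<equiv> expectation (\<lambda>\<omega>. (\<Sum>i\<in>{1..p}. u (X i \<omega>))\<^sup>2)"
  shows "cmod ((LINT \<omega>|M. iexp (s * block_sum u p r 0 (path \<omega>))) - of_real (1 - s\<^sup>2 * V / 2))
     \<le> \<bar>s\<bar> ^ 3 * (b * real p * V) / 6"
proof -
  let ?B = "\<lambda>\<omega>. block_sum u p r 0 (path \<omega>)"
  have B: "?B \<omega> = (\<Sum>i\<in>{1..p}. u (X i \<omega>))" for \<omega>
    unfolding block_sum_def by (auto intro!: sum.cong simp: path_apply)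
  have b0: "b \<ge> 0" using ub[of 0] by auto
  have Bb: "\<bar>?B \<omega>\<bar> \<le> b * real p" for \<omega>
  proof -
    have "\<bar>?B \<omega>\<bar> \<le> (\<Sum>i\<in>{1..p}. \<bar>u (X i \<omega>)\<bar>)" unfolding B by (rule sum_abs)
    also have "\<dots> \<le> (\<Sum>i\<in>{1..p}. b)" by (intro sum_mono ub)
    finally show ?thesis by (simp add: mult.commute)
  qed
  have Bm[measurable]: "?B \<in> borel_measurable M" by measurable
  have iB: "integrable M ?B" using Bb by (intro integrable_const_bound[where B = "b * real p"]) auto
  have B2b: "(?B \<omega>)\<^sup>2 \<le> (b * real p)\<^sup>2" for \<omega> using Bb[of \<omega>] by (rule abs_le_square_iff[THEN iffD1, OF order_trans[OF _ abs_ge_self]])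
  have iB2: "integrable M (\<lambda>\<omega>. (?B \<omega>)\<^sup>2)"
    using B2b by (intro integrable_const_bound[where B = "(b * real p)\<^sup>2"]) auto
  have EB: "expectation ?B = 0"
  proof -
    have "expectation ?B = (\<Sum>i\<in>{1..p}. expectation (\<lambda>\<omega>. u (X i \<omega>)))"
      unfolding B using integrable_X_bounded[OF u ub] by (intro Bochner_Integration.integral_sum) auto
    also have "\<dots> = 0"
    proof (intro sum.neutral ballI)
      fix i assume "i \<in> {1..p}"
      then show "expectation (\<lambda>\<omega>. u (X i \<omega>)) = 0"
        using expectation_shift1[OF u, of i] mean by simp
    qed
    finally show ?thesis .
  qed
  have iE: "integrable M (\<lambda>\<omega>. iexp (s * ?B \<omega>))"
    by (rule integrable_const_bound[where B = 1]) auto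
  let ?T = "\<lambda>\<omega>. 1 + \<i> * of_real (s * ?B \<omega>) - of_real ((s * ?B \<omega>)\<^sup>2 / 2)"
  have iT: "integrable M ?T"
    using iB iB2 by (auto simp: power_mult_distrib simp del: of_real_mult of_real_divide of_real_power)
  have ET: "(LINT \<omega>|M. ?T \<omega>) = of_real (1 - s\<^sup>2 * V / 2)"
  proof -
    have "(LINT \<omega>|M. ?T \<omega>) = 1 + \<i> * of_real (expectation (\<lambda>\<omega>. s * ?B \<omega>)) - of_real (expectation (\<lambda>\<omega>. (s * ?B \<omega>)\<^sup>2 / 2))"
      using iB iB2 by (simp add: power_mult_distrib prob_space del: of_real_mult of_real_divide of_real_power)
    then show ?thesis unfolding V_def B[symmetric] by (simp add: EB power_mult_distrib)
  qed
  have pt: "cmod (iexp (s * ?B \<omega>) - ?T \<omega>) \<le> \<bar>s\<bar> ^ 3 / 6 * (b * real p * (?B \<omega>)\<^sup>2)" for \<omega>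
    using Bb by (rule iexp_taylor2_scaled)
  have "cmod ((LINT \<omega>|M. iexp (s * ?B \<omega>)) - of_real (1 - s\<^sup>2 * V / 2)) = cmod (LINT \<omega>|M. iexp (s * ?B \<omega>) - ?T \<omega>)"
    using iE iT ET by (subst Bochner_Integration.integral_diff) auto
  also have "\<dots> \<le> (LINT \<omega>|M. \<bar>s\<bar> ^ 3 / 6 * (b * real p * (?B \<omega>)\<^sup>2))"
    by (intro order.trans[OF integral_norm_bound] integral_mono integrable_norm Bochner_Integration.integrable_diff iE iT pt)
      (use iB2 in auto)
  also have "\<dots> = \<bar>s\<bar> ^ 3 * (b * real p * V) / 6" unfolding V_def B by simp
  finally show ?thesis .
qed

text \<open>The observations in no block, those in the gaps and in the tail after the last period, number
  \<open>n - k * p\<close>; their sum is small in mean square, hence in mean.\<close>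

lemma blocks_remainder:
  assumes u[measurable]: "u \<in> borel_measurable borel" and ub: "\<And>x. \<bar>u x\<bar> \<le> b"
    and mean: "expectation (\<lambda>\<omega>. u (X 1 \<omega>)) = 0"
    and kr: "k * (p + q) \<le> n"
  shows "cmod ((LINT \<omega>|M. iexp (s * (\<Sum>i\<in>{1..n}. u (X i \<omega>))))
            - (LINT \<omega>|M. (\<Prod>j<k. iexp (s * block_sum u p (p + q) j (path \<omega>)))))
      \<le> \<bar>s\<bar> * sqrt (2 * real (n - k * p) * (\<Sum>k. autocov_majorant b k))"
proof -
  let ?r = "p + q"
  define Bl where "Bl j = {j * ?r + 1..j * ?r + p}" for j
  define R where "R = {1..n} - (\<Union>j<k. Bl j)"
  have sub: "(\<Union>j<k. Bl j) \<subseteq> {1..n}"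
  proof
    fix i assume "i \<in> (\<Union>j<k. Bl j)"
    then obtain j where "j < k" "i \<in> Bl j" by auto
    moreover from \<open>j < k\<close> have "Suc j * ?r \<le> k * ?r" by (intro mult_le_mono1) simp
    ultimately show "i \<in> {1..n}" using kr unfolding Bl_def by simp
  qed
  have disj: "Bl i \<inter> Bl j = {}" if "i \<noteq> j" for i j
  proof -
    have "Bl i \<inter> Bl j = {}" if "i < j" for i j
    proof -
      have "Suc i * ?r \<le> j * ?r" using that by (intro mult_le_mono1) simp
      then show ?thesis unfolding Bl_def by auto
    qed
    then show ?thesis using that by (metis inf_commute linorder_neqE_nat)
  qed
  have cardU: "card (\<Union>j<k. Bl j) = k * p"
    using disj by (subst card_UN_disjoint) (auto simp: Bl_def)
  have cardR: "card R = n - k * p"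
    unfolding R_def using card_Diff_subset[OF finite_subset[OF sub] sub] by (simp add: cardU)
  have RI: "finite R" "R \<subseteq> {1..}" unfolding R_def by auto
  let ?R = "\<lambda>\<omega>. \<Sum>i\<in>R. u (X i \<omega>)"
  have split: "(\<Sum>i\<in>{1..n}. u (X i \<omega>)) = (\<Sum>j<k. block_sum u p ?r j (path \<omega>)) + ?R \<omega>" for \<omega>
  proof -
    have "(\<Sum>i\<in>{1..n}. u (X i \<omega>)) = (\<Sum>i\<in>(\<Union>j<k. Bl j). u (X i \<omega>)) + ?R \<omega>"
      unfolding R_def using sub by (intro sum.subset_diff[of _ "{1..n}", THEN trans[OF _ add.commute]]) auto
    also have "(\<Sum>i\<in>(\<Union>j<k. Bl j). u (X i \<omega>)) = (\<Sum>j<k. \<Sum>i\<in>Bl j. u (X i \<omega>))"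
      using disj by (intro sum.UNION_disjoint) (auto simp: Bl_def)
    also have "\<dots> = (\<Sum>j<k. block_sum u p ?r j (path \<omega>))"
      unfolding block_sum_def Bl_def by (intro sum.cong) (auto simp: path_apply)
    finally show ?thesis .
  qed
  have Xm: "i \<in> {1..n} \<union> R \<Longrightarrow> X i \<in> borel_measurable M" for i by (auto intro!: X_measurable simp: R_def)
  have Rm[measurable]: "?R \<in> borel_measurable M" using Xm by measurable
  have Sm[measurable]: "(\<lambda>\<omega>. \<Sum>i\<in>{1..n}. u (X i \<omega>)) \<in> borel_measurable M" using Xm by measurable
  have b0: "b \<ge> 0" using ub[of 0] by auto
  have Rb: "\<bar>?R \<omega>\<bar> \<le> b * real (card R)" for \<omega>
  proof -
    have "\<bar>?R \<omega>\<bar> \<le> (\<Sum>i\<in>R. \<bar>u (X i \<omega>)\<bar>)" by (rule sum_abs)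
    also have "\<dots> \<le> (\<Sum>i\<in>R. b)" by (intro sum_mono ub)
    finally show ?thesis by (simp add: mult.commute)
  qed
  have iR: "integrable M ?R" using Rb by (intro integrable_const_bound[where B = "b * real (card R)"]) auto
  have R2b: "(?R \<omega>)\<^sup>2 \<le> (b * real (card R))\<^sup>2" for \<omega>
    using Rb[of \<omega>] by (rule abs_le_square_iff[THEN iffD1, OF order_trans[OF _ abs_ge_self]])
  have iR2: "integrable M (\<lambda>\<omega>. (?R \<omega>)\<^sup>2)"
    using R2b by (intro integrable_const_bound[where B = "(b * real (card R))\<^sup>2"]) auto
  have prod: "(\<Prod>j<k. iexp (s * block_sum u p ?r j (path \<omega>))) = iexp (s * (\<Sum>j<k. block_sum u p ?r j (path \<omega>)))" for \<omega>
    by (simp add: exp_sum[symmetric] sum_distrib_left)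
  have i1: "integrable M (\<lambda>\<omega>. iexp (s * (\<Sum>i\<in>{1..n}. u (X i \<omega>))))"
    by (rule integrable_iexp_real, rule borel_measurable_times[OF borel_measurable_const Sm])
  have i2: "integrable M (\<lambda>\<omega>. \<Prod>j<k. iexp (s * block_sum u p ?r j (path \<omega>)))"
    unfolding prod by (rule integrable_iexp_real) measurable
  have "cmod ((LINT \<omega>|M. iexp (s * (\<Sum>i\<in>{1..n}. u (X i \<omega>))))
            - (LINT \<omega>|M. (\<Prod>j<k. iexp (s * block_sum u p (p + q) j (path \<omega>)))))
     = cmod (LINT \<omega>|M. iexp (s * (\<Sum>i\<in>{1..n}. u (X i \<omega>))) - (\<Prod>j<k. iexp (s * block_sum u p (p + q) j (path \<omega>))))"
    by (subst Bochner_Integration.integral_diff[OF i1 i2]) (rule refl)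
  also have "\<dots> \<le> (LINT \<omega>|M. \<bar>s\<bar> * \<bar>?R \<omega>\<bar>)"
  proof (intro order.trans[OF integral_norm_bound] integral_mono)
    show "integrable M (\<lambda>\<omega>. cmod (iexp (s * (\<Sum>i\<in>{1..n}. u (X i \<omega>))) - (\<Prod>j<k. iexp (s * block_sum u p (p + q) j (path \<omega>)))))"
      by (intro integrable_norm Bochner_Integration.integrable_diff i1 i2)
    show "integrable M (\<lambda>\<omega>. \<bar>s\<bar> * \<bar>?R \<omega>\<bar>)" using iR by auto
    fix \<omega>
    show "cmod (iexp (s * (\<Sum>i\<in>{1..n}. u (X i \<omega>))) - (\<Prod>j<k. iexp (s * block_sum u p (p + q) j (path \<omega>)))) \<le> \<bar>s\<bar> * \<bar>?R \<omega>\<bar>"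
      unfolding prod by (rule order.trans[OF iexp_lipschitz]) (simp only: split right_diff_distrib[symmetric] add_diff_cancel_left' abs_mult order_refl)
  qed
  also have "\<dots> = \<bar>s\<bar> * expectation (\<lambda>\<omega>. \<bar>?R \<omega>\<bar>)" by simp
  also have "\<dots> \<le> \<bar>s\<bar> * sqrt (expectation (\<lambda>\<omega>. (?R \<omega>)\<^sup>2))"
    by (intro mult_left_mono expectation_abs_le_sqrt iR iR2) auto
  also have "\<dots> \<le> \<bar>s\<bar> * sqrt (2 * real (card R) * (\<Sum>k. autocov_majorant b k))"
    by (intro mult_left_mono real_sqrt_le_mono second_moment_sum_le[OF u ub RI _ summable_autocov_majorant]
        autocov_le_majorant[OF u ub mean]) auto
  finally show ?thesis unfolding cardR .
qed

end

context mixing_process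
begin

text \<open>The four summands are, in this order, the cost of dropping the gaps, of making the blocks
  independent, of expanding the characteristic function of a block, and of replacing
  \<open>(1 - x / k) ^ k\<close> by \<open>exp (- x)\<close>.\<close>

lemma block_clt_estimate:
  fixes t :: real
  assumes u[measurable]: "u \<in> borel_measurable borel" and ub: "\<And>x. \<bar>u x\<bar> \<le> b"
    and mean: "expectation (\<lambda>\<omega>. u (X 1 \<omega>)) = 0"
    and kr: "k * (p + q) \<le> n" and p: "p \<ge> 1" and k: "k \<ge> 1"
  defines "V \<equiv> expectation (\<lambda>\<omega>. (\<Sum>i\<in>{1..p}. u (X i \<omega>))\<^sup>2)"
  defines "x \<equiv> real k * (t\<^sup>2 * V / (2 * real n))"
  assumes y1: "t\<^sup>2 * V / (2 * real n) \<le> 1"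
  shows "cmod ((LINT \<omega>|M. iexp (t / sqrt (real n) * (\<Sum>i\<in>{1..n}. u (X i \<omega>)))) - of_real (exp (- x)))
    \<le> \<bar>t\<bar> * sqrt (2 * (\<Sum>k. autocov_majorant b k) * (real (n - k * p) / real n))
      + 16 * K * (real k / real (q + 1) ^ 8)
      + \<bar>t\<bar> ^ 3 * b / 6 * (real k * real p * V / (real n * sqrt (real n))) + x\<^sup>2 / real k"
proof -
  let ?s = "t / sqrt (real n)" let ?r = "p + q"
  have n: "real n > 0"
  proof -
    have "1 * 1 \<le> k * (p + q)" using p k by (intro mult_le_mono) auto
    then have "1 \<le> n" using kr by linarith
    then show ?thesis by simp
  qed
  define y where "y = t\<^sup>2 * V / (2 * real n)"
  have V0: "V \<ge> 0" unfolding V_def by simp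
  have y0: "0 \<le> y" using V0 n by (simp add: y_def)
  have b0: "b \<ge> 0" using ub[of 0] by auto
  have xy: "x = real k * y" by (simp add: x_def y_def)
  let ?\<phi> = "LINT \<omega>|M. iexp (?s * block_sum u p ?r 0 (path \<omega>))"
  have \<phi>1: "cmod ?\<phi> \<le> 1"
  proof -
    have "cmod ?\<phi> \<le> (LINT \<omega>|M. cmod (iexp (?s * block_sum u p ?r 0 (path \<omega>))))" by (rule integral_norm_bound)
    then show ?thesis by (simp add: prob_space)
  qed
  have s2: "?s\<^sup>2 = t\<^sup>2 / real n" using n by (simp add: power_divide)
  have s3: "\<bar>?s\<bar> ^ 3 = \<bar>t\<bar> ^ 3 / (real n * sqrt (real n))"
    using n by (simp add: power_divide power3_eq_cube)
  have c1: "cmod ((LINT \<omega>|M. iexp (?s * (\<Sum>i\<in>{1..n}. u (X i \<omega>))))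
            - (LINT \<omega>|M. (\<Prod>j<k. iexp (?s * block_sum u p ?r j (path \<omega>)))))
      \<le> \<bar>t\<bar> * sqrt (2 * (\<Sum>k. autocov_majorant b k) * (real (n - k * p) / real n))"
  proof (rule order.trans[OF blocks_remainder[OF u ub mean kr]])
    have "\<bar>?s\<bar> * sqrt (2 * real (n - k * p) * (\<Sum>k. autocov_majorant b k))
       = \<bar>t\<bar> * (sqrt (2 * real (n - k * p) * (\<Sum>k. autocov_majorant b k)) / sqrt (real n))"
      by (simp add: abs_divide)
    also have "sqrt (2 * real (n - k * p) * (\<Sum>k. autocov_majorant b k)) / sqrt (real n)
       = sqrt (2 * (\<Sum>k. autocov_majorant b k) * (real (n - k * p) / real n))"
      unfolding real_sqrt_divide[symmetric] by (simp add: mult_ac)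
    finally show "\<bar>?s\<bar> * sqrt (2 * real (n - k * p) * (\<Sum>k. autocov_majorant b k))
       \<le> \<bar>t\<bar> * sqrt (2 * (\<Sum>k. autocov_majorant b k) * (real (n - k * p) / real n))" by simp
  qed
  have c2: "cmod ((LINT \<omega>|M. (\<Prod>j<k. iexp (?s * block_sum u p ?r j (path \<omega>)))) - ?\<phi> ^ k)
      \<le> 16 * K * (real k / real (q + 1) ^ 8)"
    by (rule order.trans[OF char_blocks[OF u p]]) (simp add: mult_ac)
  have c3: "cmod (?\<phi> ^ k - of_real (1 - y) ^ k) \<le> \<bar>t\<bar> ^ 3 * b / 6 * (real k * real p * V / (real n * sqrt (real n)))"
  proof -
    have "cmod (?\<phi> ^ k - of_real (1 - y) ^ k) \<le> real k * cmod (?\<phi> - of_real (1 - y))"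
      using \<phi>1 y0 y1 by (intro norm_power_diff) (auto simp: y_def[symmetric] simp del: of_real_diff)
    also have "cmod (?\<phi> - of_real (1 - y)) \<le> \<bar>?s\<bar> ^ 3 * (b * real p * V) / 6"
    proof -
      have yy: "1 - y = 1 - ?s\<^sup>2 * V / 2" unfolding s2 by (simp add: y_def)
      show ?thesis unfolding yy unfolding V_def by (rule block_char_taylor[OF u ub mean])
    qed
    finally have "cmod (?\<phi> ^ k - of_real (1 - y) ^ k) \<le> real k * (\<bar>?s\<bar> ^ 3 * (b * real p * V) / 6)"
      by (simp add: mult_left_mono)
    also have "\<dots> = \<bar>t\<bar> ^ 3 * b / 6 * (real k * real p * V / (real n * sqrt (real n)))"
      unfolding s3 by (simp add: mult_ac)
    finally show ?thesis .
  qed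
  have c4: "cmod (of_real (1 - y) ^ k - of_real (exp (- x))) \<le> x\<^sup>2 / real k"
  proof -
    have "y = x / real k" using k by (simp add: xy)
    moreover have "0 \<le> x" "x \<le> real k" using y0 y1 by (auto simp: xy y_def[symmetric] mult_left_le)
    ultimately have "\<bar>(1 - y) ^ k - exp (- x)\<bar> \<le> x\<^sup>2 / real k"
      using exp_one_minus_power_bound[OF _ _ k] by simp
    moreover have "of_real (1 - y) ^ k - of_real (exp (- x)) = (of_real ((1 - y) ^ k - exp (- x)) :: complex)"
      by simp
    ultimately show ?thesis by (metis norm_of_real)
  qed
  show ?thesis
    using norm_triangle_le_diff norm_diff_triangle_le[OF norm_diff_triangle_le[OF norm_diff_triangle_le[OF c1 c2] c3] c4]
    by linarith
qed

text \<open>With \<open>Q\<close> the integer part of \<open>root 6 n\<close>, blocks of length \<open>Q\<^sup>2\<close> and gaps of length \<open>Q\<close>, there are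
  about \<open>Q\<^sup>4\<close> blocks, and every error of \<open>block_clt_estimate\<close> is at most of order \<open>1 / Q\<close>.\<close>

lemma block_length_bounds:
  fixes n Q :: nat
  assumes Q: "Q \<ge> 2" and lo: "Q ^ 6 \<le> n" and hi: "n < (Q + 1) ^ 6"
  defines "k \<equiv> n div (Q\<^sup>2 + Q)"
  shows "k * (Q\<^sup>2 + Q) \<le> n" "real Q \<le> real k"
    "real (n - k * Q\<^sup>2) / real n \<le> 3 / real Q"
    "real k / real (Q + 1) ^ 8 \<le> 1 / real Q"
    "real (Q\<^sup>2) / sqrt (real n) \<le> 1 / real Q"
    "real (Q\<^sup>2) / real n \<le> 1 / real Q"
proof -
  define r where "r = Q\<^sup>2 + Q"
  have r: "r > 0" using Q by (simp add: r_def)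
  show kr: "k * (Q\<^sup>2 + Q) \<le> n" by (simp add: k_def)
  have kr1: "n < k * r + r"
    using dividend_less_div_times[OF r, of n] unfolding k_def r_def by linarith
  have QR: "real Q \<ge> 2" "real Q > 0" using Q by auto
  have lo': "real Q ^ 6 \<le> real n" using lo by (metis of_nat_le_iff of_nat_power)
  have n0: "real n > 0" using lo' QR by (smt (verit) zero_less_power)
  have hi': "real n \<le> (real Q + 1) ^ 6" using hi by (metis less_imp_le of_nat_1 of_nat_add of_nat_le_iff of_nat_power)
  have rr: "real r = real Q ^ 2 + real Q" by (simp add: r_def)
  have Q2: "real Q \<le> real Q ^ 2" using QR by (simp add: power2_eq_square)
  have kn: "real k * (real Q ^ 2) \<le> real n"
  proof -
    have "k * Q\<^sup>2 \<le> n" using kr by (simp add: algebra_simps)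
    then show ?thesis by (metis of_nat_le_iff of_nat_mult of_nat_power)
  qed
  show "real Q \<le> real k"
  proof (rule ccontr)
    assume "\<not> real Q \<le> real k"
    then have "k + 1 \<le> Q" by simp
    then have "(k + 1) * r \<le> Q * r" by (rule mult_le_mono1)
    then have "n < Q * r" using kr1 by simp
    also have "Q * r \<le> Q * (2 * Q\<^sup>2)" unfolding r_def using Q by (intro mult_left_mono) (auto simp: power2_eq_square)
    also have "\<dots> \<le> Q * (Q * Q\<^sup>2)" using Q by (intro mult_left_mono mult_right_mono) auto
    also have "\<dots> = Q ^ 4" by (simp add: eval_nat_numeral)
    also have "\<dots> \<le> Q ^ 6" using Q by (intro power_increasing) auto
    finally show False using lo by simp
  qed
  show b: "real (Q\<^sup>2) / real n \<le> 1 / real Q"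
  proof -
    have "real Q ^ 2 * real Q = real Q ^ 3" by (simp add: eval_nat_numeral)
    also have "\<dots> \<le> real Q ^ 6" using QR by (intro power_increasing) auto
    finally have "real Q ^ 2 * real Q \<le> real n" using lo' by linarith
    then show ?thesis using n0 QR by (simp add: field_simps)
  qed
  show "real (n - k * Q\<^sup>2) / real n \<le> 3 / real Q"
  proof -
    have "n - k * Q\<^sup>2 \<le> r + k * Q" using kr1 unfolding r_def by (simp add: algebra_simps)
    then have "real (n - k * Q\<^sup>2) \<le> real r + real k * real Q" by (metis of_nat_add of_nat_le_iff of_nat_mult)
    also have "\<dots> \<le> 2 * real Q ^ 2 + real k * real Q" using Q2 by (simp add: rr)
    finally have "real (n - k * Q\<^sup>2) / real n \<le> (2 * real Q ^ 2 + real k * real Q) / real n"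
      using n0 by (intro divide_right_mono) auto
    also have "\<dots> = 2 * (real (Q\<^sup>2) / real n) + real k * real Q / real n" by (simp add: add_divide_distrib)
    also have "real k * real Q / real n \<le> 1 / real Q"
      using kn n0 QR by (simp add: field_simps power2_eq_square)
    finally show ?thesis using b by simp
  qed
  show "real k / real (Q + 1) ^ 8 \<le> 1 / real Q"
  proof -
    have "real k * real Q \<le> real k * real Q ^ 2" using Q2 by (intro mult_left_mono) auto
    also have "\<dots> \<le> (real Q + 1) ^ 6" using kn hi' by linarith
    also have "\<dots> \<le> (real Q + 1) ^ 8" using QR by (intro power_increasing) auto
    finally have "real k * real Q \<le> real (Q + 1) ^ 8" by (simp add: add.commute)
    then show ?thesis using QR by (simp add: field_simps)
  qed
  show "real (Q\<^sup>2) / sqrt (real n) \<le> 1 / real Q"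
  proof -
    have "real Q ^ 3 \<le> sqrt (real n)" using lo' by (intro real_le_rsqrt) (simp add: power_mult[symmetric])
    then show ?thesis using n0 QR by (simp add: field_simps eval_nat_numeral)
  qed
qed

lemma exists_sixth_root_floor: "\<exists>Q :: nat \<Rightarrow> nat. (\<forall>n. Q n ^ 6 \<le> n \<and> n < (Q n + 1) ^ 6) \<and> filterlim (\<lambda>n. real (Q n)) at_top sequentially"
proof -
  define Q where "Q n = nat \<lfloor>root 6 (real n)\<rfloor>" for n :: nat
  have Qle: "real (Q n) \<le> root 6 (real n)" and Qgt: "root 6 (real n) < real (Q n) + 1" for n
    unfolding Q_def by (auto simp: of_nat_nat)
  have "Q n ^ 6 \<le> n" for n
  proof -
    have "real (Q n) ^ 6 \<le> root 6 (real n) ^ 6" using Qle by (intro power_mono) auto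
    also have "\<dots> = real n" by simp
    finally show ?thesis by (metis of_nat_le_iff of_nat_power)
  qed
  moreover have "n < (Q n + 1) ^ 6" for n
  proof -
    have "real n = root 6 (real n) ^ 6" by simp
    also have "\<dots> < (real (Q n) + 1) ^ 6" using Qgt by (intro power_strict_mono) auto
    finally show ?thesis by (metis of_nat_1 of_nat_add of_nat_less_iff of_nat_power)
  qed
  moreover have "filterlim (\<lambda>n. real (Q n)) at_top sequentially"
  proof (rule filterlim_at_top_mono)
    show "filterlim (\<lambda>n. root 6 (real n) - 1) at_top sequentially" by real_asymp
    show "eventually (\<lambda>n. root 6 (real n) - 1 \<le> real (Q n)) sequentially"
      using Qgt by (intro always_eventually allI) (smt (verit))
  qed
  ultimately show ?thesis by blast
qed

text \<open>With these block lengths all errors of \<open>block_clt_estimate\<close> vanish, and its exponent converges by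
  \<open>block_variance_limit\<close>.\<close>

theorem clt_char:
  assumes u[measurable]: "u \<in> borel_measurable borel" and ub: "\<And>x. \<bar>u x\<bar> \<le> b"
    and mean: "expectation (\<lambda>\<omega>. u (X 1 \<omega>)) = 0"
  shows "(\<lambda>n. LINT \<omega>|M. iexp (t / sqrt (real n) * (\<Sum>i\<in>{1..n}. u (X i \<omega>))))
     \<longlonglongrightarrow> of_real (exp (- (t\<^sup>2 * longrun u / 2)))"
proof -
  obtain Q :: "nat \<Rightarrow> nat" where lo: "\<And>n. Q n ^ 6 \<le> n" and hi: "\<And>n. n < (Q n + 1) ^ 6"
    and Qinf: "filterlim (\<lambda>n. real (Q n)) at_top sequentially" using exists_sixth_root_floor by blast
  define p where "p n = (Q n)\<^sup>2" for n
  define k where "k n = n div ((Q n)\<^sup>2 + Q n)" for n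
  define V where "V m = expectation (\<lambda>\<omega>. (\<Sum>i\<in>{1..m}. u (X i \<omega>))\<^sup>2)" for m :: nat
  define C where "C = (\<Sum>k. autocov_majorant b k)"
  define x where "x n = real (k n) * (t\<^sup>2 * V (p n) / (2 * real n))" for n
  have b0: "b \<ge> 0" using ub[of 0] by auto
  have V0: "V m \<ge> 0" for m unfolding V_def by simp
  have VC: "V m \<le> 2 * C * real m" for m
    using second_moment_sum_le[OF u ub, of "{1..m}" "autocov_majorant b"] autocov_le_majorant[OF u ub mean] summable_autocov_majorant
    unfolding V_def C_def by (auto simp: mult_ac)
  have C0: "C \<ge> 0" using VC[of 1] V0[of 1] by simp
  have ev2: "eventually (\<lambda>n. Q n \<ge> 2) sequentially"
    using Qinf[unfolded filterlim_at_top, rule_format, of 2] by eventually_elim simp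
  have inv: "(\<lambda>n. c / real (Q n)) \<longlonglongrightarrow> 0" for c
    by (rule real_tendsto_divide_at_top[OF tendsto_const Qinf])
  have evy: "eventually (\<lambda>n. t\<^sup>2 * V (p n) / (2 * real n) \<le> 1) sequentially"
  proof -
    have "eventually (\<lambda>n. t\<^sup>2 * C / real (Q n) < 1) sequentially"
      by (rule order_tendstoD(2)[OF inv]) simp
    with ev2 show ?thesis
    proof eventually_elim
      case (elim n)
      have "t\<^sup>2 * V (p n) / (2 * real n) \<le> t\<^sup>2 * (2 * C * real (p n)) / (2 * real n)"
        by (intro divide_right_mono mult_left_mono VC) auto
      also have "\<dots> = t\<^sup>2 * C * (real ((Q n)\<^sup>2) / real n)" by (simp add: p_def)
      also have "\<dots> \<le> t\<^sup>2 * C * (1 / real (Q n))"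
        using C0 by (intro mult_left_mono block_length_bounds(6)[OF elim(1) lo hi]) auto
      finally have "t\<^sup>2 * V (p n) / (2 * real n) \<le> t\<^sup>2 * C / real (Q n)" by simp
      then show ?case using elim(2) by linarith
    qed
  qed
  have kp: "(\<lambda>n. real (n - k n * p n) / real n) \<longlonglongrightarrow> 0"
  proof (rule tendsto_sandwich[OF _ _ tendsto_const inv])
    show "eventually (\<lambda>n. real (n - k n * p n) / real n \<le> 3 / real (Q n)) sequentially"
      using ev2 unfolding k_def p_def by eventually_elim (rule block_length_bounds(3)[OF _ lo hi])
  qed simp
  have x_lim: "x \<longlonglongrightarrow> t\<^sup>2 * longrun u / 2"
  proof -
    have pinf: "filterlim p at_top sequentially"
    proof -
      have "filterlim (\<lambda>n. real (Q n) * real (Q n)) at_top sequentially"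
        by (rule filterlim_at_top_mult_at_top[OF Qinf Qinf])
      then have "filterlim (\<lambda>n. real (p n)) at_top sequentially" by (simp add: p_def power2_eq_square)
      then show ?thesis by (simp add: filterlim_sequentially_iff_filterlim_real)
    qed
    have Vp: "(\<lambda>n. V (p n) / real (p n)) \<longlonglongrightarrow> longrun u"
      using filterlim_compose[OF block_variance_limit[OF u ub mean] pinf] by (simp add: V_def)
    have "(\<lambda>n. 1 - real (n - k n * p n) / real n) \<longlonglongrightarrow> 1 - 0" by (intro tendsto_intros kp)
    moreover have "eventually (\<lambda>n. 1 - real (n - k n * p n) / real n = real (k n * p n) / real n) sequentially"
      using ev2
    proof eventually_elim
      case (elim n)
      have "k n * p n \<le> n" using block_length_bounds(1)[OF elim lo hi] by (simp add: k_def p_def algebra_simps)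
      moreover have "n > 0" using lo[of n] elim by (metis gr0I le_0_eq not_numeral_le_zero power_not_zero)
      ultimately show ?case by (simp add: of_nat_diff field_simps)
    qed
    ultimately have kp1: "(\<lambda>n. real (k n * p n) / real n) \<longlonglongrightarrow> 1"
      using Lim_transform_eventually by fastforce
    have "(\<lambda>n. t\<^sup>2 / 2 * (real (k n * p n) / real n) * (V (p n) / real (p n))) \<longlonglongrightarrow> t\<^sup>2 / 2 * 1 * longrun u"
      by (intro tendsto_intros kp1 Vp)
    moreover have "eventually (\<lambda>n. t\<^sup>2 / 2 * (real (k n * p n) / real n) * (V (p n) / real (p n)) = x n) sequentially"
      using ev2 by eventually_elim (simp add: x_def p_def)
    ultimately show ?thesis using Lim_transform_eventually by fastforce
  qed
  define err where "err n = \<bar>t\<bar> * sqrt (2 * C * (real (n - k n * p n) / real n))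
      + 16 * K * (1 / real (Q n)) + \<bar>t\<bar> ^ 3 * b / 6 * (2 * C / real (Q n)) + (x n)\<^sup>2 / real (Q n)" for n
  have "(\<lambda>n. \<bar>t\<bar> * sqrt (2 * C * (real (n - k n * p n) / real n))
      + 16 * K * (1 / real (Q n)) + \<bar>t\<bar> ^ 3 * b / 6 * (2 * C / real (Q n)) + (x n)\<^sup>2 / real (Q n))
      \<longlonglongrightarrow> \<bar>t\<bar> * sqrt (2 * C * 0) + 16 * K * 0 + \<bar>t\<bar> ^ 3 * b / 6 * 0 + 0"
    by (intro tendsto_intros kp inv real_tendsto_divide_at_top[OF tendsto_power[OF x_lim] Qinf])
  then have err0: "err \<longlonglongrightarrow> 0" unfolding err_def by simp
  have bound: "eventually (\<lambda>n. norm ((LINT \<omega>|M. iexp (t / sqrt (real n) * (\<Sum>i\<in>{1..n}. u (X i \<omega>)))) - of_real (exp (- x n))) \<le> err n) sequentially"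
    using ev2 evy
  proof eventually_elim
    case (elim n)
    note B = block_length_bounds[OF elim(1) lo hi, folded k_def p_def]
    have n0: "n > 0" using lo[of n] elim(1) by (metis gr0I le_0_eq not_numeral_le_zero power_not_zero)
    have p1: "p n \<ge> 1" using elim(1) by (simp add: p_def)
    have k1: "k n \<ge> 1" using B(2) elim(1) by simp
    have kpn: "real (k n * p n) / real n \<le> 1"
    proof -
      have "k n * p n \<le> n" using B(1) by (simp add: algebra_simps)
      then show ?thesis using n0 by (simp add: divide_le_eq del: of_nat_mult)
    qed
    have "real (k n) * real (p n) * V (p n) / (real n * sqrt (real n)) = (real (k n * p n) / real n) * (V (p n) / sqrt (real n))"
      by simp
    also have "\<dots> \<le> 1 * (2 * C * real (p n) / sqrt (real n))"
      using kpn n0 VC V0 by (intro mult_mono divide_right_mono) auto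
    also have "\<dots> = 2 * C * (real (p n) / sqrt (real n))" by simp
    also have "\<dots> \<le> 2 * C * (1 / real (Q n))" using C0 B(5) by (intro mult_left_mono) auto
    finally have e3: "real (k n) * real (p n) * V (p n) / (real n * sqrt (real n)) \<le> 2 * C / real (Q n)" by simp
    have e4: "(x n)\<^sup>2 / real (k n) \<le> (x n)\<^sup>2 / real (Q n)"
      using B(2) elim(1) by (intro divide_left_mono mult_pos_pos) auto
    have "norm ((LINT \<omega>|M. iexp (t / sqrt (real n) * (\<Sum>i\<in>{1..n}. u (X i \<omega>)))) - of_real (exp (- x n)))
      \<le> \<bar>t\<bar> * sqrt (2 * C * (real (n - k n * p n) / real n))
      + 16 * K * (real (k n) / real (Q n + 1) ^ 8)
      + \<bar>t\<bar> ^ 3 * b / 6 * (real (k n) * real (p n) * V (p n) / (real n * sqrt (real n))) + (x n)\<^sup>2 / real (k n)"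
      unfolding x_def V_def C_def
      by (rule block_clt_estimate[OF u ub mean B(1) p1 k1 elim(2)[unfolded V_def]])
    also have "\<dots> \<le> err n"
      unfolding err_def using e3 e4 B(4) b0 K_nonneg
      by (intro add_mono mult_left_mono order_refl) auto
    finally show ?case .
  qed
  have "(\<lambda>n. (LINT \<omega>|M. iexp (t / sqrt (real n) * (\<Sum>i\<in>{1..n}. u (X i \<omega>)))) - of_real (exp (- x n))) \<longlonglongrightarrow> 0"
    by (rule Lim_null_comparison[OF bound err0])
  moreover have "(\<lambda>n. of_real (exp (- x n)) :: complex) \<longlonglongrightarrow> of_real (exp (- (t\<^sup>2 * longrun u / 2)))"
    by (intro tendsto_intros x_lim)
  ultimately show ?thesis using tendsto_add by fastforce
qed

end

section \<open>Decoupling single observations\<close>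

text \<open>Rounding down to a multiple of \<open>\<eta>\<close> inside \<open>{-N..N}\<close>; everything outside goes to 0.\<close>

lemma finite_discretization:
  fixes \<eta> N :: real
  assumes "\<eta> > 0" "N > 0"
  obtains D :: "real \<Rightarrow> real" and V where "D \<in> borel_measurable borel" "finite V" "\<And>c. D c \<in> V"
    "real (card V) \<le> 2 * N / \<eta> + 3" "\<And>c. \<bar>c\<bar> \<le> N \<Longrightarrow> \<bar>c - D c\<bar> \<le> \<eta>"
proof
  let ?D = "\<lambda>c. if \<bar>c\<bar> \<le> N then \<eta> * real_of_int \<lfloor>c / \<eta>\<rfloor> else 0"
  let ?I = "{\<lfloor>- N / \<eta>\<rfloor>..\<lfloor>N / \<eta>\<rfloor>}"
  let ?V = "insert 0 ((\<lambda>j. \<eta> * real_of_int j) ` ?I)"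
  show "?D \<in> borel_measurable borel" by measurable
  show "finite ?V" by simp
  show "?D c \<in> ?V" for c
  proof (cases "\<bar>c\<bar> \<le> N")
    case True
    then have "- N \<le> c" "c \<le> N" by auto
    then have "- N / \<eta> \<le> c / \<eta>" "c / \<eta> \<le> N / \<eta>" using assms by (intro divide_right_mono; simp)+
    then have "\<lfloor>c / \<eta>\<rfloor> \<in> ?I" by (auto intro: floor_mono)
    then show ?thesis using True by auto
  qed simp
  have "card (insert 0 A) \<le> Suc (card A)" if "finite A" for A :: "real set"
    using that by (simp add: card_insert_if)
  moreover have "card ((\<lambda>j. \<eta> * real_of_int j) ` ?I) \<le> card ?I" by (rule card_image_le) simp
  ultimately have "card ?V \<le> Suc (card ?I)" by (meson Suc_le_mono finite_atLeastAtMost_int finite_imageI order.trans)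
  then have "real (card ?V) \<le> 1 + real (card ?I)" by linarith
  also have "real (card ?I) \<le> real_of_int \<lfloor>N / \<eta>\<rfloor> - real_of_int \<lfloor>- N / \<eta>\<rfloor> + 1"
  proof -
    have "\<lfloor>- N / \<eta>\<rfloor> \<le> \<lfloor>N / \<eta>\<rfloor>" using assms by (intro floor_mono divide_right_mono) auto
    then show ?thesis by simp
  qed
  also have "\<dots> \<le> 2 * N / \<eta> + 2"
  proof -
    have "real_of_int \<lfloor>N / \<eta>\<rfloor> \<le> N / \<eta>" "- N / \<eta> < real_of_int \<lfloor>- N / \<eta>\<rfloor> + 1" "2 * N / \<eta> = 2 * (N / \<eta>)" "- N / \<eta> = - (N / \<eta>)"
      by linarith+
    then show ?thesis by linarith
  qed
  finally show "real (card ?V) \<le> 2 * N / \<eta> + 3" by simp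
  show "\<bar>c - ?D c\<bar> \<le> \<eta>" if "\<bar>c\<bar> \<le> N" for c
  proof -
    have "real_of_int \<lfloor>c / \<eta>\<rfloor> \<le> c / \<eta>" "c / \<eta> < real_of_int \<lfloor>c / \<eta>\<rfloor> + 1" by linarith+
    then have "\<eta> * real_of_int \<lfloor>c / \<eta>\<rfloor> \<le> \<eta> * (c / \<eta>)" "\<eta> * (c / \<eta>) < \<eta> * (real_of_int \<lfloor>c / \<eta>\<rfloor> + 1)"
      using assms by (intro mult_left_mono mult_strict_left_mono; simp)+
    then have "\<eta> * real_of_int \<lfloor>c / \<eta>\<rfloor> \<le> c" "c < \<eta> * real_of_int \<lfloor>c / \<eta>\<rfloor> + \<eta>"
      using assms by (simp_all add: distrib_left)
    then show ?thesis using that by auto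
  qed
qed

context mixing_process
begin

definition marginal :: "real measure" where
  "marginal = distr M borel (X 1)"

lemma prob_space_marginal: "prob_space marginal"
  unfolding marginal_def by (rule prob_space_distr) simp

lemma sets_marginal[measurable_cong, simp]: "sets marginal = sets borel"
  and space_marginal[simp]: "space marginal = UNIV"
  unfolding marginal_def by auto

definition iid_paths :: "(nat \<Rightarrow> real) measure" where
  "iid_paths = PiM UNIV (\<lambda>_. marginal)"

lemma prob_space_iid_paths: "prob_space iid_paths"
  unfolding iid_paths_def by (intro prob_space_PiM prob_space_marginal)

lemma sets_iid_paths[measurable_cong]: "sets iid_paths = sets path_space"
  unfolding iid_paths_def by (intro sets_PiM_cong) auto

lemma space_iid_paths[simp]: "space iid_paths = UNIV"
  unfolding iid_paths_def by (simp add: space_PiM)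

lemma measure_iid_paths_UNIV[simp]: "measure iid_paths UNIV = 1"
  and measure_marginal_UNIV[simp]: "measure marginal UNIV = 1"
  using prob_space.prob_space[OF prob_space_iid_paths] prob_space.prob_space[OF prob_space_marginal] by auto

text \<open>Under the i.i.d. law, this is a version of the conditional expectation of \<open>F\<close> given the
  coordinates outside \<open>S\<close>; being defined for every path, it can also be evaluated along the
  dependent process.\<close>

definition integrate_out :: "nat set \<Rightarrow> ((nat \<Rightarrow> real) \<Rightarrow> real) \<Rightarrow> (nat \<Rightarrow> real) \<Rightarrow> real" where
  "integrate_out S F x = (LINT z|iid_paths. F (override_on x z S))"

lemma measurable_override_on[measurable]:
  "(\<lambda>(x, z). override_on x z S) \<in> path_space \<Otimes>\<^sub>M path_space \<rightarrow>\<^sub>M path_space"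
proof (rule measurable_PiM_single')
  fix s show "(\<lambda>w. (case w of (x, z) \<Rightarrow> override_on x z S) s) \<in> borel_measurable (path_space \<Otimes>\<^sub>M path_space)"
    by (cases "s \<in> S") (auto simp: override_on_def split_beta)
qed auto

lemma measurable_override_on2[measurable]:
  assumes [measurable]: "f \<in> L \<rightarrow>\<^sub>M path_space" "g \<in> L \<rightarrow>\<^sub>M path_space"
  shows "(\<lambda>w. override_on (f w) (g w) S) \<in> L \<rightarrow>\<^sub>M path_space"
  using measurable_compose[OF measurable_Pair[OF assms] measurable_override_on[of S]] by simp

lemma measurable_override_on_const[measurable]: "(\<lambda>z. override_on x z S) \<in> path_space \<rightarrow>\<^sub>M path_space"
  by (intro measurable_override_on2 measurable_const measurable_ident_sets) (auto simp: space_PiM)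

lemma measurable_integrate_out[measurable]:
  assumes [measurable]: "F \<in> borel_measurable path_space"
  shows "integrate_out S F \<in> borel_measurable path_space"
proof -
  interpret I: prob_space iid_paths by (rule prob_space_iid_paths)
  show ?thesis unfolding integrate_out_def by measurable
qed

lemma integrable_iid_bounded:
  assumes [measurable]: "F \<in> borel_measurable path_space" and "\<And>x. \<bar>F x\<bar> \<le> (B :: real)"
  shows "integrable iid_paths F"
proof -
  interpret I: prob_space iid_paths by (rule prob_space_iid_paths)
  show ?thesis by (rule I.integrable_const_bound[where B = B]) (auto simp: assms)
qed

lemma integrable_override_on:
  assumes [measurable]: "F \<in> borel_measurable path_space" and "\<And>x. \<bar>F x\<bar> \<le> (B :: real)"
  shows "integrable iid_paths (\<lambda>z. F (override_on x z S))"
  by (rule integrable_iid_bounded[where B = B]) (auto simp: assms)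

lemma integrate_out_empty[simp]: "integrate_out {} F = F"
  by (simp add: integrate_out_def fun_eq_iff)

lemma integrate_out_bounded:
  assumes [measurable]: "F \<in> borel_measurable path_space" and B: "\<And>x. \<bar>F x\<bar> \<le> (B :: real)"
  shows "\<bar>integrate_out S F x\<bar> \<le> B"
proof -
  interpret I: prob_space iid_paths by (rule prob_space_iid_paths)
  have "\<bar>integrate_out S F x\<bar> \<le> (LINT z|iid_paths. \<bar>F (override_on x z S)\<bar>)"
    unfolding integrate_out_def by (rule integral_abs_bound)
  also have "\<dots> \<le> (LINT z|iid_paths. B)"
    by (intro integral_mono integrable_abs integrable_override_on[OF assms] B) auto
  finally show ?thesis by (simp)
qed

lemma depends_on_integrate_out:
  assumes "depends_on F T"
  shows "depends_on (integrate_out S F) (T - S)"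
  unfolding depends_on_def integrate_out_def
  by (auto intro!: Bochner_Integration.integral_cong depends_onD[OF assms] simp: override_on_def)

text \<open>The product law is invariant under drawing one coordinate afresh; this reduces averaging over several
  coordinates to averaging over one at a time.\<close>

lemma resample_coordinate:
  assumes [measurable]: "F \<in> borel_measurable path_space" and B: "\<And>x. \<bar>F x\<bar> \<le> (B :: real)"
  shows "(LINT z|iid_paths. F z) = (LINT z|iid_paths. LINT c|marginal. F (z(s := c)))"
proof -
  interpret I: prob_space iid_paths by (rule prob_space_iid_paths)
  interpret m: prob_space marginal by (rule prob_space_marginal)
  interpret mI: pair_prob_space marginal iid_paths ..
  have Fm: "F \<in> borel_measurable iid_paths" by measurable
  have eq: "distr (marginal \<Otimes>\<^sub>M iid_paths) iid_paths (\<lambda>(c, z). z(s := c)) = iid_paths"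
    using distr_pair_PiM_eq_PiM[of UNIV "\<lambda>_. marginal" s] prob_space_marginal
    by (simp add: iid_paths_def)
  have upd[measurable]: "(\<lambda>(c, z). z(s := c)) \<in> marginal \<Otimes>\<^sub>M iid_paths \<rightarrow>\<^sub>M iid_paths"
  proof -
    have "(\<lambda>w. (snd w)(s := fst w)) \<in> marginal \<Otimes>\<^sub>M iid_paths \<rightarrow>\<^sub>M path_space"
    proof (rule measurable_PiM_single')
      fix i show "(\<lambda>w. ((snd w)(s := fst w)) i) \<in> borel_measurable (marginal \<Otimes>\<^sub>M iid_paths)"
        by (cases "i = s") auto
    qed auto
    then show ?thesis by (simp add: split_beta measurable_cong_sets[OF refl sets_iid_paths])
  qed
  have "(LINT z|iid_paths. F z) = (\<integral>z. F z \<partial>(distr (marginal \<Otimes>\<^sub>M iid_paths) iid_paths (\<lambda>(c, z). z(s := c))))"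
    by (simp add: eq)
  also have "\<dots> = (\<integral>w. F (case w of (c, z) \<Rightarrow> z(s := c)) \<partial>(marginal \<Otimes>\<^sub>M iid_paths))"
    by (rule integral_distr[OF upd Fm])
  also have "\<dots> = (\<integral>w. (case w of (c, z) \<Rightarrow> F (z(s := c))) \<partial>(marginal \<Otimes>\<^sub>M iid_paths))"
    by (simp add: split_beta)
  also have "\<dots> = (LINT z|iid_paths. LINT c|marginal. F (z(s := c)))"
  proof (rule mI.integral_snd[symmetric])
    have "integrable (marginal \<Otimes>\<^sub>M iid_paths) (\<lambda>w. F (case w of (c, z) \<Rightarrow> z(s := c)))"
      by (rule mI.P.integrable_const_bound[OF _ measurable_compose[OF upd Fm], where B = B]) (auto simp: B)
    then show "integrable (marginal \<Otimes>\<^sub>M iid_paths) (\<lambda>(c, z). F (z(s := c)))" unfolding case_prod_unfold .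
  qed
  finally show ?thesis .
qed

lemma integrate_out_single:
  assumes F[measurable]: "F \<in> borel_measurable path_space" and B: "\<And>x. \<bar>F x\<bar> \<le> (B :: real)"
  shows "integrate_out {s} F x = (LINT c|marginal. F (x(s := c)))"
proof -
  interpret I: prob_space iid_paths by (rule prob_space_iid_paths)
  have "integrate_out {s} F x = (LINT z|iid_paths. LINT c|marginal. F (override_on x (z(s := c)) {s}))"
    unfolding integrate_out_def by (rule resample_coordinate[where B = B]) (auto simp: B)
  also have "(\<lambda>z c. F (override_on x (z(s := c)) {s})) = (\<lambda>z c. F (x(s := c)))"
    by (intro ext arg_cong[where f = F]) (auto simp: override_on_def)
  finally show ?thesis by (simp)
qed

lemma integrate_out_insert:
  assumes F[measurable]: "F \<in> borel_measurable path_space" and B: "\<And>x. \<bar>F x\<bar> \<le> (B :: real)" and "s \<notin> S"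
  shows "integrate_out S (integrate_out {s} F) = integrate_out (insert s S) F"
proof
  fix x
  have "integrate_out (insert s S) F x = (LINT z|iid_paths. LINT c|marginal. F (override_on x (z(s := c)) (insert s S)))"
    unfolding integrate_out_def by (rule resample_coordinate[where B = B]) (auto simp: B)
  also have "(\<lambda>z c. F (override_on x (z(s := c)) (insert s S))) = (\<lambda>z c. F ((override_on x z S)(s := c)))"
    using \<open>s \<notin> S\<close> by (intro ext arg_cong[where f = F]) (auto simp: override_on_def)
  finally show "integrate_out S (integrate_out {s} F) x = integrate_out (insert s S) F x"
    unfolding integrate_out_single[OF F B] by (simp add: integrate_out_def)
qed

lemma integrate_out_union:
  assumes "finite T" "S \<inter> T = {}"
    and "F \<in> borel_measurable path_space" "\<And>x. \<bar>F x\<bar> \<le> (B :: real)"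
  shows "integrate_out S (integrate_out T F) = integrate_out (S \<union> T) F"
  using assms
proof (induction T arbitrary: F rule: finite_induct)
  case empty
  then show ?case by simp
next
  case (insert t T)
  have "integrate_out S (integrate_out (insert t T) F) = integrate_out S (integrate_out T (integrate_out {t} F))"
    using insert by (subst integrate_out_insert[symmetric, where B = B]) auto
  also have "\<dots> = integrate_out (S \<union> T) (integrate_out {t} F)"
    using insert by (intro insert.IH) (auto intro!: integrate_out_bounded)
  also have "\<dots> = integrate_out (insert t (S \<union> T)) F"
    using insert by (intro integrate_out_insert[where B = B]) auto
  finally show ?case by simp
qed

lemma integrate_out_mult:
  assumes "depends_on G T" "T \<inter> S = {}"
  shows "integrate_out S (\<lambda>x. F x * G x) x = integrate_out S F x * G x"
proof -
  have "G (override_on x z S) = G x" for z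
    using assms(2) by (intro depends_onD[OF assms(1)]) (auto simp: override_on_def)
  then show ?thesis by (simp add: integrate_out_def)
qed

definition tail_prob :: "real \<Rightarrow> real" where
  "tail_prob N = prob {\<omega> \<in> space M. N < \<bar>X 1 \<omega>\<bar>}"

lemma tail_prob_eq: "tail_prob N = expectation (\<lambda>\<omega>. of_bool (N < \<bar>X 1 \<omega>\<bar>))"
proof -
  have "expectation (\<lambda>\<omega>. of_bool (N < \<bar>X 1 \<omega>\<bar>)) = expectation (indicat_real {\<omega>\<in>space M. N < \<bar>X 1 \<omega>\<bar>})"
    by (intro Bochner_Integration.integral_cong) (auto simp: indicator_def)
  then show ?thesis unfolding tail_prob_def by simp
qed

definition lipschitz_at :: "nat \<Rightarrow> real \<Rightarrow> ((nat \<Rightarrow> real) \<Rightarrow> real) \<Rightarrow> bool" where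
  "lipschitz_at s \<Lambda> F \<longleftrightarrow> (\<forall>x c c'. \<bar>F (x(s := c)) - F (x(s := c'))\<bar> \<le> \<Lambda> * \<bar>c - c'\<bar>)"

text \<open>The three summands come from rounding at mesh \<open>\<eta>\<close>, from truncation at \<open>N\<close>, each of them for the
  dependent and for the independent coordinate, and from one covariance inequality for each of the
  at most \<open>2 * N / \<eta> + 3\<close> cells.\<close>

definition decoupling_error :: "real \<Rightarrow> real \<Rightarrow> nat \<Rightarrow> real \<Rightarrow> real \<Rightarrow> real" where
  "decoupling_error B \<Lambda> l \<eta> N = 2 * \<Lambda> * \<eta> + 4 * B * tail_prob N + (2 * N / \<eta> + 3) * (4 * B * mixing_coeff M X l)"

lemma measurable_fun_upd[measurable]:
  assumes [measurable]: "f \<in> L \<rightarrow>\<^sub>M path_space" "g \<in> borel_measurable L"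
  shows "(\<lambda>w. (f w)(s := g w)) \<in> L \<rightarrow>\<^sub>M path_space"
proof (rule measurable_PiM_single')
  fix i show "(\<lambda>w. ((f w)(s := g w)) i) \<in> borel_measurable L" by (cases "i = s") auto
qed auto

text \<open>After rounding coordinate \<open>s\<close> to a grid, \<open>F\<close> is a finite sum over the grid values \<open>v\<close> of a function
  of the coordinates in \<open>S\<close> times the indicator that coordinate \<open>s\<close> rounds to \<open>v\<close>. The covariance
  inequality applies to each product, because \<open>s\<close> lies at distance \<open>l\<close> to one side of all of \<open>S\<close>.\<close>

lemma decouple_one:
  assumes F[measurable]: "F \<in> borel_measurable path_space" and B: "\<And>x. \<bar>F x\<bar> \<le> (B :: real)"
    and dep: "depends_on F (insert s S)" and s: "s \<notin> S" "s \<ge> 1" "S \<subseteq> {1..}"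
    and sep: "(\<forall>t\<in>S. t + l \<le> s) \<or> (\<forall>t\<in>S. s + l \<le> t)"
    and lip: "lipschitz_at s \<Lambda> F" and \<eta>: "\<eta> > 0" and N: "N > 0"
  shows "\<bar>expectation (\<lambda>\<omega>. F (path \<omega>)) - expectation (\<lambda>\<omega>. integrate_out {s} F (path \<omega>))\<bar>
    \<le> decoupling_error B \<Lambda> l \<eta> N"
proof -
  interpret m: prob_space marginal by (rule prob_space_marginal)
  obtain D :: "real \<Rightarrow> real" and V where D[measurable]: "D \<in> borel_measurable borel" and V: "finite V" "\<And>c. D c \<in> V"
    and cardV: "real (card V) \<le> 2 * N / \<eta> + 3" and D\<eta>: "\<And>c. \<bar>c\<bar> \<le> N \<Longrightarrow> \<bar>c - D c\<bar> \<le> \<eta>"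
    using finite_discretization[OF \<eta> N] by metis
  have B0: "B \<ge> 0" using B[of undefined] by auto
  have \<Lambda>0: "\<Lambda> \<ge> 0" using lip[unfolded lipschitz_at_def, rule_format, of undefined 1 0] by auto
  have Xs[measurable]: "X s \<in> borel_measurable M" by (rule X_measurable) (rule s)
  have pt: "\<bar>F (x(s := c)) - F (x(s := D c))\<bar> \<le> \<Lambda> * \<eta> + 2 * B * of_bool (N < \<bar>c\<bar>)" for x c
  proof (cases "\<bar>c\<bar> \<le> N")
    case True
    have "\<bar>F (x(s := c)) - F (x(s := D c))\<bar> \<le> \<Lambda> * \<bar>c - D c\<bar>" using lip by (simp add: lipschitz_at_def)
    also have "\<dots> \<le> \<Lambda> * \<eta>" using D\<eta>[OF True] \<Lambda>0 by (intro mult_left_mono) auto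
    finally show ?thesis using True by simp
  next
    case False
    have "\<bar>F (x(s := c)) - F (x(s := D c))\<bar> \<le> 2 * B" using B[of "x(s := c)"] B[of "x(s := D c)"] by linarith
    then show ?thesis using False \<Lambda>0 \<eta> by (simp add: add_increasing)
  qed
  have tail_s: "expectation (\<lambda>\<omega>. of_bool (N < \<bar>X s \<omega>\<bar>)) = tail_prob N"
    unfolding tail_prob_eq by (rule expectation_shift1[of "\<lambda>c. of_bool (N < \<bar>c\<bar>)"]) (use s in auto)
  have tail_m: "(LINT c|marginal. of_bool (N < \<bar>c\<bar>)) = tail_prob N"
    unfolding tail_prob_eq marginal_def by (subst integral_distr) auto
  have Xpath: "path \<omega> s = X s \<omega>" for \<omega> using s by (simp add: path_apply)
  define Ft where "Ft x = F (x(s := D (x s)))" for x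
  have Ftm[measurable]: "Ft \<in> borel_measurable path_space" unfolding Ft_def by measurable
  have FtB: "\<bar>Ft x\<bar> \<le> B" for x unfolding Ft_def by (rule B)
  have iF: "integrable M (\<lambda>\<omega>. F (path \<omega>))" "integrable M (\<lambda>\<omega>. Ft (path \<omega>))"
    using B FtB by (auto intro!: integrable_bounded_path[where b = B])
  have itail: "integrable M (\<lambda>\<omega>. of_bool (N < \<bar>X s \<omega>\<bar>) :: real)"
    by (rule integrable_const_bound[where B = 1]) auto
  have step1: "\<bar>expectation (\<lambda>\<omega>. F (path \<omega>)) - expectation (\<lambda>\<omega>. Ft (path \<omega>))\<bar> \<le> \<Lambda> * \<eta> + 2 * B * tail_prob N"
  proof -
    have "\<bar>expectation (\<lambda>\<omega>. F (path \<omega>)) - expectation (\<lambda>\<omega>. Ft (path \<omega>))\<bar>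
        = \<bar>expectation (\<lambda>\<omega>. F (path \<omega>) - Ft (path \<omega>))\<bar>" using iF by simp
    also have "\<dots> \<le> expectation (\<lambda>\<omega>. \<bar>F (path \<omega>) - Ft (path \<omega>)\<bar>)" by (rule integral_abs_bound)
    also have "\<dots> \<le> expectation (\<lambda>\<omega>. \<Lambda> * \<eta> + 2 * B * of_bool (N < \<bar>X s \<omega>\<bar>))"
    proof (rule integral_mono)
      fix \<omega> show "\<bar>F (path \<omega>) - Ft (path \<omega>)\<bar> \<le> \<Lambda> * \<eta> + 2 * B * of_bool (N < \<bar>X s \<omega>\<bar>)"
        using pt[of "path \<omega>" "path \<omega> s"] unfolding Ft_def fun_upd_triv unfolding Xpath .
    qed (use iF itail in \<open>auto simp del: of_bool_eq\<close>)
    also have "\<dots> = \<Lambda> * \<eta> + 2 * B * tail_prob N" using itail by (simp add: prob_space tail_s)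
    finally show ?thesis .
  qed
  define Gt where "Gt x = (LINT c|marginal. F (x(s := D c)))" for x
  have Gtm[measurable]: "Gt \<in> borel_measurable path_space" unfolding Gt_def by measurable
  have iD: "integrable marginal (\<lambda>c. F (x(s := D c)))" "integrable marginal (\<lambda>c. F (x(s := c)))" for x
  proof -
    have [measurable]: "(\<lambda>c. x(s := c)) \<in> borel \<rightarrow>\<^sub>M path_space"
      by (rule measurable_fun_upd) (auto simp: space_PiM)
    have "(\<lambda>c. F (x(s := c))) \<in> borel_measurable borel" "(\<lambda>c. F (x(s := D c))) \<in> borel_measurable borel" by measurable
    then show "integrable marginal (\<lambda>c. F (x(s := D c)))" "integrable marginal (\<lambda>c. F (x(s := c)))"
      by (auto intro!: m.integrable_const_bound[where B = B] simp: B)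
  qed
  have itail_m: "integrable marginal (\<lambda>c. of_bool (N < \<bar>c\<bar>) :: real)"
    by (rule m.integrable_const_bound[where B = 1]) auto
  have GtB: "\<bar>Gt x\<bar> \<le> B" for x
  proof -
    have "\<bar>Gt x\<bar> \<le> (LINT c|marginal. \<bar>F (x(s := D c))\<bar>)" unfolding Gt_def by (rule integral_abs_bound)
    also have "\<dots> \<le> (LINT c|marginal. B)" by (intro integral_mono integrable_abs iD B) auto
    finally show ?thesis by (simp)
  qed
  have iG: "integrable M (\<lambda>\<omega>. integrate_out {s} F (path \<omega>))" "integrable M (\<lambda>\<omega>. Gt (path \<omega>))"
    using GtB by (auto intro!: integrable_bounded_path[where b = B] integrate_out_bounded B)
  have pt2: "\<bar>integrate_out {s} F x - Gt x\<bar> \<le> \<Lambda> * \<eta> + 2 * B * tail_prob N" for x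
  proof -
    have "\<bar>integrate_out {s} F x - Gt x\<bar> = \<bar>LINT c|marginal. F (x(s := c)) - F (x(s := D c))\<bar>"
      unfolding integrate_out_single[OF F B] Gt_def using iD by simp
    also have "\<dots> \<le> (LINT c|marginal. \<bar>F (x(s := c)) - F (x(s := D c))\<bar>)" by (rule integral_abs_bound)
    also have "\<dots> \<le> (LINT c|marginal. \<Lambda> * \<eta> + 2 * B * of_bool (N < \<bar>c\<bar>))"
      by (rule integral_mono[OF _ _ pt]) (use iD itail_m in \<open>auto simp del: of_bool_eq\<close>)
    also have "\<dots> = \<Lambda> * \<eta> + 2 * B * tail_prob N" using itail_m by (simp add: tail_m)
    finally show ?thesis .
  qed
  have step3: "\<bar>expectation (\<lambda>\<omega>. integrate_out {s} F (path \<omega>)) - expectation (\<lambda>\<omega>. Gt (path \<omega>))\<bar> \<le> \<Lambda> * \<eta> + 2 * B * tail_prob N"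
  proof -
    have "\<bar>expectation (\<lambda>\<omega>. integrate_out {s} F (path \<omega>)) - expectation (\<lambda>\<omega>. Gt (path \<omega>))\<bar>
        = \<bar>expectation (\<lambda>\<omega>. integrate_out {s} F (path \<omega>) - Gt (path \<omega>))\<bar>" using iG by simp
    also have "\<dots> \<le> expectation (\<lambda>\<omega>. \<bar>integrate_out {s} F (path \<omega>) - Gt (path \<omega>)\<bar>)" by (rule integral_abs_bound)
    also have "\<dots> \<le> expectation (\<lambda>\<omega>. \<Lambda> * \<eta> + 2 * B * tail_prob N)"
      using iG pt2 by (intro integral_mono) auto
    finally show ?thesis by (simp add: prob_space)
  qed
  have cell: "f (D c) = (\<Sum>v\<in>V. f v * of_bool (D c = v))" for f :: "real \<Rightarrow> real" and c
    using V(1) V(2)[of c] by (simp add: of_bool_def if_distrib[of "\<lambda>y. _ * y"] sum.delta cong: if_cong)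
  have dS: "depends_on (\<lambda>x. F (x(s := v))) S" for v
    unfolding depends_on_def by (auto intro!: depends_onD[OF dep])
  have cov: "\<bar>expectation (\<lambda>\<omega>. F ((path \<omega>)(s := v)) * of_bool (D (path \<omega> s) = v))
     - expectation (\<lambda>\<omega>. F ((path \<omega>)(s := v))) * expectation (\<lambda>\<omega>. of_bool (D (path \<omega> s) = v))\<bar>
     \<le> 4 * B * mixing_coeff M X l" for v
  proof -
    have ds: "depends_on (\<lambda>x. of_bool (D (x s) = v) :: real) {s}" by (auto simp: depends_on_def)
    show ?thesis
    proof (cases "S \<noteq> {} \<and> (\<forall>t\<in>S. t + l \<le> s)")
      case True
      then obtain t where "t \<in> S" "t + l \<le> s" by auto
      then have n: "s - l \<ge> 1" "s - l + l = s" using s by auto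
      have "S \<subseteq> {1..s - l}"
      proof
        fix x assume "x \<in> S"
        then have "x + l \<le> s" "1 \<le> x" using True s by blast+
        then show "x \<in> {1..s - l}" by simp
      qed
      show ?thesis
        using mixing_covariance[of "\<lambda>x. F (x(s := v))" B "\<lambda>x. of_bool (D (x s) = v)" 1 "s - l" l]
          depends_on_mono[OF dS \<open>S \<subseteq> {1..s - l}\<close>] depends_on_mono[OF ds, of "{s - l + l..}"] n B
        by (simp add: n(2))
    next
      case False
      then have "S \<subseteq> {s + l..}" using sep by auto
      then show ?thesis
        using mixing_covariance[of "\<lambda>x. of_bool (D (x s) = v)" 1 "\<lambda>x. F (x(s := v))" B s l]
          depends_on_mono[OF dS \<open>S \<subseteq> {s + l..}\<close>] depends_on_mono[OF ds, of "{1..s}"] s B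
        by (simp add: mult.commute)
    qed
  qed
  have iv: "integrable M (\<lambda>\<omega>. F ((path \<omega>)(s := v)) * of_bool (D (path \<omega> s) = v))"
    "integrable M (\<lambda>\<omega>. F ((path \<omega>)(s := v)))" for v
    using B B0 by (auto intro!: integrable_bounded_path[where b = B and F = "\<lambda>x. F (x(s := v)) * of_bool (D (x s) = v)"]
       integrable_bounded_path[where b = B and F = "\<lambda>x. F (x(s := v))"])
  have E1: "expectation (\<lambda>\<omega>. Ft (path \<omega>)) = (\<Sum>v\<in>V. expectation (\<lambda>\<omega>. F ((path \<omega>)(s := v)) * of_bool (D (path \<omega> s) = v)))"
  proof -
    have "Ft x = (\<Sum>v\<in>V. F (x(s := v)) * of_bool (D (x s) = v))" for x
      unfolding Ft_def by (rule cell)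
    then show ?thesis using iv by (simp add: Bochner_Integration.integral_sum)
  qed
  have E2: "expectation (\<lambda>\<omega>. Gt (path \<omega>)) = (\<Sum>v\<in>V. expectation (\<lambda>\<omega>. F ((path \<omega>)(s := v))) * expectation (\<lambda>\<omega>. of_bool (D (path \<omega> s) = v)))"
  proof -
    have im: "integrable marginal (\<lambda>c. of_bool (D c = v) :: real)" for v
      by (rule m.integrable_const_bound[where B = 1]) auto
    have pm: "(LINT c|marginal. of_bool (D c = v)) = expectation (\<lambda>\<omega>. of_bool (D (path \<omega> s) = v) :: real)" for v
    proof -
      have "(LINT c|marginal. of_bool (D c = v)) = expectation (\<lambda>\<omega>. of_bool (D (X 1 \<omega>) = v) :: real)"
        unfolding marginal_def by (subst integral_distr) auto
      also have "\<dots> = expectation (\<lambda>\<omega>. of_bool (D (X s \<omega>) = v))"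
        by (rule expectation_shift1[of "\<lambda>c. of_bool (D c = v)", symmetric]) (use s in auto)
      finally show ?thesis by (simp add: Xpath)
    qed
    have "Gt x = (\<Sum>v\<in>V. F (x(s := v)) * expectation (\<lambda>\<omega>. of_bool (D (path \<omega> s) = v)))" for x
    proof -
      have "Gt x = (LINT c|marginal. (\<Sum>v\<in>V. F (x(s := v)) * of_bool (D c = v)))"
        unfolding Gt_def by (intro Bochner_Integration.integral_cong refl cell)
      also have "\<dots> = (\<Sum>v\<in>V. F (x(s := v)) * (LINT c|marginal. of_bool (D c = v)))"
        using im by (subst Bochner_Integration.integral_sum) auto
      finally show ?thesis by (simp add: pm)
    qed
    then show ?thesis using iv by (simp add: Bochner_Integration.integral_sum)
  qed
  have "\<bar>expectation (\<lambda>\<omega>. Ft (path \<omega>)) - expectation (\<lambda>\<omega>. Gt (path \<omega>))\<bar>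
     \<le> (\<Sum>v\<in>V. 4 * B * mixing_coeff M X l)"
    unfolding E1 E2 sum_subtractf[symmetric] by (intro order.trans[OF sum_abs] sum_mono cov)
  also have "\<dots> = real (card V) * (4 * B * mixing_coeff M X l)" by simp
  also have "\<dots> \<le> (2 * N / \<eta> + 3) * (4 * B * mixing_coeff M X l)"
    using cardV B0 mixing_coeff_nonneg by (intro mult_right_mono) auto
  finally show ?thesis using step1 step3 unfolding decoupling_error_def by linarith
qed

lemma lipschitz_at_integrate_out:
  assumes F[measurable]: "F \<in> borel_measurable path_space" and B: "\<And>x. \<bar>F x\<bar> \<le> (B :: real)"
    and lip: "lipschitz_at t \<Lambda> F" and "t \<notin> S"
  shows "lipschitz_at t \<Lambda> (integrate_out S F)"
  unfolding lipschitz_at_def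
proof (intro allI)
  fix x :: "nat \<Rightarrow> real" and c c' :: real
  interpret I: prob_space iid_paths by (rule prob_space_iid_paths)
  have upd: "override_on (x(t := c)) z S = (override_on x z S)(t := c)" for z c
    using \<open>t \<notin> S\<close> by (auto simp: override_on_def)
  note i = integrable_override_on[OF F B]
  have "\<bar>integrate_out S F (x(t := c)) - integrate_out S F (x(t := c'))\<bar>
     = \<bar>LINT z|iid_paths. F (override_on (x(t := c)) z S) - F (override_on (x(t := c')) z S)\<bar>"
    unfolding integrate_out_def using i by simp
  also have "\<dots> \<le> (LINT z|iid_paths. \<bar>F (override_on (x(t := c)) z S) - F (override_on (x(t := c')) z S)\<bar>)"
    by (rule integral_abs_bound)
  also have "\<dots> \<le> (LINT z|iid_paths. \<Lambda> * \<bar>c - c'\<bar>)"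
  proof (rule integral_mono)
    fix z show "\<bar>F (override_on (x(t := c)) z S) - F (override_on (x(t := c')) z S)\<bar> \<le> \<Lambda> * \<bar>c - c'\<bar>"
      using lip unfolding upd lipschitz_at_def by blast
  qed (auto intro!: integrable_abs Bochner_Integration.integrable_diff i)
  finally show "\<bar>integrate_out S F (x(t := c)) - integrate_out S F (x(t := c'))\<bar> \<le> \<Lambda> * \<bar>c - c'\<bar>"
    by (simp)
qed

text \<open>The covariance inequality separates past from future, so only an extreme coordinate can be
  decoupled. There is always one outside the core: if the minimum and the maximum of \<open>S\<close> both
  belonged to the core, whose diameter is less than \<open>l\<close>, a coordinate outside of it would lie
  between them and yet be \<open>l\<close> away from the minimum.\<close>

lemma decouple_all_but_core:
  assumes "finite S" "S \<subseteq> {1..}" "C \<subseteq> S"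
    and "F \<in> borel_measurable path_space" "\<And>x. \<bar>F x\<bar> \<le> (B :: real)" "depends_on F S"
    and "\<And>s t. s \<in> S - C \<Longrightarrow> t \<in> S \<Longrightarrow> t \<noteq> s \<Longrightarrow> l \<le> gap s t"
    and "\<And>s t. s \<in> C \<Longrightarrow> t \<in> C \<Longrightarrow> gap s t < l"
    and "\<And>s. s \<in> S - C \<Longrightarrow> lipschitz_at s \<Lambda> F" and "\<eta> > 0" "N > 0"
  shows "\<bar>expectation (\<lambda>\<omega>. F (path \<omega>)) - expectation (\<lambda>\<omega>. integrate_out (S - C) F (path \<omega>))\<bar>
    \<le> real (card (S - C)) * decoupling_error B \<Lambda> l \<eta> N"
  using assms(1-9)
proof (induction "card (S - C)" arbitrary: S F)
  case 0
  have "S - C = {}" using 0 by auto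
  then show ?case by (simp only: integrate_out_empty) simp
next
  case (Suc n)
  note F = Suc.prems(4) and B = Suc.prems(5)
  have ne: "S \<noteq> {}" "S - C \<noteq> {}" using Suc.hyps(2) by (metis card.empty empty_Diff nat.distinct(1))+
  have "\<exists>s\<in>S - C. s = Max S \<or> s = Min S"
  proof (rule ccontr)
    assume "\<not> ?thesis"
    then have mx: "Max S \<in> C" "Min S \<in> C" using Max_in[OF Suc.prems(1) ne(1)] Min_in[OF Suc.prems(1) ne(1)] by auto
    obtain s where s: "s \<in> S - C" using ne by auto
    have "Min S \<le> s" "s \<le> Max S" using s Suc.prems(1) by auto
    moreover have "l \<le> gap s (Min S)"
      using s mx Suc.prems(3) by (intro Suc.prems(7)) auto
    moreover have "gap (Min S) (Max S) < l" using mx by (intro Suc.prems(8))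
    ultimately show False by (auto simp: gap_def split: if_splits)
  qed
  then obtain s where s: "s \<in> S - C" and ext: "s = Max S \<or> s = Min S" by auto
  let ?S = "S - {s}"
  have sep: "(\<forall>t\<in>?S. t + l \<le> s) \<or> (\<forall>t\<in>?S. s + l \<le> t)"
  proof -
    have g: "l \<le> gap s t" if "t \<in> ?S" for t using that s by (intro Suc.prems(7)) auto
    from ext show ?thesis
    proof
      assume "s = Max S"
      then have "t \<le> s" if "t \<in> ?S" for t using that Suc.prems(1) by auto
      then have "t + l \<le> s" if "t \<in> ?S" for t using g[OF that] that by (fastforce simp: gap_def split: if_splits)
      then show ?thesis by blast
    next
      assume "s = Min S"
      then have "s \<le> t" if "t \<in> ?S" for t using that Suc.prems(1) by auto
      then have "s + l \<le> t" if "t \<in> ?S" for t using g[OF that] that by (fastforce simp: gap_def split: if_splits)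
      then show ?thesis by blast
    qed
  qed
  have ins: "insert s ?S = S" using s by auto
  have first: "\<bar>expectation (\<lambda>\<omega>. F (path \<omega>)) - expectation (\<lambda>\<omega>. integrate_out {s} F (path \<omega>))\<bar>
    \<le> decoupling_error B \<Lambda> l \<eta> N"
    using s Suc.prems(2)
    by (intro decouple_one[OF F B _ _ _ _ sep _ assms(10,11)]) (auto simp: ins Suc.prems insert_absorb)
  have Sm: "?S - C = (S - C) - {s}" by auto
  have cn: "n = card (?S - C)" unfolding Sm using s Suc.hyps(2) Suc.prems(1) by simp
  have rest: "\<bar>expectation (\<lambda>\<omega>. integrate_out {s} F (path \<omega>)) - expectation (\<lambda>\<omega>. integrate_out (?S - C) (integrate_out {s} F) (path \<omega>))\<bar>
    \<le> real (card (?S - C)) * decoupling_error B \<Lambda> l \<eta> N"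
  proof (rule Suc.hyps(1)[OF cn])
    show "depends_on (integrate_out {s} F) ?S" by (rule depends_on_integrate_out[OF Suc.prems(6)])
    show "\<bar>integrate_out {s} F x\<bar> \<le> B" for x by (rule integrate_out_bounded[OF F B])
    show "integrate_out {s} F \<in> borel_measurable path_space" using F by measurable
    show "lipschitz_at t \<Lambda> (integrate_out {s} F)" if "t \<in> ?S - C" for t
      using that by (intro lipschitz_at_integrate_out[OF F B Suc.prems(9)]) auto
  qed (use Suc.prems(1-3,7,8) s in auto)
  have eq: "integrate_out (?S - C) (integrate_out {s} F) = integrate_out (S - C) F"
    using integrate_out_insert[OF F B, of s "?S - C"] s by (simp add: insert_absorb insert_Diff_if[symmetric] Sm insert_Diff)
  show ?case
    using first rest unfolding eq cn[symmetric] Suc.hyps(2)[symmetric] of_nat_Suc distrib_right by linarith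
qed

end

section \<open>Counting increasing index tuples\<close>

definition tuples :: "nat \<Rightarrow> nat \<Rightarrow> (nat \<Rightarrow> nat) set" where
  "tuples m n = {i \<in> {1..m} \<rightarrow>\<^sub>E {1..n}. strict_mono_on {1..m} i}"

lemma finite_tuples[simp]: "finite (tuples m n)"
  unfolding tuples_def by (rule finite_subset[of _ "{1..m} \<rightarrow>\<^sub>E {1..n}"]) (auto intro: finite_PiE)

lemma tuples_inj: "i \<in> tuples m n \<Longrightarrow> inj_on i {1..m}"
  unfolding tuples_def by (auto intro: strict_mono_on_imp_inj_on)

lemma tuples_range: "i \<in> tuples m n \<Longrightarrow> j \<in> {1..m} \<Longrightarrow> i j \<in> {1..n}"
  unfolding tuples_def by auto

lemma sorted_list_of_tuple:
  assumes "i \<in> tuples m n"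
  shows "sorted_list_of_set (i ` {1..m}) = map i [1..<Suc m]"
proof -
  have mono: "strict_mono_on {1..m} i" using assms by (simp add: tuples_def)
  have "sorted_wrt (<) (map i [1..<Suc m])"
    unfolding sorted_wrt_map
  proof (rule sorted_wrt_mono_rel[of _ "(<)"])
    show "i x < i y" if "x \<in> set [1..<Suc m]" "y \<in> set [1..<Suc m]" "x < y" for x y
      using strict_mono_onD[OF mono] that by auto
  qed (simp del: upt_Suc)
  then have "sorted_list_of_set (set (map i [1..<Suc m])) = map i [1..<Suc m]"
    by (intro sorted_list_of_set.idem_if_sorted_distinct) (auto simp: strict_sorted_iff)
  moreover have "set (map i [1..<Suc m]) = i ` {1..m}" by (auto simp: atLeastLessThanSuc_atLeastAtMost)
  ultimately show ?thesis by simp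
qed

text \<open>Counting is easier for subsets; the increasing enumeration identifies both.\<close>

lemma bij_betw_tuples_subsets:
  "bij_betw (\<lambda>i. i ` {1..m}) (tuples m n) {A. A \<subseteq> {1..n} \<and> card A = m}"
  unfolding bij_betw_def
proof
  show "inj_on (\<lambda>i. i ` {1..m}) (tuples m n)"
  proof (rule inj_onI)
    fix i i' assume i: "i \<in> tuples m n" "i' \<in> tuples m n" and eq: "i ` {1..m} = i' ` {1..m}"
    have "map i [1..<Suc m] = map i' [1..<Suc m]"
      using sorted_list_of_tuple[OF i(1)] sorted_list_of_tuple[OF i(2)] eq by simp
    then have "i j = i' j" if "j \<in> {1..m}" for j using that by (simp add: map_eq_conv del: upt_Suc)
    then show "i = i'" using i by (intro PiE_ext[of i "{1..m}" "\<lambda>_. {1..n}"]) (auto simp: tuples_def)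
  qed
  show "(\<lambda>i. i ` {1..m}) ` tuples m n = {A. A \<subseteq> {1..n} \<and> card A = m}"
  proof (intro equalityI subsetI)
    fix A assume "A \<in> (\<lambda>i. i ` {1..m}) ` tuples m n"
    then show "A \<in> {A. A \<subseteq> {1..n} \<and> card A = m}"
      using tuples_inj tuples_range by (auto simp: card_image)
  next
    fix A assume "A \<in> {A. A \<subseteq> {1..n} \<and> card A = m}"
    then have A: "A \<subseteq> {1..n}" "card A = m" and fin: "finite A" by (auto intro: finite_subset)
    let ?L = "sorted_list_of_set A"
    have len: "length ?L = m" using A by simp
    define i where "i = (\<lambda>j\<in>{1..m}. ?L ! (j - 1))"
    have img: "i ` {1..m} = A"
    proof -
      have "i ` {1..m} = (!) ?L ` ((\<lambda>j. j - 1) ` {1..m})" unfolding i_def by (auto simp: image_image)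
      also have "(\<lambda>j. j - 1) ` {1..m} = {..<m}"
        by (auto simp: image_iff intro!: bexI[of _ "Suc _"])
      also have "(!) ?L ` {..<m} = set ?L" using len by (auto simp: set_conv_nth)
      finally show ?thesis using fin by simp
    qed
    have "strict_mono_on {1..m} i"
    proof (rule strict_mono_onI)
      fix r s assume rs: "r \<in> {1..m}" "s \<in> {1..m}" "r < s"
      have "sorted_wrt (<) ?L" using strict_sorted_list_of_set by blast
      from sorted_wrt_nth_less[OF this, of "r - 1" "s - 1"]
      have "?L ! (r - 1) < ?L ! (s - 1)" using rs len by auto
      then show "i r < i s" using rs by (simp add: i_def)
    qed
    moreover have "i \<in> {1..m} \<rightarrow>\<^sub>E {1..n}"
      using img A unfolding i_def by (fastforce simp: image_def)
    ultimately show "A \<in> (\<lambda>i. i ` {1..m}) ` tuples m n" using img by (auto simp: tuples_def)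
  qed
qed

lemma card_tuples: "card (tuples m n) = n choose m"
  using bij_betw_same_card[OF bij_betw_tuples_subsets[of m n]] n_subsets[of "{1..n}" m] by simp

lemma card_subsets_containing:
  assumes "finite A" "s \<in> A" "m \<ge> 1"
  shows "card {B. B \<subseteq> A \<and> card B = m \<and> s \<in> B} = (card A - 1) choose (m - 1)"
proof -
  have "bij_betw (insert s) {B. B \<subseteq> A - {s} \<and> card B = m - 1} {B. B \<subseteq> A \<and> card B = m \<and> s \<in> B}"
  proof (rule bij_betw_byWitness[where f' = "\<lambda>B. B - {s}"])
    show "insert s ` {B. B \<subseteq> A - {s} \<and> card B = m - 1} \<subseteq> {B. B \<subseteq> A \<and> card B = m \<and> s \<in> B}"
    proof safe
      fix B assume B: "B \<subseteq> A - {s}" "card B = m - 1"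
      then have "finite B" "s \<notin> B" using assms(1) finite_subset by blast+
      then show "card (insert s B) = m" using B assms by simp
    qed (use assms in auto)
  qed (use assms finite_subset in \<open>auto simp: card_Diff_singleton\<close>)
  from bij_betw_same_card[OF this] show ?thesis
    using n_subsets[of "A - {s}" "m - 1"] assms by simp
qed

text \<open>By symmetry each index occurs in the same fraction \<open>m / n\<close> of the tuples.\<close>

lemma sum_tuples_linear:
  fixes u :: "nat \<Rightarrow> real"
  assumes "m \<ge> 1" "m \<le> n"
  shows "(\<Sum>i\<in>tuples m n. \<Sum>j\<in>{1..m}. u (i j)) / real (n choose m) = real m / real n * (\<Sum>s\<in>{1..n}. u s)"
proof -
  let ?A = "{A. A \<subseteq> {1..n} \<and> card A = m}"
  have finA: "finite ?A" by (rule finite_subset[of _ "Pow {1..n}"]) auto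
  have "(\<Sum>i\<in>tuples m n. \<Sum>j\<in>{1..m}. u (i j)) = (\<Sum>i\<in>tuples m n. \<Sum>s\<in>i ` {1..m}. u s)"
    by (rule sum.cong[OF refl], subst sum.reindex[OF tuples_inj], assumption, simp only: comp_def)
  also have "\<dots> = (\<Sum>A\<in>?A. \<Sum>s\<in>A. u s)"
    by (rule sum.reindex_bij_betw[OF bij_betw_tuples_subsets])
  also have "\<dots> = (\<Sum>A\<in>?A. \<Sum>s\<in>{1..n}. if s \<in> A then u s else 0)"
  proof (rule sum.cong[OF refl])
    fix A assume "A \<in> ?A"
    then have "{1..n} \<inter> A = A" by auto
    then show "(\<Sum>s\<in>A. u s) = (\<Sum>s\<in>{1..n}. if s \<in> A then u s else 0)"
      using sum.inter_restrict[of "{1..n}" u A] by simp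
  qed
  also have "\<dots> = (\<Sum>s\<in>{1..n}. \<Sum>A\<in>?A. if s \<in> A then u s else 0)"
    by (rule sum.swap)
  also have "\<dots> = (\<Sum>s\<in>{1..n}. real ((n - 1) choose (m - 1)) * u s)"
  proof (intro sum.cong refl)
    fix s assume s: "s \<in> {1..n}"
    have "(\<Sum>A\<in>?A. if s \<in> A then u s else 0) = real (card {A \<in> ?A. s \<in> A}) * u s"
      using finA by (simp add: sum.If_cases Int_def)
    also have "{A \<in> ?A. s \<in> A} = {B. B \<subseteq> {1..n} \<and> card B = m \<and> s \<in> B}" by auto
    also have "card \<dots> = (n - 1) choose (m - 1)" using card_subsets_containing[of "{1..n}" s m] s assms by simp
    finally show "(\<Sum>A\<in>?A. if s \<in> A then u s else 0) = real ((n - 1) choose (m - 1)) * u s" .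
  qed
  also have "\<dots> = real ((n - 1) choose (m - 1)) * (\<Sum>s\<in>{1..n}. u s)" by (simp add: sum_distrib_left)
  finally have eq: "(\<Sum>i\<in>tuples m n. \<Sum>j\<in>{1..m}. u (i j)) = \<dots>" .
  have "m * (n choose m) = n * ((n - 1) choose (m - 1))" using assms by (intro times_binomial_minus1_eq) auto
  then have "real m * real (n choose m) = real n * real ((n - 1) choose (m - 1))" by (metis of_nat_mult)
  moreover have "real n > 0" "real (n choose m) > 0" using assms by auto
  ultimately have "real ((n - 1) choose (m - 1)) / real (n choose m) = real m / real n"
    by (simp add: field_simps)
  then show ?thesis unfolding eq by (metis times_divide_eq_left)
qed

lemma gap_offset: "gap x y < L \<Longrightarrow> y + L - x < 2 * L \<and> x < y + L"
  by (auto simp: gap_def split: if_splits)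

text \<open>The coordinate \<open>b\<close> is determined by the coordinate \<open>a\<close> and an offset with fewer than \<open>2 * L\<close>
  values, which saves a factor of order \<open>n / L\<close> in the count.\<close>

lemma card_close_pair:
  assumes ab: "a \<in> {1..m}" "b \<in> {1..m}" "a \<noteq> b"
  shows "card {i \<in> {1..m} \<rightarrow>\<^sub>E {1..n}. gap (i a) (i b) < L} \<le> 2 * L * n ^ (m - 1)"
proof -
  let ?S = "{i \<in> {1..m} \<rightarrow>\<^sub>E {1..n}. gap (i a) (i b) < L}"
  let ?J = "{1..m} - {b}"
  let ?f = "\<lambda>i :: nat \<Rightarrow> nat. (i b + L - i a, restrict i ?J)"
  have "card ?S \<le> card ({..<2 * L} \<times> (?J \<rightarrow>\<^sub>E {1..n}))"
  proof (rule card_inj_on_le[where f = ?f])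
    show "inj_on ?f ?S"
    proof (rule inj_onI)
      fix i i' assume i: "i \<in> ?S" "i' \<in> ?S" and eq: "?f i = ?f i'"
      have eqJ: "i j = i' j" if "j \<in> ?J" for j
        using eq that by (metis (no_types, lifting) prod.inject restrict_apply')
      have "i a = i' a" using ab by (intro eqJ) auto
      moreover have "i b + L - i a = i' b + L - i' a" using eq by simp
      moreover have "i a < i b + L" "i' a < i' b + L" using i by (auto simp: gap_def split: if_splits)
      ultimately have "i b = i' b" by linarith
      with eqJ have "i j = i' j" if "j \<in> {1..m}" for j using that by (cases "j = b") auto
      then show "i = i'" using i by (intro PiE_ext[of i "{1..m}" "\<lambda>_. {1..n}"]) auto
    qed
    show "?f ` ?S \<subseteq> {..<2 * L} \<times> (?J \<rightarrow>\<^sub>E {1..n})"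
    proof (rule image_subsetI)
      fix i assume "i \<in> ?S"
      then have i: "i \<in> {1..m} \<rightarrow>\<^sub>E {1..n}" "i b + L - i a < 2 * L" using gap_offset by auto
      have "restrict i ?J \<in> ?J \<rightarrow>\<^sub>E {1..n}" using i(1) by (auto simp: PiE_def Pi_def)
      then show "?f i \<in> {..<2 * L} \<times> (?J \<rightarrow>\<^sub>E {1..n})" using i(2) by simp
    qed
  qed (auto intro: finite_PiE)
  also have "\<dots> = 2 * L * n ^ (m - 1)" using ab by (simp add: card_cartesian_product card_PiE)
  finally show ?thesis .
qed

text \<open>Because \<open>b\<close> and \<open>b'\<close> differ, two coordinates of \<open>i'\<close> are determined by \<open>i\<close> up to offsets. The
  positions \<open>a\<close> and \<open>a'\<close> may coincide.\<close>

lemma card_two_close_pairs: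
  assumes ab: "a \<in> {1..m}" "a' \<in> {1..m}" "b \<in> {1..m}" "b' \<in> {1..m}" "b \<noteq> b'"
  shows "card {(i, i'). i \<in> {1..m} \<rightarrow>\<^sub>E {1..n} \<and> i' \<in> {1..m} \<rightarrow>\<^sub>E {1..n} \<and> gap (i a) (i' b) < L \<and> gap (i a') (i' b') < L}
    \<le> (2 * L)\<^sup>2 * n ^ (2 * m - 2)"
proof -
  let ?S = "{(i, i'). i \<in> {1..m} \<rightarrow>\<^sub>E {1..n} \<and> i' \<in> {1..m} \<rightarrow>\<^sub>E {1..n} \<and> gap (i a) (i' b) < L \<and> gap (i a') (i' b') < L}"
  let ?J = "{1..m} - {b, b'}"
  let ?f = "\<lambda>(i :: nat \<Rightarrow> nat, i' :: nat \<Rightarrow> nat). ((i' b + L - i a, i' b' + L - i a'), (i, restrict i' ?J))"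
  have "card ?S \<le> card (({..<2 * L} \<times> {..<2 * L}) \<times> (({1..m} \<rightarrow>\<^sub>E {1..n}) \<times> (?J \<rightarrow>\<^sub>E {1..n})))"
  proof (rule card_inj_on_le[where f = ?f])
    show "inj_on ?f ?S"
    proof (rule inj_onI)
      fix p q assume p: "p \<in> ?S" "q \<in> ?S" and eq: "?f p = ?f q"
      obtain i i' k k' where [simp]: "p = (i, i')" "q = (k, k')" by (cases p, cases q) auto
      have ik: "i = k" using eq by simp
      have eqJ: "i' j = k' j" if "j \<in> ?J" for j
      proof -
        have "restrict i' ?J = restrict k' ?J" using eq by simp
        then show ?thesis using that by (metis restrict_apply')
      qed
      have "i' b + L - i a = k' b + L - i a" "i' b' + L - i a' = k' b' + L - i a'" using eq ik by auto
      moreover have "i a < i' b + L" "i a' < i' b' + L" "i a < k' b + L" "i a' < k' b' + L"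
        using p ik by (auto simp: gap_def split: if_splits)
      ultimately have "i' b = k' b" "i' b' = k' b'" by linarith+
      with eqJ have "i' j = k' j" if "j \<in> {1..m}" for j using that by (cases "j = b"; cases "j = b'") auto
      then have "i' = k'" using p by (intro PiE_ext[of i' "{1..m}" "\<lambda>_. {1..n}"]) auto
      then show "p = q" using ik by simp
    qed
    show "?f ` ?S \<subseteq> ({..<2 * L} \<times> {..<2 * L}) \<times> (({1..m} \<rightarrow>\<^sub>E {1..n}) \<times> (?J \<rightarrow>\<^sub>E {1..n}))"
    proof (rule image_subsetI)
      fix p assume "p \<in> ?S"
      then obtain i i' where p: "p = (i, i')" and i: "i \<in> {1..m} \<rightarrow>\<^sub>E {1..n}" "i' \<in> {1..m} \<rightarrow>\<^sub>E {1..n}"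
        and g: "gap (i a) (i' b) < L" "gap (i a') (i' b') < L" by auto
      have "restrict i' ?J \<in> ?J \<rightarrow>\<^sub>E {1..n}" using i(2) by (auto simp: PiE_def Pi_def)
      then show "?f p \<in> ({..<2 * L} \<times> {..<2 * L}) \<times> (({1..m} \<rightarrow>\<^sub>E {1..n}) \<times> (?J \<rightarrow>\<^sub>E {1..n}))"
        using i gap_offset[OF g(1)] gap_offset[OF g(2)] unfolding p by simp
    qed
  qed (auto intro: finite_PiE)
  also have "\<dots> = (2 * L)\<^sup>2 * (n ^ m * n ^ (m - 2))"
    using ab by (simp add: card_cartesian_product card_PiE power2_eq_square card_Diff_subset numeral_2_eq_2)
  also have "n ^ m * n ^ (m - 2) = n ^ (2 * m - 2)"
  proof -
    have "m \<ge> 2" using ab(3-5) by (cases "m \<ge> 2") auto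
    then show ?thesis by (simp add: power_add[symmetric] mult_2)
  qed
  finally show ?thesis .
qed

text \<open>Tuples that are clustered are too few to matter; for the others, an index of another tuple can
  be close to at most one entry.\<close>

definition clustered :: "nat \<Rightarrow> nat \<Rightarrow> (nat \<Rightarrow> nat) \<Rightarrow> bool" where
  "clustered m L i \<longleftrightarrow> (\<exists>a\<in>{1..m}. \<exists>b\<in>{1..m}. a \<noteq> b \<and> gap (i a) (i b) < L)"

definition doubly_close :: "nat \<Rightarrow> nat \<Rightarrow> (nat \<Rightarrow> nat) \<Rightarrow> (nat \<Rightarrow> nat) \<Rightarrow> bool" where
  "doubly_close m L i i' \<longleftrightarrow> (\<exists>a\<in>{1..m}. \<exists>a'\<in>{1..m}. \<exists>b\<in>{1..m}. \<exists>b'\<in>{1..m}.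
     b \<noteq> b' \<and> gap (i a) (i' b) < L \<and> gap (i a') (i' b') < L)"

lemma binomial_lower_bound: "m \<le> n \<Longrightarrow> m \<ge> 1 \<Longrightarrow> real n ^ m \<le> real m ^ m * real (n choose m)"
  using binomial_ge_n_over_k_pow_k[of m n, where ?'a = real] by (simp add: power_divide field_simps)

lemma clustered_fraction:
  assumes "m \<le> n" "m \<ge> 1"
  shows "real (card {i \<in> tuples m n. clustered m L i}) / real (n choose m) \<le> 2 * real m ^ (m + 2) * (real L / real n)"
proof -
  have n: "real n > 0" and c: "real (n choose m) > 0" using assms by auto
  have "{i \<in> tuples m n. clustered m L i}
     \<subseteq> (\<Union>(a, b)\<in>{(a, b) \<in> {1..m} \<times> {1..m}. a \<noteq> b}. {i \<in> {1..m} \<rightarrow>\<^sub>E {1..n}. gap (i a) (i b) < L})"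
  proof
    fix i assume "i \<in> {i \<in> tuples m n. clustered m L i}"
    then obtain a b where "a \<in> {1..m}" "b \<in> {1..m}" "a \<noteq> b" "gap (i a) (i b) < L" "i \<in> {1..m} \<rightarrow>\<^sub>E {1..n}"
      unfolding tuples_def clustered_def by blast
    then show "i \<in> (\<Union>(a, b)\<in>{(a, b) \<in> {1..m} \<times> {1..m}. a \<noteq> b}. {i \<in> {1..m} \<rightarrow>\<^sub>E {1..n}. gap (i a) (i b) < L})"
      by (intro UN_I[of "(a, b)"]) simp_all
  qed
  then have "card {i \<in> tuples m n. clustered m L i}
     \<le> card (\<Union>(a, b)\<in>{(a, b) \<in> {1..m} \<times> {1..m}. a \<noteq> b}. {i \<in> {1..m} \<rightarrow>\<^sub>E {1..n}. gap (i a) (i b) < L})"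
    by (rule card_mono[rotated]) (auto intro!: finite_subset[of _ "{1..m} \<rightarrow>\<^sub>E {1..n}"] finite_PiE finite_subset[of _ "{1..m} \<times> {1..m}"])
  also have "\<dots> \<le> (\<Sum>(a, b)\<in>{(a, b) \<in> {1..m} \<times> {1..m}. a \<noteq> b}. card {i \<in> {1..m} \<rightarrow>\<^sub>E {1..n}. gap (i a) (i b) < L})"
    unfolding split_beta by (rule card_UN_le) (rule finite_subset[of _ "{1..m} \<times> {1..m}"], auto)
  also have "\<dots> \<le> (\<Sum>(a, b)\<in>{(a, b) \<in> {1..m} \<times> {1..m}. a \<noteq> b}. 2 * L * n ^ (m - 1))"
  proof (rule sum_mono)
    fix w assume "w \<in> {(a, b) \<in> {1..m} \<times> {1..m}. a \<noteq> b}"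
    then obtain a b where w: "w = (a, b)" "a \<in> {1..m}" "b \<in> {1..m}" "a \<noteq> b" by auto
    show "(case w of (a, b) \<Rightarrow> card {i \<in> {1..m} \<rightarrow>\<^sub>E {1..n}. gap (i a) (i b) < L})
        \<le> (case w of (a, b) \<Rightarrow> 2 * L * n ^ (m - 1))"
      unfolding w(1) prod.case by (rule card_close_pair[OF w(2-)])
  qed
  also have "\<dots> = card {(a, b) \<in> {1..m} \<times> {1..m}. a \<noteq> b} * (2 * L * n ^ (m - 1))" by (simp add: split_beta)
  also have "card {(a, b) \<in> {1..m} \<times> {1..m}. a \<noteq> b} \<le> card ({1..m} \<times> {1..m})" by (rule card_mono) auto
  finally have "card {i \<in> tuples m n. clustered m L i} \<le> m * m * (2 * L * n ^ (m - 1))"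
    by (simp add: card_cartesian_product)
  then have "real (card {i \<in> tuples m n. clustered m L i}) \<le> real (m * m * (2 * L * n ^ (m - 1)))"
    by (rule of_nat_mono)
  then have "real (card {i \<in> tuples m n. clustered m L i}) * real n \<le> real (m * m * (2 * L * n ^ (m - 1))) * real n"
    by (rule mult_right_mono) simp
  also have "\<dots> = 2 * real m ^ 2 * real L * real n ^ m"
  proof -
    have "real n ^ (m - 1) * real n = real n ^ m" using assms by (intro power_minus_mult) simp
    moreover have "real (m * m * (2 * L * n ^ (m - 1))) * real n = 2 * real m ^ 2 * real L * (real n ^ (m - 1) * real n)"
      by (simp add: power2_eq_square)
    ultimately show ?thesis by simp
  qed
  also have "\<dots> \<le> 2 * real m ^ 2 * real L * (real m ^ m * real (n choose m))"
    using binomial_lower_bound[OF assms] by (intro mult_left_mono) auto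
  also have "\<dots> = 2 * real m ^ (m + 2) * real L * real (n choose m)" by (simp add: power_add power2_eq_square mult_ac)
  finally show ?thesis using n c by (simp add: field_simps)
qed

lemma doubly_close_fraction:
  assumes "m \<le> n" "m \<ge> 1"
  shows "real (card {(i, i') \<in> tuples m n \<times> tuples m n. doubly_close m L i i'}) / (real (n choose m))\<^sup>2
     \<le> 4 * real m ^ (2 * m + 4) * (real L / real n)\<^sup>2"
proof -
  have n: "real n > 0" and c: "real (n choose m) > 0" using assms by auto
  let ?I = "{(a, a', b, b') \<in> {1..m} \<times> {1..m} \<times> {1..m} \<times> {1..m}. b \<noteq> b'}"
  let ?B = "\<lambda>a a' b b'. {(i, i'). i \<in> {1..m} \<rightarrow>\<^sub>E {1..n} \<and> i' \<in> {1..m} \<rightarrow>\<^sub>E {1..n} \<and> gap (i a) (i' b) < L \<and> gap (i a') (i' b') < L}"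
  have finI: "finite ?I" by (rule finite_subset[of _ "{1..m} \<times> {1..m} \<times> {1..m} \<times> {1..m}"]) auto
  have finB: "finite (?B a a' b b')" for a a' b b'
    by (rule finite_subset[of _ "({1..m} \<rightarrow>\<^sub>E {1..n}) \<times> ({1..m} \<rightarrow>\<^sub>E {1..n})"]) (auto intro: finite_PiE)
  have "{(i, i') \<in> tuples m n \<times> tuples m n. doubly_close m L i i'} \<subseteq> (\<Union>w\<in>?I. case w of (a, a', b, b') \<Rightarrow> ?B a a' b b')"
  proof
    fix p assume "p \<in> {(i, i') \<in> tuples m n \<times> tuples m n. doubly_close m L i i'}"
    then obtain i i' where p: "p = (i, i')" "i \<in> tuples m n" "i' \<in> tuples m n" "doubly_close m L i i'" by auto
    from p(4) obtain a a' b b' where "a \<in> {1..m}" "a' \<in> {1..m}" "b \<in> {1..m}" "b' \<in> {1..m}" "b \<noteq> b'"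
        "gap (i a) (i' b) < L" "gap (i a') (i' b') < L" unfolding doubly_close_def by blast
    then show "p \<in> (\<Union>w\<in>?I. case w of (a, a', b, b') \<Rightarrow> ?B a a' b b')"
      using p(2,3) unfolding p(1) tuples_def by (intro UN_I[of "(a, a', b, b')"]) simp_all
  qed
  then have "card {(i, i') \<in> tuples m n \<times> tuples m n. doubly_close m L i i'} \<le> card (\<Union>w\<in>?I. case w of (a, a', b, b') \<Rightarrow> ?B a a' b b')"
    by (rule card_mono[rotated]) (use finI finB in \<open>auto split: prod.splits\<close>)
  also have "\<dots> \<le> (\<Sum>w\<in>?I. card (case w of (a, a', b, b') \<Rightarrow> ?B a a' b b'))"
    by (rule card_UN_le[OF finI])
  also have "\<dots> \<le> (\<Sum>w\<in>?I. (2 * L)\<^sup>2 * n ^ (2 * m - 2))"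
  proof (rule sum_mono)
    fix w assume "w \<in> ?I"
    then obtain a a' b b' where w: "w = (a, a', b, b')" "a \<in> {1..m}" "a' \<in> {1..m}" "b \<in> {1..m}" "b' \<in> {1..m}" "b \<noteq> b'" by auto
    show "card (case w of (a, a', b, b') \<Rightarrow> ?B a a' b b') \<le> (2 * L)\<^sup>2 * n ^ (2 * m - 2)"
      unfolding w(1) prod.case by (rule card_two_close_pairs[OF w(2-)])
  qed
  also have "\<dots> = card ?I * ((2 * L)\<^sup>2 * n ^ (2 * m - 2))" by simp
  also have "card ?I \<le> card ({1..m} \<times> {1..m} \<times> {1..m} \<times> {1..m})" by (rule card_mono) auto
  finally have "card {(i, i') \<in> tuples m n \<times> tuples m n. doubly_close m L i i'} \<le> m ^ 4 * ((2 * L)\<^sup>2 * n ^ (2 * m - 2))"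
    by (simp add: card_cartesian_product eval_nat_numeral)
  then have "real (card {(i, i') \<in> tuples m n \<times> tuples m n. doubly_close m L i i'}) \<le> real (m ^ 4 * ((2 * L)\<^sup>2 * n ^ (2 * m - 2)))"
    by (rule of_nat_mono)
  then have "real (card {(i, i') \<in> tuples m n \<times> tuples m n. doubly_close m L i i'}) * (real n)\<^sup>2
      \<le> real (m ^ 4 * ((2 * L)\<^sup>2 * n ^ (2 * m - 2))) * (real n)\<^sup>2"
    by (rule mult_right_mono) simp
  also have "\<dots> = 4 * real m ^ 4 * (real L)\<^sup>2 * (real n ^ (2 * m - 2) * real n ^ 2)"
    by (simp add: power_mult_distrib)
  also have "real n ^ (2 * m - 2) * real n ^ 2 = (real n ^ m)\<^sup>2"
  proof -
    have "real n ^ (2 * m - 2) * real n ^ 2 = real n ^ (2 * m - 2 + 2)" by (rule power_add[symmetric])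
    also have "2 * m - 2 + 2 = m * 2" using assms by simp
    finally show ?thesis by (simp only: power_mult)
  qed
  also have "4 * real m ^ 4 * (real L)\<^sup>2 * (real n ^ m)\<^sup>2 \<le> 4 * real m ^ 4 * (real L)\<^sup>2 * (real m ^ m * real (n choose m))\<^sup>2"
    using binomial_lower_bound[OF assms] by (intro mult_left_mono power_mono) auto
  also have "\<dots> = 4 * real m ^ (2 * m + 4) * (real L)\<^sup>2 * (real (n choose m))\<^sup>2"
    by (simp add: power_add power_mult_distrib power_mult[symmetric] mult_ac)
  finally show ?thesis using n c by (simp add: field_simps power_divide)
qed

section \<open>Hoeffding decomposition of U-statistics\<close>

context mixing_process
begin

definition theta :: "nat \<Rightarrow> ((nat \<Rightarrow> real) \<Rightarrow> real) \<Rightarrow> real" where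
  "theta m \<phi> = (LINT z|iid_paths. \<phi> (\<lambda>j\<in>{1..m}. z j))"

text \<open>The first Hoeffding projection: the mean of the kernel given that one argument equals \<open>c\<close>. Since
  kernels are symmetric, fixing the first argument loses no generality.\<close>

definition projection :: "nat \<Rightarrow> ((nat \<Rightarrow> real) \<Rightarrow> real) \<Rightarrow> real \<Rightarrow> real" where
  "projection m \<phi> c = (LINT z|iid_paths. \<phi> (\<lambda>j\<in>{1..m}. if j = 1 then c else z j))"

text \<open>What the Hoeffding decomposition leaves of a single summand of a U-statistic after removing its
  mean and its projections.\<close>

definition remainder :: "nat \<Rightarrow> ((nat \<Rightarrow> real) \<Rightarrow> real) \<Rightarrow> (nat \<Rightarrow> nat) \<Rightarrow> (nat \<Rightarrow> real) \<Rightarrow> real" where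
  "remainder m \<phi> i x = \<phi> (\<lambda>j\<in>{1..m}. x (i j)) - theta m \<phi> - (\<Sum>j\<in>{1..m}. projection m \<phi> (x (i j)) - theta m \<phi>)"

text \<open>The bound 1 is that of the indicators of \<open>h \<le> y\<close> and of their smooth versions. It is required at
  all functions, also the non-extensional ones, which spares the side conditions.\<close>

definition unit_kernel :: "nat \<Rightarrow> ((nat \<Rightarrow> real) \<Rightarrow> real) \<Rightarrow> bool" where
  "unit_kernel m \<phi> \<longleftrightarrow> kernel m \<phi> \<and> (\<forall>v. 0 \<le> \<phi> v \<and> \<phi> v \<le> 1)"

definition coordinate_lipschitz :: "nat \<Rightarrow> real \<Rightarrow> ((nat \<Rightarrow> real) \<Rightarrow> real) \<Rightarrow> bool" where
  "coordinate_lipschitz m \<Lambda> \<phi> \<longleftrightarrow>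
     (\<forall>v\<in>extensional {1..m}. \<forall>a\<in>{1..m}. \<forall>c c'. \<bar>\<phi> (v(a := c)) - \<phi> (v(a := c'))\<bar> \<le> \<Lambda> * \<bar>c - c'\<bar>)"

lemma measurable_select[measurable]:
  "(\<lambda>x. \<lambda>j\<in>J. x (i j)) \<in> path_space \<rightarrow>\<^sub>M PiM J (\<lambda>_. borel)"
  by (intro measurable_restrict) simp

lemma measurable_select_mixed[measurable]:
  "(\<lambda>(c, z). \<lambda>j\<in>J. if j = a then c else z (i j)) \<in> borel \<Otimes>\<^sub>M path_space \<rightarrow>\<^sub>M PiM J (\<lambda>_. borel)"
proof -
  have "(\<lambda>w. if j = a then fst w else snd w (i j)) \<in> borel_measurable (borel \<Otimes>\<^sub>M path_space)" for j
    by (cases "j = a") auto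
  then show ?thesis unfolding split_beta by (rule measurable_restrict)
qed

lemma kernel_measurable: "unit_kernel m \<phi> \<Longrightarrow> \<phi> \<in> borel_measurable (PiM {1..m} (\<lambda>_. borel))"
  by (simp add: unit_kernel_def kernel_def)

lemma kernel_symmetric:
  "unit_kernel m \<phi> \<Longrightarrow> \<pi> permutes {1..m} \<Longrightarrow> v \<in> extensional {1..m} \<Longrightarrow> \<phi> (v \<circ> \<pi>) = \<phi> v"
  by (simp add: unit_kernel_def kernel_def)

lemma unit_kernelD: "unit_kernel m \<phi> \<Longrightarrow> 0 \<le> \<phi> v" "unit_kernel m \<phi> \<Longrightarrow> \<phi> v \<le> 1"
  and unit_kernel_abs: "unit_kernel m \<phi> \<Longrightarrow> \<bar>\<phi> v\<bar> \<le> 1"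
  by (auto simp: unit_kernel_def)

lemma iid_select_law:
  assumes f: "f \<in> borel_measurable (PiM J (\<lambda>_. borel))" and i: "inj_on i J"
  shows "(LINT z|iid_paths. f (\<lambda>j\<in>J. z (i j))) = (LINT w|PiM J (\<lambda>_. marginal). f w :: real)"
proof -
  have eq: "distr iid_paths (PiM J (\<lambda>_. marginal)) (\<lambda>z. \<lambda>j\<in>J. z (i j)) = PiM J (\<lambda>_. marginal)"
    unfolding iid_paths_def using i prob_space_marginal
    by (intro distr_PiM_reindex[of UNIV "\<lambda>_. marginal"]) auto
  have sets: "sets (PiM J (\<lambda>_. marginal)) = sets (PiM J (\<lambda>_. borel))" by (intro sets_PiM_cong) auto
  have fm: "f \<in> borel_measurable (PiM J (\<lambda>_. marginal))" using f by (simp cong: measurable_cong_sets add: sets)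
  have "(LINT w|PiM J (\<lambda>_. marginal). f w) = (\<integral>w. f w \<partial>(distr iid_paths (PiM J (\<lambda>_. marginal)) (\<lambda>z. \<lambda>j\<in>J. z (i j))))"
    by (simp only: eq)
  also have "\<dots> = (LINT z|iid_paths. f (\<lambda>j\<in>J. z (i j)))"
  proof (rule integral_distr[OF _ fm])
    show "(\<lambda>z. \<lambda>j\<in>J. z (i j)) \<in> iid_paths \<rightarrow>\<^sub>M PiM J (\<lambda>_. marginal)"
      using measurable_select[where J = J and i = i]
      by (simp cong: measurable_cong_sets add: sets_iid_paths sets)
  qed
  finally show ?thesis by simp
qed

lemma iid_reindex:
  assumes f: "f \<in> borel_measurable (PiM J (\<lambda>_. borel))" and i: "inj_on i J"
  shows "(LINT z|iid_paths. f (\<lambda>j\<in>J. z (i j))) = (LINT z|iid_paths. f (\<lambda>j\<in>J. z j) :: real)"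
  using iid_select_law[OF assms] iid_select_law[OF f, of "\<lambda>j. j"] by simp

lemma iid_coordinate:
  assumes [measurable]: "g \<in> borel_measurable borel" and B: "\<And>c. \<bar>g c\<bar> \<le> (B :: real)"
  shows "(LINT z|iid_paths. g (z s)) = (LINT c|marginal. g c)"
proof -
  have "(LINT z|iid_paths. g (z s)) = (LINT z|iid_paths. LINT c|marginal. g ((z(s := c)) s))"
    by (rule resample_coordinate[where B = B]) (auto simp: B)
  then show ?thesis by simp
qed

lemma unit_kernel_bounds_integral:
  assumes \<phi>: "unit_kernel m \<phi>" and f: "f \<in> path_space \<rightarrow>\<^sub>M PiM {1..m} (\<lambda>_. borel)"
  shows "integrable iid_paths (\<lambda>z. \<phi> (f z))" "0 \<le> (LINT z|iid_paths. \<phi> (f z))" "(LINT z|iid_paths. \<phi> (f z)) \<le> 1"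
proof -
  interpret I: prob_space iid_paths by (rule prob_space_iid_paths)
  have m: "(\<lambda>z. \<phi> (f z)) \<in> borel_measurable path_space"
    using measurable_compose[OF f kernel_measurable[OF \<phi>]] .
  show i: "integrable iid_paths (\<lambda>z. \<phi> (f z))"
    by (rule integrable_iid_bounded[OF m, where B = 1]) (use unit_kernelD[OF \<phi>] in auto)
  show "0 \<le> (LINT z|iid_paths. \<phi> (f z))" using unit_kernelD[OF \<phi>] by simp
  have "(LINT z|iid_paths. \<phi> (f z)) \<le> (LINT z|iid_paths. 1)"
    by (intro integral_mono i unit_kernelD[OF \<phi>]) auto
  then show "(LINT z|iid_paths. \<phi> (f z)) \<le> 1" by simp
qed

lemma theta_unit: "unit_kernel m \<phi> \<Longrightarrow> 0 \<le> theta m \<phi>" "unit_kernel m \<phi> \<Longrightarrow> theta m \<phi> \<le> 1"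
  unfolding theta_def using unit_kernel_bounds_integral(2,3)[of m \<phi> "\<lambda>z. \<lambda>j\<in>{1..m}. z j"] measurable_select[where J = "{1..m}" and i = "\<lambda>j. j"] by auto

lemma measurable_select_mixed2[measurable]:
  "(\<lambda>z. \<lambda>j\<in>J. if j = a then c else z (i j)) \<in> path_space \<rightarrow>\<^sub>M PiM J (\<lambda>_. borel)"
proof -
  have "(\<lambda>z. if j = a then c else z (i j)) \<in> borel_measurable path_space" for j
    by (cases "j = a") auto
  then show ?thesis by (rule measurable_restrict)
qed

lemma projection_unit:
  assumes "unit_kernel m \<phi>" shows "0 \<le> projection m \<phi> c" "projection m \<phi> c \<le> 1"
  unfolding projection_def using unit_kernel_bounds_integral(2,3)[OF assms measurable_select_mixed2[where a = 1 and c = c and i = "\<lambda>j. j"]] by auto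

lemma measurable_projection[measurable (raw)]:
  assumes \<phi>: "unit_kernel m \<phi>"
  shows "projection m \<phi> \<in> borel_measurable borel"
proof -
  interpret I: prob_space iid_paths by (rule prob_space_iid_paths)
  have "(\<lambda>(c, z). \<phi> (\<lambda>j\<in>{1..m}. if j = 1 then c else z j)) \<in> borel_measurable (borel \<Otimes>\<^sub>M path_space)"
    using measurable_compose[OF measurable_select_mixed[where J = "{1..m}" and a = 1 and i = "\<lambda>j. j"] kernel_measurable[OF \<phi>]]
    by (simp add: split_beta)
  then have "(\<lambda>(c, z). \<phi> (\<lambda>j\<in>{1..m}. if j = 1 then c else z j)) \<in> borel_measurable (borel \<Otimes>\<^sub>M iid_paths)"
    by (simp only: measurable_cong_sets[OF sets_pair_measure_cong[OF refl sets_iid_paths] refl])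
  then show ?thesis unfolding projection_def by (rule I.borel_measurable_lebesgue_integral)
qed

lemma theta_eq_integral_projection:
  assumes \<phi>: "unit_kernel m \<phi>" and "m \<ge> 1"
  shows "(LINT c|marginal. projection m \<phi> c) = theta m \<phi>"
proof -
  interpret I: prob_space iid_paths by (rule prob_space_iid_paths)
  interpret mm: prob_space marginal by (rule prob_space_marginal)
  interpret mI: pair_prob_space marginal iid_paths ..
  have mes: "(\<lambda>(c, z). \<phi> (\<lambda>j\<in>{1..m}. if j = 1 then c else z j)) \<in> borel_measurable (borel \<Otimes>\<^sub>M path_space)"
    using measurable_compose[OF measurable_select_mixed[where J = "{1..m}" and a = 1 and i = "\<lambda>j. j"] kernel_measurable[OF \<phi>]]
    by (simp add: split_beta)
  have "integrable (marginal \<Otimes>\<^sub>M iid_paths) (\<lambda>(c, z). \<phi> (\<lambda>j\<in>{1..m}. if j = 1 then c else z j))"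
  proof (rule mI.P.integrable_const_bound[where B = 1])
    show "(\<lambda>(c, z). \<phi> (\<lambda>j\<in>{1..m}. if j = 1 then c else z j)) \<in> borel_measurable (marginal \<Otimes>\<^sub>M iid_paths)"
      using mes by (simp only: measurable_cong_sets[OF sets_pair_measure_cong[OF sets_marginal sets_iid_paths] refl])
  qed (use unit_kernelD[OF \<phi>] in auto)
  then have "(LINT c|marginal. projection m \<phi> c) = (LINT z|iid_paths. LINT c|marginal. \<phi> (\<lambda>j\<in>{1..m}. if j = 1 then c else z j))"
    unfolding projection_def by (rule mI.Fubini_integral[symmetric])
  also have "(\<lambda>z c. \<phi> (\<lambda>j\<in>{1..m}. if j = 1 then c else z j)) = (\<lambda>z c. \<phi> (\<lambda>j\<in>{1..m}. (z(1 := c)) j))"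
    by (intro ext arg_cong[where f = \<phi>]) (auto simp: restrict_def)
  also have "(LINT z|iid_paths. LINT c|marginal. \<phi> (\<lambda>j\<in>{1..m}. (z(1 := c)) j)) = theta m \<phi>"
    unfolding theta_def
    by (rule resample_coordinate[where F = "\<lambda>z. \<phi> (\<lambda>j\<in>{1..m}. z j)", OF _ unit_kernel_abs[OF \<phi>], symmetric])
      (rule measurable_compose[OF measurable_select[where J = "{1..m}" and i = "\<lambda>j. j"] kernel_measurable[OF \<phi>]])
  finally show ?thesis .
qed

text \<open>A transposition moves the kept argument to the first place.\<close>

lemma projection_any_coordinate:
  assumes \<phi>: "unit_kernel m \<phi>" and i: "inj_on i {1..m}" and a: "a \<in> {1..m}"
  shows "(LINT z|iid_paths. \<phi> (\<lambda>j\<in>{1..m}. if j = a then c else z (i j))) = projection m \<phi> c"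
proof -
  let ?J = "{1..m}" let ?\<pi> = "Transposition.transpose 1 a"
  have one: "1 \<in> ?J" using a by auto
  have perm: "?\<pi> permutes ?J" using one a by (rule permutes_swap_id)
  have upd: "(\<lambda>w. \<phi> (\<lambda>j\<in>?J. if j = b then c else w j)) \<in> borel_measurable (PiM ?J (\<lambda>_. borel))" for b
  proof (rule measurable_compose[OF _ kernel_measurable[OF \<phi>]])
    show "(\<lambda>w. \<lambda>j\<in>?J. if j = b then c else w j) \<in> PiM ?J (\<lambda>_. borel) \<rightarrow>\<^sub>M PiM ?J (\<lambda>_. borel)"
    proof (rule measurable_restrict)
      fix j assume "j \<in> ?J"
      then show "(\<lambda>w. if j = b then c else w j) \<in> borel_measurable (PiM ?J (\<lambda>_. borel))"
        by (cases "j = b") auto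
    qed
  qed
  have re: "(LINT z|iid_paths. \<phi> (\<lambda>j\<in>?J. if j = b then c else z (i j))) = (LINT z|iid_paths. \<phi> (\<lambda>j\<in>?J. if j = b then c else z j))"
    if "inj_on i ?J" for i b
  proof -
    have "(\<lambda>j\<in>?J. if j = b then c else (\<lambda>j\<in>?J. z (i j)) j) = (\<lambda>j\<in>?J. if j = b then c else z (i j))" for z :: "nat \<Rightarrow> real" and i
      by (auto simp: restrict_def)
    with iid_reindex[OF upd[of b] that] show ?thesis by (auto simp: restrict_def cong: if_cong)
  qed
  have "(LINT z|iid_paths. \<phi> (\<lambda>j\<in>?J. if j = a then c else z (i j))) = (LINT z|iid_paths. \<phi> (\<lambda>j\<in>?J. if j = a then c else z j))"
    by (rule re[OF i])
  also have "\<dots> = (LINT z|iid_paths. \<phi> (\<lambda>j\<in>?J. if j = 1 then c else z (?\<pi> j)))"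
  proof (rule Bochner_Integration.integral_cong[OF refl])
    fix z :: "nat \<Rightarrow> real"
    have "(\<lambda>j\<in>?J. if j = a then c else z j) \<circ> ?\<pi> = (\<lambda>j\<in>?J. if j = 1 then c else z (?\<pi> j))"
    proof
      fix j show "((\<lambda>j\<in>?J. if j = a then c else z j) \<circ> ?\<pi>) j = (\<lambda>j\<in>?J. if j = 1 then c else z (?\<pi> j)) j"
        using one a by (auto simp: restrict_def Transposition.transpose_def)
    qed
    then show "\<phi> (\<lambda>j\<in>?J. if j = a then c else z j) = \<phi> (\<lambda>j\<in>?J. if j = 1 then c else z (?\<pi> j))"
      using kernel_symmetric[OF \<phi> perm, of "\<lambda>j\<in>?J. if j = a then c else z j"] by (simp only: restrict_extensional)
  qed
  also have "\<dots> = (LINT z|iid_paths. \<phi> (\<lambda>j\<in>?J. if j = 1 then c else z j))"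
    by (rule re) (rule permutes_inj_on[OF perm])
  finally show ?thesis by (simp add: projection_def)
qed

lemma measurable_remainder[measurable (raw)]:
  assumes \<phi>: "unit_kernel m \<phi>"
  shows "remainder m \<phi> i \<in> borel_measurable path_space"
proof -
  note [measurable] = measurable_projection[OF \<phi>] measurable_compose[OF measurable_select[where J = "{1..m}" and i = i] kernel_measurable[OF \<phi>]]
  show ?thesis unfolding remainder_def by measurable
qed

lemma remainder_bounded:
  assumes \<phi>: "unit_kernel m \<phi>"
  shows "\<bar>remainder m \<phi> i x\<bar> \<le> real m + 1"
proof -
  have "\<bar>\<Sum>j\<in>{1..m}. projection m \<phi> (x (i j)) - theta m \<phi>\<bar> \<le> (\<Sum>j\<in>{1..m}. 1)"
  proof (intro order.trans[OF sum_abs] sum_mono)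
    fix j show "\<bar>projection m \<phi> (x (i j)) - theta m \<phi>\<bar> \<le> 1"
      using projection_unit[OF \<phi>, of "x (i j)"] theta_unit[OF \<phi>] by linarith
  qed
  then have "\<bar>\<Sum>j\<in>{1..m}. projection m \<phi> (x (i j)) - theta m \<phi>\<bar> \<le> real m" by simp
  moreover have "0 \<le> \<phi> (\<lambda>j\<in>{1..m}. x (i j))" "\<phi> (\<lambda>j\<in>{1..m}. x (i j)) \<le> 1" by (rule unit_kernelD[OF \<phi>])+
  ultimately show ?thesis unfolding remainder_def using theta_unit[OF \<phi>] by linarith
qed

lemma depends_on_remainder: "depends_on (remainder m \<phi> i) (i ` {1..m})"
  unfolding depends_on_def
proof (intro allI impI)
  fix x y :: "nat \<Rightarrow> real" assume eq: "\<forall>s\<in>i ` {1..m}. x s = y s"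
  have "(\<lambda>j\<in>{1..m}. x (i j)) = (\<lambda>j\<in>{1..m}. y (i j))" using eq by (auto simp: restrict_def)
  moreover have "(\<Sum>j\<in>{1..m}. projection m \<phi> (x (i j)) - theta m \<phi>) = (\<Sum>j\<in>{1..m}. projection m \<phi> (y (i j)) - theta m \<phi>)"
    using eq by (intro sum.cong) auto
  ultimately show "remainder m \<phi> i x = remainder m \<phi> i y" by (simp add: remainder_def)
qed

lemma projection_lipschitz:
  assumes \<phi>: "unit_kernel m \<phi>" and lip: "coordinate_lipschitz m \<Lambda> \<phi>" and "m \<ge> 1"
  shows "\<bar>projection m \<phi> c - projection m \<phi> c'\<bar> \<le> \<Lambda> * \<bar>c - c'\<bar>"
proof -
  interpret I: prob_space iid_paths by (rule prob_space_iid_paths)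
  note i = unit_kernel_bounds_integral(1)[OF \<phi> measurable_select_mixed2[where a = 1 and i = "\<lambda>j. j"]]
  have upd: "(\<lambda>j\<in>{1..m}. if j = 1 then c else z j) = (\<lambda>j\<in>{1..m}. z j)(1 := c)" for c and z :: "nat \<Rightarrow> real"
    using \<open>m \<ge> 1\<close> by (auto simp: restrict_def)
  have "\<bar>projection m \<phi> c - projection m \<phi> c'\<bar>
     = \<bar>LINT z|iid_paths. \<phi> (\<lambda>j\<in>{1..m}. if j = 1 then c else z j) - \<phi> (\<lambda>j\<in>{1..m}. if j = 1 then c' else z j)\<bar>"
    unfolding projection_def using i by simp
  also have "\<dots> \<le> (LINT z|iid_paths. \<bar>\<phi> (\<lambda>j\<in>{1..m}. if j = 1 then c else z j) - \<phi> (\<lambda>j\<in>{1..m}. if j = 1 then c' else z j)\<bar>)"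
    by (rule integral_abs_bound)
  also have "\<dots> \<le> (LINT z|iid_paths. \<Lambda> * \<bar>c - c'\<bar>)"
  proof (rule integral_mono)
    fix z :: "nat \<Rightarrow> real"
    show "\<bar>\<phi> (\<lambda>j\<in>{1..m}. if j = 1 then c else z j) - \<phi> (\<lambda>j\<in>{1..m}. if j = 1 then c' else z j)\<bar> \<le> \<Lambda> * \<bar>c - c'\<bar>"
      unfolding upd using lip \<open>m \<ge> 1\<close> unfolding coordinate_lipschitz_def by simp
  qed (use i in auto)
  finally show ?thesis by simp
qed

lemma lipschitz_at_remainder:
  assumes \<phi>: "unit_kernel m \<phi>" and lip: "coordinate_lipschitz m \<Lambda> \<phi>" and i: "inj_on i {1..m}" and m: "m \<ge> 1"
  shows "lipschitz_at s (2 * \<Lambda>) (remainder m \<phi> i)"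
  unfolding lipschitz_at_def
proof (intro allI)
  fix x :: "nat \<Rightarrow> real" and c c' :: real
  have "0 \<le> \<bar>projection m \<phi> 1 - projection m \<phi> 0\<bar>" by simp
  also have "\<dots> \<le> \<Lambda> * \<bar>1 - 0\<bar>" by (rule projection_lipschitz[OF \<phi> lip m])
  finally have \<Lambda>0: "\<Lambda> \<ge> 0" by simp
  show "\<bar>remainder m \<phi> i (x(s := c)) - remainder m \<phi> i (x(s := c'))\<bar> \<le> 2 * \<Lambda> * \<bar>c - c'\<bar>"
  proof (cases "s \<in> i ` {1..m}")
    case False
    then have "remainder m \<phi> i (x(s := c)) = remainder m \<phi> i (x(s := c'))"
      by (intro depends_onD[OF depends_on_remainder]) auto
    then show ?thesis using \<Lambda>0 by simp
  next
    case True
    then obtain a where a: "a \<in> {1..m}" "s = i a" by auto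
    have ij: "i j = s \<longleftrightarrow> j = a" if "j \<in> {1..m}" for j unfolding a(2) by (rule inj_on_eq_iff[OF i that a(1)])
    have tup: "(\<lambda>j\<in>{1..m}. (x(s := c)) (i j)) = (\<lambda>j\<in>{1..m}. x (i j))(a := c)" for c
    proof
      fix j
      have "(x(s := c)) (i j) = (if j = a then c else x (i j))" if "j \<in> {1..m}" using ij[OF that] by simp
      then show "(\<lambda>j\<in>{1..m}. (x(s := c)) (i j)) j = ((\<lambda>j\<in>{1..m}. x (i j))(a := c)) j"
        using a(1) by (cases "j \<in> {1..m}") auto
    qed
    have k: "\<bar>\<phi> (\<lambda>j\<in>{1..m}. (x(s := c)) (i j)) - \<phi> (\<lambda>j\<in>{1..m}. (x(s := c')) (i j))\<bar> \<le> \<Lambda> * \<bar>c - c'\<bar>"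
      unfolding tup using lip a unfolding coordinate_lipschitz_def by simp
    have p: "(\<Sum>j\<in>{1..m}. projection m \<phi> ((x(s := c)) (i j)) - theta m \<phi>)
        = projection m \<phi> c - theta m \<phi> + (\<Sum>j\<in>{1..m} - {a}. projection m \<phi> (x (i j)) - theta m \<phi>)" for c
    proof -
      have "(x(s := c)) (i j) = (if j = a then c else x (i j))" if "j \<in> {1..m}" for j using ij[OF that] by simp
      then have "(\<Sum>j\<in>{1..m}. projection m \<phi> ((x(s := c)) (i j)) - theta m \<phi>)
          = (\<Sum>j\<in>{1..m}. projection m \<phi> (if j = a then c else x (i j)) - theta m \<phi>)"
        by (intro sum.cong refl) simp
      also have "\<dots> = projection m \<phi> c - theta m \<phi> + (\<Sum>j\<in>{1..m} - {a}. projection m \<phi> (if j = a then c else x (i j)) - theta m \<phi>)"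
        using a(1) by (subst sum.remove[of _ a]) simp_all
      also have "(\<Sum>j\<in>{1..m} - {a}. projection m \<phi> (if j = a then c else x (i j)) - theta m \<phi>)
          = (\<Sum>j\<in>{1..m} - {a}. projection m \<phi> (x (i j)) - theta m \<phi>)"
        by (intro sum.cong refl) simp
      finally show ?thesis .
    qed
    have "remainder m \<phi> i (x(s := c)) - remainder m \<phi> i (x(s := c'))
       = (\<phi> (\<lambda>j\<in>{1..m}. (x(s := c)) (i j)) - \<phi> (\<lambda>j\<in>{1..m}. (x(s := c')) (i j))) - (projection m \<phi> c - projection m \<phi> c')"
      unfolding remainder_def p by simp
    then show ?thesis using k projection_lipschitz[OF \<phi> lip m, of c c'] by linarith
  qed
qed

text \<open>Degeneracy: averaging out all coordinates but the \<open>a\<close>-th turns the kernel into its projection at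
  that coordinate, which is the only term of the projection sum that survives.\<close>

lemma remainder_degenerate:
  assumes \<phi>: "unit_kernel m \<phi>" and i: "inj_on i {1..m}" and a: "a \<in> {1..m}"
  shows "integrate_out (i ` {1..m} - {i a}) (remainder m \<phi> i) x = 0"
proof -
  let ?S = "i ` {1..m} - {i a}" and ?J = "{1..m}"
  have coord: "override_on x z ?S (i j) = (if j = a then x (i a) else z (i j))" if "j \<in> ?J" for z j
    using that inj_on_eq_iff[OF i that a] by (auto simp: override_on_def)
  have tup: "(\<lambda>j\<in>?J. override_on x z ?S (i j)) = (\<lambda>j\<in>?J. if j = a then x (i a) else z (i j))" for z
    using coord by (intro restrict_ext) simp
  have pj: "(\<Sum>j\<in>?J. projection m \<phi> (override_on x z ?S (i j)) - theta m \<phi>)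
     = projection m \<phi> (x (i a)) - theta m \<phi> + (\<Sum>j\<in>?J - {a}. projection m \<phi> (z (i j)) - theta m \<phi>)" for z
  proof -
    have "(\<Sum>j\<in>?J. projection m \<phi> (override_on x z ?S (i j)) - theta m \<phi>)
        = (\<Sum>j\<in>?J. projection m \<phi> (if j = a then x (i a) else z (i j)) - theta m \<phi>)"
      by (intro sum.cong refl) (simp only: coord)
    also have "\<dots> = projection m \<phi> (x (i a)) - theta m \<phi> + (\<Sum>j\<in>?J - {a}. projection m \<phi> (if j = a then x (i a) else z (i j)) - theta m \<phi>)"
      using a by (subst sum.remove[of _ a]) simp_all
    also have "(\<Sum>j\<in>?J - {a}. projection m \<phi> (if j = a then x (i a) else z (i j)) - theta m \<phi>)
        = (\<Sum>j\<in>?J - {a}. projection m \<phi> (z (i j)) - theta m \<phi>)"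
      by (intro sum.cong refl) simp
    finally show ?thesis .
  qed
  note [measurable] = measurable_projection[OF \<phi>]
  have pb: "\<bar>projection m \<phi> c\<bar> \<le> 1" for c using projection_unit[OF \<phi>, of c] by auto
  have ip: "integrable iid_paths (\<lambda>z. projection m \<phi> (z s))" for s
    by (rule integrable_iid_bounded[where B = 1]) (auto simp: pb)
  have ik: "integrable iid_paths (\<lambda>z. \<phi> (\<lambda>j\<in>?J. if j = a then x (i a) else z (i j)))"
    by (rule unit_kernel_bounds_integral(1)[OF \<phi>]) measurable
  have m1: "m \<ge> 1" using a by auto
  have E: "(LINT z|iid_paths. projection m \<phi> (z s)) = theta m \<phi>" for s
    using iid_coordinate[of "projection m \<phi>" 1 s] theta_eq_integral_projection[OF \<phi> m1] pb by simp
  have "integrate_out ?S (remainder m \<phi> i) x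
     = (LINT z|iid_paths. \<phi> (\<lambda>j\<in>?J. if j = a then x (i a) else z (i j)) - theta m \<phi>
         - (projection m \<phi> (x (i a)) - theta m \<phi> + (\<Sum>j\<in>?J - {a}. projection m \<phi> (z (i j)) - theta m \<phi>)))"
    unfolding integrate_out_def remainder_def tup pj ..
  also have "\<dots> = (LINT z|iid_paths. \<phi> (\<lambda>j\<in>?J. if j = a then x (i a) else z (i j))) - theta m \<phi>
         - (projection m \<phi> (x (i a)) - theta m \<phi> + (\<Sum>j\<in>?J - {a}. (LINT z|iid_paths. projection m \<phi> (z (i j))) - theta m \<phi>))"
  proof -
    interpret I: prob_space iid_paths by (rule prob_space_iid_paths)
    show ?thesis using ik ip by (simp add: Bochner_Integration.integral_sum)
  qed
  also have "\<dots> = 0"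
    unfolding projection_any_coordinate[OF \<phi> i a] E by simp
  finally show ?thesis .
qed

end

lemma gap_commute: "gap x y = gap y x"
  by (simp add: gap_def)

lemma gap_triangle: "gap x z \<le> gap x y + gap y z"
  by (auto simp: gap_def)

context mixing_process
begin

lemma lipschitz_at_nonneg: "lipschitz_at s \<Lambda> F \<Longrightarrow> 0 \<le> \<Lambda>"
  unfolding lipschitz_at_def by (drule spec[of _ undefined], drule spec[of _ 1], drule spec[of _ 0]) auto

lemma lipschitz_at_mult:
  assumes F: "lipschitz_at s \<Lambda> F" "\<And>x. \<bar>F x\<bar> \<le> B" and G: "lipschitz_at s \<Lambda> G" "\<And>x. \<bar>G x\<bar> \<le> B"
  shows "lipschitz_at s (2 * B * \<Lambda>) (\<lambda>x. F x * G x)"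
  unfolding lipschitz_at_def
proof (intro allI)
  fix x :: "nat \<Rightarrow> real" and c c' :: real
  let ?x = "x(s := c)" and ?y = "x(s := c')"
  have B0: "B \<ge> 0" using F(2)[of undefined] by simp
  have "F ?x * G ?x - F ?y * G ?y = (F ?x - F ?y) * G ?x + F ?y * (G ?x - G ?y)" by (simp add: algebra_simps)
  then have "\<bar>F ?x * G ?x - F ?y * G ?y\<bar> \<le> \<bar>F ?x - F ?y\<bar> * \<bar>G ?x\<bar> + \<bar>F ?y\<bar> * \<bar>G ?x - G ?y\<bar>"
    by (metis abs_mult abs_triangle_ineq)
  also have "\<dots> \<le> (\<Lambda> * \<bar>c - c'\<bar>) * B + B * (\<Lambda> * \<bar>c - c'\<bar>)"
    using F G B0 lipschitz_at_nonneg[OF F(1)] unfolding lipschitz_at_def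
    by (intro add_mono mult_mono) auto
  finally show "\<bar>F ?x * G ?x - F ?y * G ?y\<bar> \<le> 2 * B * \<Lambda> * \<bar>c - c'\<bar>" by (simp add: mult_ac)
qed

lemma decoupling_error_nonneg: "B \<ge> 0 \<Longrightarrow> \<Lambda> \<ge> 0 \<Longrightarrow> \<eta> > 0 \<Longrightarrow> N > 0 \<Longrightarrow> 0 \<le> decoupling_error B \<Lambda> l \<eta> N"
  unfolding decoupling_error_def tail_prob_def using mixing_coeff_nonneg by (intro add_nonneg_nonneg mult_nonneg_nonneg) auto

text \<open>As neither tuple is clustered at scale \<open>2 * l\<close>, an index is within \<open>l\<close> of at most one index of the other
  tuple, and as the tuples are not doubly close there is at most one such pair. Everything outside
  of this pair can be decoupled, and then the remainder of the first tuple, with all but one of its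
  coordinates averaged out, vanishes by degeneracy.\<close>

lemma remainder_product_small:
  assumes \<phi>: "unit_kernel m \<phi>" and lip: "coordinate_lipschitz m \<Lambda> \<phi>" and m: "m \<ge> 1" and l: "l \<ge> 1"
    and i: "i \<in> tuples m n" "i' \<in> tuples m n"
    and sep: "\<not> clustered m (2 * l) i" "\<not> clustered m (2 * l) i'" "\<not> doubly_close m l i i'"
    and \<eta>: "\<eta> > 0" and N: "N > 0"
  shows "\<bar>expectation (\<lambda>\<omega>. remainder m \<phi> i (path \<omega>) * remainder m \<phi> i' (path \<omega>))\<bar>
    \<le> 2 * real m * decoupling_error ((real m + 1)\<^sup>2) (4 * (real m + 1) * \<Lambda>) l \<eta> N"
proof -
  let ?J = "{1..m}"
  define A A' where "A = i ` ?J" and "A' = i' ` ?J"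
  let ?G = "remainder m \<phi> i" and ?G' = "remainder m \<phi> i'"
  let ?F = "\<lambda>x. ?G x * ?G' x"
  have inj: "inj_on i ?J" "inj_on i' ?J" using i tuples_inj by auto
  have fin: "finite (A \<union> A')" by (simp add: A_def A'_def)
  have ge1: "A \<union> A' \<subseteq> {1..}" using i tuples_range by (fastforce simp: A_def A'_def)
  have sepA: "2 * l \<le> gap (i a) (i b)" if "a \<in> ?J" "b \<in> ?J" "a \<noteq> b" for a b
    using sep(1) that unfolding clustered_def by (meson not_less)
  have sepA': "2 * l \<le> gap (i' a) (i' b)" if "a \<in> ?J" "b \<in> ?J" "a \<noteq> b" for a b
    using sep(2) that unfolding clustered_def by (meson not_less)
  have one_b: "b = b'" if "a \<in> ?J" "a' \<in> ?J" "b \<in> ?J" "b' \<in> ?J" "gap (i a) (i' b) < l" "gap (i a') (i' b') < l" for a a' b b'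
    using sep(3) that unfolding doubly_close_def by blast
  have one_a: "a = a'" if "a \<in> ?J" "a' \<in> ?J" "b \<in> ?J" "gap (i a) (i' b) < l" "gap (i a') (i' b) < l" for a a' b
  proof (rule ccontr)
    assume "a \<noteq> a'"
    then have "2 * l \<le> gap (i a) (i a')" using that by (intro sepA)
    also have "\<dots> \<le> gap (i a) (i' b) + gap (i a') (i' b)"
      using gap_triangle[of "i a" "i a'" "i' b"] by (simp add: gap_commute)
    finally show False using that by linarith
  qed
  \<comment> \<open>The core is the close pair if there is one, and a single index of \<open>i\<close> otherwise.\<close>
  obtain a C where a: "a \<in> ?J" and C: "C \<subseteq> A \<union> A'" "i a \<in> C" "A \<inter> C = {i a}"
    and core: "\<And>s t. s \<in> C \<Longrightarrow> t \<in> C \<Longrightarrow> gap s t < l"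
    and cross: "\<And>a' b'. a' \<in> ?J \<Longrightarrow> b' \<in> ?J \<Longrightarrow> gap (i a') (i' b') < l \<Longrightarrow> i a' \<in> C \<and> i' b' \<in> C"
  proof (cases "\<exists>a\<in>?J. \<exists>b\<in>?J. gap (i a) (i' b) < l")
    case True
    then obtain a b where ab: "a \<in> ?J" "b \<in> ?J" "gap (i a) (i' b) < l" by auto
    show ?thesis
    proof (rule that[of a "{i a, i' b}"])
      show "A \<inter> {i a, i' b} = {i a}"
      proof -
        have "i' b = i a" if bA: "i' b \<in> A"
        proof -
          obtain a' where a': "a' \<in> ?J" "i' b = i a'" using bA by (auto simp: A_def)
          then have "gap (i a') (i' b) < l" using l by (simp add: gap_def)
          then have "a = a'" using ab a' by (intro one_a[of a a' b]) auto
          then show ?thesis using a' by simp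
        qed
        moreover have "i a \<in> A" using ab by (simp add: A_def)
        ultimately show ?thesis by blast
      qed
      show "gap s t < l" if "s \<in> {i a, i' b}" "t \<in> {i a, i' b}" for s t
      proof -
        have "gap x x = 0" for x by (simp add: gap_def)
        then show ?thesis using that ab l by (auto simp: gap_commute)
      qed
      show "i a' \<in> {i a, i' b} \<and> i' b' \<in> {i a, i' b}" if "a' \<in> ?J" "b' \<in> ?J" "gap (i a') (i' b') < l" for a' b'
      proof -
        have bb: "b = b'" using that ab by (intro one_b[of a a']) auto
        then have "a = a'" using that ab by (intro one_a[of a a' b]) auto
        with bb show ?thesis by simp
      qed
    qed (use ab in \<open>auto simp: A_def A'_def\<close>)
  next
    case False
    show ?thesis
    proof (rule that[of 1 "{i 1}"])
      show "gap s t < l" if "s \<in> {i 1}" "t \<in> {i 1}" for s t using that l by (simp add: gap_def)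
      show "i a' \<in> {i 1} \<and> i' b' \<in> {i 1}" if "a' \<in> ?J" "b' \<in> ?J" "gap (i a') (i' b') < l" for a' b'
        using False that by blast
    qed (use m in \<open>auto simp: A_def\<close>)
  qed
  have far: "l \<le> gap s t" if s: "s \<in> (A \<union> A') - C" and t: "t \<in> A \<union> A'" and ne: "t \<noteq> s" for s t
  proof (rule ccontr)
    assume "\<not> l \<le> gap s t"
    then have close: "gap s t < l" "gap t s < l" by (auto simp: gap_commute)
    consider (AA) a b where "a \<in> ?J" "b \<in> ?J" "s = i a" "t = i b" | (BB) a b where "a \<in> ?J" "b \<in> ?J" "s = i' a" "t = i' b"
      | (AB) a b where "a \<in> ?J" "b \<in> ?J" "s = i a" "t = i' b" | (BA) a b where "a \<in> ?J" "b \<in> ?J" "s = i' b" "t = i a"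
      using s t by (auto simp: A_def A'_def)
    then show False
    proof cases
      case AA then have "a \<noteq> b" using ne by auto
      with AA have "2 * l \<le> gap s t" using sepA by simp
      then show False using close by simp
    next
      case BB then have "a \<noteq> b" using ne by auto
      with BB have "2 * l \<le> gap s t" using sepA' by simp
      then show False using close by simp
    next
      case AB then show False using cross[of a b] close s by auto
    next
      case BA then show False using cross[of a b] close s by auto
    qed
  qed
  note Gm[measurable] = measurable_remainder[OF \<phi>]
  note Gb = remainder_bounded[OF \<phi>]
  have Fm: "?F \<in> borel_measurable path_space" by measurable
  have Fb: "\<bar>?F x\<bar> \<le> (real m + 1)\<^sup>2" for x
    unfolding abs_mult power2_eq_square by (intro mult_mono Gb) auto
  have dep: "depends_on ?F (A \<union> A')"
  proof -
    have "depends_on ?G (A \<union> A')" "depends_on ?G' (A \<union> A')"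
      unfolding A_def A'_def by (rule depends_on_mono[OF depends_on_remainder], simp)+
    then show ?thesis unfolding depends_on_def by metis
  qed
  have lipF: "lipschitz_at s (4 * (real m + 1) * \<Lambda>) ?F" for s
    using lipschitz_at_mult[OF lipschitz_at_remainder[OF \<phi> lip inj(1) m, of s] Gb lipschitz_at_remainder[OF \<phi> lip inj(2) m, of s] Gb]
    by (simp add: mult_ac)
  have \<Lambda>0: "0 \<le> \<Lambda>" using lipschitz_at_nonneg[OF lipschitz_at_remainder[OF \<phi> lip inj(1) m]] by simp
  have zero: "integrate_out ((A \<union> A') - C) ?F = (\<lambda>_. 0)"
  proof -
    let ?T = "A - C" let ?S = "(A' - C) - ?T"
    have T: "?T = i ` ?J - {i a}" using C(3) by (auto simp: A_def)
    have "integrate_out ?T ?F x = 0" for x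
    proof -
      have "A' \<inter> ?T = {}"
      proof (rule ccontr)
        assume "A' \<inter> ?T \<noteq> {}"
        then obtain s where s: "s \<in> A" "s \<in> A'" "s \<notin> C" by blast
        obtain a' where "a' \<in> ?J" "s = i a'" using s(1) unfolding A_def by blast
        moreover obtain b' where "b' \<in> ?J" "s = i' b'" using s(2) unfolding A'_def by blast
        ultimately have "a' \<in> ?J" "b' \<in> ?J" "i a' = i' b'" "i a' \<notin> C" using s(3) by auto
        then show False using cross[of a' b'] l by (simp add: gap_def)
      qed
      then have "integrate_out ?T ?F x = integrate_out ?T ?G x * ?G' x"
        by (intro integrate_out_mult[OF depends_on_remainder]) (simp add: A'_def)
      also have "integrate_out ?T ?G x = 0" unfolding T by (rule remainder_degenerate[OF \<phi> inj(1) a])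
      finally show ?thesis by simp
    qed
    then have "integrate_out ?T ?F = (\<lambda>_. 0)" by auto
    then have "integrate_out ?S (integrate_out ?T ?F) = (\<lambda>_. 0)" by (simp add: integrate_out_def fun_eq_iff)
    moreover have "integrate_out ?S (integrate_out ?T ?F) = integrate_out (?S \<union> ?T) ?F"
      by (rule integrate_out_union[OF _ _ Fm Fb]) (auto simp: A_def)
    moreover have "?S \<union> ?T = (A \<union> A') - C" by auto
    ultimately show ?thesis by simp
  qed
  have "\<bar>expectation (\<lambda>\<omega>. ?F (path \<omega>)) - expectation (\<lambda>\<omega>. integrate_out ((A \<union> A') - C) ?F (path \<omega>))\<bar>
    \<le> real (card ((A \<union> A') - C)) * decoupling_error ((real m + 1)\<^sup>2) (4 * (real m + 1) * \<Lambda>) l \<eta> N"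
    by (rule decouple_all_but_core[OF fin ge1 C(1) Fm Fb dep far core lipF \<eta> N])
  also have "\<dots> \<le> (2 * real m) * decoupling_error ((real m + 1)\<^sup>2) (4 * (real m + 1) * \<Lambda>) l \<eta> N"
  proof (intro mult_right_mono decoupling_error_nonneg \<eta> N)
    have "card ((A \<union> A') - C) \<le> card (A \<union> A')" by (rule card_mono[OF fin]) auto
    also have "\<dots> \<le> card A + card A'" by (rule card_Un_le)
    also have "\<dots> \<le> m + m" unfolding A_def A'_def by (intro add_mono order.trans[OF card_image_le]) auto
    finally show "real (card ((A \<union> A') - C)) \<le> 2 * real m" by linarith
  qed (use \<Lambda>0 in auto)
  finally show ?thesis unfolding zero by simp
qed

lemma U_statistic_decomposition:
  assumes "m \<ge> 1" "m \<le> n"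
  shows "(\<Sum>i\<in>tuples m n. remainder m \<phi> i (path \<omega>)) / real (n choose m)
    = (\<Sum>i\<in>tuples m n. \<phi> (\<lambda>j\<in>{1..m}. X (i j) \<omega>)) / real (n choose m) - theta m \<phi>
      - real m / real n * (\<Sum>s\<in>{1..n}. projection m \<phi> (X s \<omega>) - theta m \<phi>)"
proof -
  have c: "real (n choose m) > 0" using assms by simp
  have r: "remainder m \<phi> i (path \<omega>) = \<phi> (\<lambda>j\<in>{1..m}. X (i j) \<omega>) - theta m \<phi>
      - (\<Sum>j\<in>{1..m}. projection m \<phi> (X (i j) \<omega>) - theta m \<phi>)" if "i \<in> tuples m n" for i
  proof -
    have p: "path \<omega> (i j) = X (i j) \<omega>" if "j \<in> {1..m}" for j
      using tuples_range[OF \<open>i \<in> tuples m n\<close> that] by (simp add: path_apply)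
    have "(\<lambda>j\<in>{1..m}. path \<omega> (i j)) = (\<lambda>j\<in>{1..m}. X (i j) \<omega>)" using p by (intro restrict_ext)
    moreover have "(\<Sum>j\<in>{1..m}. projection m \<phi> (path \<omega> (i j)) - theta m \<phi>) = (\<Sum>j\<in>{1..m}. projection m \<phi> (X (i j) \<omega>) - theta m \<phi>)"
      by (intro sum.cong refl) (simp only: p)
    ultimately show ?thesis unfolding remainder_def by simp
  qed
  have "(\<Sum>i\<in>tuples m n. remainder m \<phi> i (path \<omega>)) / real (n choose m)
     = (\<Sum>i\<in>tuples m n. \<phi> (\<lambda>j\<in>{1..m}. X (i j) \<omega>)) / real (n choose m)
       - real (n choose m) * theta m \<phi> / real (n choose m)
       - (\<Sum>i\<in>tuples m n. \<Sum>j\<in>{1..m}. projection m \<phi> (X (i j) \<omega>) - theta m \<phi>) / real (n choose m)"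
    by (simp add: r sum_subtractf card_tuples diff_divide_distrib)
  then show ?thesis
    using c sum_tuples_linear[OF assms, of "\<lambda>s. projection m \<phi> (X s \<omega>) - theta m \<phi>"] by simp
qed

definition linearization_const :: "nat \<Rightarrow> real" where
  "linearization_const m = 2 * ((real m + 1)\<^sup>2 * (4 * real m ^ (2 * m + 4)) + ((real m + 1) * (4 * real m ^ (m + 2)))\<^sup>2)"

text \<open>Clustered tuples form a fraction of order \<open>l / n\<close> and are bounded deterministically; the same
  holds for doubly close pairs with the fraction \<open>(l / n)\<^sup>2\<close>. All other pairs fall under
  \<open>remainder_product_small\<close>.\<close>

lemma linearization_second_moment:
  assumes \<phi>: "unit_kernel m \<phi>" and lip: "coordinate_lipschitz m \<Lambda> \<phi>" and m: "m \<ge> 1" "m \<le> n" and l: "l \<ge> 1"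
    and \<eta>: "\<eta> > 0" and N: "N > 0"
  shows "expectation (\<lambda>\<omega>. ((\<Sum>i\<in>tuples m n. \<phi> (\<lambda>j\<in>{1..m}. X (i j) \<omega>)) / real (n choose m) - theta m \<phi>
      - real m / real n * (\<Sum>s\<in>{1..n}. projection m \<phi> (X s \<omega>) - theta m \<phi>))\<^sup>2)
    \<le> linearization_const m * (real l / real n)\<^sup>2
      + 4 * real m * decoupling_error ((real m + 1)\<^sup>2) (4 * (real m + 1) * \<Lambda>) l \<eta> N"
proof -
  let ?R = "\<lambda>i \<omega>. remainder m \<phi> i (path \<omega>)" let ?c = "real (n choose m)"
  let ?B = "real m + 1"
  let ?err = "decoupling_error (?B\<^sup>2) (4 * ?B * \<Lambda>) l \<eta> N"
  have c: "?c > 0" using m by simp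
  define Bad where "Bad = {i \<in> tuples m n. clustered m (2 * l) i}"
  define Good where "Good = tuples m n - Bad"
  have fin: "finite Good" "finite Bad" unfolding Good_def Bad_def by auto
  note Rb = remainder_bounded[OF \<phi>]
  note [measurable] = measurable_remainder[OF \<phi>]
  have \<Lambda>0: "0 \<le> \<Lambda>"
  proof -
    have "0 \<le> \<bar>projection m \<phi> 1 - projection m \<phi> 0\<bar>" by simp
    also have "\<dots> \<le> \<Lambda> * \<bar>1 - 0\<bar>" by (rule projection_lipschitz[OF \<phi> lip m(1)])
    finally show ?thesis by simp
  qed
  have err0: "0 \<le> ?err" using \<Lambda>0 by (intro decoupling_error_nonneg \<eta> N) auto
  have iRR: "integrable M (\<lambda>\<omega>. ?R i \<omega> * ?R i' \<omega>)" for i i'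
    by (rule integrable_bounded_path[where b = "?B * ?B" and F = "\<lambda>x. remainder m \<phi> i x * remainder m \<phi> i' x"])
      (auto simp: abs_mult intro!: mult_mono Rb)
  have RRb: "expectation (\<lambda>\<omega>. ?R i \<omega> * ?R i' \<omega>) \<le> ?B\<^sup>2" for i i'
  proof -
    have "expectation (\<lambda>\<omega>. ?R i \<omega> * ?R i' \<omega>) \<le> expectation (\<lambda>\<omega>. ?B\<^sup>2)"
    proof (rule integral_mono[OF iRR])
      fix \<omega>
      have "?R i \<omega> * ?R i' \<omega> \<le> \<bar>?R i \<omega>\<bar> * \<bar>?R i' \<omega>\<bar>" by (metis abs_ge_self abs_mult)
      also have "\<dots> \<le> ?B * ?B" by (intro mult_mono Rb) auto
      finally show "?R i \<omega> * ?R i' \<omega> \<le> ?B\<^sup>2" by (simp add: power2_eq_square)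
    qed auto
    then show ?thesis by (simp add: prob_space)
  qed
  let ?DC = "{(i, i') \<in> tuples m n \<times> tuples m n. doubly_close m l i i'}"
  have finDC: "finite ?DC" by (rule finite_subset[of _ "tuples m n \<times> tuples m n"]) auto
  have good: "expectation (\<lambda>\<omega>. (\<Sum>i\<in>Good. ?R i \<omega>)\<^sup>2) \<le> real (card ?DC) * ?B\<^sup>2 + ?c\<^sup>2 * (2 * real m * ?err)"
  proof -
    have "expectation (\<lambda>\<omega>. (\<Sum>i\<in>Good. ?R i \<omega>)\<^sup>2) = expectation (\<lambda>\<omega>. \<Sum>p\<in>Good \<times> Good. ?R (fst p) \<omega> * ?R (snd p) \<omega>)"
      by (simp add: power2_eq_square sum_product sum.cartesian_product split_beta)
    also have "\<dots> = (\<Sum>p\<in>Good \<times> Good. expectation (\<lambda>\<omega>. ?R (fst p) \<omega> * ?R (snd p) \<omega>))"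
      by (intro Bochner_Integration.integral_sum iRR)
    also have "\<dots> \<le> (\<Sum>p\<in>Good \<times> Good. of_bool (p \<in> ?DC) * ?B\<^sup>2 + 2 * real m * ?err)"
    proof (rule sum_mono)
      fix p assume p: "p \<in> Good \<times> Good"
      show "expectation (\<lambda>\<omega>. ?R (fst p) \<omega> * ?R (snd p) \<omega>) \<le> of_bool (p \<in> ?DC) * ?B\<^sup>2 + 2 * real m * ?err"
      proof (cases "p \<in> ?DC")
        case True
        then show ?thesis using RRb[of "fst p" "snd p"] err0 by (simp add: add_increasing2)
      next
        case False
        then have nd: "\<not> doubly_close m l (fst p) (snd p)" using p by (auto simp: Good_def)
        have "\<bar>expectation (\<lambda>\<omega>. ?R (fst p) \<omega> * ?R (snd p) \<omega>)\<bar> \<le> 2 * real m * ?err"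
          using p nd by (intro remainder_product_small[OF \<phi> lip m(1) l _ _ _ _ _ \<eta> N, of _ n]) (auto simp: Good_def Bad_def)
        then show ?thesis using False by simp
      qed
    qed
    also have "\<dots> = (\<Sum>p\<in>Good \<times> Good. of_bool (p \<in> ?DC) * ?B\<^sup>2) + real (card (Good \<times> Good)) * (2 * real m * ?err)"
      by (simp add: sum.distrib)
    also have "(\<Sum>p\<in>Good \<times> Good. of_bool (p \<in> ?DC) * ?B\<^sup>2) = real (card ((Good \<times> Good) \<inter> ?DC)) * ?B\<^sup>2"
      using fin by (simp add: sum_distrib_right[symmetric] of_bool_def sum.If_cases Int_def)
    also have "\<dots> \<le> real (card ?DC) * ?B\<^sup>2"
      using finDC by (intro mult_right_mono of_nat_mono card_mono) auto
    also have "real (card (Good \<times> Good)) * (2 * real m * ?err) \<le> ?c\<^sup>2 * (2 * real m * ?err)"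
    proof (intro mult_right_mono)
      have "card Good \<le> n choose m" unfolding card_tuples[symmetric] Good_def by (intro card_mono) auto
      then have "card (Good \<times> Good) \<le> (n choose m)\<^sup>2" by (simp add: card_cartesian_product power2_eq_square mult_le_mono)
      then show "real (card (Good \<times> Good)) \<le> ?c\<^sup>2" by (metis of_nat_mono of_nat_power)
    qed (use err0 in auto)
    finally show ?thesis by simp
  qed
  let ?bad = "(real (card Bad) / ?c) * ?B"
  have badle: "\<bar>(\<Sum>i\<in>Bad. ?R i \<omega>) / ?c\<bar> \<le> ?bad" for \<omega>
  proof -
    have "\<bar>\<Sum>i\<in>Bad. ?R i \<omega>\<bar> \<le> (\<Sum>i\<in>Bad. ?B)" by (intro order.trans[OF sum_abs] sum_mono Rb)
    then show ?thesis using c by (simp add: abs_divide divide_right_mono)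
  qed
  have iG: "integrable M (\<lambda>\<omega>. (\<Sum>i\<in>Good. ?R i \<omega>)\<^sup>2)"
    unfolding power2_eq_square sum_product by (intro Bochner_Integration.integrable_sum iRR)
  have iT: "integrable M (\<lambda>\<omega>. ((\<Sum>i\<in>tuples m n. ?R i \<omega>) / ?c)\<^sup>2)"
    unfolding power_divide unfolding power2_eq_square sum_product by (intro integrable_divide Bochner_Integration.integrable_sum iRR)
  have "expectation (\<lambda>\<omega>. ((\<Sum>i\<in>tuples m n. ?R i \<omega>) / ?c)\<^sup>2)
     \<le> expectation (\<lambda>\<omega>. 2 * ((\<Sum>i\<in>Good. ?R i \<omega>)\<^sup>2 / ?c\<^sup>2) + 2 * ?bad\<^sup>2)"
  proof (rule integral_mono[OF iT])
    fix \<omega>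
    have "(\<Sum>i\<in>tuples m n. ?R i \<omega>) = (\<Sum>i\<in>Good. ?R i \<omega>) + (\<Sum>i\<in>Bad. ?R i \<omega>)"
      unfolding Good_def by (rule sum.subset_diff) (auto simp: Bad_def)
    then have "((\<Sum>i\<in>tuples m n. ?R i \<omega>) / ?c)\<^sup>2 = ((\<Sum>i\<in>Good. ?R i \<omega>) / ?c + (\<Sum>i\<in>Bad. ?R i \<omega>) / ?c)\<^sup>2"
      by (simp add: add_divide_distrib)
    also have "\<dots> \<le> 2 * ((\<Sum>i\<in>Good. ?R i \<omega>) / ?c)\<^sup>2 + 2 * ((\<Sum>i\<in>Bad. ?R i \<omega>) / ?c)\<^sup>2"
      by (rule square_sum_le)
    also have "((\<Sum>i\<in>Bad. ?R i \<omega>) / ?c)\<^sup>2 \<le> ?bad\<^sup>2"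
      using power_mono[OF badle[of \<omega>] abs_ge_zero, of 2] by (simp only: power2_abs)
    finally show "((\<Sum>i\<in>tuples m n. ?R i \<omega>) / ?c)\<^sup>2 \<le> 2 * ((\<Sum>i\<in>Good. ?R i \<omega>)\<^sup>2 / ?c\<^sup>2) + 2 * ?bad\<^sup>2"
      by (simp add: power_divide)
  qed (use iG in auto)
  also have "\<dots> = 2 * (expectation (\<lambda>\<omega>. (\<Sum>i\<in>Good. ?R i \<omega>)\<^sup>2) / ?c\<^sup>2) + 2 * ?bad\<^sup>2"
    using iG by (simp add: prob_space)
  also have "\<dots> \<le> 2 * ((real (card ?DC) * ?B\<^sup>2 + ?c\<^sup>2 * (2 * real m * ?err)) / ?c\<^sup>2) + 2 * ?bad\<^sup>2"
    by (intro add_mono mult_left_mono divide_right_mono good) auto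
  also have "(real (card ?DC) * ?B\<^sup>2 + ?c\<^sup>2 * (2 * real m * ?err)) / ?c\<^sup>2 = (real (card ?DC) / ?c\<^sup>2) * ?B\<^sup>2 + 2 * real m * ?err"
    using c by (simp add: add_divide_distrib)
  also have "2 * ((real (card ?DC) / ?c\<^sup>2) * ?B\<^sup>2 + 2 * real m * ?err) + 2 * ?bad\<^sup>2
     \<le> 2 * ((4 * real m ^ (2 * m + 4) * (real l / real n)\<^sup>2) * ?B\<^sup>2 + 2 * real m * ?err)
       + 2 * ((2 * real m ^ (m + 2) * (real (2 * l) / real n)) * ?B)\<^sup>2"
    unfolding Bad_def
    by (intro add_mono mult_left_mono power_mono mult_right_mono order_refl doubly_close_fraction clustered_fraction m) auto
  also have "\<dots> = linearization_const m * (real l / real n)\<^sup>2 + 4 * real m * ?err"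
  proof -
    have gen: "2 * ((4 * P * x\<^sup>2) * B\<^sup>2 + 2 * r * E) + 2 * ((2 * Q * (2 * x)) * B)\<^sup>2
        = 2 * (B\<^sup>2 * (4 * P) + (B * (4 * Q))\<^sup>2) * x\<^sup>2 + 4 * r * E" for P Q x B r E :: real
      by (simp add: power2_eq_square algebra_simps)
    have two: "real (2 * l) / real n = 2 * (real l / real n)" by simp
    show ?thesis unfolding linearization_const_def two by (rule gen)
  qed
  finally show ?thesis unfolding U_statistic_decomposition[OF m] .
qed

end

section \<open>Uniform linearization of the empirical kernel distribution\<close>

context mixing_process
begin

text \<open>A bound, up to constants, for the long-run variance of a centred function bounded by 1 whose mean
  modulus is at most \<open>\<tau>\<close>.\<close>

definition small_variance :: "real \<Rightarrow> real" where
  "small_variance \<tau> = (\<Sum>k. min \<tau> (autocov_majorant 1 k))"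

lemma autocov_majorant_nonneg: "0 \<le> autocov_majorant b k"
  using K_nonneg by (simp add: autocov_majorant_def)

lemma summable_min_majorant: "\<tau> \<ge> 0 \<Longrightarrow> summable (\<lambda>k. min \<tau> (autocov_majorant 1 k))"
  by (rule summable_comparison_test'[OF summable_autocov_majorant[of 1]]) (simp add: autocov_majorant_nonneg)

text \<open>Dominated convergence for series: every summand is at most \<open>\<tau> n\<close>, and the tails are uniformly
  small.\<close>

lemma small_variance_tendsto_0:
  assumes "\<tau> \<longlonglongrightarrow> 0" "\<And>n. \<tau> n \<ge> 0"
  shows "(\<lambda>n. small_variance (\<tau> n)) \<longlonglongrightarrow> 0"
proof (rule LIMSEQ_I)
  fix e :: real assume e: "e > 0"
  obtain N where N: "norm (\<Sum>k. autocov_majorant 1 (k + N)) < e / 2"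
    using suminf_exist_split[OF _ summable_autocov_majorant, of "e / 2"] e by auto
  have "(\<lambda>n. real N * \<tau> n) \<longlonglongrightarrow> real N * 0" by (intro tendsto_intros assms)
  then have "eventually (\<lambda>n. real N * \<tau> n < e / 2) sequentially"
    by (rule order_tendstoD(2)) (use e in simp)
  then obtain no where no: "\<And>n. n \<ge> no \<Longrightarrow> real N * \<tau> n < e / 2" by (auto simp: eventually_sequentially)
  show "\<exists>no. \<forall>n\<ge>no. norm (small_variance (\<tau> n) - 0) < e"
  proof (intro exI[of _ no] allI impI)
    fix n assume n: "no \<le> n"
    have s: "summable (\<lambda>k. min (\<tau> n) (autocov_majorant 1 k))" by (rule summable_min_majorant[OF assms(2)])
    have "0 \<le> small_variance (\<tau> n)"
      unfolding small_variance_def by (intro suminf_nonneg s) (simp add: assms autocov_majorant_nonneg)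
    moreover have "small_variance (\<tau> n) = (\<Sum>k. min (\<tau> n) (autocov_majorant 1 (k + N))) + (\<Sum>k<N. min (\<tau> n) (autocov_majorant 1 k))"
      unfolding small_variance_def by (rule suminf_split_initial_segment[OF s])
    moreover have "(\<Sum>k. min (\<tau> n) (autocov_majorant 1 (k + N))) \<le> (\<Sum>k. autocov_majorant 1 (k + N))"
      by (intro suminf_le summable_ignore_initial_segment s summable_autocov_majorant) simp
    moreover have "(\<Sum>k<N. min (\<tau> n) (autocov_majorant 1 k)) \<le> (\<Sum>k<N. \<tau> n)" by (intro sum_mono) simp
    ultimately show "norm (small_variance (\<tau> n) - 0) < e" using N no[OF n] by simp
  qed
qed

lemma centered_sum_small:
  assumes w[measurable]: "w \<in> borel_measurable borel" and w01: "\<And>c. 0 \<le> w c" "\<And>c. w c \<le> 1"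
    and \<tau>: "expectation (\<lambda>\<omega>. w (X 1 \<omega>)) \<le> \<tau>" and I: "finite I" "I \<subseteq> {1..}"
  shows "expectation (\<lambda>\<omega>. (\<Sum>s\<in>I. w (X s \<omega>) - expectation (\<lambda>\<omega>. w (X 1 \<omega>)))\<^sup>2) \<le> 2 * real (card I) * small_variance (2 * \<tau>)"
proof -
  let ?e = "expectation (\<lambda>\<omega>. w (X 1 \<omega>))"
  define u where "u c = w c - ?e" for c
  have um[measurable]: "u \<in> borel_measurable borel" unfolding u_def by measurable
  have iw: "integrable M (\<lambda>\<omega>. w (X 1 \<omega>))" using w01 by (intro integrable_X_bounded[where b = 1] w) auto
  have e0: "0 \<le> ?e" using w01 by simp
  have e1: "?e \<le> 1"
  proof -
    have "?e \<le> expectation (\<lambda>\<omega>. 1)" by (intro integral_mono iw w01) auto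
    then show ?thesis by (simp add: prob_space)
  qed
  have ub: "\<bar>u c\<bar> \<le> 1" for c using w01[of c] e0 e1 unfolding u_def by linarith
  have mean: "expectation (\<lambda>\<omega>. u (X 1 \<omega>)) = 0" unfolding u_def using iw by (simp add: prob_space)
  have "expectation (\<lambda>\<omega>. \<bar>u (X 1 \<omega>)\<bar>) \<le> expectation (\<lambda>\<omega>. w (X 1 \<omega>) + ?e)"
  proof (rule integral_mono)
    show "integrable M (\<lambda>\<omega>. \<bar>u (X 1 \<omega>)\<bar>)" unfolding u_def using iw by simp
    show "\<bar>u (X 1 \<omega>)\<bar> \<le> w (X 1 \<omega>) + ?e" for \<omega> using w01[of "X 1 \<omega>"] e0 unfolding u_def by linarith
  qed (use iw in auto)
  also have "\<dots> \<le> 2 * \<tau>" using iw \<tau> by (simp add: prob_space)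
  finally have L1: "expectation (\<lambda>\<omega>. \<bar>u (X 1 \<omega>)\<bar>) \<le> 2 * \<tau>" .
  have "\<bar>autocov u k\<bar> \<le> min (2 * \<tau>) (autocov_majorant 1 k)" for k
    using autocov_bound_L1[OF um ub, of k] autocov_le_majorant[OF um ub mean, of k] L1 by simp
  from second_moment_sum_le[OF um ub I this summable_min_majorant] e0 \<tau>
  show ?thesis unfolding small_variance_def u_def by simp
qed

text \<open>Integrability of the observations gives slightly more than Markov's inequality.\<close>

lemma tail_prob_scaled:
  assumes moment: "integrable M (\<lambda>\<omega>. \<bar>X 1 \<omega>\<bar>)"
  shows "(\<lambda>n. real n * tail_prob (real n)) \<longlonglongrightarrow> 0"
proof -
  have "(\<lambda>n. expectation (\<lambda>\<omega>. \<bar>X 1 \<omega>\<bar> * of_bool (real n < \<bar>X 1 \<omega>\<bar>))) \<longlonglongrightarrow> expectation (\<lambda>\<omega>. 0)"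
  proof (rule integral_dominated_convergence[OF _ _ moment])
    show "AE \<omega> in M. (\<lambda>n. \<bar>X 1 \<omega>\<bar> * of_bool (real n < \<bar>X 1 \<omega>\<bar>)) \<longlonglongrightarrow> 0"
    proof (rule AE_I2)
      fix \<omega>
      obtain N :: nat where "\<bar>X 1 \<omega>\<bar> \<le> real N" using real_arch_simple by blast
      then have "\<bar>X 1 \<omega>\<bar> * of_bool (real n < \<bar>X 1 \<omega>\<bar>) = 0" if "n \<ge> N" for n
        using that by (simp add: not_less order.trans)
      then have "eventually (\<lambda>n. \<bar>X 1 \<omega>\<bar> * of_bool (real n < \<bar>X 1 \<omega>\<bar>) = 0) sequentially"
        unfolding eventually_sequentially by blast
      then show "(\<lambda>n. \<bar>X 1 \<omega>\<bar> * of_bool (real n < \<bar>X 1 \<omega>\<bar>)) \<longlonglongrightarrow> 0" by (rule tendsto_eventually)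
    qed
  qed auto
  then have lim: "(\<lambda>n. expectation (\<lambda>\<omega>. \<bar>X 1 \<omega>\<bar> * of_bool (real n < \<bar>X 1 \<omega>\<bar>))) \<longlonglongrightarrow> 0" by simp
  show ?thesis
  proof (rule tendsto_sandwich[OF _ _ tendsto_const lim])
    show "eventually (\<lambda>n. real n * tail_prob (real n) \<le> expectation (\<lambda>\<omega>. \<bar>X 1 \<omega>\<bar> * of_bool (real n < \<bar>X 1 \<omega>\<bar>))) sequentially"
    proof (intro always_eventually allI)
      fix n
      have "real n * tail_prob (real n) = expectation (\<lambda>\<omega>. real n * of_bool (real n < \<bar>X 1 \<omega>\<bar>))"
        by (simp add: tail_prob_eq)
      also have "\<dots> \<le> expectation (\<lambda>\<omega>. \<bar>X 1 \<omega>\<bar> * of_bool (real n < \<bar>X 1 \<omega>\<bar>))"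
      proof (rule integral_mono)
        show "integrable M (\<lambda>\<omega>. \<bar>X 1 \<omega>\<bar> * of_bool (real n < \<bar>X 1 \<omega>\<bar>))"
          by (rule Bochner_Integration.integrable_bound[OF moment]) auto
        show "integrable M (\<lambda>\<omega>. real n * of_bool (real n < \<bar>X 1 \<omega>\<bar>))"
          by (rule integrable_const_bound[where B = "real n"]) auto
      qed auto
      finally show "real n * tail_prob (real n) \<le> expectation (\<lambda>\<omega>. \<bar>X 1 \<omega>\<bar> * of_bool (real n < \<bar>X 1 \<omega>\<bar>))" .
    qed
  qed (auto simp: tail_prob_def)
qed

text \<open>
  The gap \<open>l = n powr 0.48\<close>, the smoothing width \<open>n powr - 0.52\<close>, the mesh \<open>\<eta> = n powr - 1.55\<close> and the truncation
  \<open>N = n\<close> are balanced against each other. Multiplied by \<open>n\<close>, the rare tuples contribute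
  \<open>n * (l / n)\<^sup>2 = n powr - 0.04\<close>, rounding a function with Lipschitz constant \<open>n powr 0.52\<close> contributes
  \<open>n powr - 0.03\<close>, and the \<open>n powr 2.55\<close> cells contribute \<open>n powr 3.55\<close> times the mixing coefficient at \<open>l\<close>, which
  is of order \<open>n powr - 3.84\<close>. This is where the exponent 8 of the mixing rate enters.
\<close>

lemma error_rate:
  assumes moment: "integrable M (\<lambda>\<omega>. \<bar>X 1 \<omega>\<bar>)" and "L \<ge> 0"
  defines "l \<equiv> \<lambda>n. nat \<lceil>real n powr 0.48\<rceil>"
  shows "(\<lambda>n. real n * (c * (real (l n) / real n)\<^sup>2
      + c' * decoupling_error B (b * (L / (real n powr (- 0.52)))) (l n) (real n powr (- 1.55)) (real n))) \<longlonglongrightarrow> 0"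
proof -
  have l1: "real (l n) \<le> real n powr 0.48 + 1" "real n powr 0.48 \<le> real (l n)" for n
    unfolding l_def by (auto simp: of_nat_nat)
  have t1: "(\<lambda>n. real n * (real (l n) / real n)\<^sup>2) \<longlonglongrightarrow> 0"
  proof (rule tendsto_sandwich[OF _ _ tendsto_const])
    show "eventually (\<lambda>n. real n * (real (l n) / real n)\<^sup>2 \<le> real n * ((real n powr 0.48 + 1) / real n)\<^sup>2) sequentially"
      using l1(1) by (intro always_eventually allI mult_left_mono power_mono divide_right_mono) auto
    show "(\<lambda>n. real n * ((real n powr 0.48 + 1) / real n)\<^sup>2) \<longlonglongrightarrow> 0" by real_asymp
  qed auto
  have t2: "(\<lambda>n. real n * ((1 / real n powr (- 0.52)) * real n powr (- 1.55))) \<longlonglongrightarrow> 0" by real_asymp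
  have t3: "(\<lambda>n. real n * (2 * real n / real n powr (- 1.55) + 3) * mixing_coeff M X (l n)) \<longlonglongrightarrow> 0"
  proof (rule tendsto_sandwich[OF _ _ tendsto_const])
    show "eventually (\<lambda>n. real n * (2 * real n / real n powr (- 1.55) + 3) * mixing_coeff M X (l n)
        \<le> real n * (2 * real n / real n powr (- 1.55) + 3) * (K / (real n powr 0.48) ^ 8)) sequentially"
      using eventually_ge_at_top[of 1]
    proof eventually_elim
      case (elim n)
      have p: "real n powr 0.48 > 0" using elim by simp
      then have "real (l n) > 0" using l1(2)[of n] by linarith
      then have "mixing_coeff M X (l n) \<le> K / real (l n) ^ 8" by (intro mixing_rate) simp
      also have "\<dots> \<le> K / (real n powr 0.48) ^ 8"
        using l1(2)[of n] p K_nonneg \<open>real (l n) > 0\<close> by (intro divide_left_mono power_mono) auto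
      finally show ?case by (intro mult_left_mono) auto
    qed
    show "(\<lambda>n. real n * (2 * real n / real n powr (- 1.55) + 3) * (K / (real n powr 0.48) ^ 8)) \<longlonglongrightarrow> 0" by real_asymp
  qed (auto intro!: always_eventually mult_nonneg_nonneg mixing_coeff_nonneg add_nonneg_nonneg divide_nonneg_nonneg)
  have "(\<lambda>n. c * (real n * (real (l n) / real n)\<^sup>2) + c' * (2 * b * L * (real n * ((1 / real n powr (- 0.52)) * real n powr (- 1.55)))
     + 4 * B * (real n * tail_prob (real n))
     + 4 * B * (real n * (2 * real n / real n powr (- 1.55) + 3) * mixing_coeff M X (l n))))
     \<longlonglongrightarrow> c * 0 + c' * (2 * b * L * 0 + 4 * B * 0 + 4 * B * 0)"
    by (intro tendsto_intros t1 t2 t3 tail_prob_scaled[OF moment])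
  moreover have "(\<lambda>n. c * (real n * (real (l n) / real n)\<^sup>2) + c' * (2 * b * L * (real n * ((1 / real n powr (- 0.52)) * real n powr (- 1.55)))
     + 4 * B * (real n * tail_prob (real n))
     + 4 * B * (real n * (2 * real n / real n powr (- 1.55) + 3) * mixing_coeff M X (l n))))
    = (\<lambda>n. real n * (c * (real (l n) / real n)\<^sup>2
      + c' * decoupling_error B (b * (L / (real n powr (- 0.52)))) (l n) (real n powr (- 1.55)) (real n)))"
    unfolding decoupling_error_def by (intro ext) (simp only: divide_inverse distrib_left distrib_right mult_ac mult_1)
  ultimately show ?thesis by simp
qed

end

text \<open>The last assumption is what a bounded density of the kernel provides: a Lipschitz bound for its
  distribution function under the i.i.d. law.\<close>

locale kernel_process = mixing_process M X K for M :: "'a measure" and X K +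
  fixes m :: nat and h :: "(nat \<Rightarrow> real) \<Rightarrow> real" and L D :: real
  assumes m1: "m \<ge> 1" and h_kernel: "kernel m h"
    and L0: "L \<ge> 0" and h_lipschitz: "\<And>x y. x \<in> extensional {1..m} \<Longrightarrow> y \<in> extensional {1..m} \<Longrightarrow>
        \<bar>h x - h y\<bar> \<le> L * L2_set (\<lambda>j. x j - y j) {1..m}"
    and moment: "integrable M (\<lambda>\<omega>. \<bar>X 1 \<omega>\<bar>)"
    and D0: "D \<ge> 0"
    and HF_increment: "\<And>a b. a \<le> b \<Longrightarrow> theta m (\<lambda>v. of_bool (h v \<le> b)) - theta m (\<lambda>v. of_bool (h v \<le> a)) \<le> D * (b - a)"
begin

definition ind :: "real \<Rightarrow> (nat \<Rightarrow> real) \<Rightarrow> real" where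
  "ind y v = of_bool (h v \<le> y)"

definition smoothed :: "real \<Rightarrow> real \<Rightarrow> (nat \<Rightarrow> real) \<Rightarrow> real" where
  "smoothed \<epsilon> y v = max 0 (min 1 ((y + \<epsilon> - h v) / \<epsilon>))"

definition HF :: "real \<Rightarrow> real" where
  "HF y = theta m (ind y)"

definition Hn :: "nat \<Rightarrow> 'a \<Rightarrow> real \<Rightarrow> real" where
  "Hn n \<omega> y = (\<Sum>i\<in>tuples m n. ind y (\<lambda>j\<in>{1..m}. X (i j) \<omega>)) / real (n choose m)"

definition U_stat :: "((nat \<Rightarrow> real) \<Rightarrow> real) \<Rightarrow> nat \<Rightarrow> 'a \<Rightarrow> real" where
  "U_stat \<phi> n \<omega> = (\<Sum>i\<in>tuples m n. \<phi> (\<lambda>j\<in>{1..m}. X (i j) \<omega>)) / real (n choose m)"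

definition linear_part :: "((nat \<Rightarrow> real) \<Rightarrow> real) \<Rightarrow> nat \<Rightarrow> 'a \<Rightarrow> real" where
  "linear_part \<phi> n \<omega> = real m / real n * (\<Sum>s\<in>{1..n}. projection m \<phi> (X s \<omega>) - theta m \<phi>)"

lemma h_measurable[measurable]: "h \<in> borel_measurable (PiM {1..m} (\<lambda>_. borel))"
  using h_kernel by (simp add: kernel_def)

lemma unit_kernel_ind: "unit_kernel m (ind y)"
  using h_kernel unfolding unit_kernel_def kernel_def ind_def by auto

lemma unit_kernel_smoothed: "unit_kernel m (smoothed \<epsilon> y)"
  using h_kernel unfolding unit_kernel_def kernel_def smoothed_def by auto

lemma coordinate_lipschitz_smoothed:
  assumes "\<epsilon> > 0" shows "coordinate_lipschitz m (L / \<epsilon>) (smoothed \<epsilon> y)"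
  unfolding coordinate_lipschitz_def
proof (intro ballI allI)
  fix v :: "nat \<Rightarrow> real" and a and c c' :: real assume v: "v \<in> extensional {1..m}" and a: "a \<in> {1..m}"
  have ext: "v(a := c) \<in> extensional {1..m}" for c using v a by (auto simp: extensional_def)
  have "L2_set (\<lambda>j. (v(a := c)) j - (v(a := c')) j) {1..m} = \<bar>c - c'\<bar>"
  proof -
    have "(\<Sum>j\<in>{1..m}. ((v(a := c)) j - (v(a := c')) j)\<^sup>2) = (\<Sum>j\<in>{1..m}. if j = a then (c - c')\<^sup>2 else 0)"
      by (intro sum.cong) auto
    also have "\<dots> = (c - c')\<^sup>2" using a by (simp add: sum.delta)
    finally show ?thesis by (simp add: L2_set_def)
  qed
  then have hh: "\<bar>h (v(a := c)) - h (v(a := c'))\<bar> \<le> L * \<bar>c - c'\<bar>" using h_lipschitz[OF ext ext, of c c'] by simp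
  have "\<bar>max 0 (min 1 p) - max 0 (min 1 q)\<bar> \<le> \<bar>p - q\<bar>" for p q :: real by (auto simp: max_def min_def)
  then have "\<bar>smoothed \<epsilon> y (v(a := c)) - smoothed \<epsilon> y (v(a := c'))\<bar>
     \<le> \<bar>(y + \<epsilon> - h (v(a := c))) / \<epsilon> - (y + \<epsilon> - h (v(a := c'))) / \<epsilon>\<bar>" unfolding smoothed_def .
  also have "\<dots> = \<bar>h (v(a := c)) - h (v(a := c'))\<bar> / \<epsilon>"
    using assms by (simp add: diff_divide_distrib[symmetric] abs_divide abs_minus_commute)
  also have "\<dots> \<le> L * \<bar>c - c'\<bar> / \<epsilon>" using hh assms by (intro divide_right_mono) auto
  finally show "\<bar>smoothed \<epsilon> y (v(a := c)) - smoothed \<epsilon> y (v(a := c'))\<bar> \<le> L / \<epsilon> * \<bar>c - c'\<bar>" by simp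
qed

lemma ind_le_smoothed: "\<epsilon> > 0 \<Longrightarrow> ind y v \<le> smoothed \<epsilon> y v"
  by (auto simp: ind_def smoothed_def field_simps)

lemma smoothed_le_ind: "\<epsilon> > 0 \<Longrightarrow> smoothed \<epsilon> y v \<le> ind (y + \<epsilon>) v"
  by (auto simp: ind_def smoothed_def field_simps)

lemma theta_mono:
  assumes "unit_kernel m \<phi>" "unit_kernel m \<psi>" "\<And>v. \<phi> v \<le> \<psi> v"
  shows "theta m \<phi> \<le> theta m \<psi>"
  unfolding theta_def
  by (rule integral_mono[OF unit_kernel_bounds_integral(1)[OF assms(1)] unit_kernel_bounds_integral(1)[OF assms(2)] assms(3)])
    (rule measurable_select[where J = "{1..m}" and i = "\<lambda>j. j"])+

lemma projection_mono:
  assumes "unit_kernel m \<phi>" "unit_kernel m \<psi>" "\<And>v. \<phi> v \<le> \<psi> v"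
  shows "projection m \<phi> c \<le> projection m \<psi> c"
  unfolding projection_def
  by (rule integral_mono[OF unit_kernel_bounds_integral(1)[OF assms(1)] unit_kernel_bounds_integral(1)[OF assms(2)] assms(3)])
    (rule measurable_select_mixed2[where a = 1 and c = c and i = "\<lambda>j. j"])+

lemma expectation_projection:
  assumes \<phi>: "unit_kernel m \<phi>" shows "expectation (\<lambda>\<omega>. projection m \<phi> (X 1 \<omega>)) = theta m \<phi>"
proof -
  have "(LINT c|marginal. projection m \<phi> c) = expectation (\<lambda>\<omega>. projection m \<phi> (X 1 \<omega>))"
    unfolding marginal_def by (rule integral_distr) (auto intro: measurable_projection[OF \<phi>])
  then show ?thesis using theta_eq_integral_projection[OF \<phi> m1] by simp
qed

lemma X_tuple_measurable:
  assumes "i \<in> tuples m n" shows "(\<lambda>\<omega>. \<lambda>j\<in>{1..m}. X (i j) \<omega>) \<in> M \<rightarrow>\<^sub>M PiM {1..m} (\<lambda>_. borel)"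
  using tuples_range[OF assms] by (intro measurable_restrict X_measurable) auto

lemma U_stat_measurable: "unit_kernel m \<phi> \<Longrightarrow> U_stat \<phi> n \<in> borel_measurable M"
  unfolding U_stat_def
  by (intro borel_measurable_divide borel_measurable_sum borel_measurable_const)
    (rule measurable_compose[OF X_tuple_measurable kernel_measurable])

lemma linear_part_measurable: "unit_kernel m \<phi> \<Longrightarrow> linear_part \<phi> n \<in> borel_measurable M"
  unfolding linear_part_def
  by (intro borel_measurable_times borel_measurable_sum borel_measurable_diff
      measurable_compose[OF X_measurable measurable_projection]) auto

lemma U_stat_unit:
  assumes "unit_kernel m \<phi>" "m \<le> n" shows "0 \<le> U_stat \<phi> n \<omega>" "U_stat \<phi> n \<omega> \<le> 1"
proof -
  have c: "real (n choose m) > 0" using assms by simp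
  show "0 \<le> U_stat \<phi> n \<omega>" unfolding U_stat_def using unit_kernelD[OF assms(1)] by (auto intro!: sum_nonneg divide_nonneg_nonneg)
  have "(\<Sum>i\<in>tuples m n. \<phi> (\<lambda>j\<in>{1..m}. X (i j) \<omega>)) \<le> (\<Sum>i\<in>tuples m n. 1)"
    by (intro sum_mono unit_kernelD[OF assms(1)])
  then show "U_stat \<phi> n \<omega> \<le> 1" unfolding U_stat_def using c by (simp add: card_tuples divide_le_eq_1)
qed

lemma linear_part_bounded:
  assumes \<phi>: "unit_kernel m \<phi>" shows "\<bar>linear_part \<phi> n \<omega>\<bar> \<le> real m"
proof -
  have "\<bar>\<Sum>s\<in>{1..n}. projection m \<phi> (X s \<omega>) - theta m \<phi>\<bar> \<le> (\<Sum>s\<in>{1..n}. 1)"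
  proof (intro order.trans[OF sum_abs] sum_mono)
    fix s show "\<bar>projection m \<phi> (X s \<omega>) - theta m \<phi>\<bar> \<le> 1"
      using projection_unit[OF \<phi>, of "X s \<omega>"] theta_unit[OF \<phi>] by linarith
  qed
  then have "\<bar>\<Sum>s\<in>{1..n}. projection m \<phi> (X s \<omega>) - theta m \<phi>\<bar> \<le> real n" by simp
  then have "real m / real n * \<bar>\<Sum>s\<in>{1..n}. projection m \<phi> (X s \<omega>) - theta m \<phi>\<bar> \<le> real m / real n * real n"
    by (intro mult_left_mono) auto
  also have "\<dots> \<le> real m" by simp
  finally show ?thesis unfolding linear_part_def by (simp add: abs_mult)
qed

lemma integrable_bounded_rv:
  assumes "f \<in> borel_measurable M" "\<And>\<omega>. \<bar>f \<omega>\<bar> \<le> (b :: real)"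
  shows "integrable M f" "integrable M (\<lambda>\<omega>. (f \<omega>)\<^sup>2)"
proof -
  note [measurable] = assms(1)
  show "integrable M f" by (rule integrable_const_bound[where B = b]) (auto simp: assms)
  have "(f \<omega>)\<^sup>2 \<le> b\<^sup>2" for \<omega> using power_mono[OF assms(2) abs_ge_zero, of \<omega> 2] by simp
  then show "integrable M (\<lambda>\<omega>. (f \<omega>)\<^sup>2)" by (intro integrable_const_bound[where B = "b\<^sup>2"]) auto
qed

text \<open>The projections of ordered kernels with close means are close in \<open>L\<^sup>1\<close>.\<close>

lemma linear_part_difference:
  assumes \<phi>: "unit_kernel m \<phi>" and \<psi>: "unit_kernel m \<psi>" and le: "\<And>v. \<phi> v \<le> \<psi> v"
    and \<tau>: "theta m \<psi> - theta m \<phi> \<le> \<tau>" and n: "n \<ge> 1"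
  shows "real n * expectation (\<lambda>\<omega>. (linear_part \<psi> n \<omega> - linear_part \<phi> n \<omega>)\<^sup>2) \<le> 2 * (real m)\<^sup>2 * small_variance (2 * \<tau>)"
proof -
  define w where "w c = projection m \<psi> c - projection m \<phi> c" for c
  note [measurable] = measurable_projection[OF \<phi>] measurable_projection[OF \<psi>]
  have wm: "w \<in> borel_measurable borel" unfolding w_def by measurable
  have w01: "0 \<le> w c" "w c \<le> 1" for c
    using projection_mono[OF \<phi> \<psi> le, of c] projection_unit[OF \<phi>, of c] projection_unit[OF \<psi>, of c] by (auto simp: w_def)
  have i: "integrable M (\<lambda>\<omega>. projection m \<zeta> (X 1 \<omega>))" if "unit_kernel m \<zeta>" for \<zeta>
    using projection_unit[OF that] by (intro integrable_X_bounded[where b = 1] measurable_projection[OF that]) auto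
  have Ew: "expectation (\<lambda>\<omega>. w (X 1 \<omega>)) = theta m \<psi> - theta m \<phi>"
    unfolding w_def using i[OF \<phi>] i[OF \<psi>] by (simp add: expectation_projection \<phi> \<psi> del: One_nat_def)
  have eq: "linear_part \<psi> n \<omega> - linear_part \<phi> n \<omega>
     = real m / real n * (\<Sum>s\<in>{1..n}. w (X s \<omega>) - (theta m \<psi> - theta m \<phi>))" for \<omega>
    unfolding linear_part_def right_diff_distrib[symmetric] sum_subtractf[symmetric] w_def
    by (intro arg_cong[where f = "\<lambda>x. real m / real n * x"] sum.cong) auto
  have "expectation (\<lambda>\<omega>. (\<Sum>s\<in>{1..n}. w (X s \<omega>) - (theta m \<psi> - theta m \<phi>))\<^sup>2) \<le> 2 * real (card {1..n}) * small_variance (2 * \<tau>)"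
    using centered_sum_small[OF wm w01, of \<tau> "{1..n}"] \<tau> unfolding Ew by simp
  then have "real n * ((real m / real n)\<^sup>2 * expectation (\<lambda>\<omega>. (\<Sum>s\<in>{1..n}. w (X s \<omega>) - (theta m \<psi> - theta m \<phi>))\<^sup>2))
      \<le> real n * ((real m / real n)\<^sup>2 * (2 * real n * small_variance (2 * \<tau>)))"
    by (intro mult_left_mono) auto
  also have "\<dots> = 2 * (real m)\<^sup>2 * small_variance (2 * \<tau>)" using n by (simp add: power2_eq_square)
  finally show ?thesis unfolding eq power_mult_distrib by simp
qed

lemma HF_increment': "a \<le> b \<Longrightarrow> HF b - HF a \<le> D * (b - a)"
  using HF_increment unfolding HF_def ind_def .

lemma HF_mono: "a \<le> b \<Longrightarrow> HF a \<le> HF b"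
  unfolding HF_def by (intro theta_mono unit_kernel_ind) (auto simp: ind_def)

definition lin_error :: "nat \<Rightarrow> real \<Rightarrow> 'a \<Rightarrow> real" where
  "lin_error n y \<omega> = Hn n \<omega> y - HF y - linear_part (ind y) n \<omega>"

lemma Hn_U_stat: "Hn n \<omega> y = U_stat (ind y) n \<omega>"
  by (simp add: Hn_def U_stat_def)

lemma lin_error_bounded: "m \<le> n \<Longrightarrow> \<bar>lin_error n y \<omega>\<bar> \<le> real m + 1"
  using U_stat_unit[OF unit_kernel_ind, of n y \<omega>] theta_unit[OF unit_kernel_ind, of y] linear_part_bounded[OF unit_kernel_ind, of y n \<omega>]
  unfolding lin_error_def Hn_U_stat HF_def by linarith

lemma lin_error_measurable[measurable]: "lin_error n y \<in> borel_measurable M"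
  unfolding lin_error_def Hn_U_stat
  by (intro borel_measurable_diff U_stat_measurable linear_part_measurable unit_kernel_ind) auto

text \<open>The empirical distribution function lies between the U-statistics of the smoothed indicators
  at \<open>y - \<epsilon>\<close> and at \<open>y\<close>, both of which are linearized by \<open>linearization_second_moment\<close>. Replacing
  their means and projections by those of the indicator costs \<open>D * \<epsilon>\<close> and, by
  \<open>linear_part_difference\<close>, \<open>o(1 / sqrt n)\<close>.\<close>

lemma uniform_linearization:
  obtains e :: "nat \<Rightarrow> real" where "e \<longlonglongrightarrow> 0"
    "\<And>n y. n \<ge> m \<Longrightarrow> real n * expectation (\<lambda>\<omega>. (lin_error n y \<omega>)\<^sup>2) \<le> e n"
proof -
  define \<epsilon> where "\<epsilon> n = real n powr (- 0.52)" for n :: nat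
  define l where "l n = nat \<lceil>real n powr 0.48\<rceil>" for n :: nat
  define R where "R n = linearization_const m * (real (l n) / real n)\<^sup>2
      + 4 * real m * decoupling_error ((real m + 1)\<^sup>2) (4 * (real m + 1) * (L / \<epsilon> n)) (l n) (real n powr (- 1.55)) (real n)" for n
  define \<Delta> where "\<Delta> n = 2 * real n * (D * \<epsilon> n)\<^sup>2 + 2 * (2 * (real m)\<^sup>2 * small_variance (2 * (D * \<epsilon> n)))" for n
  define e where "e n = 4 * (real n * R n) + 4 * \<Delta> n" for n
  have "(\<lambda>n. real n * R n) \<longlonglongrightarrow> 0"
    unfolding R_def \<epsilon>_def l_def by (rule error_rate[OF moment L0])
  moreover have "\<Delta> \<longlonglongrightarrow> 0"
  proof -
    have "(\<lambda>n. real n * (\<epsilon> n)\<^sup>2) \<longlonglongrightarrow> 0" unfolding \<epsilon>_def by real_asymp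
    then have "(\<lambda>n. 2 * D\<^sup>2 * (real n * (\<epsilon> n)\<^sup>2)) \<longlonglongrightarrow> 2 * D\<^sup>2 * 0" by (intro tendsto_intros)
    then have "(\<lambda>n. 2 * real n * (D * \<epsilon> n)\<^sup>2) \<longlonglongrightarrow> 0" by (simp add: power_mult_distrib mult_ac)
    moreover have "(\<lambda>n. small_variance (2 * (D * \<epsilon> n))) \<longlonglongrightarrow> 0"
    proof (rule small_variance_tendsto_0)
      have "\<epsilon> \<longlonglongrightarrow> 0" unfolding \<epsilon>_def by real_asymp
      then have "(\<lambda>n. 2 * (D * \<epsilon> n)) \<longlonglongrightarrow> 2 * (D * 0)" by (intro tendsto_intros)
      then show "(\<lambda>n. 2 * (D * \<epsilon> n)) \<longlonglongrightarrow> 0" by simp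
    qed (use D0 in \<open>auto simp: \<epsilon>_def\<close>)
    ultimately have "(\<lambda>n. 2 * real n * (D * \<epsilon> n)\<^sup>2 + 2 * (2 * (real m)\<^sup>2 * small_variance (2 * (D * \<epsilon> n)))) \<longlonglongrightarrow> 0 + 2 * (2 * (real m)\<^sup>2 * 0)"
      by (intro tendsto_intros)
    then show ?thesis unfolding \<Delta>_def[abs_def] by simp
  qed
  ultimately have "(\<lambda>n. 4 * (real n * R n) + 4 * \<Delta> n) \<longlonglongrightarrow> 4 * 0 + 4 * 0" by (intro tendsto_intros)
  then have lim: "e \<longlonglongrightarrow> 0" unfolding e_def[abs_def] by simp
  have bound: "real n * expectation (\<lambda>\<omega>. (lin_error n y \<omega>)\<^sup>2) \<le> e n" if n: "n \<ge> m" for n y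
  proof -
    have n1: "n \<ge> 1" using n m1 by simp
    have \<epsilon>: "\<epsilon> n > 0" using n1 by (simp add: \<epsilon>_def)
    have l: "l n \<ge> 1"
    proof -
      have "0 < \<lceil>real n powr 0.48\<rceil>" using n1 by simp
      then show ?thesis unfolding l_def by linarith
    qed
    let ?sm = "\<lambda>z. smoothed (\<epsilon> n) z"
    \<comment> \<open>\<open>r\<close> is the linearization error of the smoothed indicator, \<open>d\<close> the discrepancy between its
      linear approximation and that of the indicator itself.\<close>
    define r where "r z \<omega> = U_stat (?sm z) n \<omega> - theta m (?sm z) - linear_part (?sm z) n \<omega>" for z \<omega>
    have uk: "unit_kernel m (?sm z)" for z by (rule unit_kernel_smoothed)
    have r2: "expectation (\<lambda>\<omega>. (r z \<omega>)\<^sup>2) \<le> R n" for z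
      unfolding r_def U_stat_def linear_part_def R_def
      by (rule linearization_second_moment[OF uk coordinate_lipschitz_smoothed[OF \<epsilon>] m1 n l]) (use n1 in auto)
    have rm: "r z \<in> borel_measurable M" for z
      unfolding r_def by (intro borel_measurable_diff U_stat_measurable linear_part_measurable uk) auto
    have rb: "\<bar>r z \<omega>\<bar> \<le> real m + 1" for z \<omega>
      using U_stat_unit[OF uk n, of z \<omega>] theta_unit[OF uk, of z] linear_part_bounded[OF uk, of z n \<omega>] unfolding r_def by linarith
    define d where "d z \<omega> = (theta m (?sm z) - HF y) + (linear_part (?sm z) n \<omega> - linear_part (ind y) n \<omega>)" for z \<omega>
    have dm: "d z \<in> borel_measurable M" for z
      unfolding d_def by (intro borel_measurable_diff borel_measurable_add linear_part_measurable uk unit_kernel_ind) auto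
    have db: "\<bar>d z \<omega>\<bar> \<le> 1 + 2 * real m" for z \<omega>
      using theta_unit[OF uk, of z] theta_unit[OF unit_kernel_ind, of y] linear_part_bounded[OF uk, of z n \<omega>] linear_part_bounded[OF unit_kernel_ind, of y n \<omega>]
      unfolding d_def HF_def by linarith
    have dle: "real n * expectation (\<lambda>\<omega>. (d z \<omega>)\<^sup>2) \<le> \<Delta> n"
      if t: "\<bar>theta m (?sm z) - HF y\<bar> \<le> D * \<epsilon> n"
        and lin: "real n * expectation (\<lambda>\<omega>. (linear_part (?sm z) n \<omega> - linear_part (ind y) n \<omega>)\<^sup>2) \<le> 2 * (real m)\<^sup>2 * small_variance (2 * (D * \<epsilon> n))" for z
    proof -
      let ?q = "\<lambda>\<omega>. linear_part (?sm z) n \<omega> - linear_part (ind y) n \<omega>"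
      have qm: "?q \<in> borel_measurable M" by (intro borel_measurable_diff linear_part_measurable uk unit_kernel_ind)
      have qb: "\<bar>?q \<omega>\<bar> \<le> 2 * real m" for \<omega>
        using linear_part_bounded[OF uk, of z n \<omega>] linear_part_bounded[OF unit_kernel_ind, of y n \<omega>] by linarith
      note iq = integrable_bounded_rv(2)[OF qm qb]
      have "expectation (\<lambda>\<omega>. (d z \<omega>)\<^sup>2) \<le> expectation (\<lambda>\<omega>. 2 * (D * \<epsilon> n)\<^sup>2 + 2 * (?q \<omega>)\<^sup>2)"
      proof (rule integral_mono[OF integrable_bounded_rv(2)[OF dm db]])
        fix \<omega>
        have "(d z \<omega>)\<^sup>2 \<le> 2 * (theta m (?sm z) - HF y)\<^sup>2 + 2 * (?q \<omega>)\<^sup>2"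
          unfolding d_def by (rule square_sum_le)
        also have "(theta m (?sm z) - HF y)\<^sup>2 \<le> (D * \<epsilon> n)\<^sup>2" using power_mono[OF t abs_ge_zero, of 2] by (simp only: power2_abs)
        finally show "(d z \<omega>)\<^sup>2 \<le> 2 * (D * \<epsilon> n)\<^sup>2 + 2 * (?q \<omega>)\<^sup>2" by simp
      qed (use iq in auto)
      also have "\<dots> = 2 * (D * \<epsilon> n)\<^sup>2 + 2 * expectation (\<lambda>\<omega>. (?q \<omega>)\<^sup>2)" using iq by (simp add: prob_space)
      finally have "real n * expectation (\<lambda>\<omega>. (d z \<omega>)\<^sup>2) \<le> real n * (2 * (D * \<epsilon> n)\<^sup>2 + 2 * expectation (\<lambda>\<omega>. (?q \<omega>)\<^sup>2))"
        by (rule mult_left_mono) simp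
      also have "\<dots> = 2 * real n * (D * \<epsilon> n)\<^sup>2 + 2 * (real n * expectation (\<lambda>\<omega>. (?q \<omega>)\<^sup>2))" by (simp add: algebra_simps)
      also have "\<dots> \<le> \<Delta> n" unfolding \<Delta>_def using lin by (intro add_mono mult_left_mono) auto
      finally show ?thesis .
    qed
    have up: "ind y v \<le> ?sm y v" and lo: "?sm (y - \<epsilon> n) v \<le> ind y v" for v
      using ind_le_smoothed[OF \<epsilon>, of y v] smoothed_le_ind[OF \<epsilon>, of "y - \<epsilon> n" v] by auto
    have tup: "theta m (?sm y) - HF y \<le> D * \<epsilon> n"
    proof -
      have "theta m (?sm y) \<le> HF (y + \<epsilon> n)"
        unfolding HF_def by (rule theta_mono[OF uk unit_kernel_ind]) (rule smoothed_le_ind[OF \<epsilon>])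
      then show ?thesis using HF_increment'[of y "y + \<epsilon> n"] \<epsilon> by simp
    qed
    have tlo: "HF y - theta m (?sm (y - \<epsilon> n)) \<le> D * \<epsilon> n"
    proof -
      have "HF (y - \<epsilon> n) \<le> theta m (?sm (y - \<epsilon> n))"
        unfolding HF_def by (rule theta_mono[OF unit_kernel_ind uk]) (rule ind_le_smoothed[OF \<epsilon>])
      then show ?thesis using HF_increment'[of "y - \<epsilon> n" y] \<epsilon> by simp
    qed
    have dup: "real n * expectation (\<lambda>\<omega>. (d y \<omega>)\<^sup>2) \<le> \<Delta> n"
    proof (rule dle)
      have "HF y \<le> theta m (?sm y)" unfolding HF_def by (rule theta_mono[OF unit_kernel_ind uk up])
      then show "\<bar>theta m (?sm y) - HF y\<bar> \<le> D * \<epsilon> n" using tup by simp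
      show "real n * expectation (\<lambda>\<omega>. (linear_part (?sm y) n \<omega> - linear_part (ind y) n \<omega>)\<^sup>2) \<le> 2 * (real m)\<^sup>2 * small_variance (2 * (D * \<epsilon> n))"
        by (rule linear_part_difference[OF unit_kernel_ind uk up tup[unfolded HF_def] n1])
    qed
    have dlo: "real n * expectation (\<lambda>\<omega>. (d (y - \<epsilon> n) \<omega>)\<^sup>2) \<le> \<Delta> n"
    proof (rule dle)
      have "theta m (?sm (y - \<epsilon> n)) \<le> HF y" unfolding HF_def by (rule theta_mono[OF uk unit_kernel_ind lo])
      then show "\<bar>theta m (?sm (y - \<epsilon> n)) - HF y\<bar> \<le> D * \<epsilon> n" using tlo by simp
      show "real n * expectation (\<lambda>\<omega>. (linear_part (?sm (y - \<epsilon> n)) n \<omega> - linear_part (ind y) n \<omega>)\<^sup>2) \<le> 2 * (real m)\<^sup>2 * small_variance (2 * (D * \<epsilon> n))"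
        using linear_part_difference[OF uk unit_kernel_ind lo tlo[unfolded HF_def] n1] by (simp add: power2_commute)
    qed
    have Umono: "U_stat \<phi> n \<omega> \<le> U_stat \<psi> n \<omega>" if "\<And>v. \<phi> v \<le> \<psi> v" for \<phi> \<psi> \<omega>
      unfolding U_stat_def by (intro divide_right_mono sum_mono that) auto
    have pt: "(lin_error n y \<omega>)\<^sup>2 \<le> 2 * (r y \<omega>)\<^sup>2 + 2 * (d y \<omega>)\<^sup>2 + (2 * (r (y - \<epsilon> n) \<omega>)\<^sup>2 + 2 * (d (y - \<epsilon> n) \<omega>)\<^sup>2)" for \<omega>
    proof -
      have hi: "lin_error n y \<omega> \<le> r y \<omega> + d y \<omega>"
        using Umono[of "ind y" "?sm y" \<omega>, OF up] unfolding lin_error_def Hn_U_stat r_def d_def by simp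
      have lw: "r (y - \<epsilon> n) \<omega> + d (y - \<epsilon> n) \<omega> \<le> lin_error n y \<omega>"
        using Umono[of "?sm (y - \<epsilon> n)" "ind y" \<omega>, OF lo] unfolding lin_error_def Hn_U_stat r_def d_def by simp
      have sq: "x\<^sup>2 \<le> u\<^sup>2 + w\<^sup>2" if "w \<le> x" "x \<le> u" for x u w :: real
      proof (cases "x \<ge> 0")
        case True
        then have "x\<^sup>2 \<le> u\<^sup>2" using that by (intro power_mono) auto
        then show ?thesis by (simp add: add_increasing2)
      next
        case False
        then have "(- x)\<^sup>2 \<le> (- w)\<^sup>2" using that by (intro power_mono) auto
        then show ?thesis by (simp add: add_increasing)
      qed
      from sq[OF lw hi] square_sum_le[of "r y \<omega>" "d y \<omega>"] square_sum_le[of "r (y - \<epsilon> n) \<omega>" "d (y - \<epsilon> n) \<omega>"]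
      show ?thesis by linarith
    qed
    note ir = integrable_bounded_rv(2)[OF rm rb] and id = integrable_bounded_rv(2)[OF dm db]
    have "expectation (\<lambda>\<omega>. (lin_error n y \<omega>)\<^sup>2)
       \<le> expectation (\<lambda>\<omega>. 2 * (r y \<omega>)\<^sup>2 + 2 * (d y \<omega>)\<^sup>2 + (2 * (r (y - \<epsilon> n) \<omega>)\<^sup>2 + 2 * (d (y - \<epsilon> n) \<omega>)\<^sup>2))"
      by (rule integral_mono[OF integrable_bounded_rv(2)[OF lin_error_measurable lin_error_bounded[OF n]] _ pt])
        (intro Bochner_Integration.integrable_add integrable_mult_right ir id)
    also have "\<dots> = 2 * expectation (\<lambda>\<omega>. (r y \<omega>)\<^sup>2) + 2 * expectation (\<lambda>\<omega>. (d y \<omega>)\<^sup>2)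
        + (2 * expectation (\<lambda>\<omega>. (r (y - \<epsilon> n) \<omega>)\<^sup>2) + 2 * expectation (\<lambda>\<omega>. (d (y - \<epsilon> n) \<omega>)\<^sup>2))"
      using ir id by simp
    finally have "real n * expectation (\<lambda>\<omega>. (lin_error n y \<omega>)\<^sup>2) \<le> real n * \<dots>" by (rule mult_left_mono) simp
    also have "\<dots> = 2 * (real n * expectation (\<lambda>\<omega>. (r y \<omega>)\<^sup>2)) + 2 * (real n * expectation (\<lambda>\<omega>. (d y \<omega>)\<^sup>2))
        + (2 * (real n * expectation (\<lambda>\<omega>. (r (y - \<epsilon> n) \<omega>)\<^sup>2)) + 2 * (real n * expectation (\<lambda>\<omega>. (d (y - \<epsilon> n) \<omega>)\<^sup>2)))"
      by (simp add: algebra_simps)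
    also have "\<dots> \<le> 2 * (real n * R n) + 2 * \<Delta> n + (2 * (real n * R n) + 2 * \<Delta> n)"
      by (intro add_mono mult_left_mono r2 dup dlo) auto
    also have "\<dots> = e n" by (simp add: e_def)
    finally show ?thesis .
  qed
  show ?thesis using that[OF lim bound] .
qed

end

section \<open>Convergence in probability and quantile inversion\<close>

context prob_space
begin

text \<open>Convergence to 0 in probability, phrased with exceptional events so that no measurability of
  the sequence itself is involved.\<close>

definition vanishing :: "(nat \<Rightarrow> 'a \<Rightarrow> real) \<Rightarrow> bool" where
  "vanishing \<Delta> \<longleftrightarrow> (\<forall>\<epsilon>>0. \<forall>e>0. eventually (\<lambda>n. \<exists>B\<in>events. prob B < e \<and> (\<forall>\<omega>\<in>space M - B. \<bar>\<Delta> n \<omega>\<bar> \<le> \<epsilon>)) sequentially)"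

lemma vanishingD:
  "vanishing \<Delta> \<Longrightarrow> \<epsilon> > 0 \<Longrightarrow> e > 0 \<Longrightarrow>
    eventually (\<lambda>n. \<exists>B\<in>events. prob B < e \<and> (\<forall>\<omega>\<in>space M - B. \<bar>\<Delta> n \<omega>\<bar> \<le> \<epsilon>)) sequentially"
  unfolding vanishing_def by blast

lemma vanishing_zero: "vanishing (\<lambda>_ _. 0)"
  unfolding vanishing_def by (auto intro!: always_eventually bexI[of _ "{}"])

lemma vanishing_add:
  assumes "vanishing \<Delta>" "vanishing \<Delta>'" shows "vanishing (\<lambda>n \<omega>. \<Delta> n \<omega> + \<Delta>' n \<omega>)"
  unfolding vanishing_def
proof (intro allI impI)
  fix \<epsilon> e :: real assume "\<epsilon> > 0" "e > 0"
  then have h: "\<epsilon> / 2 > 0" "e / 2 > 0" by auto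
  from vanishingD[OF assms(1) h] vanishingD[OF assms(2) h]
  show "eventually (\<lambda>n. \<exists>B\<in>events. prob B < e \<and> (\<forall>\<omega>\<in>space M - B. \<bar>\<Delta> n \<omega> + \<Delta>' n \<omega>\<bar> \<le> \<epsilon>)) sequentially"
  proof eventually_elim
    case (elim n)
    obtain B where B: "B \<in> events" "prob B < e / 2" "\<And>\<omega>. \<omega> \<in> space M - B \<Longrightarrow> \<bar>\<Delta> n \<omega>\<bar> \<le> \<epsilon> / 2" using elim(1) by blast
    obtain B' where B': "B' \<in> events" "prob B' < e / 2" "\<And>\<omega>. \<omega> \<in> space M - B' \<Longrightarrow> \<bar>\<Delta>' n \<omega>\<bar> \<le> \<epsilon> / 2" using elim(2) by blast
    show ?case
    proof (intro bexI[of _ "B \<union> B'"] conjI ballI)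
      show "prob (B \<union> B') < e" using measure_subadditive[of B M B'] B B' by simp
      fix \<omega> assume "\<omega> \<in> space M - (B \<union> B')"
      then have "\<bar>\<Delta> n \<omega>\<bar> \<le> \<epsilon> / 2" "\<bar>\<Delta>' n \<omega>\<bar> \<le> \<epsilon> / 2" using B(3) B'(3) by auto
      then show "\<bar>\<Delta> n \<omega> + \<Delta>' n \<omega>\<bar> \<le> \<epsilon>" by linarith
    qed (use B B' in auto)
  qed
qed

lemma vanishing_cmult:
  assumes "vanishing \<Delta>" shows "vanishing (\<lambda>n \<omega>. c * \<Delta> n \<omega>)"
  unfolding vanishing_def
proof (intro allI impI)
  fix \<epsilon> e :: real assume \<epsilon>: "\<epsilon> > 0" and e: "e > 0"
  have c: "\<bar>c\<bar> + 1 > 0" by linarith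
  then have h: "\<epsilon> / (\<bar>c\<bar> + 1) > 0" using \<epsilon> by simp
  from vanishingD[OF assms h e]
  show "eventually (\<lambda>n. \<exists>B\<in>events. prob B < e \<and> (\<forall>\<omega>\<in>space M - B. \<bar>c * \<Delta> n \<omega>\<bar> \<le> \<epsilon>)) sequentially"
  proof eventually_elim
    case (elim n)
    then obtain B where B: "B \<in> events" "prob B < e" "\<And>\<omega>. \<omega> \<in> space M - B \<Longrightarrow> \<bar>\<Delta> n \<omega>\<bar> \<le> \<epsilon> / (\<bar>c\<bar> + 1)" by blast
    have "\<bar>c * \<Delta> n \<omega>\<bar> \<le> \<epsilon>" if "\<omega> \<in> space M - B" for \<omega>
    proof -
      have "\<bar>c * \<Delta> n \<omega>\<bar> \<le> (\<bar>c\<bar> + 1) * (\<epsilon> / (\<bar>c\<bar> + 1))"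
        unfolding abs_mult using B(3)[OF that] by (intro mult_mono) auto
      also have "\<dots> = \<epsilon>" using c by simp
      finally show ?thesis .
    qed
    then show ?case using B by blast
  qed
qed

lemma vanishing_sum:
  "finite I \<Longrightarrow> (\<And>i. i \<in> I \<Longrightarrow> vanishing (\<Delta> i)) \<Longrightarrow> vanishing (\<lambda>n \<omega>. \<Sum>i\<in>I. \<Delta> i n \<omega>)"
  by (induction I rule: finite_induct) (auto simp: vanishing_zero intro!: vanishing_add)

text \<open>The domination may fail on events of vanishing probability.\<close>

lemma vanishing_off_null:
  assumes \<Delta>: "vanishing \<Delta>" and E: "\<And>n. E n \<in> events" "(\<lambda>n. prob (E n)) \<longlonglongrightarrow> 0"
    and eq: "eventually (\<lambda>n. \<forall>\<omega>\<in>space M - E n. \<bar>\<Delta>' n \<omega>\<bar> \<le> \<bar>\<Delta> n \<omega>\<bar>) sequentially"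
  shows "vanishing \<Delta>'"
  unfolding vanishing_def
proof (intro allI impI)
  fix \<epsilon> e :: real assume \<epsilon>: "\<epsilon> > 0" and e: "e > 0"
  then have h: "e / 2 > 0" by simp
  from vanishingD[OF \<Delta> \<epsilon> h] eq order_tendstoD(2)[OF E(2) h]
  show "eventually (\<lambda>n. \<exists>B\<in>events. prob B < e \<and> (\<forall>\<omega>\<in>space M - B. \<bar>\<Delta>' n \<omega>\<bar> \<le> \<epsilon>)) sequentially"
  proof eventually_elim
    case (elim n)
    then obtain B where B: "B \<in> events" "prob B < e / 2" "\<And>\<omega>. \<omega> \<in> space M - B \<Longrightarrow> \<bar>\<Delta> n \<omega>\<bar> \<le> \<epsilon>" by blast
    show ?case
    proof (intro bexI[of _ "B \<union> E n"] conjI ballI)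
      show "prob (B \<union> E n) < e" using measure_subadditive[of B M "E n"] B E(1)[of n] elim(3) by simp
      fix \<omega> assume w: "\<omega> \<in> space M - (B \<union> E n)"
      then have "\<bar>\<Delta>' n \<omega>\<bar> \<le> \<bar>\<Delta> n \<omega>\<bar>" "\<bar>\<Delta> n \<omega>\<bar> \<le> \<epsilon>" using elim(2) B(3) by auto
      then show "\<bar>\<Delta>' n \<omega>\<bar> \<le> \<epsilon>" by linarith
    qed (use B E in auto)
  qed
qed

lemma markov_event:
  fixes Z :: "'a \<Rightarrow> real"
  assumes i: "integrable M Z" and "\<And>\<omega>. \<omega> \<in> space M \<Longrightarrow> 0 \<le> Z \<omega>" and "c > 0"
  shows "prob {\<omega> \<in> space M. c < Z \<omega>} \<le> expectation Z / c"
proof -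
  have [measurable]: "Z \<in> borel_measurable M" using i by auto
  have "prob {\<omega> \<in> space M. c < Z \<omega>} \<le> prob {\<omega> \<in> space M. c \<le> Z \<omega>}" by (intro finite_measure_mono) auto
  also have "\<dots> \<le> expectation Z / c" using assms by (intro integral_Markov_inequality_measure[where A = "space M"]) auto
  finally show ?thesis .
qed

lemma vanishing_L1:
  assumes i: "eventually (\<lambda>n. integrable M (\<Delta> n)) sequentially"
    and lim: "(\<lambda>n. expectation (\<lambda>\<omega>. \<bar>\<Delta> n \<omega>\<bar>)) \<longlonglongrightarrow> 0"
  shows "vanishing \<Delta>"
  unfolding vanishing_def
proof (intro allI impI)
  fix \<epsilon> e :: real assume \<epsilon>: "\<epsilon> > 0" and e: "e > 0"
  have "eventually (\<lambda>n. expectation (\<lambda>\<omega>. \<bar>\<Delta> n \<omega>\<bar>) < \<epsilon> * e) sequentially"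
    using \<epsilon> e by (intro order_tendstoD(2)[OF lim]) simp
  with i show "eventually (\<lambda>n. \<exists>B\<in>events. prob B < e \<and> (\<forall>\<omega>\<in>space M - B. \<bar>\<Delta> n \<omega>\<bar> \<le> \<epsilon>)) sequentially"
  proof eventually_elim
    case (elim n)
    let ?B = "{\<omega> \<in> space M. \<epsilon> < \<bar>\<Delta> n \<omega>\<bar>}"
    have [measurable]: "\<Delta> n \<in> borel_measurable M" using elim(1) by auto
    have "prob ?B \<le> expectation (\<lambda>\<omega>. \<bar>\<Delta> n \<omega>\<bar>) / \<epsilon>"
      using elim(1) \<epsilon> by (intro markov_event) auto
    also have "\<dots> < e" using elim(2) \<epsilon> by (simp add: pos_divide_less_eq mult.commute)
    finally have "prob ?B < e" .
    moreover have "?B \<in> events" by measurable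
    ultimately show ?case by (intro bexI[of _ ?B]) (auto simp: not_less)
  qed
qed

lemma vanishing_L2:
  assumes i: "eventually (\<lambda>n. integrable M (\<Delta> n) \<and> integrable M (\<lambda>\<omega>. (\<Delta> n \<omega>)\<^sup>2)) sequentially"
    and lim: "(\<lambda>n. expectation (\<lambda>\<omega>. (\<Delta> n \<omega>)\<^sup>2)) \<longlonglongrightarrow> 0"
  shows "vanishing \<Delta>"
proof (rule vanishing_L1)
  show "eventually (\<lambda>n. integrable M (\<Delta> n)) sequentially" using i by eventually_elim simp
  show "(\<lambda>n. expectation (\<lambda>\<omega>. \<bar>\<Delta> n \<omega>\<bar>)) \<longlonglongrightarrow> 0"
  proof (rule tendsto_sandwich[OF _ _ tendsto_const])
    show "eventually (\<lambda>n. expectation (\<lambda>\<omega>. \<bar>\<Delta> n \<omega>\<bar>) \<le> sqrt (expectation (\<lambda>\<omega>. (\<Delta> n \<omega>)\<^sup>2))) sequentially"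
      using i by eventually_elim (auto intro: expectation_abs_le_sqrt)
    show "(\<lambda>n. sqrt (expectation (\<lambda>\<omega>. (\<Delta> n \<omega>)\<^sup>2))) \<longlonglongrightarrow> 0" using tendsto_real_sqrt[OF lim] by simp
  qed auto
qed

text \<open>Slutsky's lemma on the level of characteristic functions.\<close>

lemma char_transfer:
  assumes \<Delta>: "vanishing (\<lambda>n \<omega>. V n \<omega> - W n \<omega>)"
    and m: "eventually (\<lambda>n. V n \<in> borel_measurable M \<and> W n \<in> borel_measurable M) sequentially"
    and W: "(\<lambda>n. LINT \<omega>|M. iexp (t * W n \<omega>)) \<longlonglongrightarrow> z"
  shows "(\<lambda>n. LINT \<omega>|M. iexp (t * V n \<omega>)) \<longlonglongrightarrow> z"
proof -
  have "(\<lambda>n. (LINT \<omega>|M. iexp (t * V n \<omega>)) - (LINT \<omega>|M. iexp (t * W n \<omega>))) \<longlonglongrightarrow> 0"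
  proof (rule LIMSEQ_I)
    fix e :: real assume e: "e > 0"
    define \<epsilon> where "\<epsilon> = e / (4 * (\<bar>t\<bar> + 1))"
    have \<epsilon>: "\<epsilon> > 0" using e by (simp add: \<epsilon>_def)
    have e4: "e / 4 > 0" using e by simp
    from vanishingD[OF \<Delta> \<epsilon> e4] m
    have "eventually (\<lambda>n. norm ((LINT \<omega>|M. iexp (t * V n \<omega>)) - (LINT \<omega>|M. iexp (t * W n \<omega>)) - 0) < e) sequentially"
    proof eventually_elim
      case (elim n)
      then obtain B where B: "B \<in> events" "prob B < e / 4" "\<And>\<omega>. \<omega> \<in> space M - B \<Longrightarrow> \<bar>V n \<omega> - W n \<omega>\<bar> \<le> \<epsilon>" by blast
      note [measurable] = conjunct1[OF elim(2)] conjunct2[OF elim(2)] B(1)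
      have iV: "integrable M (\<lambda>\<omega>. iexp (t * V n \<omega>))" "integrable M (\<lambda>\<omega>. iexp (t * W n \<omega>))"
        by (rule integrable_iexp_real, measurable)+
      have "norm ((LINT \<omega>|M. iexp (t * V n \<omega>)) - (LINT \<omega>|M. iexp (t * W n \<omega>)))
         = norm (LINT \<omega>|M. iexp (t * V n \<omega>) - iexp (t * W n \<omega>))"
        by (subst Bochner_Integration.integral_diff[OF iV]) (rule refl)
      also have "\<dots> \<le> (LINT \<omega>|M. norm (iexp (t * V n \<omega>) - iexp (t * W n \<omega>)))" by (rule integral_norm_bound)
      also have "\<dots> \<le> (LINT \<omega>|M. \<bar>t\<bar> * \<epsilon> + 2 * indicator B \<omega>)"
      proof (rule integral_mono)
        show "integrable M (\<lambda>\<omega>. norm (iexp (t * V n \<omega>) - iexp (t * W n \<omega>)))"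
          by (intro integrable_norm Bochner_Integration.integrable_diff iV)
        show "integrable M (\<lambda>\<omega>. \<bar>t\<bar> * \<epsilon> + 2 * indicator B \<omega> :: real)" using B(1) by (auto simp: emeasure_eq_measure)
        fix \<omega> assume w: "\<omega> \<in> space M"
        show "norm (iexp (t * V n \<omega>) - iexp (t * W n \<omega>)) \<le> \<bar>t\<bar> * \<epsilon> + 2 * indicator B \<omega>"
        proof (cases "\<omega> \<in> B")
          case True
          have "norm (iexp (t * V n \<omega>) - iexp (t * W n \<omega>)) \<le> norm (iexp (t * V n \<omega>)) + norm (iexp (t * W n \<omega>))"
            by (rule norm_triangle_ineq4)
          also have "\<dots> = 2" by (simp only: norm_exp_i_times)
          finally show ?thesis using True \<epsilon> by (simp add: add_increasing)
        next
          case False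
          have "norm (iexp (t * V n \<omega>) - iexp (t * W n \<omega>)) \<le> \<bar>t * V n \<omega> - t * W n \<omega>\<bar>" by (rule iexp_lipschitz)
          also have "\<dots> = \<bar>t\<bar> * \<bar>V n \<omega> - W n \<omega>\<bar>" by (simp add: abs_mult[symmetric] right_diff_distrib)
          also have "\<dots> \<le> \<bar>t\<bar> * \<epsilon>" using B(3)[of \<omega>] w False by (intro mult_left_mono) auto
          finally show ?thesis using False by simp
        qed
      qed
      also have "\<dots> = \<bar>t\<bar> * \<epsilon> + 2 * prob B" using B(1) by (simp add: prob_space emeasure_eq_measure)
      also have "\<bar>t\<bar> * \<epsilon> \<le> e / 4"
      proof -
        have "\<bar>t\<bar> * \<epsilon> \<le> (\<bar>t\<bar> + 1) * \<epsilon>" using \<epsilon> by (intro mult_right_mono) auto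
        also have "\<dots> = e / 4"
        proof -
          have "x * (e / (4 * x)) = e / 4" if "x > 0" for x :: real using that by simp
          then show ?thesis unfolding \<epsilon>_def by (metis abs_ge_zero add_nonneg_pos zero_less_one)
        qed
        finally show ?thesis .
      qed
      finally show ?case using B(2) e by simp
    qed
    then show "\<exists>no. \<forall>n\<ge>no. norm ((LINT \<omega>|M. iexp (t * V n \<omega>)) - (LINT \<omega>|M. iexp (t * W n \<omega>)) - 0) < e"
      by (simp add: eventually_sequentially)
  qed
  from tendsto_add[OF this W] show ?thesis by simp
qed

text \<open>Ghosh's lemma. The event \<open>V n \<le> t\<close> is the event that \<open>Z t n\<close>, which is close to \<open>W n\<close>, lies below
  a number close to \<open>t\<close>. Tightness of \<open>W\<close> reduces this to the \<open>t\<close> in a finite grid, and the two grid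
  points around \<open>W n\<close> trap \<open>V n\<close>.\<close>

lemma ghosh:
  fixes V W :: "nat \<Rightarrow> 'a \<Rightarrow> real" and Z :: "real \<Rightarrow> nat \<Rightarrow> 'a \<Rightarrow> real" and \<tau> :: "real \<Rightarrow> nat \<Rightarrow> real"
  assumes inv: "\<And>t. eventually (\<lambda>n. \<forall>\<omega>\<in>space M. V n \<omega> \<le> t \<longleftrightarrow> Z t n \<omega> \<le> \<tau> t n) sequentially"
    and \<tau>: "\<And>t. \<tau> t \<longlonglongrightarrow> t"
    and Z: "\<And>t. vanishing (\<lambda>n \<omega>. Z t n \<omega> - W n \<omega>)"
    and W: "\<And>n. n \<ge> start \<Longrightarrow> integrable M (\<lambda>\<omega>. (W n \<omega>)\<^sup>2)" "\<And>n. n \<ge> start \<Longrightarrow> expectation (\<lambda>\<omega>. (W n \<omega>)\<^sup>2) \<le> C"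
  shows "vanishing (\<lambda>n \<omega>. V n \<omega> - W n \<omega>)"
proof -
  have key: "eventually (\<lambda>n. \<exists>B\<in>events. prob B < e \<and> (\<forall>\<omega>\<in>space M - B. \<bar>V n \<omega> - W n \<omega>\<bar> \<le> \<epsilon>)) sequentially"
    if \<epsilon>: "\<epsilon> > 0" and e: "e > 0" for \<epsilon> e
  proof -
    define s where "s = \<epsilon> / 2"
    have s: "s > 0" using \<epsilon> by (simp add: s_def)
    \<comment> \<open>By Chebyshev's inequality, \<open>W n\<close> leaves \<open>{- s * A..s * A}\<close> with probability at most \<open>e / 2\<close>.\<close>
    obtain A :: nat where A: "real A > 2 * \<bar>C\<bar> / (e * s\<^sup>2) + 1" using reals_Archimedean2 by blast
    have A1: "real A > 1"
    proof -
      have "0 \<le> 2 * \<bar>C\<bar> / (e * s\<^sup>2)" using e by simp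
      then show ?thesis using A by linarith
    qed
    define grid where "grid = (\<lambda>j. s * real_of_int j) ` {- int A - 2..int A + 2}"
    have fin: "finite grid" by (simp add: grid_def)
    have "grid \<noteq> {}" by (auto simp: grid_def)
    then have cg: "real (card grid) > 0" using fin by (simp add: card_gt_0_iff)
    define e' where "e' = e / (2 * real (card grid))"
    have e': "e' > 0" "real (card grid) * e' = e / 2" using e cg by (auto simp: e'_def)
    define BW where "BW n = (if n \<ge> start then {\<omega> \<in> space M. (s * real A)\<^sup>2 < (W n \<omega>)\<^sup>2} else {})" for n
    have BWe: "BW n \<in> events" for n
    proof (cases "n \<ge> start")
      case True
      have [measurable]: "(\<lambda>\<omega>. (W n \<omega>)\<^sup>2) \<in> borel_measurable M" using W(1)[OF True] by auto
      show ?thesis unfolding BW_def using True by simp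
    qed (simp add: BW_def)
    have BWp: "prob (BW n) \<le> e / 2" if n: "n \<ge> start" for n
    proof -
      have "prob (BW n) \<le> expectation (\<lambda>\<omega>. (W n \<omega>)\<^sup>2) / (s * real A)\<^sup>2"
        unfolding BW_def using n s A1 W(1)[OF n] by (simp, intro markov_event) auto
      also have "\<dots> \<le> \<bar>C\<bar> / (s * real A)\<^sup>2" using W(2)[OF n] by (intro divide_right_mono) auto
      also have "\<dots> \<le> \<bar>C\<bar> / (s\<^sup>2 * real A)"
      proof (rule divide_left_mono)
        have "real A \<le> real A * real A" using A1 by simp
        then show "s\<^sup>2 * real A \<le> (s * real A)\<^sup>2" using s by (simp add: power2_eq_square)
      qed (use s A1 in auto)
      also have "\<dots> \<le> e / 2"
      proof -
        have "2 * \<bar>C\<bar> / (e * s\<^sup>2) < real A" using A by linarith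
        then have "2 * \<bar>C\<bar> < real A * (e * s\<^sup>2)" using e s by (simp add: pos_divide_less_eq)
        then show ?thesis using s A1 by (simp add: divide_le_eq mult_ac)
      qed
      finally show ?thesis .
    qed
    have g1: "eventually (\<lambda>n. \<forall>t\<in>grid. \<exists>B\<in>events. prob B < e' \<and> (\<forall>\<omega>\<in>space M - B. \<bar>Z t n \<omega> - W n \<omega>\<bar> \<le> s / 8)) sequentially"
      using s by (intro eventually_ball_finite[OF fin] ballI vanishingD[OF Z] e'(1)) auto
    have g2: "eventually (\<lambda>n. \<forall>t\<in>grid. \<forall>\<omega>\<in>space M. V n \<omega> \<le> t \<longleftrightarrow> Z t n \<omega> \<le> \<tau> t n) sequentially"
      using fin inv by (intro eventually_ball_finite) auto
    have g3: "eventually (\<lambda>n. \<forall>t\<in>grid. \<bar>\<tau> t n - t\<bar> < s / 8) sequentially"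
    proof (rule eventually_ball_finite[OF fin], rule ballI)
      fix t
      have "(\<lambda>n. \<bar>\<tau> t n - t\<bar>) \<longlonglongrightarrow> \<bar>t - t\<bar>" by (intro tendsto_intros \<tau>)
      then show "eventually (\<lambda>n. \<bar>\<tau> t n - t\<bar> < s / 8) sequentially" using s by (intro order_tendstoD(2)) auto
    qed
    from g1 g2 g3 eventually_ge_at_top[of start] show ?thesis
    proof eventually_elim
      case (elim n)
      obtain BZ where BZ: "\<And>t. t \<in> grid \<Longrightarrow> BZ t \<in> events" "\<And>t. t \<in> grid \<Longrightarrow> prob (BZ t) < e'"
        "\<And>t \<omega>. t \<in> grid \<Longrightarrow> \<omega> \<in> space M - BZ t \<Longrightarrow> \<bar>Z t n \<omega> - W n \<omega>\<bar> \<le> s / 8"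
        using bchoice[OF elim(1)[unfolded Bex_def]] by blast
      let ?B = "BW n \<union> (\<Union>t\<in>grid. BZ t)"
      have Ue: "(\<Union>t\<in>grid. BZ t) \<in> events" using BZ(1) fin by (intro sets.finite_UN) auto
      have "prob (\<Union>t\<in>grid. BZ t) \<le> (\<Sum>t\<in>grid. prob (BZ t))"
        using fin BZ(1) by (intro measure_UNION_le) auto
      also have "\<dots> < (\<Sum>t\<in>grid. e')" using fin \<open>grid \<noteq> {}\<close> BZ(2) by (intro sum_strict_mono) auto
      finally have "prob (\<Union>t\<in>grid. BZ t) < e / 2" using e' by simp
      moreover have "prob ?B \<le> prob (BW n) + prob (\<Union>t\<in>grid. BZ t)" using BWe Ue by (intro measure_subadditive) auto
      ultimately have pB: "prob ?B < e" using BWp[OF elim(4)] by linarith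
      show ?case
      proof (intro bexI[of _ ?B] conjI ballI pB)
        show "?B \<in> events" using BWe Ue by auto
        fix \<omega> assume w: "\<omega> \<in> space M - ?B"
        have "(W n \<omega>)\<^sup>2 \<le> (s * real A)\<^sup>2" using w elim(4) by (auto simp: BW_def not_less)
        then have "\<bar>W n \<omega>\<bar> \<le> \<bar>s * real A\<bar>" by (simp only: abs_le_square_iff)
        then have Wb: "\<bar>W n \<omega>\<bar> \<le> s * real A" using s by simp
        define j where "j = \<lfloor>W n \<omega> / s\<rfloor>"
        have j: "s * real_of_int j \<le> W n \<omega>" "W n \<omega> < s * real_of_int j + s"
        proof -
          have "real_of_int j \<le> W n \<omega> / s" "W n \<omega> / s < real_of_int j + 1" unfolding j_def by linarith+
          then show "s * real_of_int j \<le> W n \<omega>" "W n \<omega> < s * real_of_int j + s"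
            using s by (simp_all add: pos_le_divide_eq pos_divide_less_eq algebra_simps)
        qed
        have jb: "- int A - 1 \<le> j" "j \<le> int A"
        proof -
          have "- real A \<le> W n \<omega> / s" "W n \<omega> / s \<le> real A" using Wb s by (auto simp: pos_le_divide_eq pos_divide_le_eq abs_le_iff algebra_simps)
          then show "- int A - 1 \<le> j" "j \<le> int A" unfolding j_def by linarith+
        qed
        let ?u = "s * real_of_int (j + 2)" and ?l = "s * real_of_int (j - 1)"
        have gr: "?u \<in> grid" "?l \<in> grid" unfolding grid_def using jb by (intro conjI imageI; simp)+
        have u: "?u = s * real_of_int j + 2 * s" and l: "?l = s * real_of_int j - s" by (simp_all add: algebra_simps)
        have Zu: "\<bar>Z ?u n \<omega> - W n \<omega>\<bar> \<le> s / 8" "\<bar>Z ?l n \<omega> - W n \<omega>\<bar> \<le> s / 8" using BZ(3) gr w by blast+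
        have iv: "V n \<omega> \<le> ?u \<longleftrightarrow> Z ?u n \<omega> \<le> \<tau> ?u n" "V n \<omega> \<le> ?l \<longleftrightarrow> Z ?l n \<omega> \<le> \<tau> ?l n" using elim(2) gr w by blast+
        have tu: "\<bar>\<tau> ?u n - ?u\<bar> < s / 8" "\<bar>\<tau> ?l n - ?l\<bar> < s / 8" using elim(3) gr by blast+
        have "V n \<omega> \<le> ?u" using iv(1) Zu(1) tu(1) j u s by linarith
        moreover have "\<not> V n \<omega> \<le> ?l"
        proof
          assume "V n \<omega> \<le> ?l"
          then have "Z ?l n \<omega> \<le> \<tau> ?l n" using iv(2) by simp
          then show False using Zu(2) tu(2) j l s by linarith
        qed
        ultimately show "\<bar>V n \<omega> - W n \<omega>\<bar> \<le> \<epsilon>" using j u l s_def by linarith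
      qed
    qed
  qed
  show ?thesis unfolding vanishing_def using key by blast
qed

end

text \<open>The Galois connection between a distribution function and its quantile function.\<close>

lemma quantile_le_iff:
  assumes mono: "mono H" and rc: "\<And>y. continuous (at_right y) H"
    and ne: "\<exists>y. p \<le> H y" and bd: "\<exists>y. H y < p"
  shows "quantile H p \<le> y \<longleftrightarrow> p \<le> H y"
proof
  let ?A = "{x. p \<le> H x}"
  obtain b where b: "H b < p" using bd by auto
  have bdd: "bdd_below ?A"
  proof (rule bdd_belowI[of _ b])
    fix x assume "x \<in> ?A"
    then show "b \<le> x" using b monoD[OF mono, of x b] by (cases "b \<le> x") auto
  qed
  show "quantile H p \<le> y" if "p \<le> H y"
    unfolding quantile_def using that by (intro cInf_lower bdd) simp
  assume q: "quantile H p \<le> y"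
  have "p \<le> H (Inf ?A)"
  proof (rule tendsto_lowerbound)
    show "(H \<longlongrightarrow> H (Inf ?A)) (at_right (Inf ?A))" using rc[of "Inf ?A"] by (simp add: continuous_within)
    show "eventually (\<lambda>x. p \<le> H x) (at_right (Inf ?A))"
    proof (rule eventually_at_right_less[THEN eventually_mono])
      fix x assume "Inf ?A < x"
      then obtain a where "p \<le> H a" "a < x" using ne by (auto simp: cInf_less_iff[OF _ bdd])
      then show "p \<le> H x" using monoD[OF mono, of a x] by simp
    qed
  qed simp
  also have "\<dots> \<le> H y" using q by (intro monoD[OF mono]) (simp add: quantile_def)
  finally show "p \<le> H y" .
qed

section \<open>L-functionals as integrals of the distribution function\<close>

text \<open>Lebesgue measure on \<open>{lo..hi}\<close> as a finite measure on the whole line, so that functions need not be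
  restricted to the interval.\<close>

definition interval_meas :: "real \<Rightarrow> real \<Rightarrow> real measure" where
  "interval_meas lo hi = density lborel (\<lambda>x. ennreal (indicator {lo..hi} x))"

lemma sets_interval_meas[measurable_cong, simp]: "sets (interval_meas lo hi) = sets borel"
  and space_interval_meas[simp]: "space (interval_meas lo hi) = UNIV"
  by (auto simp: interval_meas_def)

lemma finite_measure_interval_meas: "finite_measure (interval_meas lo hi)"
proof
  have "emeasure (interval_meas lo hi) UNIV = emeasure lborel {lo..hi}"
    unfolding interval_meas_def by (subst emeasure_density) (auto simp: ennreal_indicator)
  also have "\<dots> < \<infinity>" by (simp add: emeasure_lborel_Icc_eq)
  finally show "emeasure (interval_meas lo hi) (space (interval_meas lo hi)) \<noteq> \<infinity>" by simp
qed

lemma measure_interval_meas_UNIV: "lo \<le> hi \<Longrightarrow> measure (interval_meas lo hi) UNIV = hi - lo"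
proof -
  assume "lo \<le> hi"
  have "emeasure (interval_meas lo hi) UNIV = emeasure lborel {lo..hi}"
    unfolding interval_meas_def by (subst emeasure_density) (auto simp: ennreal_indicator)
  then show ?thesis using \<open>lo \<le> hi\<close> by (simp add: measure_def)
qed

lemma integral_interval_meas:
  fixes f :: "real \<Rightarrow> real"
  assumes "f \<in> borel_measurable borel"
  shows "(LINT y|interval_meas lo hi. f y) = (LINT y|lborel. indicator {lo..hi} y * f y)"
  unfolding interval_meas_def using assms by (subst integral_density) auto

lemma AE_interval_meas: "(AE y in lborel. P y) \<Longrightarrow> AE y in interval_meas lo hi. P y"
  unfolding interval_meas_def by (subst AE_density) (auto elim: AE_mp)

lemma integrable_interval_meas_bounded:
  fixes f :: "real \<Rightarrow> real"
  assumes "f \<in> borel_measurable borel" "\<And>y. \<bar>f y\<bar> \<le> b"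
  shows "integrable (interval_meas lo hi) f"
  by (rule finite_measure.integrable_const_bound[OF finite_measure_interval_meas, where B = b]) (use assms in auto)

lemma integral_interval_meas_bound:
  fixes f :: "real \<Rightarrow> real"
  assumes "f \<in> borel_measurable borel" "\<And>y. \<bar>f y\<bar> \<le> b" "lo \<le> hi"
  shows "\<bar>LINT y|interval_meas lo hi. f y\<bar> \<le> b * (hi - lo)"
proof -
  have "\<bar>LINT y|interval_meas lo hi. f y\<bar> \<le> (LINT y|interval_meas lo hi. \<bar>f y\<bar>)" by (rule integral_abs_bound)
  also have "\<dots> \<le> (LINT y|interval_meas lo hi. b)"
    using assms integrable_interval_meas_bounded[OF assms(1,2)] finite_measure_interval_meas
    by (intro integral_mono integrable_abs finite_measure.integrable_const) auto
  also have "\<dots> = b * (hi - lo)" using measure_interval_meas_UNIV[OF assms(3)] by simp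
  finally show ?thesis .
qed

lemma (in prob_space) interval_fubini:
  fixes f :: "real \<Rightarrow> 'a \<Rightarrow> real"
  assumes f[measurable]: "(\<lambda>(y, \<omega>). f y \<omega>) \<in> borel_measurable (borel \<Otimes>\<^sub>M M)" and b: "\<And>y \<omega>. \<bar>f y \<omega>\<bar> \<le> b"
  shows "integrable M (\<lambda>\<omega>. LINT y|interval_meas lo hi. f y \<omega>)"
    and "integrable (interval_meas lo hi) (\<lambda>y. expectation (f y))"
    and "expectation (\<lambda>\<omega>. LINT y|interval_meas lo hi. f y \<omega>) = (LINT y|interval_meas lo hi. expectation (f y))"
    and "expectation (\<lambda>\<omega>. \<bar>LINT y|interval_meas lo hi. f y \<omega>\<bar>) \<le> (LINT y|interval_meas lo hi. expectation (\<lambda>\<omega>. \<bar>f y \<omega>\<bar>))"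
proof -
  interpret I: finite_measure "interval_meas lo hi" by (rule finite_measure_interval_meas)
  interpret S: pair_sigma_finite "interval_meas lo hi" M ..
  interpret F: finite_measure "interval_meas lo hi \<Otimes>\<^sub>M M"
    by (rule finite_measure_pair_measure[OF finite_measure_axioms I.finite_measure_axioms])
  have m: "(\<lambda>(y, \<omega>). f y \<omega>) \<in> borel_measurable (interval_meas lo hi \<Otimes>\<^sub>M M)"
    using f by (simp only: measurable_cong_sets[OF sets_pair_measure_cong[OF sets_interval_meas refl] refl])
  have int: "integrable (interval_meas lo hi \<Otimes>\<^sub>M M) (\<lambda>(y, \<omega>). f y \<omega>)"
    by (rule F.integrable_const_bound[where B = b, OF _ m]) (auto simp: b)
  have inta: "integrable (interval_meas lo hi \<Otimes>\<^sub>M M) (\<lambda>(y, \<omega>). \<bar>f y \<omega>\<bar>)"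
    using integrable_abs[OF int] unfolding case_prod_unfold .
  show i1: "integrable M (\<lambda>\<omega>. LINT y|interval_meas lo hi. f y \<omega>)" using S.integrable_snd[OF int] .
  show "integrable (interval_meas lo hi) (\<lambda>y. expectation (f y))" using S.integrable_fst[OF int] by simp
  show "expectation (\<lambda>\<omega>. LINT y|interval_meas lo hi. f y \<omega>) = (LINT y|interval_meas lo hi. expectation (f y))"
    using S.Fubini_integral[OF int] by simp
  have "expectation (\<lambda>\<omega>. \<bar>LINT y|interval_meas lo hi. f y \<omega>\<bar>) \<le> expectation (\<lambda>\<omega>. LINT y|interval_meas lo hi. \<bar>f y \<omega>\<bar>)"
    using S.integrable_snd[OF inta] by (intro integral_mono integrable_abs i1 integral_abs_bound) auto
  also have "\<dots> = (LINT y|interval_meas lo hi. expectation (\<lambda>\<omega>. \<bar>f y \<omega>\<bar>))"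
    using S.Fubini_integral[OF inta] by simp
  finally show "expectation (\<lambda>\<omega>. \<bar>LINT y|interval_meas lo hi. f y \<omega>\<bar>) \<le> \<dots>" .
qed

text \<open>The delta method in mean. Near \<open>s0\<close> the error is at most \<open>\<epsilon>\<close> times the deviation, which is of order
  \<open>1 / sqrt n\<close> in mean; at distance at least \<open>\<delta>\<close> it is bounded by a multiple of the squared
  deviation, which is of order \<open>1 / n\<close>.\<close>

lemma (in prob_space) delta_remainder:
  fixes S :: "nat \<Rightarrow> 'a \<Rightarrow> real" and f :: "real \<Rightarrow> real"
  assumes S: "\<And>n. n \<ge> start \<Longrightarrow> integrable M (\<lambda>\<omega>. S n \<omega> - s0)" "\<And>n. n \<ge> start \<Longrightarrow> integrable M (\<lambda>\<omega>. (S n \<omega> - s0)\<^sup>2)"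
    and C: "\<And>n. n \<ge> start \<Longrightarrow> real n * expectation (\<lambda>\<omega>. (S n \<omega> - s0)\<^sup>2) \<le> C"
    and f[measurable]: "f \<in> borel_measurable borel" and lip: "\<And>s. \<bar>f s - f s0\<bar> \<le> B * \<bar>s - s0\<bar>" and \<kappa>: "\<bar>\<kappa>\<bar> \<le> B"
    and deriv: "\<And>\<epsilon>. \<epsilon> > 0 \<Longrightarrow> \<exists>\<delta>>0. \<forall>s. \<bar>s - s0\<bar> \<le> \<delta> \<longrightarrow> \<bar>f s - f s0 - \<kappa> * (s - s0)\<bar> \<le> \<epsilon> * \<bar>s - s0\<bar>"
  shows "(\<lambda>n. sqrt (real n) * expectation (\<lambda>\<omega>. \<bar>f (S n \<omega>) - f s0 - \<kappa> * (S n \<omega> - s0)\<bar>)) \<longlonglongrightarrow> 0"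
proof (rule LIMSEQ_I)
  fix e :: real assume e: "e > 0"
  let ?D = "\<lambda>n \<omega>. f (S n \<omega>) - f s0 - \<kappa> * (S n \<omega> - s0)"
  have B0: "B \<ge> 0" using \<kappa> by linarith
  have "0 \<le> real start * expectation (\<lambda>\<omega>. (S start \<omega> - s0)\<^sup>2)" by simp
  also have "\<dots> \<le> C" by (rule C) simp
  finally have C0: "C \<ge> 0" .
  define \<epsilon> where "\<epsilon> = e / (2 * (sqrt C + 1))"
  have sC: "sqrt C + 1 > 0" using C0 by (simp add: add_nonneg_pos)
  have \<epsilon>: "\<epsilon> > 0" using e sC by (simp add: \<epsilon>_def)
  obtain \<delta> where \<delta>: "\<delta> > 0" "\<And>s. \<bar>s - s0\<bar> \<le> \<delta> \<Longrightarrow> \<bar>f s - f s0 - \<kappa> * (s - s0)\<bar> \<le> \<epsilon> * \<bar>s - s0\<bar>" using deriv[OF \<epsilon>] by blast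
  have pt: "\<bar>?D n \<omega>\<bar> \<le> \<epsilon> * \<bar>S n \<omega> - s0\<bar> + 2 * B / \<delta> * (S n \<omega> - s0)\<^sup>2" for n \<omega>
  proof (cases "\<bar>S n \<omega> - s0\<bar> \<le> \<delta>")
    case True
    have "0 \<le> 2 * B / \<delta> * (S n \<omega> - s0)\<^sup>2" using B0 \<delta>(1) by simp
    then show ?thesis using \<delta>(2)[OF True] by linarith
  next
    case False
    have "\<bar>?D n \<omega>\<bar> \<le> \<bar>f (S n \<omega>) - f s0\<bar> + \<bar>\<kappa> * (S n \<omega> - s0)\<bar>" by linarith
    also have "\<dots> \<le> B * \<bar>S n \<omega> - s0\<bar> + B * \<bar>S n \<omega> - s0\<bar>"
      unfolding abs_mult by (intro add_mono lip mult_right_mono \<kappa>) auto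
    also have "\<dots> = 2 * B * \<bar>S n \<omega> - s0\<bar>" by simp
    also have "\<dots> \<le> 2 * B * (\<bar>S n \<omega> - s0\<bar> * (\<bar>S n \<omega> - s0\<bar> / \<delta>))"
    proof (rule mult_left_mono)
      have "1 \<le> \<bar>S n \<omega> - s0\<bar> / \<delta>" using False \<delta>(1) by simp
      then have "\<bar>S n \<omega> - s0\<bar> * 1 \<le> \<bar>S n \<omega> - s0\<bar> * (\<bar>S n \<omega> - s0\<bar> / \<delta>)" by (rule mult_left_mono) simp
      then show "\<bar>S n \<omega> - s0\<bar> \<le> \<bar>S n \<omega> - s0\<bar> * (\<bar>S n \<omega> - s0\<bar> / \<delta>)" by simp
    qed (use B0 in simp)
    also have "\<dots> = 2 * B / \<delta> * (S n \<omega> - s0)\<^sup>2" by (simp add: power2_eq_square abs_mult[symmetric])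
    finally show ?thesis using \<epsilon> by (simp add: add_increasing)
  qed
  have bound: "sqrt (real n) * expectation (\<lambda>\<omega>. \<bar>?D n \<omega>\<bar>) \<le> \<epsilon> * sqrt C + 2 * B / \<delta> * C * (1 / sqrt (real n))"
    if n: "n \<ge> start" "n \<ge> 1" for n
  proof -
    have [measurable]: "(\<lambda>\<omega>. S n \<omega> - s0) \<in> borel_measurable M" using S(1)[OF n(1)] by auto
    have "(\<lambda>\<omega>. (S n \<omega> - s0) + s0) \<in> borel_measurable M" by measurable
    then have [measurable]: "S n \<in> borel_measurable M" by simp
    have iR: "integrable M (\<lambda>\<omega>. \<epsilon> * \<bar>S n \<omega> - s0\<bar> + 2 * B / \<delta> * (S n \<omega> - s0)\<^sup>2)"
      using S[OF n(1)] by (intro Bochner_Integration.integrable_add integrable_mult_right integrable_abs)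
    have iD: "integrable M (\<lambda>\<omega>. \<bar>?D n \<omega>\<bar>)"
    proof (rule Bochner_Integration.integrable_bound[OF iR])
      show "AE \<omega> in M. norm \<bar>?D n \<omega>\<bar> \<le> norm (\<epsilon> * \<bar>S n \<omega> - s0\<bar> + 2 * B / \<delta> * (S n \<omega> - s0)\<^sup>2)"
        unfolding real_norm_def abs_abs by (rule AE_I2, rule order.trans[OF pt abs_ge_self])
    qed measurable
    have "expectation (\<lambda>\<omega>. \<bar>?D n \<omega>\<bar>) \<le> expectation (\<lambda>\<omega>. \<epsilon> * \<bar>S n \<omega> - s0\<bar> + 2 * B / \<delta> * (S n \<omega> - s0)\<^sup>2)"
      by (rule integral_mono[OF iD iR pt])
    also have "\<dots> = \<epsilon> * expectation (\<lambda>\<omega>. \<bar>S n \<omega> - s0\<bar>) + 2 * B / \<delta> * expectation (\<lambda>\<omega>. (S n \<omega> - s0)\<^sup>2)"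
      using S[OF n(1)] by (subst Bochner_Integration.integral_add) (auto intro!: integrable_mult_right integrable_abs)
    also have "\<dots> \<le> \<epsilon> * sqrt (expectation (\<lambda>\<omega>. (S n \<omega> - s0)\<^sup>2)) + 2 * B / \<delta> * expectation (\<lambda>\<omega>. (S n \<omega> - s0)\<^sup>2)"
      using S[OF n(1)] \<epsilon> B0 \<delta>(1) by (intro add_mono mult_left_mono expectation_abs_le_sqrt) auto
    finally have "sqrt (real n) * expectation (\<lambda>\<omega>. \<bar>?D n \<omega>\<bar>)
       \<le> sqrt (real n) * (\<epsilon> * sqrt (expectation (\<lambda>\<omega>. (S n \<omega> - s0)\<^sup>2)) + 2 * B / \<delta> * expectation (\<lambda>\<omega>. (S n \<omega> - s0)\<^sup>2))"
      by (rule mult_left_mono) simp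
    also have "\<dots> = \<epsilon> * sqrt (real n * expectation (\<lambda>\<omega>. (S n \<omega> - s0)\<^sup>2)) + 2 * B / \<delta> * (real n * expectation (\<lambda>\<omega>. (S n \<omega> - s0)\<^sup>2)) * (1 / sqrt (real n))"
    proof -
      let ?E = "expectation (\<lambda>\<omega>. (S n \<omega> - s0)\<^sup>2)"
      have r: "real n * (1 / sqrt (real n)) = sqrt (real n)" using n(2) by (simp add: real_div_sqrt)
      have "2 * B / \<delta> * (real n * ?E) * (1 / sqrt (real n)) = 2 * B / \<delta> * ?E * (real n * (1 / sqrt (real n)))"
        by (simp only: mult_ac)
      then have "2 * B / \<delta> * (real n * ?E) * (1 / sqrt (real n)) = 2 * B / \<delta> * ?E * sqrt (real n)" unfolding r .
      then show ?thesis by (simp add: real_sqrt_mult distrib_left mult_ac)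
    qed
    also have "\<dots> \<le> \<epsilon> * sqrt C + 2 * B / \<delta> * C * (1 / sqrt (real n))"
      using C[OF n(1)] \<epsilon> B0 \<delta>(1) by (intro add_mono mult_left_mono mult_right_mono real_sqrt_le_mono) auto
    finally show ?thesis .
  qed
  have "(\<lambda>n. 2 * B / \<delta> * C * (1 / sqrt (real n))) \<longlonglongrightarrow> 2 * B / \<delta> * C * 0"
    by (intro tendsto_intros) real_asymp
  then have "eventually (\<lambda>n. 2 * B / \<delta> * C * (1 / sqrt (real n)) < e / 2) sequentially"
    by (rule order_tendstoD(2)) (use e in simp)
  then have "eventually (\<lambda>n. norm (sqrt (real n) * expectation (\<lambda>\<omega>. \<bar>?D n \<omega>\<bar>) - 0) < e) sequentially"
    using eventually_ge_at_top[of start] eventually_ge_at_top[of 1]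
  proof eventually_elim
    case (elim n)
    have "\<epsilon> * sqrt C \<le> \<epsilon> * (sqrt C + 1)" using \<epsilon> by simp
    also have "\<dots> = e / 2" using sC by (simp add: \<epsilon>_def field_simps)
    finally have "sqrt (real n) * expectation (\<lambda>\<omega>. \<bar>?D n \<omega>\<bar>) < e" using bound[OF elim(2,3)] elim(1) by linarith
    moreover have "0 \<le> sqrt (real n) * expectation (\<lambda>\<omega>. \<bar>?D n \<omega>\<bar>)" by simp
    ultimately show ?case by simp
  qed
  then show "\<exists>no. \<forall>n\<ge>no. norm (sqrt (real n) * expectation (\<lambda>\<omega>. \<bar>?D n \<omega>\<bar>) - 0) < e" by (simp add: eventually_sequentially)
qed

text \<open>\<open>J1\<close> is a Borel version of \<open>J\<close>: only for Borel functions can product measurability be used, whereas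
  continuity is a property of \<open>J\<close> itself.\<close>

locale weight_function =
  fixes J J1 :: "real \<Rightarrow> real" and \<alpha> \<beta> B :: real
  assumes \<alpha>\<beta>: "0 < \<alpha>" "\<alpha> < \<beta>" "\<beta> < 1"
    and J_support: "\<And>t. t \<notin> {\<alpha>..\<beta>} \<Longrightarrow> J t = 0" and J1_support: "\<And>t. t \<notin> {\<alpha>..\<beta>} \<Longrightarrow> J1 t = 0"
    and J_measurable: "J \<in> borel_measurable lebesgue" and J1_measurable[measurable]: "J1 \<in> borel_measurable borel"
    and J_bounded: "\<And>t. \<bar>J t\<bar> \<le> B" and J1_bounded: "\<And>t. \<bar>J1 t\<bar> \<le> B"
    and J_J1: "AE t in lborel. J t = J1 t"
begin

definition J_primitive :: "real \<Rightarrow> real" where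
  "J_primitive s = (LINT t|lborel. J1 t * of_bool (t \<le> s))"

lemma B_nonneg: "0 \<le> B" using J_bounded[of 0] by linarith

lemma integrable_J1_mult:
  assumes [measurable]: "g \<in> borel_measurable borel" and g: "\<And>t. \<bar>g t\<bar> \<le> (b :: real)"
  shows "integrable lborel (\<lambda>t. J1 t * g t)"
proof (rule Bochner_Integration.integrable_bound[where f = "\<lambda>t. (B * b) * indicator {\<alpha>..\<beta>} t :: real"])
  have b0: "b \<ge> 0" using g[of 0] by linarith
  show "integrable lborel (\<lambda>t. (B * b) * indicator {\<alpha>..\<beta>} t :: real)"
    by (intro integrable_mult_right integrable_real_indicator) (auto simp: emeasure_lborel_Icc_eq)
  show "AE t in lborel. norm (J1 t * g t) \<le> norm ((B * b) * indicator {\<alpha>..\<beta>} t :: real)"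
  proof (rule AE_I2)
    fix t show "norm (J1 t * g t) \<le> norm ((B * b) * indicator {\<alpha>..\<beta>} t :: real)"
    proof (cases "t \<in> {\<alpha>..\<beta>}")
      case True
      then show ?thesis using J1_bounded[of t] g[of t] B_nonneg b0
        by (simp add: abs_mult mult_mono)
    qed (simp add: J1_support)
  qed
qed measurable

lemma J_primitive_diff:
  assumes "s \<le> s'" shows "J_primitive s' - J_primitive s = (LINT t|lborel. J1 t * indicator {s<..s'} t)"
proof -
  have "integrable lborel (\<lambda>t. J1 t * of_bool (t \<le> s))" for s
    by (rule integrable_J1_mult[where b = 1]) auto
  then have "J_primitive s' - J_primitive s = (LINT t|lborel. J1 t * of_bool (t \<le> s') - J1 t * of_bool (t \<le> s))"
    unfolding J_primitive_def by simp
  also have "\<dots> = (LINT t|lborel. J1 t * indicator {s<..s'} t)"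
    using assms by (intro Bochner_Integration.integral_cong) (auto simp: indicator_def)
  finally show ?thesis .
qed

lemma integral_ioc: "s \<le> s' \<Longrightarrow> (LINT t|lborel. c * indicator {s<..s'} t) = c * (s' - s :: real)"
  by simp

lemma J_primitive_lipschitz: "\<bar>J_primitive s' - J_primitive s\<bar> \<le> B * \<bar>s' - s\<bar>"
proof -
  have *: "\<bar>J_primitive s' - J_primitive s\<bar> \<le> B * (s' - s)" if "s \<le> s'" for s s'
  proof -
    have i: "integrable lborel (\<lambda>t. c * indicator {s<..s'} t)" for c :: real
      using that by (intro integrable_mult_right integrable_real_indicator) auto
    have "\<bar>J_primitive s' - J_primitive s\<bar> \<le> (LINT t|lborel. \<bar>J1 t * indicator {s<..s'} t\<bar>)"
      unfolding J_primitive_diff[OF that] by (rule integral_abs_bound)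
    also have "\<dots> \<le> (LINT t|lborel. B * indicator {s<..s'} t)"
      using J1_bounded by (intro integral_mono integrable_abs integrable_J1_mult[where b = 1] i) (auto simp: indicator_def)
    also have "\<dots> = B * (s' - s)" using that by (rule integral_ioc)
    finally show ?thesis .
  qed
  show ?thesis using *[of s s'] *[of s' s] by (cases "s \<le> s'") (auto simp: abs_minus_commute)
qed

lemma J_primitive_measurable[measurable]: "J_primitive \<in> borel_measurable borel"
proof (rule borel_measurable_continuous_onI)
  show "continuous_on UNIV J_primitive"
    by (rule lipschitz_on_continuous_on[of B]) (auto intro!: lipschitz_onI simp: dist_real_def J_primitive_lipschitz B_nonneg)
qed

lemma J_primitive_bounded: "\<bar>J_primitive s\<bar> \<le> B"
proof -
  have i: "integrable lborel (\<lambda>t. B * indicator {\<alpha>..\<beta>} t)"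
    by (intro integrable_mult_right integrable_real_indicator) (auto simp: emeasure_lborel_Icc_eq)
  have "\<bar>J_primitive s\<bar> \<le> (LINT t|lborel. \<bar>J1 t * of_bool (t \<le> s)\<bar>)" unfolding J_primitive_def by (rule integral_abs_bound)
  also have "\<dots> \<le> (LINT t|lborel. B * indicator {\<alpha>..\<beta>} t)"
    using J1_bounded J1_support B_nonneg
    by (intro integral_mono integrable_abs integrable_J1_mult[where b = 1] i) (auto simp: indicator_def)
  also have "\<dots> = B * (\<beta> - \<alpha>)" using \<alpha>\<beta> by simp
  also have "\<dots> \<le> B * 1" using \<alpha>\<beta> B_nonneg by (intro mult_left_mono) auto
  finally show ?thesis by simp
qed

text \<open>The fundamental theorem of calculus at a continuity point. It speaks of \<open>J\<close> although the primitive is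
  built from \<open>J1\<close>, as both agree almost everywhere near that point.\<close>

lemma J_primitive_derivative:
  assumes cont: "isCont J s0" and \<epsilon>: "\<epsilon> > 0"
  shows "\<exists>\<delta>>0. \<forall>s. \<bar>s - s0\<bar> \<le> \<delta> \<longrightarrow> \<bar>J_primitive s - J_primitive s0 - J s0 * (s - s0)\<bar> \<le> \<epsilon> * \<bar>s - s0\<bar>"
proof -
  from cont \<epsilon> obtain \<delta> where \<delta>: "\<delta> > 0" "\<And>t. \<bar>t - s0\<bar> < \<delta> \<Longrightarrow> \<bar>J t - J s0\<bar> < \<epsilon>"
    unfolding continuous_at_eps_delta by (auto simp: dist_real_def)
  have *: "\<bar>J_primitive b - J_primitive a - J s0 * (b - a)\<bar> \<le> \<epsilon> * (b - a)" if ab: "a \<le> b" "\<bar>a - s0\<bar> \<le> \<delta> / 2" "\<bar>b - s0\<bar> \<le> \<delta> / 2" for a b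
  proof -
    have i: "integrable lborel (\<lambda>t. c * indicator {a<..b} t)" for c :: real
      using ab by (intro integrable_mult_right integrable_real_indicator) auto
    have iJ: "integrable lborel (\<lambda>t. J1 t * indicator {a<..b} t)" by (rule integrable_J1_mult[where b = 1]) auto
    have "J_primitive b - J_primitive a - J s0 * (b - a) = (LINT t|lborel. J1 t * indicator {a<..b} t - J s0 * indicator {a<..b} t)"
      unfolding J_primitive_diff[OF ab(1)] integral_ioc[OF ab(1), symmetric] using iJ i by simp
    then have "\<bar>J_primitive b - J_primitive a - J s0 * (b - a)\<bar> \<le> (LINT t|lborel. \<bar>J1 t * indicator {a<..b} t - J s0 * indicator {a<..b} t\<bar>)"
      by (simp add: integral_abs_bound)
    also have "\<dots> \<le> (LINT t|lborel. \<epsilon> * indicator {a<..b} t)"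
    proof (rule integral_mono_AE)
      show "AE t in lborel. \<bar>J1 t * indicator {a<..b} t - J s0 * indicator {a<..b} t\<bar> \<le> \<epsilon> * indicator {a<..b} t"
        using J_J1
      proof eventually_elim
        case (elim t)
        show ?case
        proof (cases "t \<in> {a<..b}")
          case True
          then have "\<bar>t - s0\<bar> < \<delta>"
            using ab \<delta>(1) unfolding abs_le_iff abs_less_iff greaterThanAtMost_iff by linarith
          then show ?thesis using True \<delta>(2)[of t] elim by simp
        qed simp
      qed
    qed (use i iJ in auto)
    also have "\<dots> = \<epsilon> * (b - a)" by (rule integral_ioc[OF ab(1)])
    finally show ?thesis .
  qed
  show ?thesis
  proof (intro exI[of _ "\<delta> / 2"] conjI allI impI)
    fix s assume s: "\<bar>s - s0\<bar> \<le> \<delta> / 2"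
    show "\<bar>J_primitive s - J_primitive s0 - J s0 * (s - s0)\<bar> \<le> \<epsilon> * \<bar>s - s0\<bar>"
    proof (cases "s0 \<le> s")
      case True
      then show ?thesis using *[of s0 s] s \<delta>(1) by simp
    next
      case False
      have "J_primitive s - J_primitive s0 - J s0 * (s - s0) = - (J_primitive s0 - J_primitive s - J s0 * (s0 - s))" by (simp add: algebra_simps)
      then show ?thesis using *[of s s0] s \<delta>(1) False by (simp add: abs_minus_commute)
    qed
  qed (use \<delta> in simp)
qed

text \<open>For \<open>t\<close> between \<open>\<alpha>\<close> and \<open>\<beta>\<close> the quantile is \<open>hi\<close> minus the length of the set of the \<open>y\<close> in
  \<open>{lo..hi}\<close> with \<open>t \<le> H y\<close>. Inserting this and exchanging the integrals leaves the primitive of the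
  weight, evaluated at \<open>H y\<close>.\<close>

lemma L_functional_repr:
  assumes mono: "mono H" and gal: "\<And>t y. t \<in> {\<alpha>..\<beta>} \<Longrightarrow> quantile H t \<le> y \<longleftrightarrow> t \<le> H y"
    and lo: "H lo < \<alpha>" and hi: "\<beta> \<le> H hi"
  shows "(LINT t:{0..1}|lebesgue. quantile H t * J t) = hi * (LINT t|lborel. J1 t) - (LINT y|interval_meas lo hi. J_primitive (H y))"
proof -
  have Hm[measurable]: "H \<in> borel_measurable borel" by (rule borel_measurable_mono[OF mono])
  interpret I: finite_measure "interval_meas lo hi" by (rule finite_measure_interval_meas)
  have lohi: "lo \<le> hi"
  proof (rule ccontr)
    assume "\<not> lo \<le> hi" then have "H hi \<le> H lo" by (intro monoD[OF mono]) simp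
    then show False using lo hi \<alpha>\<beta> by linarith
  qed
  define Q where "Q t = hi - (LINT y|interval_meas lo hi. (of_bool (t \<le> H y) :: real))" for t
  have Qm[measurable]: "Q \<in> borel_measurable borel" unfolding Q_def by measurable
  have Qe: "quantile H t = Q t" if t: "t \<in> {\<alpha>..\<beta>}" for t
  proof -
    let ?q = "quantile H t"
    have q: "?q \<le> hi" "lo \<le> ?q" using gal[OF t, of hi] gal[OF t, of lo] lo hi t by auto
    have "(LINT y|interval_meas lo hi. (of_bool (t \<le> H y) :: real)) = (LINT y|lborel. indicator {lo..hi} y * (of_bool (t \<le> H y) :: real))"
      by (rule integral_interval_meas) measurable
    also have "\<dots> = (LINT y|lborel. indicator {?q..hi} y)"
      using q by (intro Bochner_Integration.integral_cong) (auto simp: gal[OF t, symmetric] indicator_def)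
    also have "\<dots> = hi - ?q" using q by simp
    finally show ?thesis by (simp add: Q_def)
  qed
  have "(LINT t:{0..1}|lebesgue. quantile H t * J t) = (LINT t|lebesgue. J t * Q t)"
    unfolding set_lebesgue_integral_def
  proof (rule Bochner_Integration.integral_cong[OF refl])
    fix t show "indicator {0..1} t *\<^sub>R (quantile H t * J t) = J t * Q t"
      using Qe[of t] J_support[of t] \<alpha>\<beta> by (cases "t \<in> {\<alpha>..\<beta>}") auto
  qed
  also have "\<dots> = (LINT t|lebesgue. J1 t * Q t)"
  proof (rule integral_cong_AE)
    show "AE t in lebesgue. J t * Q t = J1 t * Q t" using AE_completion[OF J_J1] by eventually_elim simp
    have "Q \<in> borel_measurable lborel" "J1 \<in> borel_measurable lborel" by measurable
    then have "Q \<in> borel_measurable lebesgue" "J1 \<in> borel_measurable lebesgue" by (auto intro: measurable_completion)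
    then show "(\<lambda>t. J t * Q t) \<in> borel_measurable lebesgue" "(\<lambda>t. J1 t * Q t) \<in> borel_measurable lebesgue"
      using J_measurable by (auto intro: borel_measurable_times)
  qed
  also have "\<dots> = (LINT t|lborel. J1 t * Q t)" by (rule integral_completion) measurable
  also have "\<dots> = hi * (LINT t|lborel. J1 t) - (LINT t|lborel. J1 t * (LINT y|interval_meas lo hi. (of_bool (t \<le> H y) :: real)))"
  proof -
    have "\<bar>LINT y|interval_meas lo hi. (of_bool (t \<le> H y) :: real)\<bar> \<le> 1 * (hi - lo)" for t
      by (rule integral_interval_meas_bound[OF _ _ lohi]) auto
    then have i: "integrable lborel (\<lambda>t. J1 t * (LINT y|interval_meas lo hi. (of_bool (t \<le> H y) :: real)))"
      by (intro integrable_J1_mult) auto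
    have i1: "integrable lborel (\<lambda>t. hi * J1 t)" using integrable_J1_mult[of "\<lambda>_. 1" 1] by simp
    have "(\<lambda>t. J1 t * Q t) = (\<lambda>t. hi * J1 t - J1 t * (LINT y|interval_meas lo hi. (of_bool (t \<le> H y) :: real)))"
      unfolding Q_def right_diff_distrib by (simp only: mult.commute[of hi])
    then show ?thesis using Bochner_Integration.integral_diff[OF i1 i] by (simp only: integral_mult_right_zero)
  qed
  also have "(LINT t|lborel. J1 t * (LINT y|interval_meas lo hi. (of_bool (t \<le> H y) :: real)))
     = (LINT t|lborel. LINT y|interval_meas lo hi. J1 t * (of_bool (t \<le> H y) :: real))" by simp
  also have "\<dots> = (LINT y|interval_meas lo hi. LINT t|lborel. J1 t * (of_bool (t \<le> H y) :: real))"
  proof -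
    interpret S: pair_sigma_finite lborel "interval_meas lo hi" ..
    have "integrable (lborel \<Otimes>\<^sub>M interval_meas lo hi) (\<lambda>(t, y). J1 t * (of_bool (t \<le> H y) :: real))"
    proof (rule S.Fubini_integrable)
      show "(\<lambda>(t, y). J1 t * (of_bool (t \<le> H y) :: real)) \<in> borel_measurable (lborel \<Otimes>\<^sub>M interval_meas lo hi)" by measurable
      have "\<bar>LINT y|interval_meas lo hi. \<bar>(of_bool (t \<le> H y) :: real)\<bar>\<bar> \<le> 1 * (hi - lo)" for t
        by (rule integral_interval_meas_bound[OF _ _ lohi]) auto
      then have "integrable lborel (\<lambda>t. J1 t * (LINT y|interval_meas lo hi. \<bar>(of_bool (t \<le> H y) :: real)\<bar>))"
        by (intro integrable_J1_mult) auto
      from integrable_norm[OF this] show "integrable lborel (\<lambda>t. LINT y|interval_meas lo hi. norm (case (t, y) of (t, y) \<Rightarrow> J1 t * (of_bool (t \<le> H y) :: real)))"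
        by (simp add: abs_mult)
      show "AE t in lborel. integrable (interval_meas lo hi) (\<lambda>y. case (t, y) of (t, y) \<Rightarrow> J1 t * (of_bool (t \<le> H y) :: real))"
      proof (rule AE_I2)
        fix t
        have "\<bar>J1 t * (of_bool (t \<le> H y) :: real)\<bar> \<le> B" for y
          using J1_bounded[of t] B_nonneg by (simp add: abs_mult)
        then have "integrable (interval_meas lo hi) (\<lambda>y. J1 t * (of_bool (t \<le> H y) :: real))"
          by (rule integrable_interval_meas_bounded[rotated]) measurable
        then show "integrable (interval_meas lo hi) (\<lambda>y. case (t, y) of (t, y) \<Rightarrow> J1 t * (of_bool (t \<le> H y) :: real))"
          unfolding prod.case .
      qed
    qed
    from S.Fubini_integral[OF this] show ?thesis by simp
  qed
  finally show ?thesis by (simp add: J_primitive_def)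
qed

end

section \<open>Linearization of empirical quantiles\<close>

context kernel_process
begin

lemma Hn_mono: "mono (Hn n \<omega>)"
  unfolding Hn_def ind_def by (intro monoI divide_right_mono sum_mono) auto

lemma Hn_right_continuous: "continuous (at_right y) (Hn n \<omega>)"
proof -
  have ind: "((\<lambda>z. ind z v) \<longlongrightarrow> ind y v) (at_right y)" for v
  proof (rule tendsto_eventually)
    show "eventually (\<lambda>z. ind z v = ind y v) (at_right y)"
    proof (cases "h v \<le> y")
      case True
      show ?thesis using eventually_at_right_less[of y] by eventually_elim (use True in \<open>auto simp: ind_def\<close>)
    next
      case False
      then have "y < h v" by simp
      from eventually_at_right_real[OF this] show ?thesis
        by eventually_elim (use False in \<open>auto simp: ind_def\<close>)
    qed
  qed
  show ?thesis
    unfolding continuous_within Hn_def divide_inverse by (intro tendsto_intros ind)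
qed

lemma Hn_exists_above: assumes "n \<ge> m" "t \<le> 1" shows "\<exists>y. t \<le> Hn n \<omega> y"
proof -
  let ?v = "\<lambda>i. h (\<lambda>j\<in>{1..m}. X (i j) \<omega>)"
  let ?y = "Max (insert 0 (?v ` tuples m n))"
  have "?v i \<le> ?y" if "i \<in> tuples m n" for i using that by (intro Max_ge) auto
  then have "(\<Sum>i\<in>tuples m n. ind ?y (\<lambda>j\<in>{1..m}. X (i j) \<omega>)) = (\<Sum>i\<in>tuples m n. 1)"
    by (intro sum.cong) (auto simp: ind_def)
  then have "Hn n \<omega> ?y = 1" using assms by (simp add: Hn_def card_tuples)
  then show ?thesis using assms by (metis)
qed

lemma Hn_exists_below: assumes "0 < t" shows "\<exists>y. Hn n \<omega> y < t"
proof -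
  let ?v = "\<lambda>i. h (\<lambda>j\<in>{1..m}. X (i j) \<omega>)"
  let ?y = "Min (insert 0 (?v ` tuples m n)) - 1"
  have "?y < ?v i" if "i \<in> tuples m n" for i
  proof -
    have "Min (insert 0 (?v ` tuples m n)) \<le> ?v i" using that by (intro Min_le) auto
    then show ?thesis by simp
  qed
  then have "(\<Sum>i\<in>tuples m n. ind ?y (\<lambda>j\<in>{1..m}. X (i j) \<omega>)) = (\<Sum>i\<in>tuples m n. 0)"
    by (intro sum.cong) (auto simp: ind_def not_le)
  then have "Hn n \<omega> ?y = 0" by (simp add: Hn_def)
  then show ?thesis using assms by metis
qed

lemma quantile_Hn: "n \<ge> m \<Longrightarrow> 0 < t \<Longrightarrow> t \<le> 1 \<Longrightarrow> quantile (Hn n \<omega>) t \<le> y \<longleftrightarrow> t \<le> Hn n \<omega> y"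
  by (rule quantile_le_iff[OF Hn_mono Hn_right_continuous Hn_exists_above Hn_exists_below])

lemma Hn_unit: "n \<ge> m \<Longrightarrow> 0 \<le> Hn n \<omega> y \<and> Hn n \<omega> y \<le> 1"
  using U_stat_unit[OF unit_kernel_ind] by (simp add: Hn_U_stat)

lemma HF_unit: "0 \<le> HF y" "HF y \<le> 1"
  unfolding HF_def using theta_unit[OF unit_kernel_ind] by auto

lemma HF_measurable[measurable]: "HF \<in> borel_measurable borel"
  by (rule borel_measurable_mono) (auto intro!: monoI HF_mono)

lemma Hn_joint_measurable[measurable]: "(\<lambda>(y, \<omega>). Hn n \<omega> y) \<in> borel_measurable (borel \<Otimes>\<^sub>M M)"
proof -
  have "(\<lambda>w. ind (fst w) (\<lambda>j\<in>{1..m}. X (i j) (snd w))) \<in> borel_measurable (borel \<Otimes>\<^sub>M M)" if "i \<in> tuples m n" for i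
  proof -
    have [measurable]: "(\<lambda>\<omega>. h (\<lambda>j\<in>{1..m}. X (i j) \<omega>)) \<in> borel_measurable M"
      by (rule measurable_compose[OF X_tuple_measurable[OF that] h_measurable])
    show ?thesis unfolding ind_def by measurable
  qed
  then show ?thesis unfolding Hn_def split_beta by (intro borel_measurable_divide borel_measurable_sum borel_measurable_const)
qed

lemma Hn_measurable[measurable]: "(\<lambda>\<omega>. Hn n \<omega> y) \<in> borel_measurable M"
  unfolding Hn_U_stat by (rule U_stat_measurable[OF unit_kernel_ind])

lemma projection_joint_measurable[measurable]: "(\<lambda>(y, c). projection m (ind y) c) \<in> borel_measurable (borel \<Otimes>\<^sub>M borel)"
proof -
  interpret I: prob_space iid_paths by (rule prob_space_iid_paths)
  have hm: "(\<lambda>w. h (\<lambda>j\<in>{1..m}. if j = 1 then fst w else snd w j)) \<in> borel_measurable (borel \<Otimes>\<^sub>M iid_paths)"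
    using measurable_compose[OF measurable_select_mixed[where J = "{1..m}" and a = 1 and i = "\<lambda>j. j"] h_measurable]
    by (simp only: split_beta measurable_cong_sets[OF sets_pair_measure_cong[OF refl sets_iid_paths] refl])
  have "(\<lambda>w. h (\<lambda>j\<in>{1..m}. if j = 1 then fst (snd (fst w), snd w) else snd (snd (fst w), snd w) j)) \<in> borel_measurable ((borel \<Otimes>\<^sub>M borel) \<Otimes>\<^sub>M iid_paths)"
    by (rule measurable_compose[OF _ hm]) measurable
  then have gm: "(\<lambda>w. h (\<lambda>j\<in>{1..m}. if j = 1 then snd (fst w) else snd w j)) \<in> borel_measurable ((borel \<Otimes>\<^sub>M borel) \<Otimes>\<^sub>M iid_paths)"
    unfolding fst_conv snd_conv .
  have compare: "(\<lambda>w. of_bool (g w \<le> f w) :: real) \<in> borel_measurable N"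
    if [measurable]: "g \<in> borel_measurable N" "f \<in> borel_measurable N" for f g :: "_ \<Rightarrow> real" and N :: "((real \<times> real) \<times> (nat \<Rightarrow> real)) measure"
    by measurable
  have "(\<lambda>w. ind (fst (fst w)) (\<lambda>j\<in>{1..m}. if j = 1 then snd (fst w) else snd w j)) \<in> borel_measurable ((borel \<Otimes>\<^sub>M borel) \<Otimes>\<^sub>M iid_paths)"
    unfolding ind_def by (rule compare[OF gm]) measurable
  then have "(\<lambda>(p, z). ind (fst p) (\<lambda>j\<in>{1..m}. if j = 1 then snd p else z j)) \<in> borel_measurable ((borel \<Otimes>\<^sub>M borel) \<Otimes>\<^sub>M iid_paths)"
    unfolding case_prod_unfold .
  then have "(\<lambda>p. LINT z|iid_paths. ind (fst p) (\<lambda>j\<in>{1..m}. if j = 1 then snd p else z j)) \<in> borel_measurable (borel \<Otimes>\<^sub>M borel)"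
    by (rule I.borel_measurable_lebesgue_integral)
  then show ?thesis unfolding projection_def case_prod_unfold .
qed

lemma linear_part_joint_measurable[measurable]: "(\<lambda>(y, \<omega>). linear_part (ind y) n \<omega>) \<in> borel_measurable (borel \<Otimes>\<^sub>M M)"
proof -
  have "(\<lambda>w. projection m (ind (fst w)) (X s (snd w)) - HF (fst w)) \<in> borel_measurable (borel \<Otimes>\<^sub>M M)" if "s \<in> {1..n}" for s
  proof -
    have [measurable]: "X s \<in> borel_measurable M" using that by (intro X_measurable) auto
    have "(\<lambda>w. (fst w, X s (snd w))) \<in> borel \<Otimes>\<^sub>M M \<rightarrow>\<^sub>M borel \<Otimes>\<^sub>M borel" by measurable
    from measurable_compose[OF this projection_joint_measurable]
    have [measurable]: "(\<lambda>w. projection m (ind (fst w)) (X s (snd w))) \<in> borel_measurable (borel \<Otimes>\<^sub>M M)" by simp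
    show ?thesis by measurable
  qed
  then show ?thesis unfolding linear_part_def HF_def[symmetric] split_beta
    by (intro borel_measurable_times borel_measurable_sum borel_measurable_const)
qed

lemma lin_error_joint_measurable[measurable]: "(\<lambda>(y, \<omega>). lin_error n y \<omega>) \<in> borel_measurable (borel \<Otimes>\<^sub>M M)"
proof -
  have [measurable]: "(\<lambda>w. Hn n (snd w) (fst w)) \<in> borel_measurable (borel \<Otimes>\<^sub>M M)"
    "(\<lambda>w. linear_part (ind (fst w)) n (snd w)) \<in> borel_measurable (borel \<Otimes>\<^sub>M M)"
    using Hn_joint_measurable[of n] linear_part_joint_measurable[of n] by (simp_all add: split_beta)
  show ?thesis unfolding lin_error_def split_beta by measurable
qed

lemma linear_part_second_moment:
  assumes "n \<ge> 1" shows "real n * expectation (\<lambda>\<omega>. (linear_part (ind y) n \<omega>)\<^sup>2) \<le> 2 * (real m)\<^sup>2 * small_variance 2"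
proof -
  let ?w = "projection m (ind y)"
  have "expectation (\<lambda>\<omega>. (\<Sum>s\<in>{1..n}. ?w (X s \<omega>) - expectation (\<lambda>\<omega>. ?w (X 1 \<omega>)))\<^sup>2) \<le> 2 * real (card {1..n}) * small_variance (2 * 1)"
    by (rule centered_sum_small)
      (use projection_unit[OF unit_kernel_ind] theta_unit[OF unit_kernel_ind] in
        \<open>auto simp: expectation_projection[OF unit_kernel_ind, simplified] intro!: measurable_projection[OF unit_kernel_ind]\<close>)
  then have "expectation (\<lambda>\<omega>. (\<Sum>s\<in>{1..n}. ?w (X s \<omega>) - theta m (ind y))\<^sup>2) \<le> 2 * real n * small_variance 2"
    unfolding expectation_projection[OF unit_kernel_ind] by simp
  then have "real n * ((real m / real n)\<^sup>2 * expectation (\<lambda>\<omega>. (\<Sum>s\<in>{1..n}. ?w (X s \<omega>) - theta m (ind y))\<^sup>2))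
      \<le> real n * ((real m / real n)\<^sup>2 * (2 * real n * small_variance 2))"
    by (intro mult_left_mono) auto
  also have "\<dots> = 2 * (real m)\<^sup>2 * small_variance 2" using assms by (simp add: power2_eq_square)
  finally show ?thesis unfolding linear_part_def power_mult_distrib by simp
qed

lemma Hn_integrable:
  assumes "n \<ge> m"
  shows "integrable M (\<lambda>\<omega>. Hn n \<omega> y - HF y)" "integrable M (\<lambda>\<omega>. (Hn n \<omega> y - HF y)\<^sup>2)"
    "integrable M (\<lambda>\<omega>. lin_error n y \<omega>)" "integrable M (\<lambda>\<omega>. (lin_error n y \<omega>)\<^sup>2)"
    "integrable M (\<lambda>\<omega>. linear_part (ind y) n \<omega>)" "integrable M (\<lambda>\<omega>. (linear_part (ind y) n \<omega>)\<^sup>2)"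
proof -
  have b: "\<bar>Hn n \<omega> y - HF y\<bar> \<le> 1" for \<omega> using Hn_unit[OF assms, of \<omega> y] HF_unit[of y] by linarith
  show "integrable M (\<lambda>\<omega>. Hn n \<omega> y - HF y)" "integrable M (\<lambda>\<omega>. (Hn n \<omega> y - HF y)\<^sup>2)"
    by (rule integrable_bounded_rv[OF _ b], measurable)+
  show "integrable M (\<lambda>\<omega>. lin_error n y \<omega>)" "integrable M (\<lambda>\<omega>. (lin_error n y \<omega>)\<^sup>2)"
    by (rule integrable_bounded_rv[OF _ lin_error_bounded[OF assms]], measurable)+
  show "integrable M (\<lambda>\<omega>. linear_part (ind y) n \<omega>)" "integrable M (\<lambda>\<omega>. (linear_part (ind y) n \<omega>)\<^sup>2)"
    by (rule integrable_bounded_rv[OF linear_part_measurable[OF unit_kernel_ind] linear_part_bounded[OF unit_kernel_ind]])+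
qed

text \<open>Both the linearization error and the linear part have second moments of order \<open>1 / n\<close>, uniformly in
  the level.\<close>

lemma Hn_second_moment:
  obtains C where "\<And>n y. n \<ge> m \<Longrightarrow> real n * expectation (\<lambda>\<omega>. (Hn n \<omega> y - HF y)\<^sup>2) \<le> C"
proof -
  obtain e where e: "e \<longlonglongrightarrow> 0" "\<And>n y. n \<ge> m \<Longrightarrow> real n * expectation (\<lambda>\<omega>. (lin_error n y \<omega>)\<^sup>2) \<le> e n"
    using uniform_linearization by blast
  obtain E where E: "\<And>n. \<bar>e n\<bar> \<le> E" using convergent_imp_Bseq[of e] e(1) by (auto simp: convergent_def Bseq_def)
  show ?thesis
  proof (rule that)
    fix n y assume n: "n \<ge> m"
    note i = Hn_integrable[OF n, of y]
    have "expectation (\<lambda>\<omega>. (Hn n \<omega> y - HF y)\<^sup>2) \<le> expectation (\<lambda>\<omega>. 2 * (lin_error n y \<omega>)\<^sup>2 + 2 * (linear_part (ind y) n \<omega>)\<^sup>2)"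
    proof (rule integral_mono)
      fix \<omega> show "(Hn n \<omega> y - HF y)\<^sup>2 \<le> 2 * (lin_error n y \<omega>)\<^sup>2 + 2 * (linear_part (ind y) n \<omega>)\<^sup>2"
        using square_sum_le[of "lin_error n y \<omega>" "linear_part (ind y) n \<omega>"] by (simp add: lin_error_def)
    qed (use i in auto)
    also have "\<dots> = 2 * expectation (\<lambda>\<omega>. (lin_error n y \<omega>)\<^sup>2) + 2 * expectation (\<lambda>\<omega>. (linear_part (ind y) n \<omega>)\<^sup>2)"
      using i by simp
    finally have "real n * expectation (\<lambda>\<omega>. (Hn n \<omega> y - HF y)\<^sup>2) \<le> real n * \<dots>" by (rule mult_left_mono) simp
    also have "\<dots> = 2 * (real n * expectation (\<lambda>\<omega>. (lin_error n y \<omega>)\<^sup>2)) + 2 * (real n * expectation (\<lambda>\<omega>. (linear_part (ind y) n \<omega>)\<^sup>2))"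
      by (simp add: algebra_simps)
    also have "\<dots> \<le> 2 * E + 2 * (2 * (real m)\<^sup>2 * small_variance 2)"
      using e(2)[OF n, of y] E[of n] linear_part_second_moment[of n y] n m1 by linarith
    finally show "real n * expectation (\<lambda>\<omega>. (Hn n \<omega> y - HF y)\<^sup>2) \<le> 2 * E + 2 * (2 * (real m)\<^sup>2 * small_variance 2)" .
  qed
qed

lemma lin_error_vanishing: "vanishing (\<lambda>n \<omega>. sqrt (real n) * lin_error n (z n) \<omega>)"
proof -
  obtain e where e: "e \<longlonglongrightarrow> 0" "\<And>n y. n \<ge> m \<Longrightarrow> real n * expectation (\<lambda>\<omega>. (lin_error n y \<omega>)\<^sup>2) \<le> e n"
    using uniform_linearization by blast
  show ?thesis
  proof (rule vanishing_L2)
    show "eventually (\<lambda>n. integrable M (\<lambda>\<omega>. sqrt (real n) * lin_error n (z n) \<omega>) \<and> integrable M (\<lambda>\<omega>. (sqrt (real n) * lin_error n (z n) \<omega>)\<^sup>2)) sequentially"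
      using eventually_ge_at_top[of m] by eventually_elim (auto simp: power_mult_distrib Hn_integrable)
    show "(\<lambda>n. expectation (\<lambda>\<omega>. (sqrt (real n) * lin_error n (z n) \<omega>)\<^sup>2)) \<longlonglongrightarrow> 0"
    proof (rule tendsto_sandwich[OF _ _ tendsto_const e(1)])
      show "eventually (\<lambda>n. expectation (\<lambda>\<omega>. (sqrt (real n) * lin_error n (z n) \<omega>)\<^sup>2) \<le> e n) sequentially"
        using eventually_ge_at_top[of m] by eventually_elim (simp add: power_mult_distrib e(2))
    qed auto
  qed
qed

text \<open>Asymptotic equicontinuity at a point: the projections at two close levels differ little in \<open>L\<^sup>1\<close>, so
  the difference of the linear parts has a small second moment.\<close>

lemma increment_vanishing:
  assumes y: "y \<longlonglongrightarrow> y0"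
  shows "vanishing (\<lambda>n \<omega>. sqrt (real n) * ((Hn n \<omega> (y n) - HF (y n)) - (Hn n \<omega> y0 - HF y0)))"
proof -
  let ?d = "\<lambda>n \<omega>. linear_part (ind (y n)) n \<omega> - linear_part (ind y0) n \<omega>"
  have d: "vanishing (\<lambda>n \<omega>. sqrt (real n) * ?d n \<omega>)"
  proof (rule vanishing_L2)
    show "eventually (\<lambda>n. integrable M (\<lambda>\<omega>. sqrt (real n) * ?d n \<omega>) \<and> integrable M (\<lambda>\<omega>. (sqrt (real n) * ?d n \<omega>)\<^sup>2)) sequentially"
    proof (intro always_eventually allI)
      fix n
      have dm: "?d n \<in> borel_measurable M" by (intro borel_measurable_diff linear_part_measurable unit_kernel_ind)
      have db: "\<bar>?d n \<omega>\<bar> \<le> 2 * real m" for \<omega>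
        using linear_part_bounded[OF unit_kernel_ind, of "y n" n \<omega>] linear_part_bounded[OF unit_kernel_ind, of y0 n \<omega>] by linarith
      show "integrable M (\<lambda>\<omega>. sqrt (real n) * ?d n \<omega>) \<and> integrable M (\<lambda>\<omega>. (sqrt (real n) * ?d n \<omega>)\<^sup>2)"
        using integrable_bounded_rv[OF dm db] by (auto simp: power_mult_distrib)
    qed
    have sv: "(\<lambda>n. small_variance (2 * (D * \<bar>y n - y0\<bar>))) \<longlonglongrightarrow> 0"
    proof (rule small_variance_tendsto_0)
      have "(\<lambda>n. 2 * (D * \<bar>y n - y0\<bar>)) \<longlonglongrightarrow> 2 * (D * \<bar>y0 - y0\<bar>)" by (intro tendsto_intros y)
      then show "(\<lambda>n. 2 * (D * \<bar>y n - y0\<bar>)) \<longlonglongrightarrow> 0" by simp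
    qed (use D0 in auto)
    have sv2: "(\<lambda>n. 2 * (real m)\<^sup>2 * small_variance (2 * (D * \<bar>y n - y0\<bar>))) \<longlonglongrightarrow> 0"
      using tendsto_mult[OF tendsto_const sv, of "2 * (real m)\<^sup>2"] by simp
    show "(\<lambda>n. expectation (\<lambda>\<omega>. (sqrt (real n) * ?d n \<omega>)\<^sup>2)) \<longlonglongrightarrow> 0"
    proof (rule tendsto_sandwich[OF _ _ tendsto_const sv2])
      show "eventually (\<lambda>n. expectation (\<lambda>\<omega>. (sqrt (real n) * ?d n \<omega>)\<^sup>2) \<le> 2 * (real m)\<^sup>2 * small_variance (2 * (D * \<bar>y n - y0\<bar>))) sequentially"
        using eventually_ge_at_top[of 1]
      proof eventually_elim
        case (elim n)
        have "real n * expectation (\<lambda>\<omega>. (?d n \<omega>)\<^sup>2) \<le> 2 * (real m)\<^sup>2 * small_variance (2 * (D * \<bar>y n - y0\<bar>))"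
        proof (cases "y0 \<le> y n")
          case True
          show ?thesis
            by (rule linear_part_difference[OF unit_kernel_ind unit_kernel_ind _ _ elim])
              (use True HF_increment'[of y0 "y n"] in \<open>auto simp: ind_def HF_def\<close>)
        next
          case False
          have "real n * expectation (\<lambda>\<omega>. (linear_part (ind y0) n \<omega> - linear_part (ind (y n)) n \<omega>)\<^sup>2) \<le> 2 * (real m)\<^sup>2 * small_variance (2 * (D * \<bar>y n - y0\<bar>))"
            by (rule linear_part_difference[OF unit_kernel_ind unit_kernel_ind _ _ elim])
              (use False HF_increment'[of "y n" y0] in \<open>auto simp: ind_def HF_def\<close>)
          then show ?thesis by (simp add: power2_commute)
        qed
        then show ?case by (simp add: power_mult_distrib)
      qed
    qed auto
  qed
  have "vanishing (\<lambda>n \<omega>. sqrt (real n) * lin_error n (y n) \<omega> + (- 1) * (sqrt (real n) * lin_error n y0 \<omega>) + sqrt (real n) * ?d n \<omega>)"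
    by (intro vanishing_add vanishing_cmult d lin_error_vanishing[of y] lin_error_vanishing[of "\<lambda>_. y0"])
  moreover have "(\<lambda>n \<omega>. sqrt (real n) * lin_error n (y n) \<omega> + (- 1) * (sqrt (real n) * lin_error n y0 \<omega>) + sqrt (real n) * ?d n \<omega>)
    = (\<lambda>n \<omega>. sqrt (real n) * ((Hn n \<omega> (y n) - HF (y n)) - (Hn n \<omega> y0 - HF y0)))"
    by (intro ext) (simp add: lin_error_def algebra_simps)
  ultimately show ?thesis by simp
qed

text \<open>The Bahadur representation. The rescaled quantile error is at most \<open>t\<close> if and only if
  \<open>p \<le> H\<^sub>n (q + t / sqrt n)\<close>, and by \<open>increment_vanishing\<close> the fluctuation of \<open>H\<^sub>n\<close> at this level may be
  replaced by that at \<open>q\<close>, while \<open>H\<^sub>F\<close> grows by about \<open>dq * t / sqrt n\<close>.\<close>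

lemma quantile_vanishing:
  assumes p: "0 < p" "p < 1" and q: "HF q = p" and deriv: "(HF has_real_derivative dq) (at q)" and dq: "dq > 0"
  shows "vanishing (\<lambda>n \<omega>. sqrt (real n) * (quantile (Hn n \<omega>) p - q) - (- sqrt (real n) * linear_part (ind q) n \<omega> / dq))"
proof -
  define V where "V n \<omega> = sqrt (real n) * (quantile (Hn n \<omega>) p - q)" for n \<omega>
  define W where "W n \<omega> = sqrt (real n) * (p - Hn n \<omega> q) / dq" for n \<omega>
  define y where "y t n = q + t / sqrt (real n)" for t and n :: nat
  define Z where "Z t n \<omega> = sqrt (real n) * (HF (y t n) - Hn n \<omega> (y t n)) / dq" for t n \<omega>
  define \<tau> where "\<tau> t n = sqrt (real n) * (HF (y t n) - p) / dq" for t n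
  have s0: "(\<lambda>n. t / sqrt (real n)) \<longlonglongrightarrow> 0" for t :: real by real_asymp
  have y_lim: "(\<lambda>n. y t n) \<longlonglongrightarrow> q" for t unfolding y_def using tendsto_add[OF tendsto_const s0, of q t] by simp
  obtain C where C: "\<And>n y. n \<ge> m \<Longrightarrow> real n * expectation (\<lambda>\<omega>. (Hn n \<omega> y - HF y)\<^sup>2) \<le> C" using Hn_second_moment by blast
  have main: "vanishing (\<lambda>n \<omega>. V n \<omega> - W n \<omega>)"
  proof (rule ghosh[where Z = Z and \<tau> = \<tau> and C = "C / dq\<^sup>2" and start = m])
    fix t
    show "eventually (\<lambda>n. \<forall>\<omega>\<in>space M. V n \<omega> \<le> t \<longleftrightarrow> Z t n \<omega> \<le> \<tau> t n) sequentially"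
      using eventually_ge_at_top[of m]
    proof eventually_elim
      case (elim n)
      have n0: "sqrt (real n) > 0" using elim m1 by simp
      show ?case
      proof
        fix \<omega>
        have "V n \<omega> \<le> t \<longleftrightarrow> (quantile (Hn n \<omega>) p - q) * sqrt (real n) \<le> t"
          unfolding V_def by (simp only: mult.commute)
        also have "\<dots> \<longleftrightarrow> quantile (Hn n \<omega>) p - q \<le> t / sqrt (real n)"
          by (rule pos_le_divide_eq[OF n0, symmetric])
        also have "\<dots> \<longleftrightarrow> quantile (Hn n \<omega>) p \<le> y t n"
          unfolding y_def by linarith
        also have "\<dots> \<longleftrightarrow> p \<le> Hn n \<omega> (y t n)" using p by (intro quantile_Hn elim) auto
        also have "\<dots> \<longleftrightarrow> Z t n \<omega> \<le> \<tau> t n"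
          unfolding Z_def \<tau>_def using dq n0 by (simp add: divide_le_cancel)
        finally show "V n \<omega> \<le> t \<longleftrightarrow> Z t n \<omega> \<le> \<tau> t n" .
      qed
    qed
    show "\<tau> t \<longlonglongrightarrow> t"
    proof (cases "t = 0")
      case True then show ?thesis by (simp add: \<tau>_def[abs_def] y_def q)
    next
      case False
      have "((\<lambda>k. (HF (q + k) - HF q) / k) \<longlongrightarrow> dq) (at 0)" using deriv by (simp add: DERIV_def)
      moreover have "filterlim (\<lambda>n. t / sqrt (real n)) (at 0) sequentially"
        unfolding filterlim_at using s0[of t] False eventually_gt_at_top[of 0] by (auto elim: eventually_mono)
      ultimately have "(\<lambda>n. (HF (q + t / sqrt (real n)) - HF q) / (t / sqrt (real n))) \<longlonglongrightarrow> dq"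
        by (rule filterlim_compose)
      then have "(\<lambda>n. t / dq * ((HF (q + t / sqrt (real n)) - HF q) / (t / sqrt (real n)))) \<longlonglongrightarrow> t / dq * dq"
        by (intro tendsto_intros)
      moreover have "(\<lambda>n. t / dq * ((HF (q + t / sqrt (real n)) - HF q) / (t / sqrt (real n)))) = \<tau> t"
        unfolding \<tau>_def y_def q using False by (intro ext) (simp add: mult_ac)
      ultimately show ?thesis using dq by simp
    qed
    have "vanishing (\<lambda>n \<omega>. (- 1 / dq) * (sqrt (real n) * ((Hn n \<omega> (y t n) - HF (y t n)) - (Hn n \<omega> q - HF q))))"
      by (intro vanishing_cmult increment_vanishing y_lim)
    moreover have "(\<lambda>n \<omega>. (- 1 / dq) * (sqrt (real n) * ((Hn n \<omega> (y t n) - HF (y t n)) - (Hn n \<omega> q - HF q)))) = (\<lambda>n \<omega>. Z t n \<omega> - W n \<omega>)"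
      unfolding Z_def W_def q using dq by (intro ext) (simp add: field_simps)
    ultimately show "vanishing (\<lambda>n \<omega>. Z t n \<omega> - W n \<omega>)" by simp
  next
    fix n assume n: "n \<ge> m"
    have W2: "(W n \<omega>)\<^sup>2 = real n / dq\<^sup>2 * (Hn n \<omega> q - HF q)\<^sup>2" for \<omega>
      unfolding W_def q by (simp add: power_divide power_mult_distrib power2_commute)
    show "integrable M (\<lambda>\<omega>. (W n \<omega>)\<^sup>2)" unfolding W2 using Hn_integrable[OF n] by auto
    have "expectation (\<lambda>\<omega>. (W n \<omega>)\<^sup>2) = (real n * expectation (\<lambda>\<omega>. (Hn n \<omega> q - HF q)\<^sup>2)) / dq\<^sup>2"
      unfolding W2 by simp
    also have "\<dots> \<le> C / dq\<^sup>2" by (intro divide_right_mono C n) auto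
    finally show "expectation (\<lambda>\<omega>. (W n \<omega>)\<^sup>2) \<le> C / dq\<^sup>2" .
  qed
  have "vanishing (\<lambda>n \<omega>. (V n \<omega> - W n \<omega>) + (- 1 / dq) * (sqrt (real n) * lin_error n q \<omega>))"
    by (intro vanishing_add main vanishing_cmult lin_error_vanishing[of "\<lambda>_. q"])
  moreover have "(\<lambda>n \<omega>. (V n \<omega> - W n \<omega>) + (- 1 / dq) * (sqrt (real n) * lin_error n q \<omega>))
     = (\<lambda>n \<omega>. sqrt (real n) * (quantile (Hn n \<omega>) p - q) - (- sqrt (real n) * linear_part (ind q) n \<omega> / dq))"
    unfolding V_def W_def lin_error_def q using dq by (intro ext) (simp add: field_simps)
  ultimately show ?thesis by simp
qed

end

section \<open>Linearization of the smooth part of the functional\<close>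

text \<open>\<open>wt\<close> is a Borel version of the function \<open>J \<circ> HF\<close>. The levels \<open>lo\<close> and \<open>hi\<close> enclose strictly the
  range of quantiles on which the weight lives.\<close>

locale gl_process = kernel_process M X K m h L D + weight_function J J1 \<alpha> \<beta> B
  for M :: "'a measure" and X K m h L D J J1 \<alpha> \<beta> B +
  fixes wt :: "real \<Rightarrow> real" and lo hi :: real
  assumes wt_measurable[measurable]: "wt \<in> borel_measurable borel" and wt_bounded: "\<And>y. \<bar>wt y\<bar> \<le> B"
    and wt_J: "AE y in lborel. wt y = J (HF y)"
    and J_cont: "AE y in lborel. isCont J (HF y)"
    and HF_lo: "HF lo < \<alpha>" and HF_hi: "\<beta> < HF hi"
    and quantile_HF: "\<And>t y. t \<in> {\<alpha>..\<beta>} \<Longrightarrow> quantile HF t \<le> y \<longleftrightarrow> t \<le> HF y"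
begin

definition L_influence :: "real \<Rightarrow> real" where
  "L_influence c = (LINT y|interval_meas lo hi. wt y * (projection m (ind y) c - HF y))"

lemma lo_hi: "lo \<le> hi"
proof (rule ccontr)
  assume "\<not> lo \<le> hi"
  then have "HF hi \<le> HF lo" by (intro HF_mono) simp
  then show False using HF_lo HF_hi \<alpha>\<beta> by linarith
qed

lemma L_influence_integrand:
  "(\<lambda>y. wt y * (projection m (ind y) c - HF y)) \<in> borel_measurable borel" (is ?m)
  "\<bar>wt y * (projection m (ind y) c - HF y)\<bar> \<le> B"
proof -
  have "(\<lambda>y::real. (y, c)) \<in> borel \<rightarrow>\<^sub>M borel \<Otimes>\<^sub>M borel" by measurable
  from measurable_compose[OF this projection_joint_measurable]
  have [measurable]: "(\<lambda>y. projection m (ind y) c) \<in> borel_measurable borel" by simp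
  show ?m by measurable
  have "\<bar>projection m (ind y) c - HF y\<bar> \<le> 1"
    using projection_unit[OF unit_kernel_ind, of y c] HF_unit[of y] by linarith
  then have "\<bar>wt y\<bar> * \<bar>projection m (ind y) c - HF y\<bar> \<le> B * 1" by (intro mult_mono wt_bounded B_nonneg) auto
  then show "\<bar>wt y * (projection m (ind y) c - HF y)\<bar> \<le> B" by (simp add: abs_mult)
qed

lemma L_influence_measurable[measurable]: "L_influence \<in> borel_measurable borel"
proof -
  interpret I: finite_measure "interval_meas lo hi" by (rule finite_measure_interval_meas)
  have "(\<lambda>w. (snd w, fst w)) \<in> borel \<Otimes>\<^sub>M borel \<rightarrow>\<^sub>M borel \<Otimes>\<^sub>M borel" by measurable
  from measurable_compose[OF this projection_joint_measurable]
  have [measurable]: "(\<lambda>w. projection m (ind (snd w)) (fst w)) \<in> borel_measurable (borel \<Otimes>\<^sub>M borel)" by simp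
  have "(\<lambda>w. wt (snd w) * (projection m (ind (snd w)) (fst w) - HF (snd w))) \<in> borel_measurable (borel \<Otimes>\<^sub>M borel)"
    by measurable
  then have "(\<lambda>(c, y). wt y * (projection m (ind y) c - HF y)) \<in> borel_measurable (borel \<Otimes>\<^sub>M interval_meas lo hi)"
    by (simp only: case_prod_unfold measurable_cong_sets[OF sets_pair_measure_cong[OF refl sets_interval_meas] refl])
  then show ?thesis unfolding L_influence_def[abs_def] by (rule I.borel_measurable_lebesgue_integral)
qed

lemma L_influence_bounded: "\<bar>L_influence c\<bar> \<le> B * (hi - lo)"
  unfolding L_influence_def by (rule integral_interval_meas_bound[OF L_influence_integrand lo_hi])

text \<open>Integrating the linear parts of all levels gives an average of the function \<open>L_influence\<close>.\<close>

lemma linear_part_integral: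
  "(LINT y|interval_meas lo hi. wt y * linear_part (ind y) n \<omega>) = real m / real n * (\<Sum>s\<in>{1..n}. L_influence (X s \<omega>))"
proof -
  have "(LINT y|interval_meas lo hi. wt y * linear_part (ind y) n \<omega>)
     = (LINT y|interval_meas lo hi. real m / real n * (\<Sum>s\<in>{1..n}. wt y * (projection m (ind y) (X s \<omega>) - HF y)))"
    unfolding linear_part_def HF_def[symmetric] by (simp add: sum_distrib_left mult_ac)
  also have "\<dots> = real m / real n * (\<Sum>s\<in>{1..n}. L_influence (X s \<omega>))"
    unfolding L_influence_def integral_mult_right_zero
    by (subst Bochner_Integration.integral_sum) (auto intro!: integrable_interval_meas_bounded[OF L_influence_integrand])
  finally show ?thesis .
qed

text \<open>By Chebyshev's inequality, the representation \<open>L_functional_repr\<close> is available for \<open>H\<^sub>n\<close> on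
  \<open>{lo..hi}\<close>, off events of vanishing probability.\<close>

lemma Hn_lo_hi_prob:
  defines "E \<equiv> \<lambda>n. {\<omega> \<in> space M. \<not> (Hn n \<omega> lo < \<alpha> \<and> \<beta> \<le> Hn n \<omega> hi)}"
  shows "E n \<in> events" "(\<lambda>n. prob (E n)) \<longlonglongrightarrow> 0"
proof -
  show E: "E n \<in> events" for n unfolding E_def by measurable
  obtain C where C: "\<And>n y. n \<ge> m \<Longrightarrow> real n * expectation (\<lambda>\<omega>. (Hn n \<omega> y - HF y)\<^sup>2) \<le> C" using Hn_second_moment by blast
  define c where "c = min (\<alpha> - HF lo) (HF hi - \<beta>)"
  have c: "c > 0" using HF_lo HF_hi by (simp add: c_def)
  have bound: "prob (E n) \<le> 2 * (C / c\<^sup>2) * (1 / real n)" if n: "n \<ge> m" for n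
  proof -
    have n0: "real n > 0" using n m1 by simp
    have ch: "prob {\<omega> \<in> space M. c\<^sup>2 \<le> (Hn n \<omega> y - HF y)\<^sup>2} \<le> C / c\<^sup>2 * (1 / real n)" for y
    proof -
      have "prob {\<omega> \<in> space M. c\<^sup>2 \<le> (Hn n \<omega> y - HF y)\<^sup>2} \<le> expectation (\<lambda>\<omega>. (Hn n \<omega> y - HF y)\<^sup>2) / c\<^sup>2"
        using c by (intro integral_Markov_inequality_measure[where A = "space M"] Hn_integrable n) auto
      also have "\<dots> \<le> (C / real n) / c\<^sup>2"
        using C[OF n, of y] n0 by (intro divide_right_mono) (auto simp: pos_le_divide_eq mult.commute)
      finally show ?thesis by (simp add: mult.commute)
    qed
    have "E n \<subseteq> {\<omega> \<in> space M. c\<^sup>2 \<le> (Hn n \<omega> lo - HF lo)\<^sup>2} \<union> {\<omega> \<in> space M. c\<^sup>2 \<le> (Hn n \<omega> hi - HF hi)\<^sup>2}"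
    proof
      fix \<omega> assume w: "\<omega> \<in> E n"
      then have "c \<le> \<bar>Hn n \<omega> lo - HF lo\<bar> \<or> c \<le> \<bar>Hn n \<omega> hi - HF hi\<bar>" unfolding E_def c_def by (auto simp: not_less not_le)
      then have "c\<^sup>2 \<le> (Hn n \<omega> lo - HF lo)\<^sup>2 \<or> c\<^sup>2 \<le> (Hn n \<omega> hi - HF hi)\<^sup>2"
        using c power_mono[of c "\<bar>Hn n \<omega> lo - HF lo\<bar>" 2] power_mono[of c "\<bar>Hn n \<omega> hi - HF hi\<bar>" 2] by auto
      then show "\<omega> \<in> {\<omega> \<in> space M. c\<^sup>2 \<le> (Hn n \<omega> lo - HF lo)\<^sup>2} \<union> {\<omega> \<in> space M. c\<^sup>2 \<le> (Hn n \<omega> hi - HF hi)\<^sup>2}"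
        using w by (auto simp: E_def)
    qed
    then have "prob (E n) \<le> prob ({\<omega> \<in> space M. c\<^sup>2 \<le> (Hn n \<omega> lo - HF lo)\<^sup>2} \<union> {\<omega> \<in> space M. c\<^sup>2 \<le> (Hn n \<omega> hi - HF hi)\<^sup>2})"
      by (intro finite_measure_mono) measurable
    also have "\<dots> \<le> prob {\<omega> \<in> space M. c\<^sup>2 \<le> (Hn n \<omega> lo - HF lo)\<^sup>2} + prob {\<omega> \<in> space M. c\<^sup>2 \<le> (Hn n \<omega> hi - HF hi)\<^sup>2}"
      by (intro measure_subadditive) (auto simp: emeasure_eq_measure)
    also have "\<dots> \<le> 2 * (C / c\<^sup>2) * (1 / real n)" using ch[of lo] ch[of hi] by simp
    finally show ?thesis .
  qed
  show "(\<lambda>n. prob (E n)) \<longlonglongrightarrow> 0"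
  proof (rule tendsto_sandwich[OF _ _ tendsto_const])
    show "eventually (\<lambda>n. prob (E n) \<le> 2 * (C / c\<^sup>2) * (1 / real n)) sequentially"
      using eventually_ge_at_top[of m] by eventually_elim (rule bound)
    show "(\<lambda>n. 2 * (C / c\<^sup>2) * (1 / real n)) \<longlonglongrightarrow> 0"
      using tendsto_mult[OF tendsto_const lim_1_over_n, of "2 * (C / c\<^sup>2)"] by simp
  qed auto
qed

text \<open>Pointwise in the level this is \<open>delta_remainder\<close>; the uniform bound on the second moments supplies the
  constant that dominates the mean errors.\<close>

lemma L_expansion_vanishing:
  "vanishing (\<lambda>n \<omega>. LINT y|interval_meas lo hi. sqrt (real n) * (J_primitive (Hn n \<omega> y) - J_primitive (HF y) - wt y * (Hn n \<omega> y - HF y)))"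
proof -
  define f where "f n y \<omega> = sqrt (real n) * (J_primitive (Hn n \<omega> y) - J_primitive (HF y) - wt y * (Hn n \<omega> y - HF y))" for n y \<omega>
  have Hnj: "(\<lambda>w. Hn n (snd w) (fst w)) \<in> borel_measurable (borel \<Otimes>\<^sub>M M)" for n
    using Hn_joint_measurable[of n] by (simp add: split_beta)
  have fm: "(\<lambda>(y, \<omega>). f n y \<omega>) \<in> borel_measurable (borel \<Otimes>\<^sub>M M)" for n
  proof -
    note [measurable] = Hnj[of n] measurable_compose[OF Hnj[of n] J_primitive_measurable]
    show ?thesis unfolding f_def split_beta by measurable
  qed
  have fb: "\<bar>f n y \<omega>\<bar> \<le> sqrt (real n) * (3 * B)" if n: "n \<ge> m" for n y \<omega>
  proof -
    have "\<bar>Hn n \<omega> y - HF y\<bar> \<le> 1" using Hn_unit[OF n, of \<omega> y] HF_unit[of y] by linarith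
    then have "\<bar>wt y * (Hn n \<omega> y - HF y)\<bar> \<le> B * 1" unfolding abs_mult by (intro mult_mono wt_bounded B_nonneg) auto
    then have "\<bar>J_primitive (Hn n \<omega> y) - J_primitive (HF y) - wt y * (Hn n \<omega> y - HF y)\<bar> \<le> 3 * B"
      using J_primitive_bounded[of "Hn n \<omega> y"] J_primitive_bounded[of "HF y"] by linarith
    then show ?thesis unfolding f_def abs_mult by (auto intro: mult_left_mono)
  qed
  obtain C where C: "\<And>n y. n \<ge> m \<Longrightarrow> real n * expectation (\<lambda>\<omega>. (Hn n \<omega> y - HF y)\<^sup>2) \<le> C" using Hn_second_moment by blast
  have fub: "integrable M (\<lambda>\<omega>. LINT y|interval_meas lo hi. f n y \<omega>)"
      "expectation (\<lambda>\<omega>. \<bar>LINT y|interval_meas lo hi. f n y \<omega>\<bar>) \<le> (LINT y|interval_meas lo hi. expectation (\<lambda>\<omega>. \<bar>f n y \<omega>\<bar>))" if "n \<ge> m" for n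
    using interval_fubini(1,4)[OF fm fb[OF that]] by auto
  have absm: "(\<lambda>(y, \<omega>). \<bar>f n y \<omega>\<bar>) \<in> borel_measurable (borel \<Otimes>\<^sub>M M)" for n
    using borel_measurable_abs[OF fm[of n]] by (simp add: split_beta)
  have iy: "integrable (interval_meas lo hi) (\<lambda>y. expectation (\<lambda>\<omega>. \<bar>f n y \<omega>\<bar>))" if "n \<ge> m" for n
    by (rule interval_fubini(2)[OF absm, where b = "sqrt (real n) * (3 * B)"]) (use fb[OF that] in simp)
  have fabs: "expectation (\<lambda>\<omega>. \<bar>f n y \<omega>\<bar>) = sqrt (real n) * expectation (\<lambda>\<omega>. \<bar>J_primitive (Hn n \<omega> y) - J_primitive (HF y) - wt y * (Hn n \<omega> y - HF y)\<bar>)" for n y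
    unfolding f_def abs_mult by simp
  have lim: "(\<lambda>n. LINT y|interval_meas lo hi. expectation (\<lambda>\<omega>. \<bar>f (n + m) y \<omega>\<bar>)) \<longlonglongrightarrow> (LINT y|interval_meas lo hi. 0)"
  proof (rule integral_dominated_convergence[where w = "\<lambda>_. 2 * B * sqrt C"])
    show "(\<lambda>y. expectation (\<lambda>\<omega>. \<bar>f (n + m) y \<omega>\<bar>)) \<in> borel_measurable (interval_meas lo hi)" for n
      using iy[of "n + m"] by auto
    show "integrable (interval_meas lo hi) (\<lambda>_. 2 * B * sqrt C)"
      by (rule finite_measure.integrable_const[OF finite_measure_interval_meas])
    show "AE y in interval_meas lo hi. norm (expectation (\<lambda>\<omega>. \<bar>f (n + m) y \<omega>\<bar>)) \<le> 2 * B * sqrt C" for n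
    proof (rule AE_I2)
      fix y
      let ?n = "n + m"
      have nm: "?n \<ge> m" by simp
      note i = Hn_integrable[OF nm, of y]
      have "expectation (\<lambda>\<omega>. \<bar>f ?n y \<omega>\<bar>) \<le> expectation (\<lambda>\<omega>. sqrt (real ?n) * (2 * B * \<bar>Hn ?n \<omega> y - HF y\<bar>))"
      proof (rule integral_mono)
        have [measurable]: "f ?n y \<in> borel_measurable M"
        proof -
          have "(\<lambda>\<omega>. (y, \<omega>)) \<in> M \<rightarrow>\<^sub>M borel \<Otimes>\<^sub>M M" by measurable
          from measurable_compose[OF this fm[of ?n]] show ?thesis by simp
        qed
        show "integrable M (\<lambda>\<omega>. \<bar>f ?n y \<omega>\<bar>)"
          by (intro integrable_abs integrable_bounded_rv(1)[OF _ fb[OF nm]]) measurable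
        show "integrable M (\<lambda>\<omega>. sqrt (real ?n) * (2 * B * \<bar>Hn ?n \<omega> y - HF y\<bar>))"
          using i(1) by (intro integrable_mult_right integrable_abs)
        fix \<omega>
        have "\<bar>J_primitive (Hn ?n \<omega> y) - J_primitive (HF y) - wt y * (Hn ?n \<omega> y - HF y)\<bar> \<le> B * \<bar>Hn ?n \<omega> y - HF y\<bar> + \<bar>wt y\<bar> * \<bar>Hn ?n \<omega> y - HF y\<bar>"
          using J_primitive_lipschitz[of "Hn ?n \<omega> y" "HF y"] unfolding abs_mult[symmetric] by linarith
        also have "\<dots> \<le> B * \<bar>Hn ?n \<omega> y - HF y\<bar> + B * \<bar>Hn ?n \<omega> y - HF y\<bar>" by (intro add_mono mult_right_mono wt_bounded) auto
        finally show "\<bar>f ?n y \<omega>\<bar> \<le> sqrt (real ?n) * (2 * B * \<bar>Hn ?n \<omega> y - HF y\<bar>)"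
          unfolding f_def abs_mult[of "sqrt _"] by (auto intro!: mult_left_mono)
      qed
      also have "\<dots> = 2 * B * (sqrt (real ?n) * expectation (\<lambda>\<omega>. \<bar>Hn ?n \<omega> y - HF y\<bar>))" by simp
      also have "\<dots> \<le> 2 * B * (sqrt (real ?n) * sqrt (expectation (\<lambda>\<omega>. (Hn ?n \<omega> y - HF y)\<^sup>2)))"
        using i B_nonneg by (intro mult_left_mono expectation_abs_le_sqrt) auto
      also have "\<dots> = 2 * B * sqrt (real ?n * expectation (\<lambda>\<omega>. (Hn ?n \<omega> y - HF y)\<^sup>2))" by (simp only: real_sqrt_mult)
      also have "\<dots> \<le> 2 * B * sqrt C" using C[OF nm] B_nonneg by (intro mult_left_mono real_sqrt_le_mono) auto
      finally show "norm (expectation (\<lambda>\<omega>. \<bar>f (n + m) y \<omega>\<bar>)) \<le> 2 * B * sqrt C" by simp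
    qed
    show "AE y in interval_meas lo hi. (\<lambda>n. expectation (\<lambda>\<omega>. \<bar>f (n + m) y \<omega>\<bar>)) \<longlonglongrightarrow> 0"
      using AE_interval_meas[OF wt_J] AE_interval_meas[OF J_cont]
    proof eventually_elim
      case (elim y)
      have "(\<lambda>n. sqrt (real n) * expectation (\<lambda>\<omega>. \<bar>J_primitive (Hn n \<omega> y) - J_primitive (HF y) - wt y * (Hn n \<omega> y - HF y)\<bar>)) \<longlonglongrightarrow> 0"
      proof (rule delta_remainder[where start = m and C = C and B = B and S = "\<lambda>n \<omega>. Hn n \<omega> y"])
        show "\<exists>\<delta>>0. \<forall>s. \<bar>s - HF y\<bar> \<le> \<delta> \<longrightarrow> \<bar>J_primitive s - J_primitive (HF y) - wt y * (s - HF y)\<bar> \<le> \<epsilon> * \<bar>s - HF y\<bar>" if "\<epsilon> > 0" for \<epsilon>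
          unfolding elim(1) by (rule J_primitive_derivative[OF elim(2) that])
      qed (auto intro: Hn_integrable C J_primitive_lipschitz wt_bounded)
      then show ?case unfolding fabs by (rule LIMSEQ_ignore_initial_segment)
    qed
  qed auto
  have lim': "(\<lambda>n. LINT y|interval_meas lo hi. expectation (\<lambda>\<omega>. \<bar>f n y \<omega>\<bar>)) \<longlonglongrightarrow> 0"
    using LIMSEQ_offset[OF lim] by simp
  have "vanishing (\<lambda>n \<omega>. LINT y|interval_meas lo hi. f n y \<omega>)"
  proof (rule vanishing_L1)
    show "eventually (\<lambda>n. integrable M (\<lambda>\<omega>. LINT y|interval_meas lo hi. f n y \<omega>)) sequentially"
      using eventually_ge_at_top[of m] by eventually_elim (rule fub(1))
    show "(\<lambda>n. expectation (\<lambda>\<omega>. \<bar>LINT y|interval_meas lo hi. f n y \<omega>\<bar>)) \<longlonglongrightarrow> 0"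
    proof (rule tendsto_sandwich[OF _ _ tendsto_const lim'])
      show "eventually (\<lambda>n. expectation (\<lambda>\<omega>. \<bar>LINT y|interval_meas lo hi. f n y \<omega>\<bar>) \<le> (LINT y|interval_meas lo hi. expectation (\<lambda>\<omega>. \<bar>f n y \<omega>\<bar>))) sequentially"
        using eventually_ge_at_top[of m] by eventually_elim (rule fub(2))
    qed auto
  qed
  then show ?thesis by (simp add: f_def)
qed

lemma weighted_lin_error_vanishing:
  "vanishing (\<lambda>n \<omega>. LINT y|interval_meas lo hi. sqrt (real n) * (wt y * lin_error n y \<omega>))"
proof -
  define f where "f n y \<omega> = sqrt (real n) * (wt y * lin_error n y \<omega>)" for n y \<omega>
  obtain e where e: "e \<longlonglongrightarrow> 0" "\<And>n y. n \<ge> m \<Longrightarrow> real n * expectation (\<lambda>\<omega>. (lin_error n y \<omega>)\<^sup>2) \<le> e n"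
    using uniform_linearization by blast
  have fm: "(\<lambda>(y, \<omega>). f n y \<omega>) \<in> borel_measurable (borel \<Otimes>\<^sub>M M)" for n
  proof -
    have [measurable]: "(\<lambda>w. lin_error n (fst w) (snd w)) \<in> borel_measurable (borel \<Otimes>\<^sub>M M)"
      using lin_error_joint_measurable[of n] by (simp add: split_beta)
    show ?thesis unfolding f_def split_beta by measurable
  qed
  have fb: "\<bar>f n y \<omega>\<bar> \<le> sqrt (real n) * (B * (real m + 1))" if n: "n \<ge> m" for n y \<omega>
    unfolding f_def abs_mult using lin_error_bounded[OF n, of y \<omega>] wt_bounded[of y] B_nonneg by (auto intro!: mult_left_mono mult_mono)
  have absm: "(\<lambda>(y, \<omega>). \<bar>f n y \<omega>\<bar>) \<in> borel_measurable (borel \<Otimes>\<^sub>M M)" for n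
    using borel_measurable_abs[OF fm[of n]] by (simp add: split_beta)
  have iy: "integrable (interval_meas lo hi) (\<lambda>y. expectation (\<lambda>\<omega>. \<bar>f n y \<omega>\<bar>))" if "n \<ge> m" for n
    by (rule interval_fubini(2)[OF absm, where b = "sqrt (real n) * (B * (real m + 1))"]) (use fb[OF that] in simp)
  have E: "expectation (\<lambda>\<omega>. \<bar>f n y \<omega>\<bar>) \<le> B * sqrt (e n)" if n: "n \<ge> m" for n y
  proof -
    note i = Hn_integrable[OF n, of y]
    have "expectation (\<lambda>\<omega>. \<bar>f n y \<omega>\<bar>) = \<bar>wt y\<bar> * (sqrt (real n) * expectation (\<lambda>\<omega>. \<bar>lin_error n y \<omega>\<bar>))"
      unfolding f_def abs_mult by simp
    also have "\<dots> \<le> B * (sqrt (real n) * sqrt (expectation (\<lambda>\<omega>. (lin_error n y \<omega>)\<^sup>2)))"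
      using i B_nonneg by (intro mult_mono wt_bounded mult_left_mono expectation_abs_le_sqrt) auto
    also have "\<dots> = B * sqrt (real n * expectation (\<lambda>\<omega>. (lin_error n y \<omega>)\<^sup>2))" by (simp only: real_sqrt_mult)
    also have "\<dots> \<le> B * sqrt (e n)" using e(2)[OF n] B_nonneg by (intro mult_left_mono real_sqrt_le_mono) auto
    finally show ?thesis .
  qed
  have lim: "(\<lambda>n. B * sqrt (e n) * (hi - lo)) \<longlonglongrightarrow> 0"
  proof -
    have "(\<lambda>n. B * sqrt (e n) * (hi - lo)) \<longlonglongrightarrow> B * sqrt 0 * (hi - lo)" by (intro tendsto_intros e)
    then show ?thesis by simp
  qed
  have "vanishing (\<lambda>n \<omega>. LINT y|interval_meas lo hi. f n y \<omega>)"
  proof (rule vanishing_L1)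
    show "eventually (\<lambda>n. integrable M (\<lambda>\<omega>. LINT y|interval_meas lo hi. f n y \<omega>)) sequentially"
      using eventually_ge_at_top[of m] by eventually_elim (rule interval_fubini(1)[OF fm fb])
    show "(\<lambda>n. expectation (\<lambda>\<omega>. \<bar>LINT y|interval_meas lo hi. f n y \<omega>\<bar>)) \<longlonglongrightarrow> 0"
    proof (rule tendsto_sandwich[OF _ _ tendsto_const lim])
      show "eventually (\<lambda>n. expectation (\<lambda>\<omega>. \<bar>LINT y|interval_meas lo hi. f n y \<omega>\<bar>) \<le> B * sqrt (e n) * (hi - lo)) sequentially"
        using eventually_ge_at_top[of m]
      proof eventually_elim
        case (elim n)
        have "expectation (\<lambda>\<omega>. \<bar>LINT y|interval_meas lo hi. f n y \<omega>\<bar>) \<le> (LINT y|interval_meas lo hi. expectation (\<lambda>\<omega>. \<bar>f n y \<omega>\<bar>))"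
          by (rule interval_fubini(4)[OF fm fb[OF elim]])
        also have "\<dots> \<le> (LINT y|interval_meas lo hi. B * sqrt (e n))"
          by (intro integral_mono iy elim E finite_measure.integrable_const finite_measure_interval_meas)
        also have "\<dots> = B * sqrt (e n) * (hi - lo)" using measure_interval_meas_UNIV[OF lo_hi] by simp
        finally show ?case .
      qed
    qed auto
  qed
  then show ?thesis by (simp add: f_def)
qed

text \<open>Off the exceptional events the difference is minus the sum of the expansion error and of the weighted
  linearization error.\<close>

theorem L_functional_vanishing:
  "vanishing (\<lambda>n \<omega>. sqrt (real n) * ((LINT t:{0..1}|lebesgue. quantile (Hn n \<omega>) t * J t) - (LINT t:{0..1}|lebesgue. quantile HF t * J t))
     - (- sqrt (real n) * (real m / real n) * (\<Sum>s\<in>{1..n}. L_influence (X s \<omega>))))"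
proof (rule vanishing_off_null[OF vanishing_add[OF L_expansion_vanishing weighted_lin_error_vanishing] Hn_lo_hi_prob])
  show "eventually (\<lambda>n. \<forall>\<omega>\<in>space M - {\<omega> \<in> space M. \<not> (Hn n \<omega> lo < \<alpha> \<and> \<beta> \<le> Hn n \<omega> hi)}.
      \<bar>sqrt (real n) * ((LINT t:{0..1}|lebesgue. quantile (Hn n \<omega>) t * J t) - (LINT t:{0..1}|lebesgue. quantile HF t * J t))
     - (- sqrt (real n) * (real m / real n) * (\<Sum>s\<in>{1..n}. L_influence (X s \<omega>)))\<bar>
     \<le> \<bar>(LINT y|interval_meas lo hi. sqrt (real n) * (J_primitive (Hn n \<omega> y) - J_primitive (HF y) - wt y * (Hn n \<omega> y - HF y)))
        + (LINT y|interval_meas lo hi. sqrt (real n) * (wt y * lin_error n y \<omega>))\<bar>) sequentially"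
    using eventually_ge_at_top[of m]
  proof eventually_elim
    case (elim n)
    show ?case
    proof
      fix \<omega> assume "\<omega> \<in> space M - {\<omega> \<in> space M. \<not> (Hn n \<omega> lo < \<alpha> \<and> \<beta> \<le> Hn n \<omega> hi)}"
      then have ev: "Hn n \<omega> lo < \<alpha>" "\<beta> \<le> Hn n \<omega> hi" and w: "\<omega> \<in> space M" by auto
      let ?I = "interval_meas lo hi"
      have r1: "(LINT t:{0..1}|lebesgue. quantile (Hn n \<omega>) t * J t) = hi * (LINT t|lborel. J1 t) - (LINT y|?I. J_primitive (Hn n \<omega> y))"
        using \<alpha>\<beta> by (intro L_functional_repr Hn_mono quantile_Hn elim ev) auto
      have r2: "(LINT t:{0..1}|lebesgue. quantile HF t * J t) = hi * (LINT t|lborel. J1 t) - (LINT y|?I. J_primitive (HF y))"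
        by (intro L_functional_repr quantile_HF HF_lo less_imp_le[OF HF_hi]) (auto intro: monoI HF_mono)
      have Hm[measurable]: "Hn n \<omega> \<in> borel_measurable borel" by (rule borel_measurable_mono[OF Hn_mono])
      have sm: "(\<lambda>y. g y \<omega>) \<in> borel_measurable borel" if "(\<lambda>(y, \<omega>). g y \<omega>) \<in> borel_measurable (borel \<Otimes>\<^sub>M M)" for g :: "real \<Rightarrow> 'a \<Rightarrow> real"
        using measurable_compose[OF measurable_Pair[OF measurable_ident measurable_const[OF w]] that] by simp
      have i1: "integrable ?I (\<lambda>y. J_primitive (Hn n \<omega> y))" "integrable ?I (\<lambda>y. J_primitive (HF y))"
        by (rule integrable_interval_meas_bounded[OF _ J_primitive_bounded], measurable)+
      have i2: "integrable ?I (\<lambda>y. wt y * (Hn n \<omega> y - HF y))"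
      proof (rule integrable_interval_meas_bounded[where b = B])
        fix y have "\<bar>Hn n \<omega> y - HF y\<bar> \<le> 1" using Hn_unit[OF elim, of \<omega> y] HF_unit[of y] by linarith
        then have "\<bar>wt y\<bar> * \<bar>Hn n \<omega> y - HF y\<bar> \<le> B * 1" by (intro mult_mono wt_bounded B_nonneg) auto
        then show "\<bar>wt y * (Hn n \<omega> y - HF y)\<bar> \<le> B" by (simp add: abs_mult)
      qed measurable
      have i3: "integrable ?I (\<lambda>y. wt y * lin_error n y \<omega>)"
      proof (rule integrable_interval_meas_bounded[where b = "B * (real m + 1)"])
        have [measurable]: "(\<lambda>y. lin_error n y \<omega>) \<in> borel_measurable borel" by (rule sm[OF lin_error_joint_measurable])
        show "(\<lambda>y. wt y * lin_error n y \<omega>) \<in> borel_measurable borel" by measurable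
        show "\<bar>wt y * lin_error n y \<omega>\<bar> \<le> B * (real m + 1)" for y
          unfolding abs_mult by (intro mult_mono wt_bounded lin_error_bounded elim B_nonneg) auto
      qed
      have i4: "integrable ?I (\<lambda>y. wt y * linear_part (ind y) n \<omega>)"
      proof -
        have "(\<lambda>y. wt y * linear_part (ind y) n \<omega>) = (\<lambda>y. wt y * (Hn n \<omega> y - HF y) - wt y * lin_error n y \<omega>)"
          by (intro ext) (simp add: lin_error_def algebra_simps)
        then show ?thesis using Bochner_Integration.integrable_diff[OF i2 i3] by simp
      qed
      have a: "(LINT y|?I. wt y * lin_error n y \<omega>) = (LINT y|?I. wt y * (Hn n \<omega> y - HF y)) - (LINT y|?I. wt y * linear_part (ind y) n \<omega>)"
      proof -
        have "(\<lambda>y. wt y * lin_error n y \<omega>) = (\<lambda>y. wt y * (Hn n \<omega> y - HF y) - wt y * linear_part (ind y) n \<omega>)"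
          by (intro ext) (simp add: lin_error_def algebra_simps)
        then show ?thesis using i2 i4 by simp
      qed
      have b: "(LINT y|?I. J_primitive (Hn n \<omega> y) - J_primitive (HF y) - wt y * (Hn n \<omega> y - HF y))
         = (LINT y|?I. J_primitive (Hn n \<omega> y)) - (LINT y|?I. J_primitive (HF y)) - (LINT y|?I. wt y * (Hn n \<omega> y - HF y))"
        using i1 i2 by simp
      have "sqrt (real n) * ((LINT t:{0..1}|lebesgue. quantile (Hn n \<omega>) t * J t) - (LINT t:{0..1}|lebesgue. quantile HF t * J t))
     - (- sqrt (real n) * (real m / real n) * (\<Sum>s\<in>{1..n}. L_influence (X s \<omega>)))
       = - (sqrt (real n) * (LINT y|?I. J_primitive (Hn n \<omega> y) - J_primitive (HF y) - wt y * (Hn n \<omega> y - HF y))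
            + sqrt (real n) * (LINT y|?I. wt y * lin_error n y \<omega>))"
        unfolding r1 r2 a b linear_part_integral by (simp add: algebra_simps)
      then show "\<bar>sqrt (real n) * ((LINT t:{0..1}|lebesgue. quantile (Hn n \<omega>) t * J t) - (LINT t:{0..1}|lebesgue. quantile HF t * J t))
     - (- sqrt (real n) * (real m / real n) * (\<Sum>s\<in>{1..n}. L_influence (X s \<omega>)))\<bar>
     \<le> \<bar>(LINT y|interval_meas lo hi. sqrt (real n) * (J_primitive (Hn n \<omega> y) - J_primitive (HF y) - wt y * (Hn n \<omega> y - HF y)))
        + (LINT y|interval_meas lo hi. sqrt (real n) * (wt y * lin_error n y \<omega>))\<bar>"
        unfolding integral_mult_right_zero by simp
    qed
  qed
qed

end

section \<open>Central limit theorem for the functional\<close>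

lemma real_distribution_normal_law: "real_distribution (normal_law v)"
proof -
  interpret N: real_distribution std_normal_distribution by (rule real_dist_normal_dist)
  show ?thesis unfolding normal_law_def by (rule N.real_distribution_distr) measurable
qed

lemma char_normal_law:
  assumes "v \<ge> 0" shows "char (normal_law v) t = of_real (exp (- (t\<^sup>2 * v / 2)))"
proof -
  have "char (normal_law v) t = char std_normal_distribution (t * sqrt v)"
    unfolding char_def normal_law_def by (subst integral_distr) (auto simp: mult.assoc)
  also have "\<dots> = of_real (exp (- (t\<^sup>2 * v / 2)))"
    unfolding char_std_normal_distribution using assms by (simp add: power_mult_distrib)
  finally show ?thesis .
qed

text \<open>\<open>dq i\<close> is the density of the kernel at the quantile of order \<open>p i\<close>.\<close>

locale gl_statistic = gl_process M X K m h L D J J1 \<alpha> \<beta> B wt lo hi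
  for M :: "'a measure" and X K m h L D J J1 \<alpha> \<beta> B wt lo hi +
  fixes d :: nat and a p dq :: "nat \<Rightarrow> real"
  assumes p01: "\<And>i. i \<in> {1..d} \<Longrightarrow> 0 < p i" "\<And>i. i \<in> {1..d} \<Longrightarrow> p i < 1"
    and HF_quantile: "\<And>i. i \<in> {1..d} \<Longrightarrow> HF (quantile HF (p i)) = p i"
    and HF_deriv: "\<And>i. i \<in> {1..d} \<Longrightarrow> (HF has_real_derivative dq i) (at (quantile HF (p i)))"
    and dq_pos: "\<And>i. i \<in> {1..d} \<Longrightarrow> dq i > 0"
begin

text \<open>The function \<open>x \<mapsto> E (A (x, Y\<^sub>2, \<dots>, Y\<^sub>m))\<close> of the theorem, with the expectation carried inside; see
  \<open>first_projection_eq_influence\<close>.\<close>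

definition influence :: "real \<Rightarrow> real" where
  "influence c = - L_influence c + (\<Sum>i=1..d. a i * ((p i - projection m (ind (quantile HF (p i))) c) / dq i))"

lemma influence_measurable[measurable]: "influence \<in> borel_measurable borel"
proof -
  note [measurable] = measurable_projection[OF unit_kernel_ind]
  show ?thesis unfolding influence_def[abs_def] by measurable
qed

lemma influence_bounded: "\<bar>influence c\<bar> \<le> B * (hi - lo) + (\<Sum>i=1..d. \<bar>a i\<bar> * (1 / dq i))"
proof -
  have "\<bar>\<Sum>i=1..d. a i * ((p i - projection m (ind (quantile HF (p i))) c) / dq i)\<bar> \<le> (\<Sum>i=1..d. \<bar>a i\<bar> * (1 / dq i))"
  proof (intro order.trans[OF sum_abs] sum_mono)
    fix i assume i: "i \<in> {1..d}"
    have "\<bar>p i - projection m (ind (quantile HF (p i))) c\<bar> \<le> 1"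
      using projection_unit[OF unit_kernel_ind, of "quantile HF (p i)" c] p01[OF i] by linarith
    then show "\<bar>a i * ((p i - projection m (ind (quantile HF (p i))) c) / dq i)\<bar> \<le> \<bar>a i\<bar> * (1 / dq i)"
      using dq_pos[OF i] unfolding abs_mult abs_divide by (intro mult_left_mono frac_le) auto
  qed
  then show ?thesis using L_influence_bounded[of c] unfolding influence_def by linarith
qed

lemma projection_ind_abs: "\<bar>projection m (ind y) c\<bar> \<le> 1"
  using projection_unit[OF unit_kernel_ind, of y c] by simp

lemma expectation_L_influence: "expectation (\<lambda>\<omega>. L_influence (X 1 \<omega>)) = 0"
proof -
  have X1: "X 1 \<in> borel_measurable M" by (rule X_measurable) simp
  note [measurable] = X1
  have "(\<lambda>w. (fst w, X 1 (snd w))) \<in> borel \<Otimes>\<^sub>M M \<rightarrow>\<^sub>M borel \<Otimes>\<^sub>M borel" by measurable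
  from measurable_compose[OF this projection_joint_measurable]
  have [measurable]: "(\<lambda>w. projection m (ind (fst w)) (X 1 (snd w))) \<in> borel_measurable (borel \<Otimes>\<^sub>M M)" by simp
  have m: "(\<lambda>(y, \<omega>). wt y * (projection m (ind y) (X 1 \<omega>) - HF y)) \<in> borel_measurable (borel \<Otimes>\<^sub>M M)"
    unfolding split_beta by measurable
  have "expectation (\<lambda>\<omega>. L_influence (X 1 \<omega>))
      = (LINT y|interval_meas lo hi. expectation (\<lambda>\<omega>. wt y * (projection m (ind y) (X 1 \<omega>) - HF y)))"
    unfolding L_influence_def by (rule interval_fubini(3)[OF m L_influence_integrand(2)])
  also have "\<dots> = (LINT y|interval_meas lo hi. 0)"
  proof (intro Bochner_Integration.integral_cong refl)
    fix y
    note [measurable] = measurable_compose[OF X1 measurable_projection[OF unit_kernel_ind[of y]]]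
    have "integrable M (\<lambda>\<omega>. projection m (ind y) (X 1 \<omega>))"
      by (rule integrable_bounded_rv(1)[OF _ projection_ind_abs]) measurable
    then show "expectation (\<lambda>\<omega>. wt y * (projection m (ind y) (X 1 \<omega>) - HF y)) = 0"
      using expectation_projection[OF unit_kernel_ind, of y] by (simp add: HF_def prob_space)
  qed
  finally show ?thesis by simp
qed

lemma expectation_influence: "expectation (\<lambda>\<omega>. influence (X 1 \<omega>)) = 0"
proof -
  have X1: "X 1 \<in> borel_measurable M" by (rule X_measurable) simp
  have i1: "integrable M (\<lambda>\<omega>. L_influence (X 1 \<omega>))"
    by (rule integrable_bounded_rv(1)[OF measurable_compose[OF X1 L_influence_measurable] L_influence_bounded])
  have i2: "integrable M (\<lambda>\<omega>. projection m (ind y) (X 1 \<omega>))" for y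
    by (rule integrable_bounded_rv(1)[OF measurable_compose[OF X1 measurable_projection[OF unit_kernel_ind[of y]]] projection_ind_abs])
  have i3: "integrable M (\<lambda>\<omega>. a i * ((p i - projection m (ind (quantile HF (p i))) (X 1 \<omega>)) / dq i))" for i
    using i2 by (intro integrable_mult_right integrable_divide_zero Bochner_Integration.integrable_diff) auto
  have e: "expectation (\<lambda>\<omega>. a i * ((p i - projection m (ind (quantile HF (p i))) (X 1 \<omega>)) / dq i)) = 0" if "i \<in> {1..d}" for i
    using i2[of "quantile HF (p i)"] expectation_projection[OF unit_kernel_ind, of "quantile HF (p i)"] HF_quantile[OF that]
    by (simp add: HF_def[of "quantile HF (p i)"] prob_space)
  have "expectation (\<lambda>\<omega>. influence (X 1 \<omega>)) = - expectation (\<lambda>\<omega>. L_influence (X 1 \<omega>))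
     + (\<Sum>i=1..d. expectation (\<lambda>\<omega>. a i * ((p i - projection m (ind (quantile HF (p i))) (X 1 \<omega>)) / dq i)))"
    unfolding influence_def using i1 i3
    by (subst Bochner_Integration.integral_add) (auto intro!: Bochner_Integration.integral_sum)
  also have "(\<Sum>i=1..d. expectation (\<lambda>\<omega>. a i * ((p i - projection m (ind (quantile HF (p i))) (X 1 \<omega>)) / dq i))) = 0"
    by (intro sum.neutral ballI e)
  finally show ?thesis using expectation_L_influence by simp
qed

text \<open>The functional is a sum, so the linearizations of the integral and of the quantiles add up.\<close>

theorem GL_functional_linearization:
  "vanishing (\<lambda>n \<omega>. sqrt (real n) * (GL_functional J d a p (Hn n \<omega>) - GL_functional J d a p HF)
     - real m / sqrt (real n) * (\<Sum>s\<in>{1..n}. influence (X s \<omega>)))"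
proof -
  define q where "q i = quantile HF (p i)" for i
  define \<Delta> where "\<Delta> i n \<omega> = sqrt (real n) * (quantile (Hn n \<omega>) (p i) - q i) - (- sqrt (real n) * linear_part (ind (q i)) n \<omega> / dq i)" for i n \<omega>
  define \<Delta>0 where "\<Delta>0 n \<omega> = sqrt (real n) * ((LINT t:{0..1}|lebesgue. quantile (Hn n \<omega>) t * J t) - (LINT t:{0..1}|lebesgue. quantile HF t * J t))
     - (- sqrt (real n) * (real m / real n) * (\<Sum>s\<in>{1..n}. L_influence (X s \<omega>)))" for n \<omega>
  have "vanishing (\<lambda>n \<omega>. \<Delta>0 n \<omega> + (\<Sum>i\<in>{1..d}. a i * \<Delta> i n \<omega>))"
    unfolding \<Delta>0_def \<Delta>_def q_def
    by (intro vanishing_add L_functional_vanishing vanishing_sum vanishing_cmult quantile_vanishing p01 HF_quantile HF_deriv dq_pos) auto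
  moreover have "\<Delta>0 n \<omega> + (\<Sum>i\<in>{1..d}. a i * \<Delta> i n \<omega>)
     = sqrt (real n) * (GL_functional J d a p (Hn n \<omega>) - GL_functional J d a p HF)
     - real m / sqrt (real n) * (\<Sum>s\<in>{1..n}. influence (X s \<omega>))" for n \<omega>
  proof -
    define r where "r = real m / sqrt (real n)"
    have r: "sqrt (real n) * (real m / real n) = r"
      by (cases "n = 0") (auto simp: r_def field_simps)
    have lp: "sqrt (real n) * linear_part (ind (q i)) n \<omega> = r * (\<Sum>s\<in>{1..n}. projection m (ind (q i)) (X s \<omega>) - p i)" if "i \<in> {1..d}" for i
      using HF_quantile[OF that] unfolding linear_part_def HF_def[symmetric] r[symmetric] q_def by (simp add: mult.assoc)
    have "(\<Sum>s\<in>{1..n}. influence (X s \<omega>)) = - (\<Sum>s\<in>{1..n}. L_influence (X s \<omega>))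
        + (\<Sum>i=1..d. \<Sum>s\<in>{1..n}. a i * ((p i - projection m (ind (q i)) (X s \<omega>)) / dq i))"
      unfolding influence_def q_def sum.distrib sum_negf by (subst sum.swap) simp
    also have "(\<Sum>i=1..d. \<Sum>s\<in>{1..n}. a i * ((p i - projection m (ind (q i)) (X s \<omega>)) / dq i))
       = (\<Sum>i=1..d. a i * (- (\<Sum>s\<in>{1..n}. projection m (ind (q i)) (X s \<omega>) - p i) / dq i))"
      by (intro sum.cong refl) (simp add: sum_distrib_left sum_divide_distrib sum_negf[symmetric])
    finally have S: "(\<Sum>s\<in>{1..n}. influence (X s \<omega>)) = - (\<Sum>s\<in>{1..n}. L_influence (X s \<omega>))
        + (\<Sum>i=1..d. a i * (- (\<Sum>s\<in>{1..n}. projection m (ind (q i)) (X s \<omega>) - p i) / dq i))" .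
    have infl: "r * (\<Sum>s\<in>{1..n}. influence (X s \<omega>)) = - r * (\<Sum>s\<in>{1..n}. L_influence (X s \<omega>))
        + (\<Sum>i=1..d. a i * (- sqrt (real n) * linear_part (ind (q i)) n \<omega> / dq i))"
    proof -
      have "r * (\<Sum>i=1..d. a i * (- (\<Sum>s\<in>{1..n}. projection m (ind (q i)) (X s \<omega>) - p i) / dq i))
          = (\<Sum>i=1..d. a i * (- sqrt (real n) * linear_part (ind (q i)) n \<omega> / dq i))"
        by (subst sum_distrib_left, intro sum.cong refl) (simp only: mult_minus_left lp, simp)
      then show ?thesis unfolding S distrib_left by simp
    qed
    have "(\<Sum>i\<in>{1..d}. a i * \<Delta> i n \<omega>) = sqrt (real n) * ((\<Sum>i=1..d. a i * quantile (Hn n \<omega>) (p i)) - (\<Sum>i=1..d. a i * q i))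
        - (\<Sum>i=1..d. a i * (- sqrt (real n) * linear_part (ind (q i)) n \<omega> / dq i))"
      unfolding \<Delta>_def by (simp add: sum_subtractf[symmetric] sum.distrib[symmetric] sum_distrib_left algebra_simps del: mult_minus_left)
    then show ?thesis
      unfolding r_def[symmetric] infl \<Delta>0_def GL_functional_def q_def[symmetric] mult_minus_left r by (simp add: algebra_simps)
  qed
  ultimately show ?thesis by simp
qed

text \<open>The sublevel sets are measurable by the Galois connection, which expresses them through \<open>H\<^sub>n\<close>.\<close>

lemma quantile_Hn_joint_measurable:
  assumes n: "n \<ge> m"
  shows "(\<lambda>(\<omega>, t). if t \<in> {\<alpha>..\<beta>} then quantile (Hn n \<omega>) t else 0) \<in> borel_measurable (M \<Otimes>\<^sub>M borel)"
  unfolding borel_measurable_iff_le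
proof
  fix x :: real
  have "{w \<in> space (M \<Otimes>\<^sub>M borel). (case w of (\<omega>, t) \<Rightarrow> if t \<in> {\<alpha>..\<beta>} then quantile (Hn n \<omega>) t else 0) \<le> x}
     = {w \<in> space (M \<Otimes>\<^sub>M borel). (snd w \<notin> {\<alpha>..\<beta>} \<and> 0 \<le> x) \<or> (snd w \<in> {\<alpha>..\<beta>} \<and> snd w \<le> Hn n (fst w) x)}"
    using \<alpha>\<beta> by (auto simp: quantile_Hn[OF n] split: if_splits)
  also have "\<dots> \<in> sets (M \<Otimes>\<^sub>M borel)" by measurable
  finally show "{w \<in> space (M \<Otimes>\<^sub>M borel). (case w of (\<omega>, t) \<Rightarrow> if t \<in> {\<alpha>..\<beta>} then quantile (Hn n \<omega>) t else 0) \<le> x} \<in> sets (M \<Otimes>\<^sub>M borel)" .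
qed

text \<open>For \<open>n < m\<close> there are no tuples and the binomial coefficient is 0, so that \<open>H\<^sub>n\<close> is constantly 0.\<close>

lemma GL_functional_measurable: "(\<lambda>\<omega>. GL_functional J d a p (Hn n \<omega>)) \<in> borel_measurable M"
proof (cases "n \<ge> m")
  case False
  then have "Hn n = (\<lambda>_ _. 0)" by (intro ext) (simp add: Hn_def binomial_eq_0)
  then show ?thesis by simp
next
  case n: True
  define Q where "Q \<omega> t = (if t \<in> {\<alpha>..\<beta>} then quantile (Hn n \<omega>) t else 0)" for \<omega> t
  have Q[measurable]: "(\<lambda>(\<omega>, t). Q \<omega> t) \<in> borel_measurable (M \<Otimes>\<^sub>M borel)"
    unfolding Q_def by (rule quantile_Hn_joint_measurable[OF n])
  have q: "(\<lambda>\<omega>. quantile (Hn n \<omega>) (p i)) \<in> borel_measurable M" if "i \<in> {1..d}" for i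
    unfolding borel_measurable_iff_le
  proof
    fix y have "{\<omega> \<in> space M. quantile (Hn n \<omega>) (p i) \<le> y} = {\<omega> \<in> space M. p i \<le> Hn n \<omega> y}"
      using p01[OF that] by (auto simp: quantile_Hn[OF n])
    also have "\<dots> \<in> sets M" by measurable
    finally show "{\<omega> \<in> space M. quantile (Hn n \<omega>) (p i) \<le> y} \<in> sets M" .
  qed
  have eq: "(LINT t:{0..1}|lebesgue. quantile (Hn n \<omega>) t * J t) = (LINT t|lborel. Q \<omega> t * J1 t)" if w: "\<omega> \<in> space M" for \<omega>
  proof -
    have "(\<lambda>t. (\<omega>, t)) \<in> borel \<rightarrow>\<^sub>M M \<Otimes>\<^sub>M borel" using w by measurable
    from measurable_compose[OF this Q] have Qm[measurable]: "Q \<omega> \<in> borel_measurable borel" by simp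
    have "(LINT t:{0..1}|lebesgue. quantile (Hn n \<omega>) t * J t) = (LINT t|lebesgue. Q \<omega> t * J t)"
      unfolding set_lebesgue_integral_def Q_def using \<alpha>\<beta> J_support
      by (intro Bochner_Integration.integral_cong refl) (auto simp: indicator_def)
    also have "\<dots> = (LINT t|lebesgue. Q \<omega> t * J1 t)"
    proof (rule integral_cong_AE)
      show "AE t in lebesgue. Q \<omega> t * J t = Q \<omega> t * J1 t" using AE_completion[OF J_J1] by eventually_elim simp
      have "Q \<omega> \<in> borel_measurable lborel" "J1 \<in> borel_measurable lborel" by measurable
      then have "Q \<omega> \<in> borel_measurable lebesgue" "J1 \<in> borel_measurable lebesgue" by (auto intro: measurable_completion)
      then show "(\<lambda>t. Q \<omega> t * J t) \<in> borel_measurable lebesgue" "(\<lambda>t. Q \<omega> t * J1 t) \<in> borel_measurable lebesgue"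
        using J_measurable by (auto intro: borel_measurable_times)
    qed
    also have "\<dots> = (LINT t|lborel. Q \<omega> t * J1 t)" by (rule integral_completion) measurable
    finally show ?thesis .
  qed
  have "(\<lambda>\<omega>. LINT t|lborel. Q \<omega> t * J1 t) \<in> borel_measurable M"
    by (rule lborel.borel_measurable_lebesgue_integral) measurable
  then have "(\<lambda>\<omega>. LINT t:{0..1}|lebesgue. quantile (Hn n \<omega>) t * J t) \<in> borel_measurable M"
    by (simp add: eq cong: measurable_cong)
  then show ?thesis unfolding GL_functional_def using q by (intro borel_measurable_add borel_measurable_sum borel_measurable_times) auto
qed

text \<open>Levy's continuity theorem turns the convergence of characteristic functions into weak convergence.\<close>

theorem GL_functional_clt:
  "weak_conv_m (\<lambda>n. distr M borel (\<lambda>\<omega>. sqrt (real n) * (GL_functional J d a p (Hn n \<omega>) - GL_functional J d a p HF)))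
     (normal_law ((real m)\<^sup>2 * longrun influence))"
proof (rule levy_continuity)
  let ?V = "\<lambda>n \<omega>. sqrt (real n) * (GL_functional J d a p (Hn n \<omega>) - GL_functional J d a p HF)"
  have V[measurable]: "?V n \<in> borel_measurable M" for n
    by (intro borel_measurable_times borel_measurable_diff GL_functional_measurable) auto
  show "real_distribution (distr M borel (?V n))" for n by (rule real_distribution_distr) measurable
  show "real_distribution (normal_law ((real m)\<^sup>2 * longrun influence))" by (rule real_distribution_normal_law)
  have W: "(\<lambda>\<omega>. real m / sqrt (real n) * (\<Sum>s\<in>{1..n}. influence (X s \<omega>))) \<in> borel_measurable M" for n
    by (intro borel_measurable_times borel_measurable_sum measurable_compose[OF X_measurable influence_measurable]) auto
  fix t
  have "(\<lambda>n. LINT \<omega>|M. iexp (t * real m / sqrt (real n) * (\<Sum>s\<in>{1..n}. influence (X s \<omega>)))) \<longlonglongrightarrow> of_real (exp (- ((t * real m)\<^sup>2 * longrun influence / 2)))"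
    by (rule clt_char[OF influence_measurable influence_bounded expectation_influence])
  then have "(\<lambda>n. LINT \<omega>|M. iexp (t * (real m / sqrt (real n) * (\<Sum>s\<in>{1..n}. influence (X s \<omega>))))) \<longlonglongrightarrow> of_real (exp (- ((t * real m)\<^sup>2 * longrun influence / 2)))"
    by (simp add: mult.assoc)
  from char_transfer[OF GL_functional_linearization _ this] V W
  have "(\<lambda>n. LINT \<omega>|M. iexp (t * ?V n \<omega>)) \<longlonglongrightarrow> of_real (exp (- ((t * real m)\<^sup>2 * longrun influence / 2)))" by simp
  moreover have "char (distr M borel (?V n)) t = (LINT \<omega>|M. iexp (t * ?V n \<omega>))" for n
    unfolding char_def by (rule integral_distr) measurable
  moreover have "longrun influence \<ge> 0" by (rule longrun_nonneg[OF influence_measurable influence_bounded expectation_influence])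
  then have "char (normal_law ((real m)\<^sup>2 * longrun influence)) t = of_real (exp (- ((t * real m)\<^sup>2 * longrun influence / 2)))"
    by (subst char_normal_law) (auto simp: power_mult_distrib mult.assoc)
  ultimately show "(\<lambda>n. char (distr M borel (?V n)) t) \<longlonglongrightarrow> char (normal_law ((real m)\<^sup>2 * longrun influence)) t" by simp
qed

end

section \<open>Continuity of the weight along the quantile function\<close>

text \<open>A Borel version of every function that is continuous almost everywhere: the set of continuity points
  is Borel, and the function is continuous on it.\<close>

definition continuous_part :: "(real \<Rightarrow> real) \<Rightarrow> real \<Rightarrow> real" where
  "continuous_part f x = indicator {x. isCont f x} x *\<^sub>R f x"

lemma continuous_part_measurable[measurable]: "continuous_part f \<in> borel_measurable borel"
  unfolding continuous_part_def[abs_def]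
proof (rule borel_measurable_continuous_on_indicator)
  show "{x. isCont f x} \<in> sets borel" using isCont_borel_pred[of f] by measurable
  show "continuous_on {x. isCont f x} f" by (simp add: continuous_at_imp_continuous_on)
qed

lemma continuous_part_bounded: "\<bar>f x\<bar> \<le> b \<Longrightarrow> \<bar>continuous_part f x\<bar> \<le> (b :: real)"
  unfolding continuous_part_def by (cases "isCont f x") auto

lemma AE_continuous_part: "AE x in lborel. isCont f x \<Longrightarrow> AE x in lborel. continuous_part f x = f x"
  by (auto simp: continuous_part_def elim: AE_mp)

text \<open>Outside of \<open>{\<alpha>..\<beta>}\<close> the function vanishes locally, so only the two endpoints are exceptional.\<close>

lemma isCont_of_continuous_within:
  fixes J :: "real \<Rightarrow> real"
  assumes supp: "\<And>t. t \<notin> {\<alpha>..\<beta>} \<Longrightarrow> J t = 0" and ne: "s \<noteq> \<alpha>" "s \<noteq> \<beta>"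
    and within: "\<alpha> < s \<Longrightarrow> s < \<beta> \<Longrightarrow> continuous (at s within {\<alpha>..\<beta>}) J"
  shows "isCont J s"
proof (cases "\<alpha> < s \<and> s < \<beta>")
  case True
  then have "at s within {\<alpha>..\<beta>} = at s" by (intro at_within_interior) simp
  then show ?thesis using within True by simp
next
  case False
  have "eventually (\<lambda>t. J t = 0) (nhds s)"
  proof -
    have "open (- {\<alpha>..\<beta>})" "s \<in> - {\<alpha>..\<beta>}" using False ne by auto
    from eventually_nhds_in_open[OF this] show ?thesis by eventually_elim (use supp in auto)
  qed
  from isCont_cong[OF this] show ?thesis by simp
qed

lemma lebesgue_measurable_AE_eq:
  assumes g: "g \<in> borel_measurable borel" and eq: "AE x in lborel. g x = (f x :: real)"
  shows "f \<in> borel_measurable lebesgue"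
proof (rule measurableI)
  fix A :: "real set" assume A: "A \<in> sets borel"
  have "g \<in> borel_measurable lborel" using g by simp
  then have gA: "g -` A \<inter> space lebesgue \<in> sets lebesgue" using A by (intro measurable_sets[OF measurable_completion]) auto
  show "f -` A \<inter> space lebesgue \<in> sets lebesgue"
    by (rule completion.in_sets_AE[OF _ gA]) (use AE_completion[OF eq] in \<open>auto elim: AE_mp\<close>)
qed simp

lemma interval_measure_shift: "interval_measure (\<lambda>t. F t - c) = interval_measure F"
  unfolding interval_measure_def by simp

locale increasing_cdf =
  fixes H :: "real \<Rightarrow> real"
  assumes H_strict: "strict_mono H" and H_cont: "\<And>y. isCont H y"
    and H_at_top: "(H \<longlongrightarrow> 1) at_top" and H_at_bot: "(H \<longlongrightarrow> 0) at_bot"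
begin

lemma H_above: "t < 1 \<Longrightarrow> \<exists>y. t < H y"
  using order_tendstoD(1)[OF H_at_top, of t] by (meson eventually_at_top_linorder order_refl)

lemma H_below: "0 < t \<Longrightarrow> \<exists>y. H y < t"
  using order_tendstoD(2)[OF H_at_bot, of t] by (meson eventually_at_bot_linorder order_refl)

lemma quantile_le: "0 < t \<Longrightarrow> t < 1 \<Longrightarrow> quantile H t \<le> y \<longleftrightarrow> t \<le> H y"
proof (rule quantile_le_iff[OF strict_mono_mono[OF H_strict]])
  show "continuous (at_right y) H" for y by (rule continuous_at_imp_continuous_at_within[OF H_cont])
  show "t < 1 \<Longrightarrow> \<exists>y. t \<le> H y" using H_above[of t] less_imp_le by blast
  show "0 < t \<Longrightarrow> \<exists>y. H y < t" by (rule H_below)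
qed

lemma H_quantile: assumes "0 < t" "t < 1" shows "H (quantile H t) = t"
proof (rule antisym)
  show "t \<le> H (quantile H t)" using quantile_le[OF assms, of "quantile H t"] by simp
  show "H (quantile H t) \<le> t"
  proof (rule ccontr)
    assume "\<not> H (quantile H t) \<le> t"
    then have *: "t < H (quantile H t)" by simp
    have "(H \<longlongrightarrow> H (quantile H t)) (at_left (quantile H t))"
      using H_cont[of "quantile H t"] unfolding isCont_def by (rule filterlim_at_split[THEN iffD1, THEN conjunct1])
    from order_tendstoD(1)[OF this *] obtain b where b: "b < quantile H t" "\<And>y. b < y \<Longrightarrow> y < quantile H t \<Longrightarrow> t < H y"
      unfolding eventually_at_left_field by blast
    obtain y where "b < y" "y < quantile H t" using dense[OF b(1)] by blast
    then show False using b(2)[of y] quantile_le[OF assms, of y] by simp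
  qed
qed

lemma quantile_H: "0 < H y \<Longrightarrow> H y < 1 \<Longrightarrow> quantile H (H y) = y"
  using H_quantile[of "H y"] strict_mono_eq[OF H_strict] by blast

lemma quantile_less_iff: "0 < t \<Longrightarrow> t < 1 \<Longrightarrow> quantile H t < y \<longleftrightarrow> t < H y"
  using H_quantile[of t] strict_mono_less[OF H_strict, of "quantile H t" y] by simp

text \<open>Both measures assign \<open>quantile H t - quantile H s\<close> to an interval from \<open>s\<close> to \<open>t\<close> inside of \<open>{\<alpha>..\<beta>}\<close>. So
  null sets of the measure induced by the quantile function correspond to Lebesgue null sets
  of the line.\<close>

lemma stieltjes_quantile:
  assumes \<alpha>\<beta>: "0 < \<alpha>" "\<alpha> \<le> \<beta>" "\<beta> < 1"
  shows "stieltjes_measure_on \<alpha> \<beta> (quantile H) = distr (interval_meas (quantile H \<alpha>) (quantile H \<beta>)) borel H"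
proof -
  let ?q = "quantile H" let ?I = "interval_meas (?q \<alpha>) (?q \<beta>)"
  \<comment> \<open>Subtracting the constant makes \<open>G\<close> a distribution function, vanishing at \<open>-\<infinity>\<close>; the measure
    that it induces does not change.\<close>
  define G where "G t = ?q (max \<alpha> (min \<beta> t)) - ?q \<alpha>" for t
  have clamp: "0 < max \<alpha> (min \<beta> t)" "max \<alpha> (min \<beta> t) < 1" for t using \<alpha>\<beta> by auto
  have qmono: "?q s \<le> ?q t" if "0 < s" "s \<le> t" "t < 1" for s t
    using quantile_le[of s "?q t"] H_quantile[of t] that by auto
  have Gmono: "G s \<le> G t" if "s \<le> t" for s t
    unfolding G_def using that clamp by (intro diff_right_mono qmono) auto
  have Gcont: "continuous (at_right t) G" for t
    unfolding continuous_within
  proof (rule order_tendstoI)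
    fix a assume a: "a < G t"
    show "eventually (\<lambda>s. a < G s) (at_right t)"
      using eventually_at_right_less[of t] by eventually_elim (use a Gmono in \<open>meson less_imp_le less_le_trans\<close>)
  next
    fix a assume "G t < a"
    then have "max \<alpha> (min \<beta> t) < H (a + ?q \<alpha>)" using quantile_less_iff[OF clamp, of t] by (simp add: G_def algebra_simps)
    moreover have "((\<lambda>s. max \<alpha> (min \<beta> s)) \<longlongrightarrow> max \<alpha> (min \<beta> t)) (at_right t)" by (intro tendsto_intros)
    ultimately have "eventually (\<lambda>s. max \<alpha> (min \<beta> s) < H (a + ?q \<alpha>)) (at_right t)" by (rule order_tendstoD(2)[rotated])
    then show "eventually (\<lambda>s. G s < a) (at_right t)"
    proof eventually_elim
      case (elim s)
      then have "?q (max \<alpha> (min \<beta> s)) < a + ?q \<alpha>" using quantile_less_iff[OF clamp] by simp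
      then show ?case by (simp add: G_def)
    qed
  qed
  have bot: "(G \<longlongrightarrow> 0) at_bot"
  proof (rule tendsto_eventually)
    show "eventually (\<lambda>t. G t = 0) at_bot" using eventually_le_at_bot[of \<alpha>]
    proof eventually_elim
      case (elim t)
      then have "max \<alpha> (min \<beta> t) = \<alpha>" using \<alpha>\<beta> by simp
      then show ?case by (simp add: G_def)
    qed
  qed
  have top: "(G \<longlongrightarrow> ?q \<beta> - ?q \<alpha>) at_top"
  proof (rule tendsto_eventually)
    show "eventually (\<lambda>t. G t = ?q \<beta> - ?q \<alpha>) at_top" using eventually_ge_at_top[of \<beta>]
    proof eventually_elim
      case (elim t)
      then have "max \<alpha> (min \<beta> t) = \<beta>" using \<alpha>\<beta> by simp
      then show ?case by (simp add: G_def)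
    qed
  qed
  have q\<alpha>\<beta>: "?q \<alpha> \<le> ?q \<beta>" using \<alpha>\<beta> by (intro qmono) auto
  have Hm[measurable]: "H \<in> borel_measurable borel" by (rule borel_measurable_mono[OF strict_mono_mono[OF H_strict]])
  have "interval_measure G = distr ?I borel H"
  proof (rule cdf_unique')
    show "finite_borel_measure (interval_measure G)"
      using finite_borel_measure_interval_measure[OF Gmono Gcont bot top] q\<alpha>\<beta> by simp
    interpret I: finite_measure ?I by (rule finite_measure_interval_meas)
    have "finite_measure (distr ?I borel H)" by (rule I.finite_measure_distr) measurable
    then show "finite_borel_measure (distr ?I borel H)"
      unfolding finite_borel_measure_def finite_borel_measure_axioms_def by simp
    have "G t = cdf (distr ?I borel H) t" for t
    proof -
      have "cdf (distr ?I borel H) t = measure ?I {y. H y \<le> t}"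
        unfolding cdf_def by (subst measure_distr) (auto simp: vimage_def)
      also have "\<dots> = (LINT y|?I. indicator {y. H y \<le> t} y)" by simp
      also have "\<dots> = (LINT y|lborel. indicator {?q \<alpha>..?q \<beta>} y * indicator {y. H y \<le> t} y)"
        by (rule integral_interval_meas) measurable
      also have "\<dots> = (LINT y|lborel. indicator (if t < \<alpha> then {} else {?q \<alpha>..?q (max \<alpha> (min \<beta> t))}) y)"
      proof (intro Bochner_Integration.integral_cong refl)
        fix y
        have e1: "H y \<le> t \<longleftrightarrow> y \<le> ?q t" if "\<alpha> \<le> t" "t \<le> \<beta>" 
          using quantile_less_iff[of t y] that \<alpha>\<beta> by (auto simp: not_less[symmetric])
        have e2: "?q \<alpha> \<le> y \<longleftrightarrow> \<alpha> \<le> H y" using quantile_le[of \<alpha> y] \<alpha>\<beta> by simp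
        have e3: "y \<le> ?q \<beta> \<longleftrightarrow> H y \<le> \<beta>" using quantile_less_iff[of \<beta> y] \<alpha>\<beta> by (auto simp: not_less[symmetric])
        consider "t < \<alpha>" | "\<alpha> \<le> t" "t \<le> \<beta>" | "\<beta> < t" by linarith
        then show "indicator {?q \<alpha>..?q \<beta>} y * indicator {y. H y \<le> t} y = (indicator (if t < \<alpha> then {} else {?q \<alpha>..?q (max \<alpha> (min \<beta> t))}) y :: real)"
        proof cases
          case 1 then show ?thesis using e2 by (auto simp: indicator_def)
        next
          case 2
          have "max \<alpha> (min \<beta> t) = t" using 2 by auto
          moreover have "?q t \<le> ?q \<beta>" using 2 \<alpha>\<beta> by (intro qmono) auto
          ultimately show ?thesis using e1[OF 2] 2 by (auto simp: indicator_def)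
        next
          case 3
          have "max \<alpha> (min \<beta> t) = \<beta>" using 3 \<alpha>\<beta> by auto
          then show ?thesis using e3 3 \<alpha>\<beta> by (auto simp: indicator_def)
        qed
      qed
      also have "\<dots> = G t"
      proof (cases "t < \<alpha>")
        case True then show ?thesis using \<alpha>\<beta> by (simp add: G_def max_def min_def)
      next
        case False
        have "?q \<alpha> \<le> ?q (max \<alpha> (min \<beta> t))" using clamp \<alpha>\<beta> by (intro qmono) auto
        then show ?thesis using False by (simp add: G_def)
      qed
      finally show ?thesis by simp
    qed
    then show "cdf (interval_measure G) = cdf (distr ?I borel H)"
      using cdf_interval_measure[OF Gmono Gcont bot] by (simp add: fun_eq_iff)
  qed
  then show ?thesis unfolding stieltjes_measure_on_def G_def[abs_def] interval_measure_shift .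
qed

text \<open>This is the form in which continuity almost everywhere with respect to the quantile function is used.
  The values \<open>\<alpha>\<close> and \<open>\<beta>\<close>, where continuity is only one-sided, are each attained by \<open>H\<close> at a single point.\<close>

lemma AE_isCont_at_H:
  fixes J :: "real \<Rightarrow> real"
  assumes \<alpha>\<beta>: "0 < \<alpha>" "\<alpha> < \<beta>" "\<beta> < 1" and supp: "\<And>t. t \<notin> {\<alpha>..\<beta>} \<Longrightarrow> J t = 0"
    and ae: "AE t in stieltjes_measure_on \<alpha> \<beta> (quantile H). t \<in> {\<alpha>..\<beta>} \<longrightarrow> continuous (at t within {\<alpha>..\<beta>}) J"
  shows "AE y in lborel. isCont J (H y)"
proof -
  let ?q = "quantile H"
  have Hm[measurable]: "H \<in> borel_measurable borel" by (rule borel_measurable_mono[OF strict_mono_mono[OF H_strict]])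
  have "AE y in interval_meas (?q \<alpha>) (?q \<beta>). H y \<in> {\<alpha>..\<beta>} \<longrightarrow> continuous (at (H y) within {\<alpha>..\<beta>}) J"
    using ae \<alpha>\<beta> by (subst (asm) stieltjes_quantile) (auto intro: AE_distrD[where M' = borel])
  then have "AE y in lborel. y \<in> {?q \<alpha>..?q \<beta>} \<longrightarrow> H y \<in> {\<alpha>..\<beta>} \<longrightarrow> continuous (at (H y) within {\<alpha>..\<beta>}) J"
    unfolding interval_meas_def by (subst (asm) AE_density) (auto simp: indicator_def elim!: AE_mp)
  moreover have "AE y in lborel. y \<noteq> ?q \<alpha>" "AE y in lborel. y \<noteq> ?q \<beta>" by (rule AE_lborel_singleton)+
  ultimately show ?thesis
  proof eventually_elim
    case (elim y)
    have ne: "H y \<noteq> \<alpha>" "H y \<noteq> \<beta>"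
      using elim(2,3) quantile_H[of y] \<alpha>\<beta> by auto
    show ?case
    proof (rule isCont_of_continuous_within[OF supp ne])
      assume "\<alpha> < H y" "H y < \<beta>"
      then have "?q \<alpha> \<le> y" "y \<le> ?q \<beta>" using quantile_le[of \<alpha> y] quantile_less_iff[of \<beta> y] \<alpha>\<beta> by auto
      then show "continuous (at (H y) within {\<alpha>..\<beta>}) J" using elim(1) \<open>\<alpha> < H y\<close> \<open>H y < \<beta>\<close> by simp
    qed
  qed
qed

end

lemma AE_isCont_supported:
  fixes J :: "real \<Rightarrow> real"
  assumes supp: "\<And>t. t \<notin> {\<alpha>..\<beta>} \<Longrightarrow> J t = 0"
    and ae: "AE t in lebesgue. t \<in> {\<alpha>..\<beta>} \<longrightarrow> continuous (at t within {\<alpha>..\<beta>}) J"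
  shows "AE t in lborel. isCont J t"
proof -
  have "AE t in lborel. t \<in> {\<alpha>..\<beta>} \<longrightarrow> continuous (at t within {\<alpha>..\<beta>}) J"
    using ae by (simp add: AE_completion_iff)
  moreover have "AE y in lborel. y \<noteq> \<alpha>" "AE y in lborel. y \<noteq> \<beta>" by (rule AE_lborel_singleton)+
  ultimately show ?thesis
  proof eventually_elim
    case (elim y)
    show ?case by (rule isCont_of_continuous_within[OF supp elim(2,3)]) (use elim(1) in auto)
  qed
qed

section \<open>Densities and independent copies\<close>

context prob_space
begin

lemma density_cdf_increment:
  fixes Z :: "'a \<Rightarrow> real"
  assumes Z: "distributed M lborel Z (\<lambda>x. ennreal (f x))" and "a \<le> b"
  shows "ennreal (prob {\<omega> \<in> space M. Z \<omega> \<le> b} - prob {\<omega> \<in> space M. Z \<omega> \<le> a}) = (\<integral>\<^sup>+x. ennreal (f x) * indicator {a<..b} x \<partial>lborel)"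
proof -
  have "Z \<in> borel_measurable M" using distributed_measurable[OF Z] by simp
  then have ev: "{\<omega> \<in> space M. Z \<omega> \<le> c} \<in> events" for c unfolding borel_measurable_iff_le by blast
  have "prob {\<omega> \<in> space M. Z \<omega> \<le> b} - prob {\<omega> \<in> space M. Z \<omega> \<le> a} = prob ({\<omega> \<in> space M. Z \<omega> \<le> b} - {\<omega> \<in> space M. Z \<omega> \<le> a})"
    by (rule finite_measure_Diff[symmetric, OF ev ev]) (use \<open>a \<le> b\<close> in force)
  also have "{\<omega> \<in> space M. Z \<omega> \<le> b} - {\<omega> \<in> space M. Z \<omega> \<le> a} = Z -` {a<..b} \<inter> space M" by auto
  finally have "ennreal (prob {\<omega> \<in> space M. Z \<omega> \<le> b} - prob {\<omega> \<in> space M. Z \<omega> \<le> a}) = emeasure M (Z -` {a<..b} \<inter> space M)"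
    by (simp add: emeasure_eq_measure)
  also have "\<dots> = (\<integral>\<^sup>+x. ennreal (f x) * indicator {a<..b} x \<partial>lborel)"
    by (rule distributed_emeasure[OF Z]) simp
  finally show ?thesis .
qed

lemma density_cdf_lipschitz:
  fixes Z :: "'a \<Rightarrow> real"
  assumes Z: "distributed M lborel Z (\<lambda>x. ennreal (f x))" and f: "\<And>x. f x \<le> D" "0 \<le> D" and ab: "a \<le> b"
  shows "prob {\<omega> \<in> space M. Z \<omega> \<le> b} - prob {\<omega> \<in> space M. Z \<omega> \<le> a} \<le> D * (b - a)"
proof -
  have "ennreal (prob {\<omega> \<in> space M. Z \<omega> \<le> b} - prob {\<omega> \<in> space M. Z \<omega> \<le> a}) \<le> (\<integral>\<^sup>+x. ennreal D * indicator {a<..b} x \<partial>lborel)"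
    unfolding density_cdf_increment[OF Z ab] by (intro nn_integral_mono mult_right_mono ennreal_leI f) auto
  also have "\<dots> = ennreal D * ennreal (b - a)" using ab by (simp add: nn_integral_cmult_indicator)
  also have "\<dots> = ennreal (D * (b - a))" using f ab by (simp add: ennreal_mult)
  finally show ?thesis using f ab by (simp add: ennreal_le_iff)
qed

text \<open>Boundedness of the density gives continuity and its positivity strict monotonicity.\<close>

lemma density_cdf_increasing:
  fixes Z :: "'a \<Rightarrow> real"
  assumes Z: "distributed M lborel Z (\<lambda>x. ennreal (f x))" and f: "\<And>x. f x \<le> D" "0 \<le> D" "\<And>x. 0 < f x"
  shows "increasing_cdf (\<lambda>y. prob {\<omega> \<in> space M. Z \<omega> \<le> y})"
proof
  define H where "H y = prob {\<omega> \<in> space M. Z \<omega> \<le> y}" for y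
  have [measurable]: "Z \<in> borel_measurable M" using distributed_measurable[OF Z] by simp
  have lt: "H a < H b" if "a < b" for a b
  proof (rule ccontr)
    assume "\<not> H a < H b"
    then have "(\<integral>\<^sup>+x. ennreal (f x) * indicator {a<..b} x \<partial>lborel) = 0"
      unfolding density_cdf_increment[OF Z less_imp_le[OF that], symmetric] H_def by (simp add: ennreal_neg)
    moreover have "f \<in> borel_measurable lborel" by (rule distributed_real_measurable[OF _ Z]) (use f(3) in \<open>auto intro: less_imp_le\<close>)
    then have "(\<lambda>x. ennreal (f x) * indicator {a<..b} x) \<in> borel_measurable lborel" by measurable
    ultimately have "AE x in lborel. ennreal (f x) * indicator {a<..b} x = 0" by (simp add: nn_integral_0_iff_AE)
    then have "AE x in lborel. x \<notin> {a<..b}"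
    proof eventually_elim
      case (elim x)
      then show ?case using f(3)[of x] by (auto simp: indicator_def ennreal_eq_0_iff split: if_splits)
    qed
    then have "emeasure lborel {a<..b} = 0" by (subst (asm) AE_iff_measurable[of "{a<..b}"]) auto
    then show False using that by simp
  qed
  then show "strict_mono (\<lambda>y. prob {\<omega> \<in> space M. Z \<omega> \<le> y})" unfolding H_def by (auto intro: strict_monoI)
  have lip: "\<bar>H b - H a\<bar> \<le> D * \<bar>b - a\<bar>" for a b
  proof (cases "a \<le> b")
    case True
    then show ?thesis using density_cdf_lipschitz[OF Z f(1,2) True] lt[of a b] unfolding H_def by (cases "a = b") auto
  next
    case False
    then show ?thesis using density_cdf_lipschitz[OF Z f(1,2), of b a] lt[of b a] unfolding H_def by auto
  qed
  show "isCont (\<lambda>y. prob {\<omega> \<in> space M. Z \<omega> \<le> y}) y" for y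
    unfolding H_def[symmetric] isCont_def
  proof (rule Lim_null[THEN iffD2], rule Lim_null_comparison)
    show "eventually (\<lambda>x. norm (H x - H y) \<le> D * \<bar>x - y\<bar>) (at y)" using lip by (simp add: abs_minus_commute)
    have "((\<lambda>x. D * \<bar>x - y\<bar>) \<longlongrightarrow> D * \<bar>y - y\<bar>) (at y)" by (intro tendsto_intros)
    then show "((\<lambda>x. D * \<bar>x - y\<bar>) \<longlongrightarrow> 0) (at y)" by simp
  qed
  interpret R: real_distribution "distr M borel Z" by (rule real_distribution_distr) measurable
  have "cdf (distr M borel Z) = (\<lambda>y. prob {\<omega> \<in> space M. Z \<omega> \<le> y})"
    unfolding cdf_def by (intro ext, subst measure_distr) (auto intro!: arg_cong[where f = prob])
  then show "((\<lambda>y. prob {\<omega> \<in> space M. Z \<omega> \<le> y}) \<longlongrightarrow> 1) at_top" "((\<lambda>y. prob {\<omega> \<in> space M. Z \<omega> \<le> y}) \<longlongrightarrow> 0) at_bot"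
    using R.cdf_lim_at_top_prob R.cdf_lim_at_bot by auto
qed

end

context mixing_process
begin

text \<open>The vector of independent copies has the product law, which is also the law of a tuple of
  coordinates under \<open>iid_paths\<close>.\<close>

lemma copies_law:
  assumes Y: "independent_copies M X Y" and m: "m \<ge> 1" and f: "f \<in> borel_measurable (PiM {1..m} (\<lambda>_. borel))"
  shows "(LINT \<omega>|M. f (\<lambda>j\<in>{1..m}. Y j \<omega>)) = (LINT z|iid_paths. f (\<lambda>j\<in>{1..m}. z j) :: real)"
proof -
  have iv: "indep_vars (\<lambda>_. borel) Y {1..m}"
    using Y unfolding independent_copies_def by (auto elim: indep_vars_subset)
  have rv: "Y j \<in> borel_measurable M" if "j \<in> {1..m}" for j using iv that unfolding indep_vars_def by auto
  have "distr M (PiM {1..m} (\<lambda>_. borel)) (\<lambda>\<omega>. \<lambda>j\<in>{1..m}. Y j \<omega>) = PiM {1..m} (\<lambda>j. distr M borel (Y j))"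
    using indep_vars_iff_distr_eq_PiM'[of "{1..m}" Y "\<lambda>_. borel"] rv iv m by auto
  also have "\<dots> = PiM {1..m} (\<lambda>_. marginal)"
    using Y unfolding independent_copies_def marginal_def by (intro PiM_cong) auto
  finally have law: "distr M (PiM {1..m} (\<lambda>_. borel)) (\<lambda>\<omega>. \<lambda>j\<in>{1..m}. Y j \<omega>) = PiM {1..m} (\<lambda>_. marginal)" .
  have "(\<lambda>\<omega>. \<lambda>j\<in>{1..m}. Y j \<omega>) \<in> M \<rightarrow>\<^sub>M PiM {1..m} (\<lambda>_. borel)" by (intro measurable_restrict rv)
  from integral_distr[OF this f] show ?thesis unfolding law using iid_select_law[OF f, of "\<lambda>j. j"] by simp
qed

lemma kernel_cdf_eq_theta:
  assumes Y: "independent_copies M X Y" and m: "m \<ge> 1" and h: "kernel m h"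
  shows "kernel_cdf M m h Y y = theta m (\<lambda>v. of_bool (h v \<le> y))"
proof -
  have hm[measurable]: "h \<in> borel_measurable (PiM {1..m} (\<lambda>_. borel))" using h by (simp add: kernel_def)
  have iv: "indep_vars (\<lambda>_. borel) Y {1..m}"
    using Y unfolding independent_copies_def by (auto elim: indep_vars_subset)
  have rv: "Y j \<in> borel_measurable M" if "j \<in> {1..m}" for j using iv that unfolding indep_vars_def by auto
  have [measurable]: "(\<lambda>\<omega>. \<lambda>j\<in>{1..m}. Y j \<omega>) \<in> M \<rightarrow>\<^sub>M PiM {1..m} (\<lambda>_. borel)" by (intro measurable_restrict rv)
  have "kernel_cdf M m h Y y = expectation (indicator {\<omega> \<in> space M. h (\<lambda>j\<in>{1..m}. Y j \<omega>) \<le> y})"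
    unfolding kernel_cdf_def by (simp add: Int_absorb2 subset_eq)
  also have "\<dots> = expectation (\<lambda>\<omega>. of_bool (h (\<lambda>j\<in>{1..m}. Y j \<omega>) \<le> y))"
    by (intro Bochner_Integration.integral_cong) (auto simp: indicator_def)
  also have "\<dots> = theta m (\<lambda>v. of_bool (h v \<le> y))"
    unfolding theta_def by (rule copies_law[OF Y m]) measurable
  finally show ?thesis .
qed

lemma long_run_variance_eq_longrun:
  assumes u[measurable]: "u \<in> borel_measurable borel" and mean: "expectation (\<lambda>\<omega>. u (X 1 \<omega>)) = 0"
  shows "long_run_variance M X u = longrun u"
proof -
  have "expectation (\<lambda>\<omega>. u (X (Suc j + 1) \<omega>)) = 0" for j using expectation_shift1[OF u, of "Suc j + 1"] mean by simp
  then show ?thesis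
    unfolding long_run_variance_def covariance_def longrun_def autocov_def using mean by (simp add: power2_eq_square)
qed

end

context gl_statistic
begin

lemma HF_weight_measurable: "(\<lambda>y. J (HF y)) \<in> borel_measurable lebesgue"
  by (rule lebesgue_measurable_AE_eq[OF wt_measurable wt_J])

text \<open>Outside of \<open>{lo..hi}\<close> the values of \<open>HF\<close> lie outside of \<open>{\<alpha>..\<beta>}\<close>, where the weight vanishes.\<close>

lemma weighted_integral_eq:
  fixes g :: "real \<Rightarrow> real"
  assumes g[measurable]: "g \<in> borel_measurable borel"
  shows "(LINT y|lebesgue. g y * J (HF y)) = (LINT y|interval_meas lo hi. wt y * g y)"
proof -
  have gl: "g \<in> borel_measurable lebesgue" using g by (auto intro: measurable_completion)
  have z: "J (HF y) = 0" if "y \<notin> {lo..hi}" for y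
    using that HF_mono[of y lo] HF_mono[of hi y] HF_lo HF_hi by (intro J_support) (auto simp: not_le)
  have "(LINT y|lebesgue. g y * J (HF y)) = (LINT y|lebesgue. indicator {lo..hi} y * (wt y * g y))"
  proof (rule integral_cong_AE)
    show "(\<lambda>y. g y * J (HF y)) \<in> borel_measurable lebesgue" using gl HF_weight_measurable by (rule borel_measurable_times)
    have "(\<lambda>y. indicator {lo..hi} y * (wt y * g y)) \<in> borel_measurable lborel" by measurable
    then show "(\<lambda>y. indicator {lo..hi} y * (wt y * g y)) \<in> borel_measurable lebesgue" by (rule measurable_completion)
    show "AE y in lebesgue. g y * J (HF y) = indicator {lo..hi} y * (wt y * g y)"
      using AE_completion[OF wt_J] by eventually_elim (use z in \<open>auto simp: indicator_def\<close>)
  qed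
  also have "\<dots> = (LINT y|lborel. indicator {lo..hi} y * (wt y * g y))" by (rule integral_completion) measurable
  also have "\<dots> = (LINT y|interval_meas lo hi. wt y * g y)" by (rule integral_interval_meas[symmetric]) measurable
  finally show ?thesis .
qed

text \<open>The kernel enters linearly through indicators of \<open>h \<le> y\<close>, whose expectations given the first
  argument are projections; Fubini's theorem carries the expectation into the integral over \<open>y\<close>.\<close>

lemma first_projection_eq_influence:
  assumes Y: "independent_copies M X Y" and dq: "\<And>i. i \<in> {1..d} \<Longrightarrow> hF (quantile HF (p i)) = dq i"
  shows "first_projection M m Y (GL_influence h J d a p HF hF) = influence"
proof
  fix c :: real
  interpret I: finite_measure "interval_meas lo hi" by (rule finite_measure_interval_meas)
  interpret P: prob_space iid_paths by (rule prob_space_iid_paths)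
  define q where "q i = quantile HF (p i)" for i
  define S where "S v = (LINT y|interval_meas lo hi. wt y * (ind y v - HF y))" for v
  define T where "T v = (\<Sum>i=1..d. a i * ((p i - ind (q i) v) / dq i))" for v
  have A: "GL_influence h J d a p HF hF v = - S v + T v" for v
  proof -
    have "(\<lambda>y. of_bool (h v \<le> y) - HF y) \<in> borel_measurable borel" by measurable
    from weighted_integral_eq[OF this] show ?thesis
      unfolding GL_influence_def S_def T_def q_def ind_def using dq by simp
  qed
  have "(\<lambda>w. wt (snd w) * (ind (snd w) (fst w) - HF (snd w))) \<in> borel_measurable (PiM {1..m} (\<lambda>_. borel) \<Otimes>\<^sub>M borel)"
    unfolding ind_def by measurable
  then have "(\<lambda>(v, y). wt y * (ind y v - HF y)) \<in> borel_measurable (PiM {1..m} (\<lambda>_. borel) \<Otimes>\<^sub>M interval_meas lo hi)"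
    by (simp only: case_prod_unfold measurable_cong_sets[OF sets_pair_measure_cong[OF refl sets_interval_meas] refl])
  then have Sm[measurable]: "S \<in> borel_measurable (PiM {1..m} (\<lambda>_. borel))"
    unfolding S_def[abs_def] by (rule I.borel_measurable_lebesgue_integral)
  have Tm[measurable]: "T \<in> borel_measurable (PiM {1..m} (\<lambda>_. borel))"
    unfolding T_def[abs_def] ind_def by measurable
  let ?s = "\<lambda>z :: nat \<Rightarrow> real. \<lambda>j\<in>{1..m}. if j = 1 then c else z j"
  have sm[measurable]: "?s \<in> PiM {1..m} (\<lambda>_. borel) \<rightarrow>\<^sub>M PiM {1..m} (\<lambda>_. borel)"
  proof (rule measurable_restrict)
    fix j assume "j \<in> {1..m}"
    then show "(\<lambda>z. if j = 1 then c else z j) \<in> borel_measurable (PiM {1..m} (\<lambda>_. borel))" by (cases "j = 1") auto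
  qed
  have sp[measurable]: "?s \<in> iid_paths \<rightarrow>\<^sub>M PiM {1..m} (\<lambda>_. borel)"
    using measurable_select_mixed2[where J = "{1..m}" and a = 1 and c = c and i = "\<lambda>j. j"] by (simp cong: measurable_cong_sets add: sets_iid_paths)
  have sr: "?s (\<lambda>j\<in>{1..m}. z j) = ?s z" for z :: "nat \<Rightarrow> real" by (auto simp: restrict_def)
  have "first_projection M m Y (GL_influence h J d a p HF hF) c = (LINT \<omega>|M. (- S (?s (\<lambda>j\<in>{1..m}. Y j \<omega>)) + T (?s (\<lambda>j\<in>{1..m}. Y j \<omega>))))"
    unfolding first_projection_def A sr ..
  also have "\<dots> = (LINT z|iid_paths. (- S (?s (\<lambda>j\<in>{1..m}. z j)) + T (?s (\<lambda>j\<in>{1..m}. z j))))"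
    by (rule copies_law[OF Y m1]) (intro borel_measurable_add borel_measurable_uminus measurable_compose[OF sm Sm] measurable_compose[OF sm Tm])
  also have "\<dots> = (LINT z|iid_paths. - S (?s z) + T (?s z))" unfolding sr ..
  also have "\<dots> = influence c"
  proof -
    define r where "r z = h (?s z)" for z
    have [measurable]: "r \<in> borel_measurable iid_paths"
      unfolding r_def[abs_def] by (rule measurable_compose[OF sp h_measurable])
    have ind_s: "ind y (?s z) = of_bool (r z \<le> y)" for y z by (simp add: ind_def r_def)
    have jm: "(\<lambda>(y, z). wt y * (ind y (?s z) - HF y)) \<in> borel_measurable (borel \<Otimes>\<^sub>M iid_paths)"
      unfolding ind_s split_beta by measurable
    have jb: "\<bar>wt y * (ind y v - HF y)\<bar> \<le> B" for y v
    proof -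
      have "\<bar>ind y v - HF y\<bar> \<le> 1" using HF_unit[of y] by (auto simp: ind_def)
      then have "\<bar>wt y\<bar> * \<bar>ind y v - HF y\<bar> \<le> B * 1" by (intro mult_mono wt_bounded B_nonneg) auto
      then show ?thesis by (simp add: abs_mult)
    qed
    note fub = P.interval_fubini[OF jm jb]
    have i1: "integrable iid_paths (\<lambda>z. S (?s z))" using fub(1) by (simp add: S_def)
    have ii: "integrable iid_paths (\<lambda>z. ind y (?s z))" for y
      unfolding ind_s by (rule P.integrable_const_bound[where B = 1]) auto
    have iT: "integrable iid_paths (\<lambda>z. a i * ((p i - ind (q i) (?s z)) / dq i))" for i
      using ii by (intro integrable_mult_right integrable_divide_zero Bochner_Integration.integrable_diff) auto
    have i2: "integrable iid_paths (\<lambda>z. T (?s z))" unfolding T_def using iT by (intro Bochner_Integration.integrable_sum)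
    have pr: "(LINT z|iid_paths. ind y (?s z)) = projection m (ind y) c" for y by (simp add: projection_def)
    have "(LINT z|iid_paths. S (?s z)) = L_influence c"
      unfolding S_def fub(3) L_influence_def using ii
      by (intro Bochner_Integration.integral_cong refl) (simp add: pr P.prob_space del: One_nat_def)
    moreover have "(LINT z|iid_paths. T (?s z)) = (\<Sum>i=1..d. a i * ((p i - projection m (ind (q i)) c) / dq i))"
      unfolding T_def using ii iT by (subst Bochner_Integration.integral_sum) (auto simp: pr P.prob_space simp del: One_nat_def)
    ultimately show ?thesis using i1 i2 by (simp add: influence_def q_def del: One_nat_def)
  qed
  finally show "first_projection M m Y (GL_influence h J d a p HF hF) c = influence c" .
qed

end

section \<open>Asymptotic normality of GL-statistics\<close>

lemma (in process) mixing_coeff_le_1: "mixing_coeff M X k \<le> 1"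
  unfolding mixing_coeff_def
proof (rule cSUP_least)
  fix n
  show "(SUP (A, B)\<in>generated_field M X {1..n} \<times> generated_field M X {n + k..}. \<bar>prob (A \<inter> B) - prob A * prob B\<bar>) \<le> 1"
  proof (rule cSUP_least)
    show "generated_field M X {1..n} \<times> generated_field M X {n + k..} \<noteq> {}"
      unfolding generated_field_def by (auto intro: sigma_sets.Empty)
    fix w assume "w \<in> generated_field M X {1..n} \<times> generated_field M X {n + k..}"
    obtain A B where w: "w = (A, B)" by (cases w)
    have "0 \<le> prob (A \<inter> B)" "prob (A \<inter> B) \<le> 1" "0 \<le> prob A * prob B" "prob A * prob B \<le> 1"
      by (auto intro: mult_le_one)
    then show "(case w of (A, B) \<Rightarrow> \<bar>prob (A \<inter> B) - prob A * prob B\<bar>) \<le> 1"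
      unfolding w prod.case abs_le_iff by linarith
  qed
qed auto

text \<open>The bound for large \<open>k\<close> is extended to all \<open>k \<ge> 1\<close>, using that mixing coefficients are at most 1.\<close>

lemma (in process) polynomial_mixing_rate:
  assumes "\<delta> \<ge> 8" and "mixing_coeff M X \<in> O(\<lambda>n. real n powr (- \<delta>))"
  obtains K where "K \<ge> 0" "\<And>k. k \<ge> 1 \<Longrightarrow> mixing_coeff M X k \<le> K / real k ^ 8"
proof -
  obtain c where c: "c > 0" "eventually (\<lambda>n. norm (mixing_coeff M X n) \<le> c * norm (real n powr (- \<delta>))) sequentially"
    using landau_o.bigE[OF assms(2)] by blast
  then obtain N where N: "\<And>n. n \<ge> N \<Longrightarrow> \<bar>mixing_coeff M X n\<bar> \<le> c * (real n powr (- \<delta>))"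
    unfolding eventually_sequentially by auto
  show thesis
  proof (rule that[of "c + real N ^ 8"])
    show "0 \<le> c + real N ^ 8" using c by simp
    fix k :: nat assume k: "k \<ge> 1"
    then have k8: "real k ^ 8 > 0" by simp
    show "mixing_coeff M X k \<le> (c + real N ^ 8) / real k ^ 8"
    proof (cases "k \<ge> N")
      case True
      have "mixing_coeff M X k \<le> c * real k powr (- \<delta>)" using N[OF True] by simp
      also have "\<dots> \<le> c * real k powr (- 8)" using k assms(1) c by (intro mult_left_mono powr_mono) auto
      also have "\<dots> = c / real k ^ 8" using k by (simp add: powr_minus powr_numeral divide_inverse)
      also have "\<dots> \<le> (c + real N ^ 8) / real k ^ 8" by (intro divide_right_mono) auto
      finally show ?thesis .
    next
      case False
      then have "real k ^ 8 \<le> real N ^ 8" by (intro power_mono) auto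
      then have "real k ^ 8 \<le> c + real N ^ 8" using c(1) by linarith
      then have "1 \<le> (c + real N ^ 8) / real k ^ 8" using k8 by (simp only: pos_le_divide_eq mult_1)
      then show ?thesis using mixing_coeff_le_1[of k] by linarith
    qed
  qed
qed

text \<open>It remains to produce the data of \<open>gl_statistic\<close>: the constants of the mixing rate, of the Lipschitz
  kernel and of the density, Borel versions of \<open>J\<close> and of \<open>J \<circ> HF\<close>, and levels \<open>lo\<close>, \<open>hi\<close> beyond the
  quantiles of orders \<open>\<alpha>\<close> and \<open>\<beta>\<close>.\<close>

theorem theorem2p2:
  fixes M :: "'a measure"
    and X Y :: "nat \<Rightarrow> 'a \<Rightarrow> real"
    and m d :: nat
    and h :: "(nat \<Rightarrow> real) \<Rightarrow> real"
    and HF hF J :: "real \<Rightarrow> real"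
    and a p :: "nat \<Rightarrow> real"
    and \<alpha> \<beta> \<rho> \<delta> :: real
  assumes "prob_space M"
    and "\<And>n. n \<ge> 1 \<Longrightarrow> X n \<in> borel_measurable M"
    and "stationary M X"
    and "strongly_mixing M X"
    and "\<rho> \<ge> 1" and "integrable M (\<lambda>\<omega>. \<bar>X 1 \<omega>\<bar> powr \<rho>)"
    and "\<delta> \<ge> 8" and "mixing_coeff M X \<in> O(\<lambda>n. real n powr (- \<delta>))"
    and "independent_copies M X Y"
    and "m \<ge> 2" and "kernel m h" and "lipschitz_kernel m h"
    and HF: "HF = kernel_cdf M m h Y"
    and "distributed M lborel (\<lambda>\<omega>. h (\<lambda>j\<in>{1..m}. Y j \<omega>)) (\<lambda>x. ennreal (hF x))"
    and "\<And>x. hF x > 0" and "bounded (range hF)"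
    and "\<And>k i. 2 \<le> k \<Longrightarrow> k \<le> m \<Longrightarrow> i \<in> {1..m} \<rightarrow> {1..} \<Longrightarrow> strict_mono_on {1..m} i \<Longrightarrow>
           has_bounded_density M (mixed_kernel_var m h X Y k i)"
    and "0 < \<alpha>" and "\<alpha> < \<beta>" and "\<beta> < 1"
    and "\<And>t. t \<notin> {\<alpha>..\<beta>} \<Longrightarrow> J t = 0"
    and "bounded (J ` {\<alpha>..\<beta>})"
    and "AE t in lebesgue. t \<in> {\<alpha>..\<beta>} \<longrightarrow> continuous (at t within {\<alpha>..\<beta>}) J"
    and "AE t in stieltjes_measure_on \<alpha> \<beta> (quantile HF).
           t \<in> {\<alpha>..\<beta>} \<longrightarrow> continuous (at t within {\<alpha>..\<beta>}) J"
    and "\<And>i. i \<in> {1..d} \<Longrightarrow> p i \<in> {0<..<1}"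
    (* hF, determined by the law only almost everywhere, is evaluated at these points *)
    and "\<And>i. i \<in> {1..d} \<Longrightarrow>
           (HF has_real_derivative hF (quantile HF (p i))) (at (quantile HF (p i)))"
  shows "weak_conv_m
           (\<lambda>n. distr M borel (\<lambda>\<omega>. sqrt (real n) *
              (GL_functional J d a p (empirical_cdf m h X n \<omega>) - GL_functional J d a p HF)))
           (normal_law ((real m)\<^sup>2 *
              long_run_variance M X (first_projection M m Y (GL_influence h J d a p HF hF))))"
proof -
  note X_meas = assms(2) and Jsupp = assms(21) and \<alpha>\<beta> = assms(18-20) and copies = assms(9)
  have m1: "m \<ge> 1" using assms(10) by simp
  interpret prob_space M by fact
  interpret process M X by unfold_locales (rule X_meas)
  obtain K where K: "K \<ge> 0" "\<And>k. k \<ge> 1 \<Longrightarrow> mixing_coeff M X k \<le> K / real k ^ 8"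
    using polynomial_mixing_rate[OF assms(7,8)] by blast
  interpret mixing_process M X K by unfold_locales (use assms(3) K in auto)
  obtain L where L: "L \<ge> 0" "\<And>x y. x \<in> extensional {1..m} \<Longrightarrow> y \<in> extensional {1..m} \<Longrightarrow>
      \<bar>h x - h y\<bar> \<le> L * L2_set (\<lambda>j. x j - y j) {1..m}"
    using assms(12) unfolding lipschitz_kernel_def by blast
  obtain D where D: "\<And>x. \<bar>hF x\<bar> \<le> D" using assms(16) unfolding bounded_iff by auto
  have D0: "D \<ge> 0" using D[of 0] by linarith
  have hD: "hF x \<le> D" for x using D[of x] by linarith
  have HF_prob: "HF = (\<lambda>y. prob {\<omega> \<in> space M. h (\<lambda>j\<in>{1..m}. Y j \<omega>) \<le> y})"
    unfolding HF kernel_cdf_def[abs_def] ..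
  have HF_theta: "theta m (\<lambda>v. of_bool (h v \<le> y)) = HF y" for y
    unfolding HF by (rule kernel_cdf_eq_theta[OF copies m1 assms(11), symmetric])
  have moment: "integrable M (\<lambda>\<omega>. \<bar>X 1 \<omega>\<bar>)"
  proof (rule Bochner_Integration.integrable_bound)
    show "integrable M (\<lambda>\<omega>. 1 + \<bar>X 1 \<omega>\<bar> powr \<rho>)" using assms(6) by simp
    show "(\<lambda>\<omega>. \<bar>X 1 \<omega>\<bar>) \<in> borel_measurable M" using X_meas[of 1] by simp
    have "\<bar>x\<bar> \<le> 1 + \<bar>x\<bar> powr \<rho>" for x :: real
    proof (cases "\<bar>x\<bar> \<le> 1")
      case False
      then have "\<bar>x\<bar> powr 1 \<le> \<bar>x\<bar> powr \<rho>" using assms(5) by (intro powr_mono) auto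
      then show ?thesis using False by simp
    qed (simp add: add_increasing2)
    then show "AE \<omega> in M. norm \<bar>X 1 \<omega>\<bar> \<le> norm (1 + \<bar>X 1 \<omega>\<bar> powr \<rho>)"
      by (intro AE_I2) (simp add: add_nonneg_nonneg)
  qed
  interpret U: kernel_process M X K m h L D
  proof unfold_locales
    show "theta m (\<lambda>v. of_bool (h v \<le> y')) - theta m (\<lambda>v. of_bool (h v \<le> y)) \<le> D * (y' - y)" if "y \<le> y'" for y y'
      unfolding HF_theta HF_prob by (rule density_cdf_lipschitz[OF assms(14) hD D0 that])
  qed (use m1 assms(11) L moment D0 in auto)
  have UHF: "U.HF = HF" unfolding U.HF_def[abs_def] U.ind_def[abs_def] HF_theta ..
  have UHn: "U.Hn n \<omega> = empirical_cdf m h X n \<omega>" for n \<omega>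
    unfolding U.Hn_def[abs_def] U.ind_def empirical_cdf_def[abs_def] tuples_def ..
  interpret C: increasing_cdf HF
    unfolding HF_prob by (rule density_cdf_increasing[OF assms(14) hD D0 assms(15)])
  obtain B0 where "\<forall>s\<in>J ` {\<alpha>..\<beta>}. norm s \<le> B0" using assms(22) unfolding bounded_iff by blast
  then have B0: "\<bar>J t\<bar> \<le> B0" if "t \<in> {\<alpha>..\<beta>}" for t using that by simp
  have B: "\<bar>J t\<bar> \<le> B0" for t
    using B0[of t] B0[of \<alpha>] Jsupp[of t] \<alpha>\<beta> by (cases "t \<in> {\<alpha>..\<beta>}") auto
  have J_cont: "AE t in lborel. isCont J t" by (rule AE_isCont_supported[OF Jsupp assms(23)])
  have JHF_cont: "AE y in lborel. isCont J (HF y)"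
    by (rule C.AE_isCont_at_H[OF \<alpha>\<beta> Jsupp assms(24)])
  have "AE y in lborel. isCont (\<lambda>y. J (HF y)) y"
    using JHF_cont by eventually_elim (rule isCont_o2[OF C.H_cont])
  note wt = AE_continuous_part[OF this]
  obtain lo where lo: "HF lo < \<alpha>" using C.H_below[OF \<alpha>\<beta>(1)] by blast
  obtain hi where hi: "\<beta> < HF hi" using C.H_above[OF \<alpha>\<beta>(3)] by blast
  interpret W: weight_function J "continuous_part J" \<alpha> \<beta> B0
  proof
    show "continuous_part J t = 0" if "t \<notin> {\<alpha>..\<beta>}" for t using Jsupp[OF that] by (simp add: continuous_part_def)
    show "J \<in> borel_measurable lebesgue" by (rule lebesgue_measurable_AE_eq[OF continuous_part_measurable AE_continuous_part[OF J_cont]])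
    show "\<bar>continuous_part J t\<bar> \<le> B0" for t by (intro continuous_part_bounded B)
    show "AE t in lborel. J t = continuous_part J t" using AE_continuous_part[OF J_cont] by eventually_elim simp
  qed (use \<alpha>\<beta> Jsupp B in auto)
  interpret G: gl_statistic M X K m h L D J "continuous_part J" \<alpha> \<beta> B0 "continuous_part (\<lambda>y. J (HF y))" lo hi d a p "\<lambda>i. hF (quantile HF (p i))"
  proof (unfold_locales, unfold UHF)
    show "\<bar>continuous_part (\<lambda>y. J (HF y)) y\<bar> \<le> B0" for y by (intro continuous_part_bounded B)
    show "quantile HF t \<le> y \<longleftrightarrow> t \<le> HF y" if "t \<in> {\<alpha>..\<beta>}" for t y using that \<alpha>\<beta> by (intro C.quantile_le) auto
    show "HF (quantile HF (p i)) = p i" if "i \<in> {1..d}" for i using assms(25)[OF that] by (intro C.H_quantile) auto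
    show "0 < p i" "p i < 1" if "i \<in> {1..d}" for i using assms(25)[OF that] by auto
  qed (use wt JHF_cont lo hi assms(15,26) in auto)
  have "first_projection M m Y (GL_influence h J d a p HF hF) = G.influence"
    using G.first_projection_eq_influence[OF copies, of hF] unfolding UHF by simp
  then show ?thesis
    using G.GL_functional_clt long_run_variance_eq_longrun[OF G.influence_measurable G.expectation_influence]
    unfolding UHn UHF by simp
qed

end
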